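(* Let $L/K$ be a finite Galois extension of fields with Galois group $G=J\rtimes G'$ ($J$ a normal subgroup of $G$, $G'$ a subgroup, $G=JG'$, $J\cap G'=1$). Let $E=L^{G'}$ and $F=L^{J}$. Then: 1. $E/K$ and $F/K$ are Hopf Galois extensions. 2. $L=EF$ and $E\cap F=K$. 3. $E/K$ and $F/K$ are linearly disjoint, i.e. the canonical map $E\otimes_K F\to EF$ is a $K$-isomorphism. Moreover, let $E/K$ be $H_1$-Galois and let $L/E$ be $H_2$-Galois, consider the corresponding induced Hopf Galois structure of $L/K$, and let $H$ be its Hopf algebra. Let $\overline H$ be the Hopf algebra of the Hopf Galois structure of $F/K$ corresponding to the given structure of $L/E$, so that $\overline H\otimes_K E=H_2$. Then: 4. $H=H_1\otimes_K\overline H$. 5. The Hopf action of $H$ on $L$ is the Kronecker product of the Hopf actions of $H_1$ on $E$ and of $\overline H$ on $F$; that is, identifying $L=E\otimes_K F$, for all $w\in H_1$, $\eta\in\overline H$, $\alpha\in E$, $z\in F$ one has $(w\otimes\eta)\cdot(\alpha\otimes z)=(w\cdot\alpha)\otimes(\eta\cdot z)$.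
   Context: A Hopf Galois structure on a finite extension of fields $L/K$ is a $K$-Hopf algebra $H$ together with a $K$-linear action of $H$ on $L$ making $L$ an $H$-module algebra, such that the map $j:L\otimes_K H\to \mathrm{End}_K(L)$, $j(x\otimes h)(y)=x\,(h\cdot y)$, is bijective. One then says $L/K$ is $H$-Galois; $L/K$ is a Hopf Galois extension if it admits some Hopf Galois structure. Greither–Pareigis description in the present setting. Let $\lambda':G'\to\mathrm{Perm}(G')$ and $\lambda:G\to\mathrm{Perm}(G)$ be the left regular representations, and let $\lambda_c:G\to\mathrm{Perm}(J)$ be $\lambda_c(\sigma\tau)(\sigma')=\sigma\tau\sigma'\tau^{-1}$ for $\sigma,\sigma'\in J$, $\tau\in G'$ (the action of $G$ on $G/G'$ by left translation, with $G/G'$ identified with $J$). A subgroup of $\mathrm{Perm}(Y)$ is regular if it acts simply transitively on $Y$. - Hopf Galois structures of $E/K$ correspond bijectively to regular subgroups $N_1\le\mathrm{Perm}(J)$ normalized by $\lambda_c(G)$; the Hopf algebra is $H_1=L[N_1]^G$, where $G$ acts on $L$ by the Galois action and on $N_1$ by conjugation through $\lambda_c$, and the action is $(\sum_i c_in_i)\cdot x=\sum_i c_i\,n_i^{-1}(1_J)(x)$ for $x\in E$. - Hopf Galois structures of $L/E$ correspond bijectively to regular subgroups $N_2\le\mathrm{Perm}(G')$ normalized by $\lambda'(G')$; the Hopf algebra is $H_2=L[N_2]^{G'}$ ($G'$ acting on $L$ by the Galois action and on $N_2$ by conjugation through $\lambda'$), with action $(\sum_j d_jm_j)\cdot x=\sum_j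 d_j\,m_j^{-1}(1_{G'})(x)$. - Identifying $G/J$ with $G'$, the same $N_2$ determines a Hopf Galois structure of $F/K$ (where $F/K$ is Galois with group $G/J\cong G'$), with Hopf algebra $\overline H=F[N_2]^{G/J}$ and action given by the same formula on $F$. This is the structure of $F/K$ corresponding to the given structure of $L/E$, and $\overline H\otimes_K E=H_2$. - The induced Hopf Galois structure of $L/K$ built from $N_1$ and $N_2$ is the one given by $N=\iota(N_1\times N_2)\le\mathrm{Perm}(G)$, where $\iota(\varphi,\psi)(\sigma\tau)=\varphi(\sigma)\psi(\tau)$ for $\sigma\in J$, $\tau\in G'$. It is a regular subgroup normalized by $\lambda(G)$. Its Hopf algebra is $H=L[N]^G$ ($G$ acting on $L$ by the Galois action and on $N$ by conjugation through $\lambda$), with action $(\sum_k c_kn_k)\cdot x=\sum_k c_k\,n_k^{-1}(1_G)(x)$ for $x\in L$. The equality $H=H_1\otimes_K\overline H$ is understood through the identification $(\sum_i c_in_i)\otimes(\sum_j d_jm_j)\mapsto\sum_{i,j}c_id_j\,\iota(n_i,m_j)$ with $n_i\in N_1$, $m_j\in N_2$. *)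

theory Defs
  imports "HOL-Algebra.Algebra"
begin

section \<open>Algebras and tensor products over a commutative ring\<close>

text \<open>The library locale \<open>algebra\<close> only covers commutative algebras.\<close>

locale assoc_algebra = module + ring M +
  assumes smult_mult_left:
      "\<lbrakk>a \<in> carrier R; x \<in> carrier M; y \<in> carrier M\<rbrakk> \<Longrightarrow>
        (a \<odot>\<^bsub>M\<^esub> x) \<otimes>\<^bsub>M\<^esub> y = a \<odot>\<^bsub>M\<^esub> (x \<otimes>\<^bsub>M\<^esub> y)"
    and smult_mult_right:
      "\<lbrakk>a \<in> carrier R; x \<in> carrier M; y \<in> carrier M\<rbrakk> \<Longrightarrow>
        x \<otimes>\<^bsub>M\<^esub> (a \<odot>\<^bsub>M\<^esub> y) = a \<odot>\<^bsub>M\<^esub> (x \<otimes>\<^bsub>M\<^esub> y)"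

definition linear_map ::
  "('k, 'r) ring_scheme \<Rightarrow> ('k, 'a, 'm) module_scheme \<Rightarrow> ('k, 'b, 'n) module_scheme
    \<Rightarrow> ('a \<Rightarrow> 'b) set"
  where "linear_map R M N =
    {f \<in> carrier M \<rightarrow> carrier N.
       (\<forall>x\<in>carrier M. \<forall>y\<in>carrier M. f (x \<oplus>\<^bsub>M\<^esub> y) = f x \<oplus>\<^bsub>N\<^esub> f y) \<and>
       (\<forall>r\<in>carrier R. \<forall>x\<in>carrier M. f (r \<odot>\<^bsub>M\<^esub> x) = r \<odot>\<^bsub>N\<^esub> f x)}"

definition alg_hom ::
  "('k, 'r) ring_scheme \<Rightarrow> ('k, 'a, 'm) module_scheme \<Rightarrow> ('k, 'b, 'n) module_scheme
    \<Rightarrow> ('a \<Rightarrow> 'b) set"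
  where "alg_hom R A B = ring_hom A B \<inter> linear_map R A B"

text \<open>
  \<open>M \<otimes>\<^sub>R N\<close> is the free abelian group on \<open>M \<times> N\<close> modulo the subgroup generated by
  the usual relators; its elements are cosets of that subgroup.
\<close>

definition tensor_relators ::
  "('k, 'r) ring_scheme \<Rightarrow> ('k, 'a, 'm) module_scheme \<Rightarrow> ('k, 'b, 'n) module_scheme
    \<Rightarrow> (('a \<times> 'b) \<Rightarrow>\<^sub>0 int) set"
  where "tensor_relators R M N =
    {frag_of (x \<oplus>\<^bsub>M\<^esub> x', y) - frag_of (x, y) - frag_of (x', y) | x x' y.
       x \<in> carrier M \<and> x' \<in> carrier M \<and> y \<in> carrier N} \<union>
    {frag_of (x, y \<oplus>\<^bsub>N\<^esub> y') - frag_of (x, y) - frag_of (x, y') | x y y'.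
       x \<in> carrier M \<and> y \<in> carrier N \<and> y' \<in> carrier N} \<union>
    {frag_of (r \<odot>\<^bsub>M\<^esub> x, y) - frag_of (x, r \<odot>\<^bsub>N\<^esub> y) | r x y.
       r \<in> carrier R \<and> x \<in> carrier M \<and> y \<in> carrier N}"

definition tensor_kernel ::
  "('k, 'r) ring_scheme \<Rightarrow> ('k, 'a, 'm) module_scheme \<Rightarrow> ('k, 'b, 'n) module_scheme
    \<Rightarrow> (('a \<times> 'b) \<Rightarrow>\<^sub>0 int) set"
  where "tensor_kernel R M N =
    generate (free_Abelian_group (carrier M \<times> carrier N)) (tensor_relators R M N)"

definition tensor_group ::
  "('k, 'r) ring_scheme \<Rightarrow> ('k, 'a, 'm) module_scheme \<Rightarrow> ('k, 'b, 'n) module_scheme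
    \<Rightarrow> (('a \<times> 'b) \<Rightarrow>\<^sub>0 int) set monoid"
  where "tensor_group R M N =
    free_Abelian_group (carrier M \<times> carrier N) Mod tensor_kernel R M N"

definition tens ::
  "('k, 'r) ring_scheme \<Rightarrow> ('k, 'a, 'm) module_scheme \<Rightarrow> ('k, 'b, 'n) module_scheme
    \<Rightarrow> 'a \<Rightarrow> 'b \<Rightarrow> (('a \<times> 'b) \<Rightarrow>\<^sub>0 int) set"
  where "tens R M N x y =
    tensor_kernel R M N #>\<^bsub>free_Abelian_group (carrier M \<times> carrier N)\<^esub> frag_of (x, y)"

text \<open>
  The homomorphism from \<open>M \<otimes>\<^sub>R N\<close> to the abelian group \<open>A\<close> (written multiplicatively)
  induced by an \<open>R\<close>-balanced biadditive map \<open>\<beta>\<close>.  It is unique on the tensor product, because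
  that is generated by the elements \<open>tens R M N x y\<close>.
\<close>

definition tensor_lift ::
  "('k, 'r) ring_scheme \<Rightarrow> ('k, 'a, 'm) module_scheme \<Rightarrow> ('k, 'b, 'n) module_scheme
    \<Rightarrow> ('c, 'd) monoid_scheme \<Rightarrow> ('a \<Rightarrow> 'b \<Rightarrow> 'c) \<Rightarrow> (('a \<times> 'b) \<Rightarrow>\<^sub>0 int) set \<Rightarrow> 'c"
  where "tensor_lift R M N A \<beta> =
    (SOME f. f \<in> hom (tensor_group R M N) A \<and>
       (\<forall>x\<in>carrier M. \<forall>y\<in>carrier N. f (tens R M N x y) = \<beta> x y))"

text \<open>The fields \<open>mult\<close> and \<open>one\<close> are meaningful when \<open>M\<close> and \<open>N\<close> are algebras.\<close>

definition tensor ::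
  "('k, 'r) ring_scheme \<Rightarrow> ('k, 'a, 'm) module_scheme \<Rightarrow> ('k, 'b, 'n) module_scheme
    \<Rightarrow> ('k, (('a \<times> 'b) \<Rightarrow>\<^sub>0 int) set) module"
  where "tensor R M N =
    \<lparr>carrier = carrier (tensor_group R M N),
     monoid.mult = (\<lambda>s t. tensor_lift R M N (tensor_group R M N)
              (\<lambda>x y. tensor_lift R M N (tensor_group R M N)
                (\<lambda>x' y'. tens R M N (x \<otimes>\<^bsub>M\<^esub> x') (y \<otimes>\<^bsub>N\<^esub> y')) t) s),
     monoid.one = tens R M N \<one>\<^bsub>M\<^esub> \<one>\<^bsub>N\<^esub>,
     ring.zero = monoid.one (tensor_group R M N),
     ring.add = monoid.mult (tensor_group R M N),
     smult = (\<lambda>r. tensor_lift R M N (tensor_group R M N) (\<lambda>x y. tens R M N (r \<odot>\<^bsub>M\<^esub> x) y))\<rparr>"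

definition tensor_map ::
  "('k, 'r) ring_scheme \<Rightarrow> ('k, 'a, 'm) module_scheme \<Rightarrow> ('k, 'b, 'n) module_scheme
    \<Rightarrow> ('k, 'c, 'p) module_scheme \<Rightarrow> ('k, 'd, 'q) module_scheme
    \<Rightarrow> ('a \<Rightarrow> 'c) \<Rightarrow> ('b \<Rightarrow> 'd) \<Rightarrow> (('a \<times> 'b) \<Rightarrow>\<^sub>0 int) set \<Rightarrow> (('c \<times> 'd) \<Rightarrow>\<^sub>0 int) set"
  where "tensor_map R M N M' N' f g =
    tensor_lift R M N (tensor_group R M' N') (\<lambda>x y. tens R M' N' (f x) (g y))"

definition tensor_assoc ::
  "('k, 'r) ring_scheme \<Rightarrow> ('k, 'a, 'm) module_scheme \<Rightarrow> ('k, 'b, 'n) module_scheme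
    \<Rightarrow> ('k, 'c, 'p) module_scheme
    \<Rightarrow> (((('a \<times> 'b) \<Rightarrow>\<^sub>0 int) set \<times> 'c) \<Rightarrow>\<^sub>0 int) set
    \<Rightarrow> (('a \<times> (('b \<times> 'c) \<Rightarrow>\<^sub>0 int) set) \<Rightarrow>\<^sub>0 int) set"
  where "tensor_assoc R M N P =
    tensor_lift R (tensor R M N) P (tensor_group R M (tensor R N P))
      (\<lambda>t z. tensor_lift R M N (tensor_group R M (tensor R N P))
        (\<lambda>x y. tens R M (tensor R N P) x (tens R N P y z)) t)"


section \<open>Hopf algebras\<close>

record ('k, 'h) hopf = "('k, 'h) module" +
  comult :: "'h \<Rightarrow> (('h \<times> 'h) \<Rightarrow>\<^sub>0 int) set"
  counit :: "'h \<Rightarrow> 'k"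
  antipode :: "'h \<Rightarrow> 'h"

locale hopf_algebra = assoc_algebra R H
  for R (structure) and H :: "('k, 'h, 'n) hopf_scheme" (structure) +
  assumes comult_hom: "comult H \<in> alg_hom R H (tensor R H H)"
    and counit_hom: "counit H \<in> ring_hom H R"
    and counit_smult:
      "\<lbrakk>r \<in> carrier R; h \<in> carrier H\<rbrakk> \<Longrightarrow> counit H (r \<odot>\<^bsub>H\<^esub> h) = r \<otimes>\<^bsub>R\<^esub> counit H h"
    and antipode_linear: "antipode H \<in> linear_map R H H"
    and coassoc:
      "h \<in> carrier H \<Longrightarrow>
        tensor_assoc R H H H (tensor_map R H H (tensor R H H) H (comult H) id (comult H h)) =
        tensor_map R H H H (tensor R H H) id (comult H) (comult H h)"
    and counit_left:
      "h \<in> carrier H \<Longrightarrow>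
        tensor_lift R H H (add_monoid H) (\<lambda>a b. counit H a \<odot>\<^bsub>H\<^esub> b) (comult H h) = h"
    and counit_right:
      "h \<in> carrier H \<Longrightarrow>
        tensor_lift R H H (add_monoid H) (\<lambda>a b. counit H b \<odot>\<^bsub>H\<^esub> a) (comult H h) = h"
    and antipode_left:
      "h \<in> carrier H \<Longrightarrow>
        tensor_lift R H H (add_monoid H) (\<lambda>a b. antipode H a \<otimes>\<^bsub>H\<^esub> b) (comult H h) =
        counit H h \<odot>\<^bsub>H\<^esub> \<one>\<^bsub>H\<^esub>"
    and antipode_right:
      "h \<in> carrier H \<Longrightarrow>
        tensor_lift R H H (add_monoid H) (\<lambda>a b. a \<otimes>\<^bsub>H\<^esub> antipode H b) (comult H h) =
        counit H h \<odot>\<^bsub>H\<^esub> \<one>\<^bsub>H\<^esub>"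

text \<open>
  Bijections preserving all structure maps.  Between \<open>R\<close>-algebras with such maps, if one side is
  a Hopf algebra, then so is the other.
\<close>

definition hopf_iso ::
  "('k, 'r) ring_scheme \<Rightarrow> ('k, 'a, 'm) hopf_scheme \<Rightarrow> ('k, 'b, 'n) hopf_scheme
    \<Rightarrow> ('a \<Rightarrow> 'b) \<Rightarrow> bool"
  where "hopf_iso R A B f \<longleftrightarrow>
    f \<in> alg_hom R A B \<and> bij_betw f (carrier A) (carrier B) \<and>
    (\<forall>a\<in>carrier A.
       comult B (f a) = tensor_map R A A B B f f (comult A a) \<and>
       counit B (f a) = counit A a \<and>
       antipode B (f a) = f (antipode A a))"

definition hopf_of ::
  "('k, 'h) module \<Rightarrow> ('h \<Rightarrow> (('h \<times> 'h) \<Rightarrow>\<^sub>0 int) set) \<Rightarrow> ('h \<Rightarrow> 'k) \<Rightarrow> ('h \<Rightarrow> 'h)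
    \<Rightarrow> ('k, 'h) hopf"
  where "hopf_of M \<Delta> \<epsilon> S =
    \<lparr>carrier = carrier M, monoid.mult = monoid.mult M, monoid.one = monoid.one M,
     ring.zero = ring.zero M, ring.add = ring.add M,
     smult = smult M, comult = \<Delta>, counit = \<epsilon>, antipode = S\<rparr>"

text \<open>
  The tensor product of two Hopf algebras; in Sweedler notation
  \<open>\<Delta>(a \<otimes> b) = \<Sum> (a\<^sub>1 \<otimes> b\<^sub>1) \<otimes> (a\<^sub>2 \<otimes> b\<^sub>2)\<close>.
\<close>

definition tensor_hopf ::
  "('k, 'r) ring_scheme \<Rightarrow> ('k, 'a, 'm) hopf_scheme \<Rightarrow> ('k, 'b, 'n) hopf_scheme
    \<Rightarrow> ('k, (('a \<times> 'b) \<Rightarrow>\<^sub>0 int) set) hopf"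
  where "tensor_hopf R A B =
    (let T = tensor R A B; TT = tensor_group R T T in
     hopf_of T
       (tensor_lift R A B TT
         (\<lambda>a b. tensor_lift R A A TT
           (\<lambda>a1 a2. tensor_lift R B B TT
             (\<lambda>b1 b2. tens R T T (tens R A B a1 b1) (tens R A B a2 b2))
             (comult B b)) (comult A a)))
       (tensor_lift R A B (add_monoid R) (\<lambda>a b. counit A a \<otimes>\<^bsub>R\<^esub> counit B b))
       (tensor_map R A B A B (antipode A) (antipode B)))"

text \<open>
  The scalar extension \<open>H \<otimes>\<^sub>R S\<close> of an \<open>R\<close>-Hopf algebra \<open>H\<close> along a commutative
  \<open>R\<close>-algebra \<open>S\<close>, as an \<open>S\<close>-Hopf algebra: \<open>\<Delta>(h \<otimes> x) = \<Sum> (h\<^sub>1 \<otimes> 1) \<otimes>\<^sub>S (h\<^sub>2 \<otimes> x)\<close>.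
\<close>

definition base_change ::
  "('k, 'r) ring_scheme \<Rightarrow> ('k, 'h, 'm) hopf_scheme \<Rightarrow> ('k, 's, 'n) module_scheme
    \<Rightarrow> ('s, (('h \<times> 's) \<Rightarrow>\<^sub>0 int) set) hopf"
  where "base_change R H S =
    (let T0 = tensor R H S;
         T = \<lparr>carrier = carrier T0, monoid.mult = monoid.mult T0, monoid.one = monoid.one T0,
              ring.zero = ring.zero T0, ring.add = ring.add T0,
              smult = (\<lambda>s. tensor_lift R H S (tensor_group R H S)
                             (\<lambda>h x. tens R H S h (s \<otimes>\<^bsub>S\<^esub> x)))\<rparr>;
         TT = tensor_group S T T in
     hopf_of T
       (tensor_lift R H S TT
         (\<lambda>h x. tensor_lift R H H TT
           (\<lambda>h1 h2. tens S T T (tens R H S h1 \<one>\<^bsub>S\<^esub>) (tens R H S h2 x)) (comult H h)))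
       (tensor_lift R H S (add_monoid S) (\<lambda>h x. counit H h \<odot>\<^bsub>S\<^esub> x))
       (tensor_map R H S H S (antipode H) id))"


section \<open>Hopf Galois structures\<close>

text \<open>Action axioms for an \<open>H\<close>-module algebra \<open>A\<close> over \<open>R\<close>; \<open>act h x\<close> is \<open>h \<cdot> x\<close>.\<close>

locale hopf_module_algebra = H?: hopf_algebra R H + A?: assoc_algebra R A
  for R (structure) and H (structure) and A (structure) +
  fixes act
  assumes act_linear: "h \<in> carrier H \<Longrightarrow> act h \<in> linear_map R A A"
    and act_add:
      "\<lbrakk>h \<in> carrier H; h' \<in> carrier H; x \<in> carrier A\<rbrakk> \<Longrightarrow>
        act (h \<oplus>\<^bsub>H\<^esub> h') x = act h x \<oplus>\<^bsub>A\<^esub> act h' x"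
    and act_smult:
      "\<lbrakk>r \<in> carrier R; h \<in> carrier H; x \<in> carrier A\<rbrakk> \<Longrightarrow>
        act (r \<odot>\<^bsub>H\<^esub> h) x = r \<odot>\<^bsub>A\<^esub> act h x"
    and act_mult:
      "\<lbrakk>h \<in> carrier H; h' \<in> carrier H; x \<in> carrier A\<rbrakk> \<Longrightarrow>
        act (h \<otimes>\<^bsub>H\<^esub> h') x = act h (act h' x)"
    and act_one: "x \<in> carrier A \<Longrightarrow> act \<one>\<^bsub>H\<^esub> x = x"
    and act_on_mult:
      "\<lbrakk>h \<in> carrier H; x \<in> carrier A; y \<in> carrier A\<rbrakk> \<Longrightarrow>
        act h (x \<otimes>\<^bsub>A\<^esub> y) =
        tensor_lift R H H (add_monoid A) (\<lambda>a b. act a x \<otimes>\<^bsub>A\<^esub> act b y) (comult H h)"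
    and act_on_one: "h \<in> carrier H \<Longrightarrow> act h \<one>\<^bsub>A\<^esub> = counit H h \<odot>\<^bsub>A\<^esub> \<one>\<^bsub>A\<^esub>"

text \<open>The additive group \<open>End\<^sub>R(M)\<close>.\<close>

definition End_group :: "('k, 'r) ring_scheme \<Rightarrow> ('k, 'a, 'm) module_scheme \<Rightarrow> ('a \<Rightarrow> 'a) monoid"
  where "End_group R M =
    \<lparr>carrier = linear_map R M M \<inter> extensional (carrier M),
     monoid.mult = (\<lambda>f g. \<lambda>x\<in>carrier M. f x \<oplus>\<^bsub>M\<^esub> g x),
     monoid.one = (\<lambda>x\<in>carrier M. \<zero>\<^bsub>M\<^esub>)\<rparr>"

text \<open>A subset \<open>E\<close> of the field \<open>L\<close> as an algebra over any subfield contained in it.\<close>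

definition sub_alg :: "('l, 'm) ring_scheme \<Rightarrow> 'l set \<Rightarrow> ('l, 'l) module"
  where "sub_alg L E =
    \<lparr>carrier = E, monoid.mult = monoid.mult L, monoid.one = monoid.one L,
     ring.zero = ring.zero L, ring.add = ring.add L, smult = monoid.mult L\<rparr>"

text \<open>Here \<open>L\<close> is an ambient field for the finite extension \<open>E/K\<close>.\<close>

definition hopf_galois ::
  "('l, 'm) ring_scheme \<Rightarrow> 'l set \<Rightarrow> 'l set \<Rightarrow> ('l, 'h, 'n) hopf_scheme \<Rightarrow> ('h \<Rightarrow> 'l \<Rightarrow> 'l) \<Rightarrow> bool"
  where "hopf_galois L K E H act \<longleftrightarrow>
    field L \<and> subfield K L \<and> subfield E L \<and> K \<subseteq> E \<and> ring.finite_dimension L K E \<and>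
    hopf_module_algebra (L\<lparr>carrier := K\<rparr>) H (sub_alg L E) act \<and>
    bij_betw
      (tensor_lift (L\<lparr>carrier := K\<rparr>) (sub_alg L E) H (End_group (L\<lparr>carrier := K\<rparr>) (sub_alg L E))
        (\<lambda>x h. \<lambda>y\<in>E. x \<otimes>\<^bsub>L\<^esub> act h y))
      (carrier (tensor (L\<lparr>carrier := K\<rparr>) (sub_alg L E) H))
      (carrier (End_group (L\<lparr>carrier := K\<rparr>) (sub_alg L E)))"

text \<open>
  The type of \<open>H\<close> has to be fixed here.  This is no restriction: bijectivity of \<open>j\<close> forces
  \<open>dim\<^sub>K H = [E : K]\<close>, so every Hopf Galois structure is isomorphic to one whose underlying set
  lives in any given type that is at least as large as the type of \<open>L\<close>.
\<close>

definition hopf_galois_extension :: "('l, 'm) ring_scheme \<Rightarrow> 'l set \<Rightarrow> 'l set \<Rightarrow> bool"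
  where "hopf_galois_extension L K E \<longleftrightarrow>
    (\<exists>(H :: ('l, (('l \<Rightarrow> 'l) \<Rightarrow> ('l \<Rightarrow> 'l)) \<Rightarrow> 'l) hopf) act. hopf_galois L K E H act)"


section \<open>Galois extensions\<close>

definition gal :: "('l, 'm) ring_scheme \<Rightarrow> 'l set \<Rightarrow> ('l \<Rightarrow> 'l) monoid"
  where "gal L K = (BijGroup (carrier L))
    \<lparr>carrier := {\<sigma> \<in> Bij (carrier L). \<sigma> \<in> ring_hom L L \<and> (\<forall>k\<in>K. \<sigma> k = k)}\<rparr>"

definition fixed_field :: "('l, 'm) ring_scheme \<Rightarrow> ('l \<Rightarrow> 'l) set \<Rightarrow> 'l set"
  where "fixed_field L S = {x \<in> carrier L. \<forall>\<sigma>\<in>S. \<sigma> x = x}"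

text \<open>Galois means that \<open>K\<close> is the fixed field of \<open>Aut(L/K)\<close>.\<close>

definition finite_galois :: "('l, 'm) ring_scheme \<Rightarrow> 'l set \<Rightarrow> bool"
  where "finite_galois L K \<longleftrightarrow>
    field L \<and> subfield K L \<and> ring.finite_dimension L K (carrier L) \<and>
    fixed_field L (carrier (gal L K)) = K"


section \<open>Greither--Pareigis Hopf algebras\<close>

text \<open>Group algebras of finite groups; an element is its family of coefficients.\<close>

definition single :: "('l, 'm) ring_scheme \<Rightarrow> ('g, 'n) monoid_scheme \<Rightarrow> 'l \<Rightarrow> 'g \<Rightarrow> 'g \<Rightarrow> 'l"
  where "single L A r g = (\<lambda>h\<in>carrier A. if h = g then r else \<zero>\<^bsub>L\<^esub>)"

definition group_alg :: "('l, 'm) ring_scheme \<Rightarrow> ('g, 'n) monoid_scheme \<Rightarrow> ('l, 'g \<Rightarrow> 'l) module"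
  where "group_alg L A =
    \<lparr>carrier = carrier A \<rightarrow>\<^sub>E carrier L,
     monoid.mult = (\<lambda>c d. \<lambda>g\<in>carrier A. \<Oplus>\<^bsub>L\<^esub>h\<in>carrier A. c h \<otimes>\<^bsub>L\<^esub> d (inv\<^bsub>A\<^esub> h \<otimes>\<^bsub>A\<^esub> g)),
     monoid.one = single L A \<one>\<^bsub>L\<^esub> \<one>\<^bsub>A\<^esub>,
     ring.zero = (\<lambda>g\<in>carrier A. \<zero>\<^bsub>L\<^esub>),
     ring.add = (\<lambda>c d. \<lambda>g\<in>carrier A. c g \<oplus>\<^bsub>L\<^esub> d g),
     smult = (\<lambda>r c. \<lambda>g\<in>carrier A. r \<otimes>\<^bsub>L\<^esub> c g)\<rparr>"

text \<open>\<open>\<Delta>(g) = g \<otimes> g\<close>, \<open>\<epsilon>(g) = 1\<close>, \<open>S(g) = g\<inverse>\<close> for group elements \<open>g\<close>.\<close>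

definition group_hopf :: "('l, 'm) ring_scheme \<Rightarrow> ('g, 'n) monoid_scheme \<Rightarrow> ('l, 'g \<Rightarrow> 'l) hopf"
  where "group_hopf L A =
    (let LA = group_alg L A in
     hopf_of LA
       (\<lambda>c. \<Oplus>\<^bsub>tensor L LA LA\<^esub>g\<in>carrier A. tens L LA LA (single L A (c g) g) (single L A \<one>\<^bsub>L\<^esub> g))
       (\<lambda>c. \<Oplus>\<^bsub>L\<^esub>g\<in>carrier A. c g)
       (\<lambda>c. \<lambda>g\<in>carrier A. c (inv\<^bsub>A\<^esub> g)))"

text \<open>
  The semilinear action of a field automorphism \<open>\<tau>\<close> on \<open>L[N]\<close>, for \<open>N\<close> a group of
  permutations of \<open>Y\<close>: \<open>\<tau>\<close> acts on coefficients, and on \<open>N\<close> by conjugation with the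
  permutation \<open>\<rho> \<tau>\<close>.
\<close>

definition gp_galois_action ::
  "'y set \<Rightarrow> (('l \<Rightarrow> 'l) \<Rightarrow> ('y \<Rightarrow> 'y)) \<Rightarrow> ('y \<Rightarrow> 'y) set \<Rightarrow> ('l \<Rightarrow> 'l)
    \<Rightarrow> (('y \<Rightarrow> 'y) \<Rightarrow> 'l) \<Rightarrow> (('y \<Rightarrow> 'y) \<Rightarrow> 'l)"
  where "gp_galois_action Y \<rho> N \<tau> c =
    (\<lambda>n\<in>N. \<tau> (c (inv\<^bsub>BijGroup Y\<^esub> (\<rho> \<tau>) \<otimes>\<^bsub>BijGroup Y\<^esub> n \<otimes>\<^bsub>BijGroup Y\<^esub> \<rho> \<tau>)))"

text \<open>
  The Hopf algebra \<open>H = L[N]\<^sup>S\<close> over \<open>R\<close>, where \<open>R\<close> is the fixed field of the group \<open>S\<close>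
  acting on \<open>L\<close>.  Its structure maps are those of \<open>L[N]\<close>; thus the comultiplication of \<open>H\<close>
  is the map to \<open>H \<otimes>\<^sub>R H\<close> that becomes the comultiplication of \<open>L[N]\<close> under the canonical
  injection \<open>H \<otimes>\<^sub>R H \<rightarrow> L[N] \<otimes>\<^sub>L L[N]\<close>.
\<close>

definition gp_hopf ::
  "('l, 'r) ring_scheme \<Rightarrow> ('l, 'm) ring_scheme \<Rightarrow> ('l \<Rightarrow> 'l) set
    \<Rightarrow> 'y set \<Rightarrow> (('l \<Rightarrow> 'l) \<Rightarrow> ('y \<Rightarrow> 'y)) \<Rightarrow> ('y \<Rightarrow> 'y) set
    \<Rightarrow> ('l, ('y \<Rightarrow> 'y) \<Rightarrow> 'l) hopf"
  where "gp_hopf R L S Y \<rho> N =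
    (let LN = group_hopf L ((BijGroup Y)\<lparr>carrier := N\<rparr>);
         H = LN\<lparr>carrier := {c \<in> carrier LN. \<forall>\<tau>\<in>S. gp_galois_action Y \<rho> N \<tau> c = c}\<rparr>
     in H\<lparr>comult := (\<lambda>h. inv_into (carrier (tensor R H H))
                            (tensor_lift R H H (tensor_group L LN LN) (tens L LN LN))
                            (comult LN h))\<rparr>)"

text \<open>
  \<open>(\<Sum> c\<^sub>n n) \<cdot> x = \<Sum> c\<^sub>n n\<inverse>(e)(x)\<close>, where the elements of \<open>Y\<close> are automorphisms of an
  overfield of \<open>L\<close> and \<open>e\<close> is the identity.
\<close>

definition gp_act ::
  "('l, 'm) ring_scheme \<Rightarrow> ('l \<Rightarrow> 'l) set \<Rightarrow> ('l \<Rightarrow> 'l) \<Rightarrow> (('l \<Rightarrow> 'l) \<Rightarrow> ('l \<Rightarrow> 'l)) set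
    \<Rightarrow> ((('l \<Rightarrow> 'l) \<Rightarrow> ('l \<Rightarrow> 'l)) \<Rightarrow> 'l) \<Rightarrow> 'l \<Rightarrow> 'l"
  where "gp_act L Y e N c x = (\<Oplus>\<^bsub>L\<^esub>n\<in>N. c n \<otimes>\<^bsub>L\<^esub> (inv\<^bsub>BijGroup Y\<^esub> n) e x)"

definition regular_subgroup :: "'y set \<Rightarrow> ('y \<Rightarrow> 'y) set \<Rightarrow> bool"
  where "regular_subgroup Y N \<longleftrightarrow>
    subgroup N (BijGroup Y) \<and> (\<forall>x\<in>Y. \<forall>y\<in>Y. \<exists>!n. n \<in> N \<and> n x = y)"

definition normalized_by :: "'y set \<Rightarrow> ('y \<Rightarrow> 'y) set \<Rightarrow> ('y \<Rightarrow> 'y) set \<Rightarrow> bool"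
  where "normalized_by Y N P \<longleftrightarrow>
    (\<forall>p\<in>P. (\<lambda>n. p \<otimes>\<^bsub>BijGroup Y\<^esub> n \<otimes>\<^bsub>BijGroup Y\<^esub> inv\<^bsub>BijGroup Y\<^esub> p) ` N = N)"

definition left_reg :: "('g, 'm) monoid_scheme \<Rightarrow> 'g set \<Rightarrow> 'g \<Rightarrow> 'g \<Rightarrow> 'g"
  where "left_reg G Y g = (\<lambda>x\<in>Y. g \<otimes>\<^bsub>G\<^esub> x)"

text \<open>The components of \<open>g = \<sigma> \<tau>\<close> in a semidirect product \<open>G = J \<rtimes> G'\<close>.\<close>

definition semidirect :: "('g, 'm) monoid_scheme \<Rightarrow> 'g set \<Rightarrow> 'g set \<Rightarrow> bool"
  where "semidirect G J G' \<longleftrightarrow>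
    J \<lhd> G \<and> subgroup G' G \<and> J <#>\<^bsub>G\<^esub> G' = carrier G \<and> J \<inter> G' = {\<one>\<^bsub>G\<^esub>}"

definition normal_part :: "('g, 'm) monoid_scheme \<Rightarrow> 'g set \<Rightarrow> 'g set \<Rightarrow> 'g \<Rightarrow> 'g"
  where "normal_part G J G' g = (THE \<sigma>. \<sigma> \<in> J \<and> (\<exists>\<tau>\<in>G'. g = \<sigma> \<otimes>\<^bsub>G\<^esub> \<tau>))"

definition compl_part :: "('g, 'm) monoid_scheme \<Rightarrow> 'g set \<Rightarrow> 'g set \<Rightarrow> 'g \<Rightarrow> 'g"
  where "compl_part G J G' g = (THE \<tau>. \<tau> \<in> G' \<and> (\<exists>\<sigma>\<in>J. g = \<sigma> \<otimes>\<^bsub>G\<^esub> \<tau>))"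

text \<open>\<open>\<lambda>\<^sub>c(\<sigma>\<tau>)(\<sigma>') = \<sigma>\<tau>\<sigma>'\<tau>\<inverse>\<close> and \<open>\<iota>(\<phi>,\<psi>)(\<sigma>\<tau>) = \<phi>(\<sigma>)\<psi>(\<tau>)\<close>.\<close>

definition lambda_c :: "('g, 'm) monoid_scheme \<Rightarrow> 'g set \<Rightarrow> 'g set \<Rightarrow> 'g \<Rightarrow> 'g \<Rightarrow> 'g"
  where "lambda_c G J G' g =
    (\<lambda>\<sigma>'\<in>J. normal_part G J G' g \<otimes>\<^bsub>G\<^esub> compl_part G J G' g \<otimes>\<^bsub>G\<^esub> \<sigma>'
              \<otimes>\<^bsub>G\<^esub> inv\<^bsub>G\<^esub> (compl_part G J G' g))"

definition iota ::
  "('g, 'm) monoid_scheme \<Rightarrow> 'g set \<Rightarrow> 'g set \<Rightarrow> ('g \<Rightarrow> 'g) \<Rightarrow> ('g \<Rightarrow> 'g) \<Rightarrow> 'g \<Rightarrow> 'g"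
  where "iota G J G' \<phi> \<psi> =
    (\<lambda>g\<in>carrier G. \<phi> (normal_part G J G' g) \<otimes>\<^bsub>G\<^esub> \<psi> (compl_part G J G' g))"

definition induced_subgroup ::
  "('g, 'm) monoid_scheme \<Rightarrow> 'g set \<Rightarrow> 'g set \<Rightarrow> ('g \<Rightarrow> 'g) set \<Rightarrow> ('g \<Rightarrow> 'g) set \<Rightarrow> ('g \<Rightarrow> 'g) set"
  where "induced_subgroup G J G' N1 N2 = (\<lambda>(\<phi>, \<psi>). iota G J G' \<phi> \<psi>) ` (N1 \<times> N2)"

text \<open>
  The element \<open>\<Sum>\<^sub>i\<^sub>j c\<^sub>i d\<^sub>j \<iota>(n\<^sub>i, m\<^sub>j)\<close> of \<open>L[\<iota>(N1 \<times> N2)]\<close>, for \<open>c = \<Sum>\<^sub>i c\<^sub>i n\<^sub>i\<close> and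
  \<open>d = \<Sum>\<^sub>j d\<^sub>j m\<^sub>j\<close>.
\<close>

definition iota_prod ::
  "('l, 'k) ring_scheme \<Rightarrow> ('g, 'm) monoid_scheme \<Rightarrow> 'g set \<Rightarrow> 'g set
    \<Rightarrow> ('g \<Rightarrow> 'g) set \<Rightarrow> ('g \<Rightarrow> 'g) set \<Rightarrow> (('g \<Rightarrow> 'g) \<Rightarrow> 'l) \<Rightarrow> (('g \<Rightarrow> 'g) \<Rightarrow> 'l)
    \<Rightarrow> ('g \<Rightarrow> 'g) \<Rightarrow> 'l"
  where "iota_prod L G J G' N1 N2 c d =
    (\<lambda>k\<in>induced_subgroup G J G' N1 N2.
       \<Oplus>\<^bsub>L\<^esub>p\<in>{p \<in> N1 \<times> N2. iota G J G' (fst p) (snd p) = k}. c (fst p) \<otimes>\<^bsub>L\<^esub> d (snd p))"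

end

theory Submission
  imports Defs
begin

text \<open>
  Galois descent reduces everything to functions on finite sets.  A \<open>K\<close>-module \<open>M\<close> is a form
  of the \<open>G\<close>-set \<open>U\<close> if it is identified with the \<open>G\<close>-equivariant functions \<open>U \<rightarrow> L\<close>.  The fields
  \<open>E\<close>, \<open>F\<close>, \<open>L\<close> are forms of \<open>J\<close>, \<open>G'\<close>, \<open>G\<close> (an element \<open>x\<close> is the function \<open>u \<mapsto> u(x)\<close>), and the
  Hopf algebras \<open>H1\<close>, \<open>Hbar\<close>, \<open>H\<close> are forms of the groups \<open>N1\<close>, \<open>N2\<close>, \<open>N\<close>.
  Linear independence of automorphisms provides dual bases of equivariant functions, which show
  that the tensor product over \<open>K\<close> of forms of \<open>U\<close> and \<open>V\<close> is a form of \<open>U \<times> V\<close>.  Hence every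
  identity between elements of iterated tensor products is an identity between functions on
  products of finite sets, where the Hopf algebra axioms are those of a group algebra, and maps
  between forms of the same set that preserve the functions are bijective.  The theorem then
  comes from the equivariant bijections \<open>J \<times> G' \<rightarrow> G\<close> and \<open>\<iota> : N1 \<times> N2 \<rightarrow> N\<close>.  For
  \<open>Hbar \<otimes>\<^sub>K E = H2\<close> one restricts functions on \<open>N2 \<times> J\<close> to \<open>N2 \<times> {1}\<close>, whose stabilizer is \<open>G'\<close>;
  this loses nothing because \<open>J\<close> acts trivially on \<open>N2\<close> and transitively on itself.
\<close>

section \<open>Finite sums and tensor products\<close>

text \<open>Maps out of tensor products are fixed by a choice operator, so all that is known about
  them is additivity and their values on pure tensors; every identity would need its own induction.
  The comultiplication of \<open>gp_hopf\<close> is worse: it is an inverse image under the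
  canonical map \<open>H \<otimes>\<^sub>K H \<rightarrow> L[N] \<otimes>\<^sub>L L[N]\<close>, so
  it says nothing until that map is known to be injective and to hit the right element. Evaluation
  at points removes both obstacles, because the canonical map preserves values. Bijectivity is never
  obtained by counting dimensions: the inverse of \<open>j\<close> and the decomposition of a tensor
  are written down with dual bases. An element of trace one takes the place of division by the order
  of the group, so the characteristic is arbitrary. One group serves for all algebras over
  \<open>K\<close>: \<open>G\<close> acts on \<open>J\<close> as on the cosets of \<open>G'\<close>,
  and on \<open>G'\<close> through the projection with kernel \<open>J\<close>. Only the algebras
  over \<open>E\<close> use the smaller group \<open>G'\<close>. The existence claims for
  \<open>E\<close> and \<open>F\<close> come from the structures given by left translations, which
  are admissible choices of \<open>N1\<close> and \<open>N2\<close>.\<close>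

lemma finprod_cong_pointwise:
  fixes f g :: "'b \<Rightarrow> 'a" and A :: "'b set"
  assumes "\<And>x. x \<in> A \<Longrightarrow> f x = g x"
  shows "finprod G f A = finprod G g A"
proof -
  \<comment> \<open>A fold over \<open>A\<close> consults the function only at points of
    \<open>A\<close>, so functions that agree there have the same derivations in
    \<open>foldSetD\<close>. No closure of the values enters, which leaves a single premise and lets
    the rule serve as a simp congruence.\<close>
  have *: "(B, z) \<in> foldSetD D (m \<circ> f') e \<Longrightarrow> (\<forall>x\<in>B. f' x = g' x) \<longrightarrow> (B, z) \<in> foldSetD D (m \<circ> g') e"
    for B z D e m and f' g' :: "'b \<Rightarrow> 'a"
  proof (induction rule: foldSetD.induct)
    case emptyI then show ?case by (simp add: foldSetD.emptyI)
  next
    case (insertI x A y)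
    show ?case
    proof
      assume "\<forall>x\<in>insert x A. f' x = g' x"
      then have "(A, y) \<in> foldSetD D (m \<circ> g') e" "(m \<circ> f') x y = (m \<circ> g') x y"
        using insertI by (blast, simp)
      with insertI foldSetD.insertI[of x A "m \<circ> g'" y D e]
      show "(insert x A, (m \<circ> f') x y) \<in> foldSetD D (m \<circ> g') e" by metis
    qed
  qed
  have "(A, z) \<in> foldSetD (carrier G) (monoid.mult G \<circ> f) \<one>\<^bsub>G\<^esub> \<longleftrightarrow>
        (A, z) \<in> foldSetD (carrier G) (monoid.mult G \<circ> g) \<one>\<^bsub>G\<^esub>" for z
    using *[of A z "carrier G" "monoid.mult G" f "\<one>\<^bsub>G\<^esub>" g] *[of A z "carrier G" "monoid.mult G" g "\<one>\<^bsub>G\<^esub>" f] assms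
    by auto
  then show ?thesis by (simp add: finprod_def foldD_def)
qed

lemma finsum_cong_pointwise:
  "(\<And>x. x \<in> A \<Longrightarrow> f x = g x) \<Longrightarrow> finsum G f A = finsum G g A"
  unfolding finsum_def by (rule finprod_cong_pointwise)

context comm_monoid begin

lemma finprod_swap:
  assumes "finite A" "finite B" "\<And>x y. x \<in> A \<Longrightarrow> y \<in> B \<Longrightarrow> f x y \<in> carrier G"
  shows "finprod G (\<lambda>x. finprod G (f x) B) A = finprod G (\<lambda>y. finprod G (\<lambda>x. f x y) A) B"
  using assms
proof (induction A rule: finite_induct)
  case empty then show ?case by simp
next
  case (insert a A)
  have "finprod G (\<lambda>x. finprod G (f x) B) (insert a A) = finprod G (f a) B \<otimes> finprod G (\<lambda>x. finprod G (f x) B) A"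
    using insert by (intro finprod_insert) (auto intro!: finprod_closed)
  also have "\<dots> = finprod G (f a) B \<otimes> finprod G (\<lambda>y. finprod G (\<lambda>x. f x y) A) B"
    using insert by simp
  also have "\<dots> = finprod G (\<lambda>y. f a y \<otimes> finprod G (\<lambda>x. f x y) A) B"
    using insert by (intro finprod_multf[symmetric]) (auto intro!: finprod_closed)
  also have "\<dots> = finprod G (\<lambda>y. finprod G (\<lambda>x. f x y) (insert a A)) B"
    using insert by (intro finprod_cong_pointwise finprod_insert[symmetric]) auto
  finally show ?case .
qed

lemma finprod_delta:
  assumes "finite A" "f a \<in> carrier G"
  shows "finprod G (\<lambda>x. if x = a then f x else \<one>) A = (if a \<in> A then f a else \<one>)"
proof (cases "a \<in> A")
  case True
  have "finprod G (\<lambda>x. if x = a then f x else \<one>) A = finprod G (\<lambda>x. if a = x then f a else \<one>) A"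
    by (rule finprod_cong_pointwise) auto
  then show ?thesis using finprod_singleton[of a A "\<lambda>_. f a"] assms True by (simp add: Pi_def)
next
  case False
  then have "finprod G (\<lambda>x. if x = a then f x else \<one>) A = finprod G (\<lambda>x. \<one>) A"
    by (intro finprod_cong_pointwise) auto
  with False show ?thesis by simp
qed

lemma finprod_reindex_bij:
  assumes "bij_betw h A B" "\<And>x. x \<in> B \<Longrightarrow> f x \<in> carrier G"
  shows "finprod G f B = finprod G (\<lambda>x. f (h x)) A"
  using finprod_reindex[of f h A] assms by (auto simp: bij_betw_def)

end

context abelian_monoid begin
lemmas finsum_swap = add.finprod_swap
lemmas finsum_delta = add.finprod_delta
lemmas finsum_reindex_bij = add.finprod_reindex_bij
end

section \<open>Universal property and module structure of the tensor product\<close>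

text \<open>The target is a multiplicative group because \<open>tensor_lift\<close> takes one; for
  modules it is the additive monoid. The last clause only moves \<open>r\<close> across, so no
  scalars are required on the target.\<close>

definition balanced ::
  "('k, 'r) ring_scheme \<Rightarrow> ('k, 'a, 'm) module_scheme \<Rightarrow> ('k, 'b, 'n) module_scheme
    \<Rightarrow> ('c, 'd) monoid_scheme \<Rightarrow> ('a \<Rightarrow> 'b \<Rightarrow> 'c) \<Rightarrow> bool"
  where "balanced R M N A \<beta> \<longleftrightarrow>
    (\<forall>x\<in>carrier M. \<forall>y\<in>carrier N. \<beta> x y \<in> carrier A) \<and>
    (\<forall>x\<in>carrier M. \<forall>x'\<in>carrier M. \<forall>y\<in>carrier N. \<beta> (x \<oplus>\<^bsub>M\<^esub> x') y = \<beta> x y \<otimes>\<^bsub>A\<^esub> \<beta> x' y) \<and>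
    (\<forall>x\<in>carrier M. \<forall>y\<in>carrier N. \<forall>y'\<in>carrier N. \<beta> x (y \<oplus>\<^bsub>N\<^esub> y') = \<beta> x y \<otimes>\<^bsub>A\<^esub> \<beta> x y') \<and>
    (\<forall>r\<in>carrier R. \<forall>x\<in>carrier M. \<forall>y\<in>carrier N. \<beta> (r \<odot>\<^bsub>M\<^esub> x) y = \<beta> x (r \<odot>\<^bsub>N\<^esub> y))"

locale module_pair = M: module R M + N: module R N
  for R :: "('k, 'r) ring_scheme" (structure) and M :: "('k, 'a, 'm) module_scheme"
    and N :: "('k, 'b, 'n) module_scheme"
begin

abbreviation "FA \<equiv> free_Abelian_group (carrier M \<times> carrier N)"
abbreviation "TG \<equiv> tensor_group R M N"

sublocale FA: comm_group FA
  by (rule abelian_free_Abelian_group)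

lemma tensor_relators_subset: "tensor_relators R M N \<subseteq> carrier FA"
  unfolding tensor_relators_def
  by (auto dest!: subsetD[OF keys_diff])

lemma tensor_kernel_subgroup: "subgroup (tensor_kernel R M N) FA"
  unfolding tensor_kernel_def by (rule FA.generate_is_subgroup[OF tensor_relators_subset])

lemma tensor_kernel_normal: "tensor_kernel R M N \<lhd> FA"
  by (rule FA.subgroup_imp_normal[OF tensor_kernel_subgroup])

sublocale TG: comm_group TG
  unfolding tensor_group_def by (rule FA.abelian_FactGroup[OF tensor_kernel_subgroup])

lemma tens_closed [simp, intro]: "x \<in> carrier M \<Longrightarrow> y \<in> carrier N \<Longrightarrow> tens R M N x y \<in> carrier TG"
  unfolding tens_def tensor_group_def carrier_FactGroup by auto

lemma coset_eq_of_diff: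
  assumes "a \<in> carrier FA" "b \<in> carrier FA" "a - b \<in> tensor_kernel R M N"
  shows "tensor_kernel R M N #>\<^bsub>FA\<^esub> a = tensor_kernel R M N #>\<^bsub>FA\<^esub> b"
proof (rule FA.repr_independence[symmetric])
  show "a \<in> tensor_kernel R M N #>\<^bsub>FA\<^esub> b"
    using assms(3) unfolding r_coset_def by (auto intro!: bexI[of _ "a - b"])
qed (use assms tensor_kernel_subgroup in auto)

lemma relator_in_kernel: "a \<in> tensor_relators R M N \<Longrightarrow> a \<in> tensor_kernel R M N"
  unfolding tensor_kernel_def by (rule generate.incl)

lemma coset_mult:
  "a \<in> carrier FA \<Longrightarrow> b \<in> carrier FA \<Longrightarrow>
   (tensor_kernel R M N #>\<^bsub>FA\<^esub> a) \<otimes>\<^bsub>TG\<^esub> (tensor_kernel R M N #>\<^bsub>FA\<^esub> b) = tensor_kernel R M N #>\<^bsub>FA\<^esub> (a + b)"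
  using normal.rcos_sum[OF tensor_kernel_normal, of a b] by (simp add: tensor_group_def)

lemma tens_add_left:
  assumes "x \<in> carrier M" "x' \<in> carrier M" "y \<in> carrier N"
  shows "tens R M N (x \<oplus>\<^bsub>M\<^esub> x') y = tens R M N x y \<otimes>\<^bsub>TG\<^esub> tens R M N x' y"
proof -
  have "frag_of (x \<oplus>\<^bsub>M\<^esub> x', y) - frag_of (x, y) - frag_of (x', y) \<in> tensor_kernel R M N"
    by (rule relator_in_kernel) (use assms in \<open>auto simp: tensor_relators_def\<close>)
  then have "tensor_kernel R M N #>\<^bsub>FA\<^esub> frag_of (x \<oplus>\<^bsub>M\<^esub> x', y) =
      tensor_kernel R M N #>\<^bsub>FA\<^esub> (frag_of (x, y) + frag_of (x', y))"
    using assms by (intro coset_eq_of_diff) (auto simp: diff_diff_eq dest!: subsetD[OF keys_add])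
  then show ?thesis unfolding tens_def using assms by (simp add: coset_mult)
qed

lemma tens_add_right:
  assumes "x \<in> carrier M" "y \<in> carrier N" "y' \<in> carrier N"
  shows "tens R M N x (y \<oplus>\<^bsub>N\<^esub> y') = tens R M N x y \<otimes>\<^bsub>TG\<^esub> tens R M N x y'"
proof -
  have "frag_of (x, y \<oplus>\<^bsub>N\<^esub> y') - frag_of (x, y) - frag_of (x, y') \<in> tensor_kernel R M N"
    by (rule relator_in_kernel) (use assms in \<open>auto simp: tensor_relators_def\<close>)
  then have "tensor_kernel R M N #>\<^bsub>FA\<^esub> frag_of (x, y \<oplus>\<^bsub>N\<^esub> y') =
      tensor_kernel R M N #>\<^bsub>FA\<^esub> (frag_of (x, y) + frag_of (x, y'))"
    using assms by (intro coset_eq_of_diff) (auto simp: diff_diff_eq dest!: subsetD[OF keys_add])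
  then show ?thesis unfolding tens_def using assms by (simp add: coset_mult)
qed

lemma tens_smult:
  assumes "r \<in> carrier R" "x \<in> carrier M" "y \<in> carrier N"
  shows "tens R M N (r \<odot>\<^bsub>M\<^esub> x) y = tens R M N x (r \<odot>\<^bsub>N\<^esub> y)"
proof -
  have "frag_of (r \<odot>\<^bsub>M\<^esub> x, y) - frag_of (x, r \<odot>\<^bsub>N\<^esub> y) \<in> tensor_kernel R M N"
    by (rule relator_in_kernel) (use assms in \<open>auto simp: tensor_relators_def\<close>)
  then show ?thesis unfolding tens_def
    using assms by (intro coset_eq_of_diff) auto
qed

lemma tens_zero_left:
  assumes "y \<in> carrier N" shows "tens R M N \<zero>\<^bsub>M\<^esub> y = \<one>\<^bsub>TG\<^esub>"
proof -
  have "tens R M N \<zero>\<^bsub>M\<^esub> y \<otimes>\<^bsub>TG\<^esub> tens R M N \<zero>\<^bsub>M\<^esub> y = tens R M N \<zero>\<^bsub>M\<^esub> y"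
    using tens_add_left[of "\<zero>\<^bsub>M\<^esub>" "\<zero>\<^bsub>M\<^esub>" y] assms by simp
  then show ?thesis
    using assms by (metis M.M.zero_closed TG.l_cancel_one' TG.one_closed tens_closed TG.r_cancel_one')
qed

text \<open>Signs are absorbed into the first factor; this keeps differences out of
  \<open>tensor_induct\<close>.\<close>

lemma tens_inv:
  assumes "x \<in> carrier M" "y \<in> carrier N"
  shows "inv\<^bsub>TG\<^esub> tens R M N x y = tens R M N (\<ominus>\<^bsub>M\<^esub> x) y"
proof (rule TG.inv_equality)
  show "tens R M N (\<ominus>\<^bsub>M\<^esub> x) y \<otimes>\<^bsub>TG\<^esub> tens R M N x y = \<one>\<^bsub>TG\<^esub>"
    using tens_add_left[of "\<ominus>\<^bsub>M\<^esub> x" x y] assms by (simp add: M.M.l_neg tens_zero_left)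
qed (use assms in auto)

text \<open>Elements are classes of integer combinations, but the negative of a pure tensor is pure
  and zero is the tensor of two zeros, so sums of pure tensors exhaust everything.\<close>

lemma tensor_induct [consumes 1, case_names tens add]:
  assumes "t \<in> carrier TG"
    and "\<And>x y. x \<in> carrier M \<Longrightarrow> y \<in> carrier N \<Longrightarrow> P (tens R M N x y)"
    and "\<And>s t. s \<in> carrier TG \<Longrightarrow> t \<in> carrier TG \<Longrightarrow> P s \<Longrightarrow> P t \<Longrightarrow> P (s \<otimes>\<^bsub>TG\<^esub> t)"
  shows "P t"
proof -
  let ?c = "\<lambda>a. tensor_kernel R M N #>\<^bsub>FA\<^esub> a"
  have cl: "?c a \<in> carrier TG" if "a \<in> carrier FA" for a
    using that unfolding tensor_group_def carrier_FactGroup by auto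
  have one: "?c 0 = \<one>\<^bsub>TG\<^esub>"
    unfolding tensor_group_def using FA.coset_join2[OF _ tensor_kernel_subgroup, of 0] subgroup.one_closed[OF tensor_kernel_subgroup]
    by simp
  have inv: "inv\<^bsub>TG\<^esub> (?c a) = ?c (- a)" if "a \<in> carrier FA" for a
    by (rule TG.inv_equality) (use that one in \<open>auto simp: coset_mult cl\<close>)
  obtain a where a: "Poly_Mapping.keys a \<subseteq> carrier M \<times> carrier N" "t = ?c a"
    using assms(1) unfolding tensor_group_def carrier_FactGroup by auto
  \<comment> \<open>Induction over the free abelian group has a case for differences; the claim is
    strengthened by the inverse to survive it.\<close>
  have "P (?c a) \<and> P (inv\<^bsub>TG\<^esub> (?c a))"
    using a(1)
  proof (induction a rule: free_Abelian_group_induct[consumes 1, case_names zero diff of])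
    case zero
    have "P (tens R M N \<zero>\<^bsub>M\<^esub> \<zero>\<^bsub>N\<^esub>)" by (rule assms(2)) auto
    then show ?case by (simp add: one tens_zero_left)
  next
    case (diff x y)
    have "x - y = x + - y" by simp
    then have "?c (x - y) = ?c x \<otimes>\<^bsub>TG\<^esub> inv\<^bsub>TG\<^esub> ?c y"
      using diff by (simp add: inv coset_mult)
    with diff show ?case
      using assms(3) cl by (simp add: TG.inv_mult_group TG.inv_inv)
  next
    case (of b)
    then obtain x y where b: "b = (x, y)" "x \<in> carrier M" "y \<in> carrier N" by auto
    then have "?c (frag_of b) = tens R M N x y" by (simp add: tens_def)
    with b show ?case using assms(2) tens_inv M.M.a_inv_closed by metis
  qed
  with a show ?thesis by simp
qed

text \<open>\<open>tensor_lift\<close> is a choice, so its properties rest on this existence: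
  \<open>\<beta>\<close> extends to the free group, kills the relators because it is balanced, and
  hence factors through the quotient.\<close>

lemma tensor_lift_exists:
  assumes "comm_group A" "balanced R M N A \<beta>"
  shows "\<exists>f. f \<in> hom TG A \<and> (\<forall>x\<in>carrier M. \<forall>y\<in>carrier N. f (tens R M N x y) = \<beta> x y)"
proof -
  interpret A: comm_group A by fact
  have bal: "\<And>x y. x \<in> carrier M \<Longrightarrow> y \<in> carrier N \<Longrightarrow> \<beta> x y \<in> carrier A"
    "\<And>x x' y. x \<in> carrier M \<Longrightarrow> x' \<in> carrier M \<Longrightarrow> y \<in> carrier N \<Longrightarrow> \<beta> (x \<oplus>\<^bsub>M\<^esub> x') y = \<beta> x y \<otimes>\<^bsub>A\<^esub> \<beta> x' y"
    "\<And>x y y'. x \<in> carrier M \<Longrightarrow> y \<in> carrier N \<Longrightarrow> y' \<in> carrier N \<Longrightarrow> \<beta> x (y \<oplus>\<^bsub>N\<^esub> y') = \<beta> x y \<otimes>\<^bsub>A\<^esub> \<beta> x y'"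
    "\<And>r x y. r \<in> carrier R \<Longrightarrow> x \<in> carrier M \<Longrightarrow> y \<in> carrier N \<Longrightarrow> \<beta> (r \<odot>\<^bsub>M\<^esub> x) y = \<beta> x (r \<odot>\<^bsub>N\<^esub> y)"
    using assms(2) unfolding balanced_def by blast+
  obtain h where h: "h \<in> hom FA A" and hf: "\<And>p. p \<in> carrier M \<times> carrier N \<Longrightarrow> h (frag_of p) = case_prod \<beta> p"
    by (rule A.free_Abelian_group_universal[of "case_prod \<beta>" "carrier M \<times> carrier N"]) (use bal(1) in auto)
  interpret h: group_hom FA A h by (unfold_locales) (rule h)
  have hdiff: "h (a - b) = h a \<otimes>\<^bsub>A\<^esub> inv\<^bsub>A\<^esub> h b" if "a \<in> carrier FA" "b \<in> carrier FA" for a b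
  proof -
    have "h (a + - b) = h a \<otimes>\<^bsub>A\<^esub> h (- b)" using h.hom_mult[of a "- b"] that by simp
    then show ?thesis using h.hom_inv[of b] that by simp
  qed
  \<comment> \<open>Covers both families of additivity relators at once; commutativity of
    \<open>A\<close> brings the factors into an order in which they cancel.\<close>
  have hdiff3: "h (frag_of p - frag_of q - frag_of q') = \<one>\<^bsub>A\<^esub>"
    if "p \<in> carrier M \<times> carrier N" "q \<in> carrier M \<times> carrier N" "q' \<in> carrier M \<times> carrier N"
      "case_prod \<beta> p = case_prod \<beta> q \<otimes>\<^bsub>A\<^esub> case_prod \<beta> q'" for p q q'
  proof -
    have k: "frag_of p - frag_of q \<in> carrier FA"
      using that keys_diff[of "frag_of p" "frag_of q"] by auto
    have c: "case_prod \<beta> q \<in> carrier A" "case_prod \<beta> q' \<in> carrier A"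
      using that bal(1) by auto
    have "h (frag_of p - frag_of q - frag_of q') =
        case_prod \<beta> q' \<otimes>\<^bsub>A\<^esub> case_prod \<beta> q \<otimes>\<^bsub>A\<^esub> inv\<^bsub>A\<^esub> case_prod \<beta> q \<otimes>\<^bsub>A\<^esub> inv\<^bsub>A\<^esub> case_prod \<beta> q'"
      using that k c by (simp add: hdiff hf A.m_comm)
    also have "\<dots> = \<one>\<^bsub>A\<^esub>" using c by (simp add: A.m_assoc)
    finally show ?thesis .
  qed
  have rel: "h a = \<one>\<^bsub>A\<^esub>" if "a \<in> tensor_relators R M N" for a
    using that unfolding tensor_relators_def
    by (elim UnE CollectE exE conjE) (auto simp: hdiff3 bal hdiff hf)
  have "tensor_kernel R M N \<subseteq> kernel FA A h"
    unfolding tensor_kernel_def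
    by (rule FA.generate_subgroup_incl[OF _ h.subgroup_kernel])
       (use rel tensor_relators_subset in \<open>unfold kernel_def, blast\<close>)
  then have ker: "h a = \<one>\<^bsub>A\<^esub>" if "a \<in> tensor_kernel R M N" for a
    using that by (auto simp: kernel_def)
  have eq: "h a = h b" if "a \<in> carrier FA" "b \<in> carrier FA"
      "tensor_kernel R M N #>\<^bsub>FA\<^esub> a = tensor_kernel R M N #>\<^bsub>FA\<^esub> b" for a b
  proof -
    have "a \<in> tensor_kernel R M N #>\<^bsub>FA\<^esub> b"
      using FA.rcos_self[OF that(1) tensor_kernel_subgroup] that(3) by simp
    then obtain k where k: "k \<in> tensor_kernel R M N" "a = k + b"
      unfolding r_coset_def by auto
    have "k \<in> carrier FA" using k(1) subgroup.subset[OF tensor_kernel_subgroup] by blast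
    then show ?thesis using k that(2) h.hom_mult[of k b] by (simp add: ker)
  qed
  obtain f where f: "f \<in> hom (FA Mod tensor_kernel R M N) A"
    "\<And>a. a \<in> carrier FA \<Longrightarrow> f (tensor_kernel R M N #>\<^bsub>FA\<^esub> a) = h a"
    using FactGroup_universal[OF h tensor_kernel_normal eq] by metis
  show ?thesis
  proof (intro exI conjI ballI)
    show "f \<in> hom TG A" using f(1) by (simp add: tensor_group_def)
    show "f (tens R M N x y) = \<beta> x y" if "x \<in> carrier M" "y \<in> carrier N" for x y
      unfolding tens_def using that by (simp add: f(2) hf)
  qed
qed

lemma
  assumes "comm_group A" "balanced R M N A \<beta>"
  shows tensor_lift_hom: "tensor_lift R M N A \<beta> \<in> hom TG A"
    and tensor_lift_tens: "\<And>x y. x \<in> carrier M \<Longrightarrow> y \<in> carrier N \<Longrightarrow> tensor_lift R M N A \<beta> (tens R M N x y) = \<beta> x y"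
  using someI_ex[OF tensor_lift_exists[OF assms]] unfolding tensor_lift_def by blast+

lemma abelian_group_tensor: "abelian_group (tensor R M N)"
proof (rule abelian_groupI)
  show "\<exists>s\<in>carrier (tensor R M N). s \<oplus>\<^bsub>tensor R M N\<^esub> t = \<zero>\<^bsub>tensor R M N\<^esub>"
    if "t \<in> carrier (tensor R M N)" for t
    using that TG.l_inv_ex by (simp add: tensor_def)
qed (simp_all add: tensor_def TG.m_ac)

text \<open>Commutativity of \<open>R\<close> lets \<open>r\<close> pass the scalar that is moved
  across, so scaling the first factor descends to the tensor product.\<close>

lemma balanced_smult:
  assumes r: "r \<in> carrier R"
  shows "balanced R M N TG (\<lambda>x y. tens R M N (r \<odot>\<^bsub>M\<^esub> x) y)"
proof -
  have "tens R M N (r \<odot>\<^bsub>M\<^esub> (a \<odot>\<^bsub>M\<^esub> x)) y = tens R M N (r \<odot>\<^bsub>M\<^esub> x) (a \<odot>\<^bsub>N\<^esub> y)"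
    if "a \<in> carrier R" "x \<in> carrier M" "y \<in> carrier N" for a x y
  proof -
    have "r \<odot>\<^bsub>M\<^esub> (a \<odot>\<^bsub>M\<^esub> x) = a \<odot>\<^bsub>M\<^esub> (r \<odot>\<^bsub>M\<^esub> x)"
      using that r M.smult_assoc1[symmetric] M.R.m_comm by simp
    then show ?thesis using that r by (simp add: tens_smult)
  qed
  then show ?thesis
    unfolding balanced_def using r by (simp add: M.smult_r_distr tens_add_left tens_add_right)
qed

lemma tensor_carrier [simp]: "carrier (tensor R M N) = carrier TG"
  by (simp add: tensor_def)

lemma tensor_add [simp]: "s \<oplus>\<^bsub>tensor R M N\<^esub> t = s \<otimes>\<^bsub>TG\<^esub> t"
  by (simp add: tensor_def)

lemma tensor_zero [simp]: "\<zero>\<^bsub>tensor R M N\<^esub> = \<one>\<^bsub>TG\<^esub>"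
  by (simp add: tensor_def)

lemma tensor_one: "\<one>\<^bsub>tensor R M N\<^esub> = tens R M N \<one>\<^bsub>M\<^esub> \<one>\<^bsub>N\<^esub>"
  by (simp add: tensor_def)

lemma tensor_smult_hom: "r \<in> carrier R \<Longrightarrow> (\<lambda>t. r \<odot>\<^bsub>tensor R M N\<^esub> t) \<in> hom TG TG"
  using tensor_lift_hom[OF TG.comm_group_axioms balanced_smult] by (simp add: tensor_def)

lemma tensor_smult_tens:
  "r \<in> carrier R \<Longrightarrow> x \<in> carrier M \<Longrightarrow> y \<in> carrier N \<Longrightarrow>
   r \<odot>\<^bsub>tensor R M N\<^esub> tens R M N x y = tens R M N (r \<odot>\<^bsub>M\<^esub> x) y"
  using tensor_lift_tens[OF TG.comm_group_axioms balanced_smult] by (simp add: tensor_def)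

text \<open>Scaling is additive in the tensor by construction, so the axioms that involve a single
  tensor need to be checked on pure tensors only.\<close>

lemma module_tensor: "module R (tensor R M N)"
proof (rule moduleI)
  show "cring R" by (rule M.R.is_cring)
  show "abelian_group (tensor R M N)" by (rule abelian_group_tensor)
  note hm = hom_mult[OF tensor_smult_hom] and hc = hom_in_carrier[OF tensor_smult_hom]
  show c: "r \<odot>\<^bsub>tensor R M N\<^esub> t \<in> carrier (tensor R M N)"
    if "r \<in> carrier R" "t \<in> carrier (tensor R M N)" for r t
    using that hc by simp
  show "r \<odot>\<^bsub>tensor R M N\<^esub> (s \<oplus>\<^bsub>tensor R M N\<^esub> t) = r \<odot>\<^bsub>tensor R M N\<^esub> s \<oplus>\<^bsub>tensor R M N\<^esub> r \<odot>\<^bsub>tensor R M N\<^esub> t"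
    if "r \<in> carrier R" "s \<in> carrier (tensor R M N)" "t \<in> carrier (tensor R M N)" for r s t
    using that hm by simp
  show "(r \<oplus> r') \<odot>\<^bsub>tensor R M N\<^esub> t = r \<odot>\<^bsub>tensor R M N\<^esub> t \<oplus>\<^bsub>tensor R M N\<^esub> r' \<odot>\<^bsub>tensor R M N\<^esub> t"
    if "r \<in> carrier R" "r' \<in> carrier R" "t \<in> carrier (tensor R M N)" for r r' t
    using that(3) unfolding tensor_carrier
  proof (induction t rule: tensor_induct)
    case (tens x y) with that show ?case by (simp add: tensor_smult_tens M.smult_l_distr tens_add_left)
  next
    case (add s t) with that hm hc show ?case by (simp add: TG.m_ac)
  qed
  show "(r \<otimes> r') \<odot>\<^bsub>tensor R M N\<^esub> t = r \<odot>\<^bsub>tensor R M N\<^esub> (r' \<odot>\<^bsub>tensor R M N\<^esub> t)"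
    if "r \<in> carrier R" "r' \<in> carrier R" "t \<in> carrier (tensor R M N)" for r r' t
    using that(3) unfolding tensor_carrier
  proof (induction t rule: tensor_induct)
    case (tens x y) with that show ?case by (simp add: tensor_smult_tens M.smult_assoc1)
  next
    case (add s t) with that hm hc show ?case by simp
  qed
  show "\<one> \<odot>\<^bsub>tensor R M N\<^esub> t = t" if "t \<in> carrier (tensor R M N)" for t
    using that unfolding tensor_carrier
  proof (induction t rule: tensor_induct)
    case (tens x y) then show ?case by (simp add: tensor_smult_tens)
  next
    case (add s t) with hm[OF M.R.one_closed] show ?case by simp
  qed
qed

end

lemma (in comm_monoid) finprod_cartesian:
  assumes "finite A" "finite B" "\<And>x y. x \<in> A \<Longrightarrow> y \<in> B \<Longrightarrow> f (x, y) \<in> carrier G"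
  shows "finprod G f (A \<times> B) = finprod G (\<lambda>x. finprod G (\<lambda>y. f (x, y)) B) A"
  using assms
proof (induction A rule: finite_induct)
  case empty then show ?case by simp
next
  case (insert a A)
  have "finprod G f (Pair a ` B \<union> A \<times> B) = finprod G f (Pair a ` B) \<otimes> finprod G f (A \<times> B)"
    using insert by (intro finprod_Un_disjoint) auto
  moreover have "insert a A \<times> B = Pair a ` B \<union> A \<times> B" by auto
  moreover have "finprod G f (Pair a ` B) = finprod G (\<lambda>y. f (a, y)) B"
    using insert by (intro finprod_reindex_bij[symmetric, THEN sym]) (auto simp: bij_betw_def inj_on_def)
  ultimately show ?case using insert by (simp add: Pi_def)
qed

lemmas (in abelian_monoid) finsum_cartesian = add.finprod_cartesian

lemma (in ring) finsum_mult:
  assumes "finite A" "finite B" "\<And>x. x \<in> A \<Longrightarrow> f x \<in> carrier R" "\<And>y. y \<in> B \<Longrightarrow> g y \<in> carrier R"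
  shows "finsum R f A \<otimes> finsum R g B = finsum R (\<lambda>x. finsum R (\<lambda>y. f x \<otimes> g y) B) A"
proof -
  have "finsum R f A \<otimes> finsum R g B = finsum R (\<lambda>x. f x \<otimes> finsum R g B) A"
    using assms by (intro finsum_ldistr) auto
  also have "\<dots> = finsum R (\<lambda>x. finsum R (\<lambda>y. f x \<otimes> g y) B) A"
    using assms by (intro finsum_cong_pointwise finsum_rdistr) auto
  finally show ?thesis .
qed

text \<open>Concatenation of two families indexed by initial segments of the naturals; this is how
  the sum of two \<open>separating\<close> functions is brought into the same shape.\<close>

lemma (in abelian_monoid) finsum_append:
  fixes n m :: nat
  assumes "\<And>i. i < n \<Longrightarrow> f i \<in> carrier G" "\<And>i. i < m \<Longrightarrow> g i \<in> carrier G"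
  shows "finsum G (\<lambda>i. if i < n then f i else g (i - n)) {..<n + m} = finsum G f {..<n} \<oplus> finsum G g {..<m}"
  using assms(2)
proof (induction m)
  case 0
  have "finsum G (\<lambda>i. if i < n then f i else g (i - n)) {..<n} = finsum G f {..<n}"
    by (rule finsum_cong_pointwise) auto
  then show ?case using assms by simp
next
  case (Suc m)
  have "finsum G (\<lambda>i. if i < n then f i else g (i - n)) (insert (n + m) {..<n + m}) =
     g m \<oplus> finsum G (\<lambda>i. if i < n then f i else g (i - n)) {..<n + m}"
    using Suc.prems assms by (subst finsum_insert) auto
  also have "\<dots> = finsum G f {..<n} \<oplus> (g m \<oplus> finsum G g {..<m})"
    using Suc assms by (simp add: a_lcomm Pi_def)
  also have "g m \<oplus> finsum G g {..<m} = finsum G g {..<Suc m}"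
    using Suc.prems by (simp add: lessThan_Suc Pi_def)
  finally show ?case by (simp add: lessThan_Suc)
qed

section \<open>Dual bases of equivariant functions\<close>

definition gset :: "('g, 'm) monoid_scheme \<Rightarrow> 'x set \<Rightarrow> ('g \<Rightarrow> 'x \<Rightarrow> 'x) \<Rightarrow> bool"
  where "gset G U a \<longleftrightarrow> finite U \<and> (\<forall>g\<in>carrier G. \<forall>x\<in>U. a g x \<in> U) \<and> (\<forall>x\<in>U. a (\<one>\<^bsub>G\<^esub>) x = x) \<and>
    (\<forall>g\<in>carrier G. \<forall>h\<in>carrier G. \<forall>x\<in>U. a (g \<otimes>\<^bsub>G\<^esub> h) x = a g (a h x))"

text \<open>For fixed \<open>U\<close> these are the \<open>L\<close>-valued functions fixed by
  \<open>G\<close>, the algebra that Galois descent attaches to the finite \<open>G\<close>-set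
  \<open>U\<close>. For the cosets of a subgroup, evaluation at the trivial coset identifies it with
  the fixed field of the subgroup.\<close>

definition equivariant ::
  "('l, 'r) ring_scheme \<Rightarrow> ('g, 'm) monoid_scheme \<Rightarrow> ('g \<Rightarrow> 'l \<Rightarrow> 'l) \<Rightarrow> 'x set \<Rightarrow> ('g \<Rightarrow> 'x \<Rightarrow> 'x)
    \<Rightarrow> ('x \<Rightarrow> 'l) \<Rightarrow> bool"
  where "equivariant L G \<alpha> U a u \<longleftrightarrow>
    (\<forall>x\<in>U. u x \<in> carrier L) \<and> (\<forall>g\<in>carrier G. \<forall>x\<in>U. u (a g x) = \<alpha> g (u x))"

lemma gset_finite: "gset G U a \<Longrightarrow> finite U"
  and gset_closed: "gset G U a \<Longrightarrow> g \<in> carrier G \<Longrightarrow> x \<in> U \<Longrightarrow> a g x \<in> U"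
  and gset_one: "gset G U a \<Longrightarrow> x \<in> U \<Longrightarrow> a \<one>\<^bsub>G\<^esub> x = x"
  and gset_mult: "gset G U a \<Longrightarrow> g \<in> carrier G \<Longrightarrow> h \<in> carrier G \<Longrightarrow> x \<in> U \<Longrightarrow> a (g \<otimes>\<^bsub>G\<^esub> h) x = a g (a h x)"
  unfolding gset_def by blast+

lemma gset_inv:
  assumes "group G" "gset G U a" "g \<in> carrier G" "x \<in> U"
  shows "a (inv\<^bsub>G\<^esub> g) (a g x) = x" "a g (a (inv\<^bsub>G\<^esub> g) x) = x"
proof -
  interpret group G by fact
  show "a (inv\<^bsub>G\<^esub> g) (a g x) = x" "a g (a (inv\<^bsub>G\<^esub> g) x) = x"
    using gset_mult[OF assms(2), of "inv\<^bsub>G\<^esub> g" g x] gset_mult[OF assms(2), of g "inv\<^bsub>G\<^esub> g" x] gset_one[OF assms(2)] assms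
    by auto
qed

lemma gset_cancel:
  assumes "group G" "gset G U a" "g \<in> carrier G" "x \<in> U" "y \<in> U"
  shows "a g x = a g y \<longleftrightarrow> x = y"
  using gset_inv(1)[OF assms(1-3)] assms(4,5) by metis

lemma gset_bij:
  assumes "group G" "gset G U a" "g \<in> carrier G"
  shows "bij_betw (a g) U U"
  using gset_closed[OF assms(2)] gset_inv[OF assms(1,2)] assms(3) group.inv_closed[OF assms(1)]
  by (intro bij_betw_byWitness[where f' = "a (inv\<^bsub>G\<^esub> g)"]) auto

lemma gset_product:
  "gset G U a \<Longrightarrow> gset G Y b \<Longrightarrow> gset G (U \<times> Y) (\<lambda>g p. (a g (fst p), b g (snd p)))"
  unfolding gset_def by auto

lemma equivariant_closed: "equivariant L G \<alpha> U a u \<Longrightarrow> x \<in> U \<Longrightarrow> u x \<in> carrier L"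
  and equivariant_eq: "equivariant L G \<alpha> U a u \<Longrightarrow> g \<in> carrier G \<Longrightarrow> x \<in> U \<Longrightarrow> u (a g x) = \<alpha> g (u x)"
  unfolding equivariant_def by blast+

section \<open>A finite group acting faithfully on a field: Artin's setting\<close>

text \<open>The action \<open>\<alpha>\<close> is kept abstract because the same results are applied
  to the Galois group, to its subgroups with their own fixed fields, and to the trivial group acting
  on a subfield.\<close>

locale galois_action = field L + G: group G
  for L :: "('l, 'r) ring_scheme" (structure) and G :: "('g, 'm) monoid_scheme"
    and \<alpha> :: "'g \<Rightarrow> 'l \<Rightarrow> 'l" and K :: "'l set" +
  assumes finite_G: "finite (carrier G)"
    and \<alpha>_hom: "g \<in> carrier G \<Longrightarrow> \<alpha> g \<in> ring_hom L L"
    and \<alpha>_mult: "\<lbrakk>g \<in> carrier G; h \<in> carrier G; x \<in> carrier L\<rbrakk> \<Longrightarrow> \<alpha> (g \<otimes>\<^bsub>G\<^esub> h) x = \<alpha> g (\<alpha> h x)"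
    and \<alpha>_one: "x \<in> carrier L \<Longrightarrow> \<alpha> \<one>\<^bsub>G\<^esub> x = x"
    and faithful: "\<lbrakk>g \<in> carrier G; \<forall>x\<in>carrier L. \<alpha> g x = x\<rbrakk> \<Longrightarrow> g = \<one>\<^bsub>G\<^esub>"
    and K_eq: "K = {x \<in> carrier L. \<forall>g\<in>carrier G. \<alpha> g x = x}"
begin

lemma \<alpha>_ring_hom_cring: "g \<in> carrier G \<Longrightarrow> ring_hom_cring L L (\<alpha> g)"
  by (simp add: ring_hom_cring_axioms_def ring_hom_cring_def is_cring \<alpha>_hom)

lemma \<alpha>_closed [simp]: "g \<in> carrier G \<Longrightarrow> x \<in> carrier L \<Longrightarrow> \<alpha> g x \<in> carrier L"
  and \<alpha>_add: "g \<in> carrier G \<Longrightarrow> x \<in> carrier L \<Longrightarrow> y \<in> carrier L \<Longrightarrow> \<alpha> g (x \<oplus> y) = \<alpha> g x \<oplus> \<alpha> g y"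
  and \<alpha>_times: "g \<in> carrier G \<Longrightarrow> x \<in> carrier L \<Longrightarrow> y \<in> carrier L \<Longrightarrow> \<alpha> g (x \<otimes> y) = \<alpha> g x \<otimes> \<alpha> g y"
  and \<alpha>_1 [simp]: "g \<in> carrier G \<Longrightarrow> \<alpha> g \<one> = \<one>"
  using \<alpha>_hom by (auto dest: ring_hom_closed ring_hom_add ring_hom_mult ring_hom_one)

lemma \<alpha>_0 [simp]: "g \<in> carrier G \<Longrightarrow> \<alpha> g \<zero> = \<zero>"
  using ring_hom_zero[OF \<alpha>_hom] ring_axioms by blast

lemma \<alpha>_minus: "g \<in> carrier G \<Longrightarrow> x \<in> carrier L \<Longrightarrow> \<alpha> g (\<ominus> x) = \<ominus> \<alpha> g x"
  by (rule ring_hom_cring.hom_a_inv[OF \<alpha>_ring_hom_cring])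

lemma \<alpha>_finsum:
  "g \<in> carrier G \<Longrightarrow> (\<And>x. x \<in> A \<Longrightarrow> f x \<in> carrier L) \<Longrightarrow> \<alpha> g (finsum L f A) = finsum L (\<lambda>x. \<alpha> g (f x)) A"
  using ring_hom_cring.hom_finsum[OF \<alpha>_ring_hom_cring, of g f A] by (simp add: Pi_def comp_def)

lemma K_subset: "K \<subseteq> carrier L" unfolding K_eq by auto

lemma K_subfield: "subfield K L"
proof (rule subfieldI')
  show "subring K L"
    by (rule subringI) (auto simp: K_eq \<alpha>_add \<alpha>_times \<alpha>_minus)
  fix k assume k: "k \<in> K - {\<zero>}"
  then have kc: "k \<in> carrier L" "k \<noteq> \<zero>" using K_subset by auto
  have "\<alpha> g (inv k) = inv k" if g: "g \<in> carrier G" for g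
  proof -
    have "k \<otimes> \<alpha> g (inv k) = \<alpha> g k \<otimes> \<alpha> g (inv k)" using k g by (auto simp: K_eq)
    also have "\<dots> = \<one>" using kc g by (simp add: field_Units flip: \<alpha>_times)
    finally show ?thesis using kc g comm_inv_char[of k "\<alpha> g (inv k)"] by (simp add: field_Units)
  qed
  then show "inv k \<in> K" using kc by (simp add: K_eq field_Units)
qed

lemma Kr_field: "field (L\<lparr>carrier := K\<rparr>)"
  by (rule subfield_iff(2)[OF K_subfield])

lemma Kr_cring: "cring (L\<lparr>carrier := K\<rparr>)"
  using Kr_field by (simp add: field_def domain_def)

text \<open>
  Separating functions form a commutative algebra under pointwise operations; the indicator
  function of \<open>1\<close> is the product over \<open>s \<noteq> 1\<close> of the functions
  \<open>g \<mapsto> (\<alpha> g x - \<alpha> s x) / (x - \<alpha> s x)\<close> with \<open>x\<close> moved by \<open>s\<close>.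
\<close>

definition separating :: "('g \<Rightarrow> 'l) \<Rightarrow> bool"
  where "separating \<phi> \<longleftrightarrow> (\<exists>n::nat. \<exists>b c. (\<forall>j<n. b j \<in> carrier L \<and> c j \<in> carrier L) \<and>
    (\<forall>g\<in>carrier G. \<phi> g = (\<Oplus>j\<in>{..<n}. b j \<otimes> \<alpha> g (c j))))"

lemma separating_add:
  assumes "separating \<phi>" "separating \<psi>"
  shows "separating (\<lambda>g. \<phi> g \<oplus> \<psi> g)"
proof -
  obtain n :: nat and b c where 1: "\<forall>j<n. b j \<in> carrier L \<and> c j \<in> carrier L"
    "\<forall>g\<in>carrier G. \<phi> g = (\<Oplus>j\<in>{..<n}. b j \<otimes> \<alpha> g (c j))"
    using assms(1) unfolding separating_def by blast
  obtain m :: nat and b' c' where 2: "\<forall>j<m. b' j \<in> carrier L \<and> c' j \<in> carrier L"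
    "\<forall>g\<in>carrier G. \<psi> g = (\<Oplus>j\<in>{..<m}. b' j \<otimes> \<alpha> g (c' j))"
    using assms(2) unfolding separating_def by blast
  let ?b = "\<lambda>j. if j < n then b j else b' (j - n)" and ?c = "\<lambda>j. if j < n then c j else c' (j - n)"
  have "\<phi> g \<oplus> \<psi> g = (\<Oplus>j\<in>{..<n + m}. ?b j \<otimes> \<alpha> g (?c j))" if g: "g \<in> carrier G" for g
  proof -
    have "(\<Oplus>j\<in>{..<n + m}. ?b j \<otimes> \<alpha> g (?c j)) =
        (\<Oplus>j\<in>{..<n + m}. if j < n then b j \<otimes> \<alpha> g (c j) else b' (j - n) \<otimes> \<alpha> g (c' (j - n)))"
      by (rule finsum_cong_pointwise) auto
    then show ?thesis using 1 2 g
      by (simp add: finsum_append[of n "\<lambda>j. b j \<otimes> \<alpha> g (c j)" m "\<lambda>j. b' j \<otimes> \<alpha> g (c' j)"])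
  qed
  then show ?thesis unfolding separating_def
    using 1(1) 2(1) by (intro exI[of _ "n + m"] exI[of _ ?b] exI[of _ ?c]) auto
qed

lemma separating_scale:
  assumes "separating \<phi>" "b' \<in> carrier L" "c' \<in> carrier L"
  shows "separating (\<lambda>g. b' \<otimes> \<phi> g \<otimes> \<alpha> g c')"
proof -
  obtain n :: nat and b c where 1: "\<forall>j<n. b j \<in> carrier L \<and> c j \<in> carrier L"
    "\<forall>g\<in>carrier G. \<phi> g = (\<Oplus>j\<in>{..<n}. b j \<otimes> \<alpha> g (c j))"
    using assms(1) unfolding separating_def by blast
  have "b' \<otimes> \<phi> g \<otimes> \<alpha> g c' = (\<Oplus>j\<in>{..<n}. (b' \<otimes> b j) \<otimes> \<alpha> g (c j \<otimes> c'))" if g: "g \<in> carrier G" for g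
  proof -
    have "b' \<otimes> \<phi> g \<otimes> \<alpha> g c' = (\<Oplus>j\<in>{..<n}. b' \<otimes> (b j \<otimes> \<alpha> g (c j)) \<otimes> \<alpha> g c')"
      using 1 g assms by (simp add: finsum_ldistr finsum_rdistr Pi_def)
    also have "\<dots> = (\<Oplus>j\<in>{..<n}. (b' \<otimes> b j) \<otimes> \<alpha> g (c j \<otimes> c'))"
      using 1 g assms by (intro finsum_cong_pointwise) (simp add: \<alpha>_times m_assoc)
    finally show ?thesis .
  qed
  then show ?thesis unfolding separating_def
    using 1(1) assms
    by (intro exI[of _ n] exI[of _ "\<lambda>j. b' \<otimes> b j"] exI[of _ "\<lambda>j. c j \<otimes> c'"]) auto
qed

lemma separating_closed: "separating \<phi> \<Longrightarrow> g \<in> carrier G \<Longrightarrow> \<phi> g \<in> carrier L"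
  unfolding separating_def by (auto intro!: finsum_closed)

lemma separating_exists:
  assumes "finite S" "S \<subseteq> carrier G - {\<one>\<^bsub>G\<^esub>}"
  shows "\<exists>\<phi>. separating \<phi> \<and> \<phi> \<one>\<^bsub>G\<^esub> = \<one> \<and> (\<forall>g\<in>S. \<phi> g = \<zero>)"
  using assms
proof (induction S rule: finite_induct)
  case empty
  have "separating (\<lambda>g. \<one>)"
    unfolding separating_def
    by (intro exI[of _ 1] exI[of _ "\<lambda>_. \<one>"]) (simp add: lessThan_Suc)
  then show ?case by auto
next
  case (insert s S)
  then obtain \<phi> where \<phi>: "separating \<phi>" "\<phi> \<one>\<^bsub>G\<^esub> = \<one>" "\<forall>g\<in>S. \<phi> g = \<zero>" by auto
  have s: "s \<in> carrier G" using insert by auto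
  obtain x where x: "x \<in> carrier L" "\<alpha> s x \<noteq> x" using faithful[of s] insert by auto
  define u where "u = inv (x \<ominus> \<alpha> s x)"
  have nz: "x \<ominus> \<alpha> s x \<in> Units L" using x s by (simp add: field_Units r_right_minus_eq)
  then have u: "u \<in> carrier L" "u \<otimes> (x \<ominus> \<alpha> s x) = \<one>" unfolding u_def by auto
  \<comment> \<open>The constant term of the factor
    \<open>(\<alpha> g x - \<alpha> s x) / (x - \<alpha> s x)\<close>. It is multiplied by
    \<open>\<alpha> g \<one>\<close> below so that it has the shape of
    \<open>separating_scale\<close>.\<close>
  define v where "v = \<ominus> (u \<otimes> \<alpha> s x)"
  have v: "v \<in> carrier L" unfolding v_def using u s x by simp
  let ?\<psi> = "\<lambda>g. (u \<otimes> \<phi> g \<otimes> \<alpha> g x) \<oplus> (v \<otimes> \<phi> g \<otimes> \<alpha> g \<one>)"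
  have "separating ?\<psi>" using \<phi> u v x by (intro separating_add separating_scale) auto
  moreover have "?\<psi> \<one>\<^bsub>G\<^esub> = \<one>"
    using u x s by (simp add: \<phi> \<alpha>_one v_def) (metis \<alpha>_closed a_minus_def r_minus r_distr a_inv_closed)
  moreover have "?\<psi> g = \<zero>" if "g \<in> S" for g
    using that \<phi> u v x insert.prems by auto
  moreover have "?\<psi> s = \<zero>"
  proof -
    have "?\<psi> s = (u \<otimes> \<alpha> s x) \<otimes> \<phi> s \<ominus> (u \<otimes> \<alpha> s x) \<otimes> \<phi> s"
      using u x s separating_closed[OF \<phi>(1) s] by (simp add: v_def l_minus r_minus m_ac a_minus_def)
    then show ?thesis using u x s separating_closed[OF \<phi>(1) s] by simp
  qed
  ultimately show ?case by (intro exI[of _ ?\<psi>]) auto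
qed

text \<open>The separating function of the unit, translated: applying \<open>\<alpha> g\<close> to
  its value at g^-1 h gives the indicator of \<open>h = g\<close>. In matrix terms, the values of
  the automorphisms at \<open>b\<close> and at \<open>c\<close> form mutually inverse matrices on
  one side, which is a quantitative form of their linear independence.\<close>

lemma dual_system:
  obtains n :: nat and b c where "\<And>j. j < n \<Longrightarrow> b j \<in> carrier L" "\<And>j. j < n \<Longrightarrow> c j \<in> carrier L"
    "\<And>g h. g \<in> carrier G \<Longrightarrow> h \<in> carrier G \<Longrightarrow>
      (\<Oplus>j\<in>{..<n}. \<alpha> g (b j) \<otimes> \<alpha> h (c j)) = (if h = g then \<one> else \<zero>)"
proof -
  obtain \<phi> where \<phi>: "separating \<phi>" "\<phi> \<one>\<^bsub>G\<^esub> = \<one>" "\<forall>g\<in>carrier G - {\<one>\<^bsub>G\<^esub>}. \<phi> g = \<zero>"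
    using separating_exists[of "carrier G - {\<one>\<^bsub>G\<^esub>}"] finite_G by auto
  obtain n :: nat and b c where 1: "\<forall>j<n. b j \<in> carrier L \<and> c j \<in> carrier L"
    "\<forall>g\<in>carrier G. \<phi> g = (\<Oplus>j\<in>{..<n}. b j \<otimes> \<alpha> g (c j))"
    using \<phi>(1) unfolding separating_def by blast
  show thesis
  proof (rule that[of n b c])
    fix g h assume gh: "g \<in> carrier G" "h \<in> carrier G"
    have e: "\<alpha> g (\<alpha> (inv\<^bsub>G\<^esub> g \<otimes>\<^bsub>G\<^esub> h) x) = \<alpha> h x" if "x \<in> carrier L" for x
      using gh that by (simp flip: \<alpha>_mult) (simp add: G.m_assoc[symmetric])
    have "(\<Oplus>j\<in>{..<n}. \<alpha> g (b j) \<otimes> \<alpha> h (c j)) = (\<Oplus>j\<in>{..<n}. \<alpha> g (b j \<otimes> \<alpha> (inv\<^bsub>G\<^esub> g \<otimes>\<^bsub>G\<^esub> h) (c j)))"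
      using 1 gh by (intro finsum_cong_pointwise) (simp add: \<alpha>_times e)
    also have "\<dots> = \<alpha> g (\<phi> (inv\<^bsub>G\<^esub> g \<otimes>\<^bsub>G\<^esub> h))"
      using 1 gh by (subst \<alpha>_finsum[symmetric]) auto
    also have "\<dots> = (if h = g then \<one> else \<zero>)"
    proof (cases "h = g")
      case True then show ?thesis using \<phi> gh by simp
    next
      case False
      then have "inv\<^bsub>G\<^esub> g \<otimes>\<^bsub>G\<^esub> h \<noteq> \<one>\<^bsub>G\<^esub>"
        using gh by (metis G.inv_equality G.inv_inv G.inv_closed G.inv_comm)
      then show ?thesis using \<phi> gh False by simp
    qed
    finally show "(\<Oplus>j\<in>{..<n}. \<alpha> g (b j) \<otimes> \<alpha> h (c j)) = (if h = g then \<one> else \<zero>)" .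
  qed (use 1 in auto)
qed

lemma trace_fixed:
  assumes "c \<in> carrier L"
  shows "(\<Oplus>g\<in>carrier G. \<alpha> g c) \<in> K"
proof -
  have "\<alpha> h (\<Oplus>g\<in>carrier G. \<alpha> g c) = (\<Oplus>g\<in>carrier G. \<alpha> g c)" if h: "h \<in> carrier G" for h
  proof -
    have "\<alpha> h (\<Oplus>g\<in>carrier G. \<alpha> g c) = (\<Oplus>g\<in>carrier G. \<alpha> (h \<otimes>\<^bsub>G\<^esub> g) c)"
      using h assms by (subst \<alpha>_finsum) (auto simp: \<alpha>_mult intro!: finsum_cong_pointwise)
    also have "\<dots> = (\<Oplus>g\<in>carrier G. \<alpha> g c)"
      using h assms G.inj_on_multc[of h]
      by (intro finsum_reindex_bij[symmetric] bij_betw_byWitness[where f' = "\<lambda>g. inv\<^bsub>G\<^esub> h \<otimes>\<^bsub>G\<^esub> g"])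
         (auto simp flip: G.m_assoc)
    finally show ?thesis .
  qed
  then show ?thesis using assms by (auto simp: K_eq intro!: finsum_closed)
qed

text \<open>The order of \<open>G\<close> may vanish in \<open>L\<close>, so it cannot be divided
  by. Instead, the dual relation with \<open>g\<close> the unit, summed over all \<open>h\<close>,
  expresses \<open>\<one>\<close> through the traces of the \<open>c j\<close>; one of them is
  therefore nonzero, lies in \<open>K\<close>, and can be normalized.\<close>

lemma trace_one: "\<exists>d\<in>carrier L. (\<Oplus>g\<in>carrier G. \<alpha> g d) = \<one>"
proof -
  obtain n :: nat and b c where bc: "\<And>j. j < n \<Longrightarrow> b j \<in> carrier L" "\<And>j. j < n \<Longrightarrow> c j \<in> carrier L"
    and dual: "\<And>g h. g \<in> carrier G \<Longrightarrow> h \<in> carrier G \<Longrightarrow>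
      (\<Oplus>j\<in>{..<n}. \<alpha> g (b j) \<otimes> \<alpha> h (c j)) = (if h = g then \<one> else \<zero>)"
    by (rule dual_system) (rule that)
  let ?T = "\<lambda>j. \<Oplus>g\<in>carrier G. \<alpha> g (c j)"
  have T: "?T j \<in> carrier L" if "j < n" for j using that bc by (auto intro!: finsum_closed)
  have "(\<Oplus>j\<in>{..<n}. b j \<otimes> ?T j) = (\<Oplus>j\<in>{..<n}. \<Oplus>g\<in>carrier G. \<alpha> \<one>\<^bsub>G\<^esub> (b j) \<otimes> \<alpha> g (c j))"
    using bc by (intro finsum_cong_pointwise) (simp add: \<alpha>_one finsum_rdistr finite_G Pi_def)
  also have "\<dots> = (\<Oplus>g\<in>carrier G. \<Oplus>j\<in>{..<n}. \<alpha> \<one>\<^bsub>G\<^esub> (b j) \<otimes> \<alpha> g (c j))"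
    using bc finite_G by (intro finsum_swap) auto
  also have "\<dots> = (\<Oplus>g\<in>carrier G. if g = \<one>\<^bsub>G\<^esub> then \<one> else \<zero>)"
    by (intro finsum_cong_pointwise) (simp add: dual)
  also have "\<dots> = \<one>" using finsum_delta[of "carrier G" "\<lambda>_. \<one>"] finite_G by simp
  finally have *: "(\<Oplus>j\<in>{..<n}. b j \<otimes> ?T j) = \<one>" .
  have "\<exists>j<n. ?T j \<noteq> \<zero>"
  proof (rule ccontr)
    assume "\<not> ?thesis"
    then have "(\<Oplus>j\<in>{..<n}. b j \<otimes> ?T j) = (\<Oplus>j\<in>{..<n}. \<zero>)"
      using bc by (intro finsum_cong_pointwise) auto
    with * show False by simp
  qed
  then obtain j where j: "j < n" "?T j \<noteq> \<zero>" by auto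
  let ?t = "inv (?T j)"
  have t: "?t \<in> K" "?t \<otimes> ?T j = \<one>"
    using subfield_m_inv[OF K_subfield, of "?T j"] trace_fixed[of "c j"] bc j by auto
  have "(\<Oplus>g\<in>carrier G. \<alpha> g (?t \<otimes> c j)) = (\<Oplus>g\<in>carrier G. ?t \<otimes> \<alpha> g (c j))"
    using t bc j by (intro finsum_cong_pointwise) (auto simp: \<alpha>_times K_eq)
  also have "\<dots> = \<one>" using t bc j K_subset finite_G by (subst finsum_rdistr[symmetric]) auto
  finally show ?thesis using t bc j K_subset by (intro bexI[of _ "?t \<otimes> c j"]) auto
qed

text \<open>The function with value \<open>c\<close> at \<open>x0\<close> and zero elsewhere, summed
  over its translates under \<open>G\<close>; on a one-point set this is the trace of
  \<open>c\<close>.\<close>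

definition orbit_sum :: "('g \<Rightarrow> 'x \<Rightarrow> 'x) \<Rightarrow> 'l \<Rightarrow> 'x \<Rightarrow> 'x \<Rightarrow> 'l"
  where "orbit_sum a c x0 x = (\<Oplus>g\<in>carrier G. if a g x0 = x then \<alpha> g c else \<zero>)"

lemma orbit_sum_equivariant:
  assumes "gset G U a" "c \<in> carrier L" "x0 \<in> U"
  shows "equivariant L G \<alpha> U a (orbit_sum a c x0)"
  unfolding equivariant_def
proof (intro conjI ballI)
  fix x assume x: "x \<in> U"
  show "orbit_sum a c x0 x \<in> carrier L"
    unfolding orbit_sum_def using assms by (auto intro!: finsum_closed)
  fix h assume h: "h \<in> carrier G"
  have "orbit_sum a c x0 (a h x) = (\<Oplus>g\<in>carrier G. if a (h \<otimes>\<^bsub>G\<^esub> g) x0 = a h x then \<alpha> (h \<otimes>\<^bsub>G\<^esub> g) c else \<zero>)"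
    unfolding orbit_sum_def
    by (rule finsum_reindex_bij[where f = "\<lambda>g. if a g x0 = a h x then \<alpha> g c else \<zero>"])
       (use h assms in \<open>auto intro!: bij_betw_byWitness[where f' = "\<lambda>g. inv\<^bsub>G\<^esub> h \<otimes>\<^bsub>G\<^esub> g"] simp flip: G.m_assoc\<close>)
  also have "\<dots> = (\<Oplus>g\<in>carrier G. \<alpha> h (if a g x0 = x then \<alpha> g c else \<zero>))"
    using h assms x gset_closed[OF assms(1)] gset_cancel[OF G.is_group assms(1)]
    by (intro finsum_cong_pointwise) (auto simp: gset_mult[OF assms(1)] \<alpha>_mult)
  also have "\<dots> = \<alpha> h (orbit_sum a c x0 x)"
    unfolding orbit_sum_def using h assms by (subst \<alpha>_finsum) auto
  finally show "orbit_sum a c x0 (a h x) = \<alpha> h (orbit_sum a c x0 x)" .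
qed

text \<open>Every point of \<open>U\<close> serves as a base point for orbit sums, so neither orbit
  representatives nor stabilizers have to be handled. With the orbit sums of \<open>b j\<close> and
  \<open>c j\<close> alone, the total would be the indicator of \<open>x = y\<close> times the order
  of \<open>G\<close>; the factor \<open>d\<close> of trace one in \<open>w\<close> turns this
  multiplicity into one.\<close>

lemma frame:
  fixes U :: "'x set"
  assumes U: "gset G U a"
  obtains I :: "('x \<times> nat) set" and w h where "finite I"
    "\<And>k. k \<in> I \<Longrightarrow> equivariant L G \<alpha> U a (w k)" "\<And>k. k \<in> I \<Longrightarrow> equivariant L G \<alpha> U a (h k)"
    "\<And>x y. x \<in> U \<Longrightarrow> y \<in> U \<Longrightarrow> (\<Oplus>k\<in>I. w k x \<otimes> h k y) = (if x = y then \<one> else \<zero>)"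
proof -
  obtain n :: nat and b c where bc: "\<And>j. j < n \<Longrightarrow> b j \<in> carrier L" "\<And>j. j < n \<Longrightarrow> c j \<in> carrier L"
    and dual: "\<And>g h. g \<in> carrier G \<Longrightarrow> h \<in> carrier G \<Longrightarrow>
      (\<Oplus>j\<in>{..<n}. \<alpha> g (b j) \<otimes> \<alpha> h (c j)) = (if h = g then \<one> else \<zero>)"
    by (rule dual_system) (rule that)
  obtain d where d: "d \<in> carrier L" "(\<Oplus>g\<in>carrier G. \<alpha> g d) = \<one>" using trace_one by auto
  define w where "w = (\<lambda>(x0, j). orbit_sum a (b j \<otimes> d) x0)"
  define h where "h = (\<lambda>(x0, j). orbit_sum a (c j) x0)"
  note Uf = gset_finite[OF U]
  have inner: "(\<Oplus>j\<in>{..<n}. w (x0, j) x \<otimes> h (x0, j) y) =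
      (\<Oplus>g\<in>carrier G. if a g x0 = x \<and> a g x0 = y then \<alpha> g d else \<zero>)"
    if "x0 \<in> U" "x \<in> U" "y \<in> U" for x0 x y
  proof -
    let ?P = "\<lambda>g e. if a g x0 = x then e else \<zero>" and ?Q = "\<lambda>g e. if a g x0 = y then e else \<zero>"
    have "(\<Oplus>j\<in>{..<n}. w (x0, j) x \<otimes> h (x0, j) y) =
      (\<Oplus>j\<in>{..<n}. \<Oplus>g\<in>carrier G. \<Oplus>g'\<in>carrier G. ?P g (\<alpha> g (b j \<otimes> d)) \<otimes> ?Q g' (\<alpha> g' (c j)))"
      unfolding w_def h_def orbit_sum_def prod.case
      using bc d finite_G by (intro finsum_cong_pointwise finsum_mult) auto
    also have "\<dots> = (\<Oplus>g\<in>carrier G. \<Oplus>j\<in>{..<n}. \<Oplus>g'\<in>carrier G. ?P g (\<alpha> g (b j \<otimes> d)) \<otimes> ?Q g' (\<alpha> g' (c j)))"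
      using bc d finite_G by (intro finsum_swap) (auto intro!: finsum_closed)
    also have "\<dots> = (\<Oplus>g\<in>carrier G. \<Oplus>g'\<in>carrier G. \<Oplus>j\<in>{..<n}. ?P g (\<alpha> g (b j \<otimes> d)) \<otimes> ?Q g' (\<alpha> g' (c j)))"
      using bc d finite_G by (intro finsum_cong_pointwise finsum_swap) auto
    \<comment> \<open>Summing over \<open>j\<close> first, the dual system removes all pairs of
      distinct group elements.\<close>
    also have "\<dots> = (\<Oplus>g\<in>carrier G. \<Oplus>g'\<in>carrier G. if g' = g then ?P g (?Q g' (\<alpha> g d)) else \<zero>)"
    proof (intro finsum_cong_pointwise)
      fix g g' assume g: "g \<in> carrier G" "g' \<in> carrier G"
      have "(\<Oplus>j\<in>{..<n}. ?P g (\<alpha> g (b j \<otimes> d)) \<otimes> ?Q g' (\<alpha> g' (c j))) =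
          (\<Oplus>j\<in>{..<n}. ?P g (?Q g' (\<alpha> g d)) \<otimes> (\<alpha> g (b j) \<otimes> \<alpha> g' (c j)))"
        using bc d g by (intro finsum_cong_pointwise) (auto simp: \<alpha>_times m_ac)
      also have "\<dots> = ?P g (?Q g' (\<alpha> g d)) \<otimes> (if g' = g then \<one> else \<zero>)"
        using bc d g by (subst finsum_rdistr[symmetric]) (auto simp: dual)
      finally show "(\<Oplus>j\<in>{..<n}. ?P g (\<alpha> g (b j \<otimes> d)) \<otimes> ?Q g' (\<alpha> g' (c j))) = (if g' = g then ?P g (?Q g' (\<alpha> g d)) else \<zero>)"
        using d g by auto
    qed
    also have "\<dots> = (\<Oplus>g\<in>carrier G. ?P g (?Q g (\<alpha> g d)))"
    proof (intro finsum_cong_pointwise)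
      fix g assume g: "g \<in> carrier G"
      show "(\<Oplus>g'\<in>carrier G. if g' = g then ?P g (?Q g' (\<alpha> g d)) else \<zero>) = ?P g (?Q g (\<alpha> g d))"
        using finsum_delta[of "carrier G" "\<lambda>g'. ?P g (?Q g' (\<alpha> g d))" g] finite_G g d by simp
    qed
    also have "\<dots> = (\<Oplus>g\<in>carrier G. if a g x0 = x \<and> a g x0 = y then \<alpha> g d else \<zero>)"
      by (rule finsum_cong_pointwise) auto
    finally show ?thesis .
  qed
  show thesis
  proof (rule that[of "U \<times> {..<n}" w h])
    show "finite (U \<times> {..<n})" using Uf by auto
    show weq: "equivariant L G \<alpha> U a (w k)" "equivariant L G \<alpha> U a (h k)" if "k \<in> U \<times> {..<n}" for k
      using that bc d by (auto simp: w_def h_def intro!: orbit_sum_equivariant[OF U])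
    fix x y assume xy: "x \<in> U" "y \<in> U"
    have "(\<Oplus>k\<in>U \<times> {..<n}. w k x \<otimes> h k y) = (\<Oplus>x0\<in>U. \<Oplus>j\<in>{..<n}. w (x0, j) x \<otimes> h (x0, j) y)"
      using Uf xy equivariant_closed[OF weq(1)] equivariant_closed[OF weq(2)]
      by (subst finsum_cartesian) auto
    also have "\<dots> = (\<Oplus>x0\<in>U. \<Oplus>g\<in>carrier G. if a g x0 = x \<and> a g x0 = y then \<alpha> g d else \<zero>)"
      using xy by (intro finsum_cong_pointwise inner) auto
    also have "\<dots> = (\<Oplus>g\<in>carrier G. \<Oplus>x0\<in>U. if a g x0 = x \<and> a g x0 = y then \<alpha> g d else \<zero>)"
      using Uf finite_G d by (intro finsum_swap) auto
    \<comment> \<open>For each \<open>g\<close> exactly one base point is carried to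
      \<open>x\<close>, namely g^-1 x, so the sum over \<open>U\<close> leaves a single copy of
      \<open>\<alpha> g d\<close>.\<close>
    also have "\<dots> = (\<Oplus>g\<in>carrier G. if x = y then \<alpha> g d else \<zero>)"
    proof (rule finsum_cong_pointwise)
      fix g assume g: "g \<in> carrier G"
      have eq: "(a g x0 = x \<and> a g x0 = y) = (x0 = a (inv\<^bsub>G\<^esub> g) x \<and> x = y)" if "x0 \<in> U" for x0
        using that gset_inv[OF G.is_group U g] xy by auto
      have "(\<Oplus>x0\<in>U. if a g x0 = x \<and> a g x0 = y then \<alpha> g d else \<zero>) =
          (\<Oplus>x0\<in>U. if x0 = a (inv\<^bsub>G\<^esub> g) x then (if x = y then \<alpha> g d else \<zero>) else \<zero>)"
        by (rule finsum_cong_pointwise) (simp add: eq)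
      also have "\<dots> = (if x = y then \<alpha> g d else \<zero>)"
        using finsum_delta[OF Uf, of "\<lambda>_. if x = y then \<alpha> g d else \<zero>" "a (inv\<^bsub>G\<^esub> g) x"]
          gset_closed[OF U, of "inv\<^bsub>G\<^esub> g" x] xy g d by simp
      finally show "(\<Oplus>x0\<in>U. if a g x0 = x \<and> a g x0 = y then \<alpha> g d else \<zero>) = (if x = y then \<alpha> g d else \<zero>)" .
    qed
    also have "\<dots> = (if x = y then \<one> else \<zero>)" using d by simp
    finally show "(\<Oplus>k\<in>U \<times> {..<n}. w k x \<otimes> h k y) = (if x = y then \<one> else \<zero>)" .
  qed
qed

end

lemma (in ring) finsum_mult_assoc:
  assumes "finite A" "\<And>x. x \<in> A \<Longrightarrow> f x \<in> carrier R" "\<And>x. x \<in> A \<Longrightarrow> g x \<in> carrier R" "c \<in> carrier R"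
  shows "(\<Oplus>x\<in>A. f x \<otimes> g x) \<otimes> c = (\<Oplus>x\<in>A. f x \<otimes> (g x \<otimes> c))"
proof -
  have "(\<Oplus>x\<in>A. f x \<otimes> g x) \<otimes> c = (\<Oplus>x\<in>A. f x \<otimes> g x \<otimes> c)"
    using assms by (intro finsum_ldistr) auto
  also have "\<dots> = (\<Oplus>x\<in>A. f x \<otimes> (g x \<otimes> c))"
    using assms by (intro finsum_cong_pointwise m_assoc) auto
  finally show ?thesis .
qed

section \<open>Forms of finite sets\<close>

text \<open>
  \<open>emb\<close> lets elements of \<open>P\<close> be compared by their values at the points of \<open>Z\<close>; \<open>form\<close> says that \<open>e\<close>
  identifies \<open>M\<close> with the equivariant functions on \<open>U\<close>, of which \<open>kfun\<close> keeps only linearity;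
  \<open>ev\<close> turns a tensor into a function on the product of the two sets.
\<close>

definition emb ::
  "('l, 'r) ring_scheme \<Rightarrow> ('p, 'q) monoid_scheme \<Rightarrow> 'z set \<Rightarrow> ('p \<Rightarrow> 'z \<Rightarrow> 'l) \<Rightarrow> bool"
  where "emb L P Z g \<longleftrightarrow> comm_group P \<and> (\<forall>m\<in>carrier P. \<forall>z\<in>Z. g m z \<in> carrier L) \<and>
    (\<forall>m\<in>carrier P. \<forall>m'\<in>carrier P. \<forall>z\<in>Z. g (m \<otimes>\<^bsub>P\<^esub> m') z = g m z \<oplus>\<^bsub>L\<^esub> g m' z) \<and>
    (\<forall>m\<in>carrier P. \<forall>m'\<in>carrier P. (\<forall>z\<in>Z. g m z = g m' z) \<longrightarrow> m = m')"

definition kfun ::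
  "('l, 'r) ring_scheme \<Rightarrow> 'l set \<Rightarrow> ('l, 'a, 'n) module_scheme \<Rightarrow> 'x set \<Rightarrow> ('a \<Rightarrow> 'x \<Rightarrow> 'l) \<Rightarrow> bool"
  where "kfun L K M U e \<longleftrightarrow> module (L\<lparr>carrier := K\<rparr>) M \<and> (\<forall>m\<in>carrier M. \<forall>x\<in>U. e m x \<in> carrier L) \<and>
    (\<forall>m\<in>carrier M. \<forall>m'\<in>carrier M. \<forall>x\<in>U. e (m \<oplus>\<^bsub>M\<^esub> m') x = e m x \<oplus>\<^bsub>L\<^esub> e m' x) \<and>
    (\<forall>r\<in>K. \<forall>m\<in>carrier M. \<forall>x\<in>U. e (r \<odot>\<^bsub>M\<^esub> m) x = r \<otimes>\<^bsub>L\<^esub> e m x)"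

definition form ::
  "('l, 'r) ring_scheme \<Rightarrow> ('g, 'm) monoid_scheme \<Rightarrow> ('g \<Rightarrow> 'l \<Rightarrow> 'l) \<Rightarrow> 'l set \<Rightarrow> ('l, 'a, 'n) module_scheme
    \<Rightarrow> 'x set \<Rightarrow> ('g \<Rightarrow> 'x \<Rightarrow> 'x) \<Rightarrow> ('a \<Rightarrow> 'x \<Rightarrow> 'l) \<Rightarrow> bool"
  where "form L G \<alpha> K M U a e \<longleftrightarrow> kfun L K M U e \<and> gset G U a \<and>
    (\<forall>m\<in>carrier M. equivariant L G \<alpha> U a (e m)) \<and>
    (\<forall>m\<in>carrier M. \<forall>m'\<in>carrier M. (\<forall>x\<in>U. e m x = e m' x) \<longrightarrow> m = m') \<and>
    (\<forall>u. equivariant L G \<alpha> U a u \<longrightarrow> (\<exists>m\<in>carrier M. \<forall>x\<in>U. e m x = u x))"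

definition ev ::
  "('l, 'r) ring_scheme \<Rightarrow> ('l, 's) ring_scheme \<Rightarrow> ('l, 'a, 'n) module_scheme \<Rightarrow> ('l, 'b, 'p) module_scheme
    \<Rightarrow> ('a \<Rightarrow> 'x \<Rightarrow> 'l) \<Rightarrow> ('b \<Rightarrow> 'y \<Rightarrow> 'l) \<Rightarrow> (('a \<times> 'b) \<Rightarrow>\<^sub>0 int) set \<Rightarrow> 'x \<times> 'y \<Rightarrow> 'l"
  where "ev L R M N e f t p =
    tensor_lift R M N (add_monoid L) (\<lambda>m n. e m (fst p) \<otimes>\<^bsub>L\<^esub> f n (snd p)) t"

text \<open>What a functional must satisfy to be applied to an evaluated tensor: additivity on
  \<open>L\<close>-valued functions, and indifference to values outside \<open>U\<close>, where
  evaluation is unspecified.\<close>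

definition addfun :: "('l, 'r) ring_scheme \<Rightarrow> 'x set \<Rightarrow> (('x \<Rightarrow> 'l) \<Rightarrow> 'l) \<Rightarrow> bool"
  where "addfun L U \<Psi> \<longleftrightarrow>
    (\<forall>u v. (\<forall>x\<in>U. u x \<in> carrier L \<and> v x \<in> carrier L) \<longrightarrow> \<Psi> (\<lambda>x. u x \<oplus>\<^bsub>L\<^esub> v x) = \<Psi> u \<oplus>\<^bsub>L\<^esub> \<Psi> v) \<and>
    (\<forall>u v. (\<forall>x\<in>U. u x = v x) \<longrightarrow> \<Psi> u = \<Psi> v)"

lemma addfunI:
  assumes "\<And>u v. (\<And>x. x \<in> U \<Longrightarrow> u x \<in> carrier L) \<Longrightarrow> (\<And>x. x \<in> U \<Longrightarrow> v x \<in> carrier L) \<Longrightarrow>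
      \<Psi> (\<lambda>x. u x \<oplus>\<^bsub>L\<^esub> v x) = \<Psi> u \<oplus>\<^bsub>L\<^esub> \<Psi> v"
    and "\<And>u v. (\<And>x. x \<in> U \<Longrightarrow> u x = v x) \<Longrightarrow> \<Psi> u = \<Psi> v"
  shows "addfun L U \<Psi>"
  using assms unfolding addfun_def by blast

lemma addfun_add:
  "addfun L U \<Psi> \<Longrightarrow> (\<And>x. x \<in> U \<Longrightarrow> u x \<in> carrier L) \<Longrightarrow> (\<And>x. x \<in> U \<Longrightarrow> v x \<in> carrier L) \<Longrightarrow>
    \<Psi> (\<lambda>x. u x \<oplus>\<^bsub>L\<^esub> v x) = \<Psi> u \<oplus>\<^bsub>L\<^esub> \<Psi> v"
  and addfun_cong: "addfun L U \<Psi> \<Longrightarrow> (\<And>x. x \<in> U \<Longrightarrow> u x = v x) \<Longrightarrow> \<Psi> u = \<Psi> v"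
  unfolding addfun_def by blast+

lemma emb_comm_group: "emb L P Z g \<Longrightarrow> comm_group P"
  and emb_closed: "emb L P Z g \<Longrightarrow> m \<in> carrier P \<Longrightarrow> z \<in> Z \<Longrightarrow> g m z \<in> carrier L"
  and emb_add: "emb L P Z g \<Longrightarrow> m \<in> carrier P \<Longrightarrow> m' \<in> carrier P \<Longrightarrow> z \<in> Z \<Longrightarrow> g (m \<otimes>\<^bsub>P\<^esub> m') z = g m z \<oplus>\<^bsub>L\<^esub> g m' z"
  and emb_inj: "emb L P Z g \<Longrightarrow> m \<in> carrier P \<Longrightarrow> m' \<in> carrier P \<Longrightarrow> (\<And>z. z \<in> Z \<Longrightarrow> g m z = g m' z) \<Longrightarrow> m = m'"
  unfolding emb_def by blast+

lemma kfun_module: "kfun L K M U e \<Longrightarrow> module (L\<lparr>carrier := K\<rparr>) M"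
  and kfun_closed: "kfun L K M U e \<Longrightarrow> m \<in> carrier M \<Longrightarrow> x \<in> U \<Longrightarrow> e m x \<in> carrier L"
  and kfun_add: "kfun L K M U e \<Longrightarrow> m \<in> carrier M \<Longrightarrow> m' \<in> carrier M \<Longrightarrow> x \<in> U \<Longrightarrow> e (m \<oplus>\<^bsub>M\<^esub> m') x = e m x \<oplus>\<^bsub>L\<^esub> e m' x"
  and kfun_smult: "kfun L K M U e \<Longrightarrow> r \<in> K \<Longrightarrow> m \<in> carrier M \<Longrightarrow> x \<in> U \<Longrightarrow> e (r \<odot>\<^bsub>M\<^esub> m) x = r \<otimes>\<^bsub>L\<^esub> e m x"
  unfolding kfun_def by blast+

lemma form_kfun: "form L G \<alpha> K M U a e \<Longrightarrow> kfun L K M U e"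
  and form_gset: "form L G \<alpha> K M U a e \<Longrightarrow> gset G U a"
  and form_equivariant: "form L G \<alpha> K M U a e \<Longrightarrow> m \<in> carrier M \<Longrightarrow> equivariant L G \<alpha> U a (e m)"
  and form_inj: "form L G \<alpha> K M U a e \<Longrightarrow> m \<in> carrier M \<Longrightarrow> m' \<in> carrier M \<Longrightarrow> (\<And>x. x \<in> U \<Longrightarrow> e m x = e m' x) \<Longrightarrow> m = m'"
  and form_surj: "form L G \<alpha> K M U a e \<Longrightarrow> equivariant L G \<alpha> U a u \<Longrightarrow> \<exists>m\<in>carrier M. \<forall>x\<in>U. e m x = u x"
  unfolding form_def by blast+

lemmas form_module = kfun_module[OF form_kfun]
lemmas form_closed = kfun_closed[OF form_kfun]
lemmas form_add = kfun_add[OF form_kfun]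
lemmas form_smult = kfun_smult[OF form_kfun]

lemma form_finite: "form L G \<alpha> K M U a e \<Longrightarrow> finite U"
  by (rule gset_finite[OF form_gset])

lemma comm_group_add_monoid: "abelian_group M \<Longrightarrow> comm_group (add_monoid M)"
  by (simp add: abelian_group_def abelian_group_axioms_def)

lemma form_emb:
  assumes "form L G \<alpha> K M U a e"
  shows "emb L (add_monoid M) U e"
proof -
  interpret M: module "L\<lparr>carrier := K\<rparr>" M by (rule form_module[OF assms])
  show ?thesis unfolding emb_def
    using form_closed[OF assms] form_add[OF assms] form_inj[OF assms] comm_group_add_monoid[OF M.M.abelian_group_axioms]
    by simp
qed

context galois_action begin

abbreviation "Kr \<equiv> L\<lparr>carrier := K\<rparr>"

lemma comm_group_L: "comm_group (add_monoid L)"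
  by (rule comm_group_add_monoid) (rule is_abelian_group)

lemma module_pair_kfun:
  assumes "kfun L K M U e" "kfun L K N V f"
  shows "module_pair Kr M N"
  using kfun_module[OF assms(1)] kfun_module[OF assms(2)] by (simp add: module_pair_def)

lemma ev_balanced:
  assumes M: "kfun L K M U e" and N: "kfun L K N V f" and xy: "x \<in> U" "y \<in> V"
  shows "balanced Kr M N (add_monoid L) (\<lambda>m n. e m x \<otimes> f n y)"
  unfolding balanced_def
  using xy kfun_closed[OF M] kfun_add[OF M] kfun_smult[OF M] kfun_closed[OF N] kfun_add[OF N] kfun_smult[OF N] K_subset
  by (auto simp: l_distr r_distr m_ac subset_iff)

context
  fixes M :: "('l, 'a, 'n) module_scheme" and N :: "('l, 'b, 'p) module_scheme"
    and U :: "'x set" and V :: "'y set" and e f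
  assumes M: "kfun L K M U e" and N: "kfun L K N V f"
begin

interpretation module_pair Kr M N by (rule module_pair_kfun[OF M N])

lemma ev_hom: "x \<in> U \<Longrightarrow> y \<in> V \<Longrightarrow> (\<lambda>t. ev L Kr M N e f t (x, y)) \<in> hom (tensor_group Kr M N) (add_monoid L)"
  unfolding ev_def using tensor_lift_hom[OF comm_group_L ev_balanced[OF M N, of x y]] by simp

lemma ev_closed:
  "t \<in> carrier (tensor_group Kr M N) \<Longrightarrow> x \<in> U \<Longrightarrow> y \<in> V \<Longrightarrow> ev L Kr M N e f t (x, y) \<in> carrier L"
  using hom_in_carrier[OF ev_hom] by auto

lemma ev_add:
  "s \<in> carrier (tensor_group Kr M N) \<Longrightarrow> t \<in> carrier (tensor_group Kr M N) \<Longrightarrow> x \<in> U \<Longrightarrow> y \<in> V \<Longrightarrow>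
   ev L Kr M N e f (s \<otimes>\<^bsub>tensor_group Kr M N\<^esub> t) (x, y) = ev L Kr M N e f s (x, y) \<oplus> ev L Kr M N e f t (x, y)"
  using hom_mult[OF ev_hom] by auto

lemma ev_tens:
  "m \<in> carrier M \<Longrightarrow> n \<in> carrier N \<Longrightarrow> x \<in> U \<Longrightarrow> y \<in> V \<Longrightarrow>
   ev L Kr M N e f (tens Kr M N m n) (x, y) = e m x \<otimes> f n y"
  unfolding ev_def using tensor_lift_tens[OF comm_group_L ev_balanced[OF M N, of x y]] by simp

lemma ev_one:
  "x \<in> U \<Longrightarrow> y \<in> V \<Longrightarrow> ev L Kr M N e f \<one>\<^bsub>tensor_group Kr M N\<^esub> (x, y) = \<zero>"
  using hom_one[OF ev_hom TG.is_group] comm_group_L by (simp add: comm_group_def)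

lemma kfun_tensor: "kfun L K (tensor Kr M N) (U \<times> V) (ev L Kr M N e f)"
  unfolding kfun_def
proof (intro conjI ballI)
  show "module Kr (tensor Kr M N)" by (rule module_tensor)
  show "ev L Kr M N e f t p \<in> carrier L" if "t \<in> carrier (tensor Kr M N)" "p \<in> U \<times> V" for t p
    using that ev_closed by auto
  show "ev L Kr M N e f (s \<oplus>\<^bsub>tensor Kr M N\<^esub> t) p = ev L Kr M N e f s p \<oplus> ev L Kr M N e f t p"
    if "s \<in> carrier (tensor Kr M N)" "t \<in> carrier (tensor Kr M N)" "p \<in> U \<times> V" for s t p
    using that ev_add by auto
  show "ev L Kr M N e f (r \<odot>\<^bsub>tensor Kr M N\<^esub> t) p = r \<otimes> ev L Kr M N e f t p"
    if r: "r \<in> K" and t: "t \<in> carrier (tensor Kr M N)" and p: "p \<in> U \<times> V" for r t p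
  proof -
    obtain x y where xy: "p = (x, y)" "x \<in> U" "y \<in> V" using p by auto
    have r': "r \<in> carrier Kr" "r \<in> carrier L" using r K_subset by auto
    show ?thesis
      using t unfolding tensor_carrier xy(1)
    proof (induction t rule: tensor_induct)
      case (tens m n)
      then show ?case using xy r r' kfun_closed[OF M] kfun_closed[OF N]
        by (simp add: tensor_smult_tens ev_tens kfun_smult[OF M] m_assoc del: partial_object.simps)
    next
      case (add s t)
      then show ?case using xy r r' hom_mult[OF tensor_smult_hom[OF r'(1)]] hom_in_carrier[OF tensor_smult_hom[OF r'(1)]]
        by (simp add: ev_add ev_closed r_distr)
    qed
  qed
qed

text \<open>
  Maps out of a tensor product are determined by their effect \<open>\<Psi>\<close> on functions, so that every
  structure map on a tensor product can be computed without mentioning representatives.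
\<close>

lemma lift_into:
  fixes P :: "('p', 'q) monoid_scheme"
  assumes P: "emb L P Z g"
    and closed: "\<And>m n. m \<in> carrier M \<Longrightarrow> n \<in> carrier N \<Longrightarrow> \<beta> m n \<in> carrier P"
    and val: "\<And>m n z. m \<in> carrier M \<Longrightarrow> n \<in> carrier N \<Longrightarrow> z \<in> Z \<Longrightarrow>
        g (\<beta> m n) z = \<Psi> z (\<lambda>p. e m (fst p) \<otimes> f n (snd p))"
    and add: "\<And>z. z \<in> Z \<Longrightarrow> addfun L (U \<times> V) (\<Psi> z)"
  shows lift_into_balanced: "balanced Kr M N P \<beta>"
    and lift_into_hom: "tensor_lift Kr M N P \<beta> \<in> hom (tensor_group Kr M N) P"
    and lift_into_tens: "\<And>m n. m \<in> carrier M \<Longrightarrow> n \<in> carrier N \<Longrightarrow>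
        tensor_lift Kr M N P \<beta> (tens Kr M N m n) = \<beta> m n"
    and lift_into_closed: "\<And>t. t \<in> carrier (tensor_group Kr M N) \<Longrightarrow> tensor_lift Kr M N P \<beta> t \<in> carrier P"
    and lift_into_val: "\<And>t z. t \<in> carrier (tensor_group Kr M N) \<Longrightarrow> z \<in> Z \<Longrightarrow>
        g (tensor_lift Kr M N P \<beta> t) z = \<Psi> z (ev L Kr M N e f t)"
proof -
  note cl = kfun_closed[OF M] kfun_closed[OF N]
  interpret P: comm_group P by (rule emb_comm_group[OF P])
  \<comment> \<open>Elements of \<open>P\<close> are equal once their values on \<open>Z\<close>
    agree, and on values the three laws follow from identities in the field \<open>L\<close>
    together with the two properties of \<open>\<Psi>\<close>. Hence balancedness is a conclusion,
    and no caller has to establish it.\<close>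
  show bal: "balanced Kr M N P \<beta>"
    unfolding balanced_def
  proof (intro conjI ballI)
    fix m m' n assume c: "m \<in> carrier M" "m' \<in> carrier M" "n \<in> carrier N"
    show "\<beta> (m \<oplus>\<^bsub>M\<^esub> m') n = \<beta> m n \<otimes>\<^bsub>P\<^esub> \<beta> m' n"
    proof (rule emb_inj[OF P])
      fix z assume z: "z \<in> Z"
      have "\<Psi> z (\<lambda>p. e (m \<oplus>\<^bsub>M\<^esub> m') (fst p) \<otimes> f n (snd p)) =
          \<Psi> z (\<lambda>p. e m (fst p) \<otimes> f n (snd p) \<oplus> e m' (fst p) \<otimes> f n (snd p))"
        by (rule addfun_cong[OF add[OF z]]) (use c cl in \<open>auto simp: kfun_add[OF M] l_distr\<close>)
      also have "\<dots> = \<Psi> z (\<lambda>p. e m (fst p) \<otimes> f n (snd p)) \<oplus> \<Psi> z (\<lambda>p. e m' (fst p) \<otimes> f n (snd p))"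
        by (rule addfun_add[OF add[OF z]]) (use c cl in auto)
      finally show "g (\<beta> (m \<oplus>\<^bsub>M\<^esub> m') n) z = g (\<beta> m n \<otimes>\<^bsub>P\<^esub> \<beta> m' n) z"
        using c z by (simp add: val closed emb_add[OF P])
    qed (use c closed in auto)
  next
    fix m n n' assume c: "m \<in> carrier M" "n \<in> carrier N" "n' \<in> carrier N"
    show "\<beta> m (n \<oplus>\<^bsub>N\<^esub> n') = \<beta> m n \<otimes>\<^bsub>P\<^esub> \<beta> m n'"
    proof (rule emb_inj[OF P])
      fix z assume z: "z \<in> Z"
      have "\<Psi> z (\<lambda>p. e m (fst p) \<otimes> f (n \<oplus>\<^bsub>N\<^esub> n') (snd p)) =
          \<Psi> z (\<lambda>p. e m (fst p) \<otimes> f n (snd p) \<oplus> e m (fst p) \<otimes> f n' (snd p))"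
        by (rule addfun_cong[OF add[OF z]]) (use c cl in \<open>auto simp: kfun_add[OF N] r_distr\<close>)
      also have "\<dots> = \<Psi> z (\<lambda>p. e m (fst p) \<otimes> f n (snd p)) \<oplus> \<Psi> z (\<lambda>p. e m (fst p) \<otimes> f n' (snd p))"
        by (rule addfun_add[OF add[OF z]]) (use c cl in auto)
      finally show "g (\<beta> m (n \<oplus>\<^bsub>N\<^esub> n')) z = g (\<beta> m n \<otimes>\<^bsub>P\<^esub> \<beta> m n') z"
        using c z by (simp add: val closed emb_add[OF P])
    qed (use c closed in auto)
  next
    fix r m n assume c: "r \<in> carrier Kr" "m \<in> carrier M" "n \<in> carrier N"
    then have r: "r \<in> K" "r \<in> carrier L" using K_subset by auto
    show "\<beta> (r \<odot>\<^bsub>M\<^esub> m) n = \<beta> m (r \<odot>\<^bsub>N\<^esub> n)"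
    proof (rule emb_inj[OF P])
      fix z assume z: "z \<in> Z"
      have "\<Psi> z (\<lambda>p. e (r \<odot>\<^bsub>M\<^esub> m) (fst p) \<otimes> f n (snd p)) = \<Psi> z (\<lambda>p. e m (fst p) \<otimes> f (r \<odot>\<^bsub>N\<^esub> n) (snd p))"
        by (rule addfun_cong[OF add[OF z]]) (use c cl r in \<open>auto simp: kfun_smult[OF M] kfun_smult[OF N] m_ac\<close>)
      then show "g (\<beta> (r \<odot>\<^bsub>M\<^esub> m) n) z = g (\<beta> m (r \<odot>\<^bsub>N\<^esub> n)) z"
        using c z M.smult_closed N.smult_closed by (simp add: val)
    qed (use c closed M.smult_closed N.smult_closed in auto)
  qed (use closed in auto)
  show h: "tensor_lift Kr M N P \<beta> \<in> hom (tensor_group Kr M N) P"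
    by (rule tensor_lift_hom[OF P.comm_group_axioms bal])
  show t: "tensor_lift Kr M N P \<beta> (tens Kr M N m n) = \<beta> m n" if "m \<in> carrier M" "n \<in> carrier N" for m n
    by (rule tensor_lift_tens[OF P.comm_group_axioms bal that])
  show c: "tensor_lift Kr M N P \<beta> t \<in> carrier P" if "t \<in> carrier (tensor_group Kr M N)" for t
    by (rule hom_in_carrier[OF h that])
  show "g (tensor_lift Kr M N P \<beta> t) z = \<Psi> z (ev L Kr M N e f t)"
    if "t \<in> carrier (tensor_group Kr M N)" and z: "z \<in> Z" for t z
    using that(1)
  proof (induction t rule: tensor_induct)
    case (tens m n)
    have "\<Psi> z (\<lambda>p. e m (fst p) \<otimes> f n (snd p)) = \<Psi> z (ev L Kr M N e f (tens Kr M N m n))"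
      by (rule addfun_cong[OF add[OF z]]) (use tens in \<open>auto simp: ev_tens\<close>)
    with tens z show ?case by (simp add: t val)
  next
    case (add s t)
    have "\<Psi> z (ev L Kr M N e f (s \<otimes>\<^bsub>tensor_group Kr M N\<^esub> t)) =
        \<Psi> z (\<lambda>p. ev L Kr M N e f s p \<oplus> ev L Kr M N e f t p)"
      by (rule addfun_cong[OF assms(4)[OF z]]) (use add in \<open>auto simp: ev_add\<close>)
    also have "\<dots> = \<Psi> z (ev L Kr M N e f s) \<oplus> \<Psi> z (ev L Kr M N e f t)"
      by (rule addfun_add[OF assms(4)[OF z]]) (use add in \<open>auto simp: ev_closed\<close>)
    finally show ?case using add z hom_mult[OF h] c by (simp add: emb_add[OF P])
  qed
qed

end

text \<open>Reindexing by the permutation \<open>b g\<close> of \<open>V\<close> moves the group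
  element out of the sum. Such contractions of the second variable produce the coefficients of a
  tensor with respect to a dual basis.\<close>

lemma equivariant_pair_sum:
  assumes "gset G V b" "equivariant L G \<alpha> (U \<times> V) (\<lambda>g p. (a g (fst p), b g (snd p))) u" "equivariant L G \<alpha> V b w"
    "gset G U a"
  shows "equivariant L G \<alpha> U a (\<lambda>x. \<Oplus>y\<in>V. u (x, y) \<otimes> w y)"
  unfolding equivariant_def
proof (intro conjI ballI)
  note uc = equivariant_closed[OF assms(2)] and wc = equivariant_closed[OF assms(3)]
  fix x assume x: "x \<in> U"
  show "(\<Oplus>y\<in>V. u (x, y) \<otimes> w y) \<in> carrier L"
    using x uc wc by (intro finsum_closed) auto
  fix g assume g: "g \<in> carrier G"
  have "(\<Oplus>y\<in>V. u (a g x, y) \<otimes> w y) = (\<Oplus>y\<in>V. u (a g x, b g y) \<otimes> w (b g y))"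
    using x g uc wc gset_closed[OF assms(4)] by (intro finsum_reindex_bij gset_bij[OF G.is_group assms(1)]) auto
  also have "\<dots> = (\<Oplus>y\<in>V. \<alpha> g (u (x, y) \<otimes> w y))"
    using x g uc wc equivariant_eq[OF assms(2) g, of "(x, y)" for y] equivariant_eq[OF assms(3) g]
    by (intro finsum_cong_pointwise) (auto simp: \<alpha>_times)
  also have "\<dots> = \<alpha> g (\<Oplus>y\<in>V. u (x, y) \<otimes> w y)"
    using x g uc wc by (subst \<alpha>_finsum) auto
  finally show "(\<Oplus>y\<in>V. u (a g x, y) \<otimes> w y) = \<alpha> g (\<Oplus>y\<in>V. u (x, y) \<otimes> w y)" .
qed

lemma equivariant_sum_K:
  assumes "gset G V b" "equivariant L G \<alpha> V b u" "equivariant L G \<alpha> V b w"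
  shows "(\<Oplus>y\<in>V. u y \<otimes> w y) \<in> K"
proof -
  \<comment> \<open>Equivariant functions on a one-point set are the fixed elements, so this is the
    contraction with \<open>U\<close> a point.\<close>
  have "equivariant L G \<alpha> {()} (\<lambda>_ x. x) (\<lambda>x. \<Oplus>y\<in>V. (u \<circ> snd) (x, y) \<otimes> w y)"
    using assms by (intro equivariant_pair_sum[of V b]) (auto simp: gset_def equivariant_def)
  then show ?thesis by (simp add: equivariant_def K_eq)
qed

lemma form_finsum:
  assumes M: "form L G \<alpha> K M U a e" and I: "finite I" "\<And>i. i \<in> I \<Longrightarrow> m i \<in> carrier M" and x: "x \<in> U"
  shows "e (finsum M m I) x = (\<Oplus>i\<in>I. e (m i) x)"
proof -
  interpret M: module Kr M by (rule form_module[OF M])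
  have z: "e \<zero>\<^bsub>M\<^esub> x = \<zero>"
    using form_add[OF M, of "\<zero>\<^bsub>M\<^esub>" "\<zero>\<^bsub>M\<^esub>" x] form_closed[OF M, of "\<zero>\<^bsub>M\<^esub>" x] x
    by (simp add: add.r_cancel_one')
  show ?thesis using I
  proof (induction I rule: finite_induct)
    case empty then show ?case by (simp add: z)
  next
    case (insert i I)
    then have "finsum M m (insert i I) = m i \<oplus>\<^bsub>M\<^esub> finsum M m I" "finsum M m I \<in> carrier M"
      by (auto intro!: M.M.finsum_insert M.M.finsum_closed)
    then have "e (finsum M m (insert i I)) x = e (m i) x \<oplus> e (finsum M m I) x"
      using x insert form_add[OF M] by simp
    then show ?case using insert x form_closed[OF M] by (simp add: Pi_def)
  qed
qed

text \<open>A form reaches all equivariant functions, so the functions of one half of a frame come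
  from elements \<open>h k\<close> of \<open>M\<close>, while the \<open>w k\<close> remain
  functions. Pairings of equivariant functions lie in \<open>K\<close>; thus the last two facts
  exhibit the \<open>h k\<close> and the pairings with \<open>w k\<close> as a dual basis of
  \<open>M\<close> over \<open>K\<close>.\<close>

lemma form_frame:
  fixes U :: "'x set"
  assumes M: "form L G \<alpha> K M U a e"
  obtains I :: "('x \<times> nat) set" and w h where "finite I"
    "\<And>k. k \<in> I \<Longrightarrow> equivariant L G \<alpha> U a (w k)" "\<And>k. k \<in> I \<Longrightarrow> h k \<in> carrier M"
    "\<And>x y. x \<in> U \<Longrightarrow> y \<in> U \<Longrightarrow> (\<Oplus>k\<in>I. w k x \<otimes> e (h k) y) = (if x = y then \<one> else \<zero>)"
    "\<And>m. m \<in> carrier M \<Longrightarrow> m = (\<Oplus>\<^bsub>M\<^esub>k\<in>I. (\<Oplus>x\<in>U. e m x \<otimes> w k x) \<odot>\<^bsub>M\<^esub> h k)"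
    "\<And>m k. m \<in> carrier M \<Longrightarrow> k \<in> I \<Longrightarrow> (\<Oplus>x\<in>U. e m x \<otimes> w k x) \<in> K"
proof -
  interpret M: module Kr M by (rule form_module[OF M])
  obtain I :: "('x \<times> nat) set" and w h0 where I: "finite I"
    "\<And>k. k \<in> I \<Longrightarrow> equivariant L G \<alpha> U a (w k)" "\<And>k. k \<in> I \<Longrightarrow> equivariant L G \<alpha> U a (h0 k)"
    "\<And>x y. x \<in> U \<Longrightarrow> y \<in> U \<Longrightarrow> (\<Oplus>k\<in>I. w k x \<otimes> h0 k y) = (if x = y then \<one> else \<zero>)"
    by (rule frame[OF form_gset[OF M]]) (rule that)
  have "\<forall>k\<in>I. \<exists>m\<in>carrier M. \<forall>x\<in>U. e m x = h0 k x" using form_surj[OF M] I(3) by blast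
  then obtain h where h: "\<And>k. k \<in> I \<Longrightarrow> h k \<in> carrier M" "\<And>k x. k \<in> I \<Longrightarrow> x \<in> U \<Longrightarrow> e (h k) x = h0 k x"
    by metis
  have fr: "(\<Oplus>k\<in>I. w k x \<otimes> e (h k) y) = (if x = y then \<one> else \<zero>)" if "x \<in> U" "y \<in> U" for x y
    unfolding I(4)[OF that, symmetric] using h that by (intro finsum_cong_pointwise) auto
  note cl = form_closed[OF M] equivariant_closed[OF I(2)]
  have K: "(\<Oplus>x\<in>U. e m x \<otimes> w k x) \<in> K" if "m \<in> carrier M" "k \<in> I" for m k
    by (rule equivariant_sum_K[OF form_gset[OF M] form_equivariant[OF M] I(2)]) (use that in auto)
  have "m = (\<Oplus>\<^bsub>M\<^esub>k\<in>I. (\<Oplus>x\<in>U. e m x \<otimes> w k x) \<odot>\<^bsub>M\<^esub> h k)" if m: "m \<in> carrier M" for m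
  proof (rule form_inj[OF M])
    fix y assume y: "y \<in> U"
    have sc: "(\<Oplus>x\<in>U. e m x \<otimes> w k x) \<odot>\<^bsub>M\<^esub> h k \<in> carrier M" if "k \<in> I" for k
      using K[OF m that] h(1)[OF that] by (intro M.smult_closed) auto
    have "e (\<Oplus>\<^bsub>M\<^esub>k\<in>I. (\<Oplus>x\<in>U. e m x \<otimes> w k x) \<odot>\<^bsub>M\<^esub> h k) y = (\<Oplus>k\<in>I. (\<Oplus>x\<in>U. e m x \<otimes> w k x) \<otimes> e (h k) y)"
      using I(1) K m h y sc by (subst form_finsum[OF M]) (auto intro!: finsum_cong_pointwise form_smult[OF M])
    also have "\<dots> = (\<Oplus>k\<in>I. \<Oplus>x\<in>U. e m x \<otimes> (w k x \<otimes> e (h k) y))"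
      using form_finite[OF M] cl m h(1) y by (intro finsum_cong_pointwise finsum_mult_assoc) auto
    also have "\<dots> = (\<Oplus>x\<in>U. \<Oplus>k\<in>I. e m x \<otimes> (w k x \<otimes> e (h k) y))"
      using form_finite[OF M] I(1) cl m h(1) y by (intro finsum_swap) auto
    also have "\<dots> = (\<Oplus>x\<in>U. e m x \<otimes> (\<Oplus>k\<in>I. w k x \<otimes> e (h k) y))"
      using I(1) cl m h(1) y by (intro finsum_cong_pointwise finsum_rdistr[symmetric]) auto
    also have "\<dots> = (\<Oplus>x\<in>U. if x = y then e m x else \<zero>)"
      using cl m y by (intro finsum_cong_pointwise) (auto simp: fr)
    also have "\<dots> = e m y"
      using finsum_delta[OF form_finite[OF M], of "e m" y] cl m y by simp
    finally show "e m y = e (\<Oplus>\<^bsub>M\<^esub>k\<in>I. (\<Oplus>x\<in>U. e m x \<otimes> w k x) \<odot>\<^bsub>M\<^esub> h k) y" by simp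
  next
    show "(\<Oplus>\<^bsub>M\<^esub>k\<in>I. (\<Oplus>x\<in>U. e m x \<otimes> w k x) \<odot>\<^bsub>M\<^esub> h k) \<in> carrier M"
      using K[OF m] h(1) by (intro M.M.finsum_closed) (auto intro!: M.smult_closed)
  qed (rule m)
  then show thesis using that[of I w h] I h fr K by blast
qed

lemma (in module_pair) tens_finsum:
  assumes "finite I" "x \<in> carrier M" "\<And>i. i \<in> I \<Longrightarrow> y i \<in> carrier N"
  shows "tens R M N x (finsum N y I) = finprod TG (\<lambda>i. tens R M N x (y i)) I"
  using assms(1,3)
proof (induction I rule: finite_induct)
  case empty
  have "tens R M N x \<zero>\<^bsub>N\<^esub> \<otimes>\<^bsub>TG\<^esub> tens R M N x \<zero>\<^bsub>N\<^esub> = tens R M N x \<zero>\<^bsub>N\<^esub>"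
    using tens_add_right[of x "\<zero>\<^bsub>N\<^esub>" "\<zero>\<^bsub>N\<^esub>"] assms by simp
  then show ?case using assms by (simp add: TG.r_cancel_one')
next
  case (insert i I)
  then show ?case using assms(2)
    by (simp add: N.M.finsum_insert TG.finprod_insert tens_add_right N.M.finsum_closed Pi_def)
qed

text \<open>A dual basis of \<open>N\<close> brings each tensor into the shape of a sum of
  \<open>mm k \<otimes> h k\<close>, where the values of \<open>mm k\<close> are contractions of the
  evaluated tensor with \<open>w k\<close>. So the values determine the tensor, and the same
  contractions of an arbitrary equivariant function yield a tensor with the prescribed
  values.\<close>

theorem form_tensor:
  fixes U :: "'x set" and V :: "'y set"
  assumes M: "form L G \<alpha> K M U a e" and N: "form L G \<alpha> K N V b f"
  shows "form L G \<alpha> K (tensor Kr M N) (U \<times> V) (\<lambda>g p. (a g (fst p), b g (snd p))) (ev L Kr M N e f)"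
proof -
  note Mk = form_kfun[OF M] and Nk = form_kfun[OF N]
  interpret module_pair Kr M N by (rule module_pair_kfun[OF Mk Nk])
  note ev' = ev_closed[OF Mk Nk] ev_add[OF Mk Nk] ev_tens[OF Mk Nk]
  note cl = form_closed[OF M] form_closed[OF N]
  obtain I :: "('y \<times> nat) set" and w h where I: "finite I"
    "\<And>k. k \<in> I \<Longrightarrow> equivariant L G \<alpha> V b (w k)" "\<And>k. k \<in> I \<Longrightarrow> h k \<in> carrier N"
    "\<And>x y. x \<in> V \<Longrightarrow> y \<in> V \<Longrightarrow> (\<Oplus>k\<in>I. w k x \<otimes> f (h k) y) = (if x = y then \<one> else \<zero>)"
    "\<And>n. n \<in> carrier N \<Longrightarrow> n = (\<Oplus>\<^bsub>N\<^esub>k\<in>I. (\<Oplus>x\<in>V. f n x \<otimes> w k x) \<odot>\<^bsub>N\<^esub> h k)"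
    "\<And>n k. n \<in> carrier N \<Longrightarrow> k \<in> I \<Longrightarrow> (\<Oplus>x\<in>V. f n x \<otimes> w k x) \<in> K"
    by (rule form_frame[OF N]) (rule that)
  let ?a = "\<lambda>g p. (a g (fst p), b g (snd p))" and ?E = "ev L Kr M N e f"
  have gs: "gset G (U \<times> V) ?a" by (rule gset_product[OF form_gset[OF M] form_gset[OF N]])
  have eqv: "equivariant L G \<alpha> (U \<times> V) ?a (?E t)" if t: "t \<in> carrier (tensor_group Kr M N)" for t
    unfolding equivariant_def
  proof (intro conjI ballI)
    fix p assume p: "p \<in> U \<times> V"
    then show "?E t p \<in> carrier L" using ev'(1) t by auto
    fix g assume g: "g \<in> carrier G"
    obtain x y where xy: "p = (x, y)" "x \<in> U" "y \<in> V" using p by auto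
    note gc = gset_closed[OF form_gset[OF M] g] gset_closed[OF form_gset[OF N] g]
    show "?E t (?a g p) = \<alpha> g (?E t p)"
      using t unfolding xy(1)
    proof (induction t rule: tensor_induct)
      case (tens m n)
      then show ?case using xy g gc cl
        by (simp add: ev' equivariant_eq[OF form_equivariant[OF M]] equivariant_eq[OF form_equivariant[OF N]] \<alpha>_times)
    next
      case (add s t)
      then show ?case using xy g gc by (simp add: ev' \<alpha>_add)
    qed
  qed
  \<comment> \<open>The formula for the values of \<open>mm k\<close> is what makes this normal form
    canonical: it refers to \<open>t\<close> only through its evaluation.\<close>
  have expand: "\<exists>mm. (\<forall>k\<in>I. mm k \<in> carrier M) \<and> t = finprod TG (\<lambda>k. tens Kr M N (mm k) (h k)) I \<and>
      (\<forall>k\<in>I. \<forall>x\<in>U. e (mm k) x = (\<Oplus>y\<in>V. ?E t (x, y) \<otimes> w k y))"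
    if "t \<in> carrier (tensor_group Kr M N)" for t
    using that
  proof (induction t rule: tensor_induct)
    case (tens m n)
    let ?c = "\<lambda>k. \<Oplus>y\<in>V. f n y \<otimes> w k y"
    have cK: "?c k \<in> carrier Kr" "?c k \<in> K" if "k \<in> I" for k using I(6)[OF tens(2) that] by auto
    have "tens Kr M N m n = tens Kr M N m (\<Oplus>\<^bsub>N\<^esub>k\<in>I. ?c k \<odot>\<^bsub>N\<^esub> h k)"
      using I(5)[OF tens(2)] by simp
    also have "\<dots> = finprod TG (\<lambda>k. tens Kr M N m (?c k \<odot>\<^bsub>N\<^esub> h k)) I"
      using I(1,3) tens cK N.smult_closed by (intro tens_finsum) auto
    also have "\<dots> = finprod TG (\<lambda>k. tens Kr M N (?c k \<odot>\<^bsub>M\<^esub> m) (h k)) I"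
      using I(3) tens cK by (intro finprod_cong_pointwise tens_smult[symmetric]) auto
    finally have 1: "tens Kr M N m n = finprod TG (\<lambda>k. tens Kr M N (?c k \<odot>\<^bsub>M\<^esub> m) (h k)) I" .
    have 2: "e (?c k \<odot>\<^bsub>M\<^esub> m) x = (\<Oplus>y\<in>V. ?E (tens Kr M N m n) (x, y) \<otimes> w k y)" if "k \<in> I" "x \<in> U" for k x
    proof -
      have "e (?c k \<odot>\<^bsub>M\<^esub> m) x = (\<Oplus>y\<in>V. (f n y \<otimes> w k y) \<otimes> e m x)"
        using that tens cK cl equivariant_closed[OF I(2)] form_finite[OF N]
        by (simp add: form_smult[OF M] finsum_ldistr Pi_def)
      also have "\<dots> = (\<Oplus>y\<in>V. ?E (tens Kr M N m n) (x, y) \<otimes> w k y)"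
        using that tens cl equivariant_closed[OF I(2)]
        by (intro finsum_cong_pointwise) (simp add: ev' m_ac)
      finally show ?thesis .
    qed
    show ?case using 1 2 tens cK M.smult_closed by (intro exI[of _ "\<lambda>k. ?c k \<odot>\<^bsub>M\<^esub> m"]) auto
  next
    case (add s t)
    then obtain mm mm' where mm: "\<forall>k\<in>I. mm k \<in> carrier M" "s = finprod TG (\<lambda>k. tens Kr M N (mm k) (h k)) I"
      "\<forall>k\<in>I. \<forall>x\<in>U. e (mm k) x = (\<Oplus>y\<in>V. ?E s (x, y) \<otimes> w k y)"
      and mm': "\<forall>k\<in>I. mm' k \<in> carrier M" "t = finprod TG (\<lambda>k. tens Kr M N (mm' k) (h k)) I"
      "\<forall>k\<in>I. \<forall>x\<in>U. e (mm' k) x = (\<Oplus>y\<in>V. ?E t (x, y) \<otimes> w k y)"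
      by blast
    have "s \<otimes>\<^bsub>TG\<^esub> t = finprod TG (\<lambda>k. tens Kr M N (mm k) (h k) \<otimes>\<^bsub>TG\<^esub> tens Kr M N (mm' k) (h k)) I"
      unfolding mm(2) mm'(2) using mm(1) mm'(1) I(3) by (intro TG.finprod_multf[symmetric]) auto
    also have "\<dots> = finprod TG (\<lambda>k. tens Kr M N (mm k \<oplus>\<^bsub>M\<^esub> mm' k) (h k)) I"
      using mm(1) mm'(1) I(3) by (intro finprod_cong_pointwise) (simp add: tens_add_left)
    finally have 1: "s \<otimes>\<^bsub>TG\<^esub> t = finprod TG (\<lambda>k. tens Kr M N (mm k \<oplus>\<^bsub>M\<^esub> mm' k) (h k)) I" .
    have 2: "e (mm k \<oplus>\<^bsub>M\<^esub> mm' k) x = (\<Oplus>y\<in>V. ?E (s \<otimes>\<^bsub>TG\<^esub> t) (x, y) \<otimes> w k y)" if "k \<in> I" "x \<in> U" for k x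
    proof -
      have "e (mm k \<oplus>\<^bsub>M\<^esub> mm' k) x = (\<Oplus>y\<in>V. ?E s (x, y) \<otimes> w k y \<oplus> ?E t (x, y) \<otimes> w k y)"
        using that mm mm' add ev'(1) equivariant_closed[OF I(2)] by (subst finsum_addf) (auto simp: form_add[OF M])
      also have "\<dots> = (\<Oplus>y\<in>V. ?E (s \<otimes>\<^bsub>TG\<^esub> t) (x, y) \<otimes> w k y)"
        using that add ev' equivariant_closed[OF I(2)] by (intro finsum_cong_pointwise) (simp add: l_distr)
      finally show ?thesis .
    qed
    show ?case using 1 2 mm(1) mm'(1) by (intro exI[of _ "\<lambda>k. mm k \<oplus>\<^bsub>M\<^esub> mm' k"]) auto
  qed
  have inj: "s = t" if s: "s \<in> carrier TG" and t: "t \<in> carrier TG" and eq: "\<forall>p\<in>U \<times> V. ?E s p = ?E t p" for s t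
  proof -
    obtain mm where mm: "\<forall>k\<in>I. mm k \<in> carrier M" "s = finprod TG (\<lambda>k. tens Kr M N (mm k) (h k)) I"
      "\<forall>k\<in>I. \<forall>x\<in>U. e (mm k) x = (\<Oplus>y\<in>V. ?E s (x, y) \<otimes> w k y)" using expand[OF s] by blast
    obtain mm' where mm': "\<forall>k\<in>I. mm' k \<in> carrier M" "t = finprod TG (\<lambda>k. tens Kr M N (mm' k) (h k)) I"
      "\<forall>k\<in>I. \<forall>x\<in>U. e (mm' k) x = (\<Oplus>y\<in>V. ?E t (x, y) \<otimes> w k y)" using expand[OF t] by blast
    have "mm k = mm' k" if k: "k \<in> I" for k
    proof (rule form_inj[OF M])
      fix x assume x: "x \<in> U"
      have "(\<Oplus>y\<in>V. ?E s (x, y) \<otimes> w k y) = (\<Oplus>y\<in>V. ?E t (x, y) \<otimes> w k y)"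
        using eq x by (intro finsum_cong_pointwise) auto
      then show "e (mm k) x = e (mm' k) x" using mm mm' k x by simp
    qed (use mm mm' k in auto)
    then show ?thesis unfolding mm(2) mm'(2) by (intro finprod_cong_pointwise) auto
  qed
  have surj: "\<exists>t\<in>carrier TG. \<forall>p\<in>U \<times> V. ?E t p = u p" if u: "equivariant L G \<alpha> (U \<times> V) ?a u" for u
  proof -
    have "\<forall>k\<in>I. \<exists>m\<in>carrier M. \<forall>x\<in>U. e m x = (\<Oplus>y\<in>V. u (x, y) \<otimes> w k y)"
      using form_surj[OF M equivariant_pair_sum[OF form_gset[OF N] u I(2) form_gset[OF M]]] by blast
    then obtain mm where mm: "\<And>k. k \<in> I \<Longrightarrow> mm k \<in> carrier M"
      "\<And>k x. k \<in> I \<Longrightarrow> x \<in> U \<Longrightarrow> e (mm k) x = (\<Oplus>y\<in>V. u (x, y) \<otimes> w k y)" by metis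
    let ?t = "finprod TG (\<lambda>k. tens Kr M N (mm k) (h k)) I"
    have tc: "?t \<in> carrier TG" using mm(1) I(3) by (intro TG.finprod_closed) auto
    have "?E ?t (x, y) = u (x, y)" if xy: "x \<in> U" "y \<in> V" for x y
    proof -
      note uc = equivariant_closed[OF u] and wc = equivariant_closed[OF I(2)]
      have "?E (finprod TG (\<lambda>k. tens Kr M N (mm k) (h k)) S) (x, y) = (\<Oplus>k\<in>S. e (mm k) x \<otimes> f (h k) y)"
        if "finite S" "S \<subseteq> I" for S
        using that
      proof (induction S rule: finite_induct)
        case empty then show ?case using ev_one[OF Mk Nk] xy by simp
      next
        case (insert k S)
        have "?E (finprod TG (\<lambda>k. tens Kr M N (mm k) (h k)) (insert k S)) (x, y) =
           ?E (tens Kr M N (mm k) (h k) \<otimes>\<^bsub>TG\<^esub> finprod TG (\<lambda>k. tens Kr M N (mm k) (h k)) S) (x, y)"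
          using insert mm(1) I(3) by (subst TG.finprod_insert) auto
        also have "\<dots> = e (mm k) x \<otimes> f (h k) y \<oplus> (\<Oplus>k\<in>S. e (mm k) x \<otimes> f (h k) y)"
          using insert mm(1) I(3) xy by (subst ev'(2)) (auto simp: ev' intro!: TG.finprod_closed)
        also have "\<dots> = (\<Oplus>k\<in>insert k S. e (mm k) x \<otimes> f (h k) y)"
          using insert mm(1) I(3) xy cl by (subst finsum_insert) auto
        finally show ?case .
      qed
      from this[OF I(1)] have "?E ?t (x, y) = (\<Oplus>k\<in>I. (\<Oplus>y'\<in>V. u (x, y') \<otimes> w k y') \<otimes> f (h k) y)"
        using mm(2) xy by (auto intro!: finsum_cong_pointwise)
      also have "\<dots> = (\<Oplus>k\<in>I. \<Oplus>y'\<in>V. u (x, y') \<otimes> (w k y' \<otimes> f (h k) y))"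
        using form_finite[OF N] cl uc wc I(3) xy by (intro finsum_cong_pointwise finsum_mult_assoc) auto
      also have "\<dots> = (\<Oplus>y'\<in>V. \<Oplus>k\<in>I. u (x, y') \<otimes> (w k y' \<otimes> f (h k) y))"
        using form_finite[OF N] I(1) cl uc wc I(3) xy by (intro finsum_swap) auto
      also have "\<dots> = (\<Oplus>y'\<in>V. u (x, y') \<otimes> (\<Oplus>k\<in>I. w k y' \<otimes> f (h k) y))"
        using I(1) cl uc wc I(3) xy by (intro finsum_cong_pointwise finsum_rdistr[symmetric]) auto
      also have "\<dots> = (\<Oplus>y'\<in>V. if y' = y then u (x, y') else \<zero>)"
        using uc xy by (intro finsum_cong_pointwise) (auto simp: I(4))
      also have "\<dots> = u (x, y)"
        using finsum_delta[OF form_finite[OF N], of "\<lambda>y'. u (x, y')" y] uc xy by simp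
      finally show ?thesis .
    qed
    then show ?thesis using tc by auto
  qed
  show ?thesis
    unfolding form_def using kfun_tensor[OF Mk Nk] gs eqv inj surj by simp
qed

end

section \<open>Hopf algebras as forms of finite groups\<close>

text \<open>
  \<open>mult_law\<close> covers both the convolution product of a group algebra (\<open>I\<close> is the group) and the
  pointwise product of functions (\<open>I\<close> is a singleton), and it is inherited by tensor products.
\<close>

definition mult_law ::
  "('l, 'r) ring_scheme \<Rightarrow> ('l, 'a, 'n) module_scheme \<Rightarrow> 'x set \<Rightarrow> ('a \<Rightarrow> 'x \<Rightarrow> 'l)
    \<Rightarrow> 'i set \<Rightarrow> ('x \<Rightarrow> 'i \<Rightarrow> 'x) \<Rightarrow> ('x \<Rightarrow> 'i \<Rightarrow> 'x) \<Rightarrow> bool"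
  where "mult_law L M U e I l r \<longleftrightarrow> finite I \<and> (\<forall>p\<in>U. \<forall>i\<in>I. l p i \<in> U \<and> r p i \<in> U) \<and>
    (\<forall>m\<in>carrier M. \<forall>m'\<in>carrier M. m \<otimes>\<^bsub>M\<^esub> m' \<in> carrier M \<and>
       (\<forall>p\<in>U. e (m \<otimes>\<^bsub>M\<^esub> m') p = (\<Oplus>\<^bsub>L\<^esub>i\<in>I. e m (l p i) \<otimes>\<^bsub>L\<^esub> e m' (r p i))))"

lemma mult_law_finite: "mult_law L M U e I l r \<Longrightarrow> finite I"
  and mult_law_index: "mult_law L M U e I l r \<Longrightarrow> p \<in> U \<Longrightarrow> i \<in> I \<Longrightarrow> l p i \<in> U"
    "mult_law L M U e I l r \<Longrightarrow> p \<in> U \<Longrightarrow> i \<in> I \<Longrightarrow> r p i \<in> U"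
  and mult_law_closed: "mult_law L M U e I l r \<Longrightarrow> m \<in> carrier M \<Longrightarrow> m' \<in> carrier M \<Longrightarrow> m \<otimes>\<^bsub>M\<^esub> m' \<in> carrier M"
  and mult_law_eq: "mult_law L M U e I l r \<Longrightarrow> m \<in> carrier M \<Longrightarrow> m' \<in> carrier M \<Longrightarrow> p \<in> U \<Longrightarrow>
    e (m \<otimes>\<^bsub>M\<^esub> m') p = (\<Oplus>\<^bsub>L\<^esub>i\<in>I. e m (l p i) \<otimes>\<^bsub>L\<^esub> e m' (r p i))"
  unfolding mult_law_def by blast+

text \<open>The group algebra of \<open>P\<close> read on coefficients: convolution, indicator of
  the unit, comultiplication concentrated on the diagonal since group elements are group-like, total
  sum, and inversion. The comultiplication is constrained through its values only, which determine
  it by \<open>form_tensor\<close>.\<close>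

definition hopf_form ::
  "('l, 'r) ring_scheme \<Rightarrow> ('g, 'm) monoid_scheme \<Rightarrow> ('g \<Rightarrow> 'l \<Rightarrow> 'l) \<Rightarrow> 'l set \<Rightarrow> ('l, 'a, 'n) hopf_scheme
    \<Rightarrow> ('x, 'p) monoid_scheme \<Rightarrow> ('g \<Rightarrow> 'x \<Rightarrow> 'x) \<Rightarrow> ('a \<Rightarrow> 'x \<Rightarrow> 'l) \<Rightarrow> bool"
  where "hopf_form L G \<alpha> K H P a e \<longleftrightarrow> form L G \<alpha> K H (carrier P) a e \<and> group P \<and>
    mult_law L H (carrier P) e (carrier P) (\<lambda>p i. i) (\<lambda>p i. inv\<^bsub>P\<^esub> i \<otimes>\<^bsub>P\<^esub> p) \<and>
    (\<one>\<^bsub>H\<^esub> \<in> carrier H \<and> (\<forall>n\<in>carrier P. e \<one>\<^bsub>H\<^esub> n = (if n = \<one>\<^bsub>P\<^esub> then \<one>\<^bsub>L\<^esub> else \<zero>\<^bsub>L\<^esub>))) \<and>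
    (\<forall>h\<in>carrier H. comult H h \<in> carrier (tensor_group (L\<lparr>carrier := K\<rparr>) H H) \<and>
      (\<forall>n\<in>carrier P. \<forall>m\<in>carrier P.
        ev L (L\<lparr>carrier := K\<rparr>) H H e e (comult H h) (n, m) = (if n = m then e h n else \<zero>\<^bsub>L\<^esub>))) \<and>
    (\<forall>h\<in>carrier H. counit H h = (\<Oplus>\<^bsub>L\<^esub>n\<in>carrier P. e h n)) \<and>
    (\<forall>h\<in>carrier H. antipode H h \<in> carrier H \<and> (\<forall>n\<in>carrier P. e (antipode H h) n = e h (inv\<^bsub>P\<^esub> n)))"

lemma hopf_form_form: "hopf_form L G \<alpha> K H P a e \<Longrightarrow> form L G \<alpha> K H (carrier P) a e"
  and hopf_form_group: "hopf_form L G \<alpha> K H P a e \<Longrightarrow> group P"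
  and hopf_form_mult_law: "hopf_form L G \<alpha> K H P a e \<Longrightarrow>
    mult_law L H (carrier P) e (carrier P) (\<lambda>p i. i) (\<lambda>p i. inv\<^bsub>P\<^esub> i \<otimes>\<^bsub>P\<^esub> p)"
  and hopf_form_one: "hopf_form L G \<alpha> K H P a e \<Longrightarrow> \<one>\<^bsub>H\<^esub> \<in> carrier H"
    "hopf_form L G \<alpha> K H P a e \<Longrightarrow> n \<in> carrier P \<Longrightarrow> e \<one>\<^bsub>H\<^esub> n = (if n = \<one>\<^bsub>P\<^esub> then \<one>\<^bsub>L\<^esub> else \<zero>\<^bsub>L\<^esub>)"
  and hopf_form_comult: "hopf_form L G \<alpha> K H P a e \<Longrightarrow> h \<in> carrier H \<Longrightarrow>
      comult H h \<in> carrier (tensor_group (L\<lparr>carrier := K\<rparr>) H H)"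
    "hopf_form L G \<alpha> K H P a e \<Longrightarrow> h \<in> carrier H \<Longrightarrow> n \<in> carrier P \<Longrightarrow> m \<in> carrier P \<Longrightarrow>
      ev L (L\<lparr>carrier := K\<rparr>) H H e e (comult H h) (n, m) = (if n = m then e h n else \<zero>\<^bsub>L\<^esub>)"
  and hopf_form_counit: "hopf_form L G \<alpha> K H P a e \<Longrightarrow> h \<in> carrier H \<Longrightarrow> counit H h = (\<Oplus>\<^bsub>L\<^esub>n\<in>carrier P. e h n)"
  and hopf_form_antipode: "hopf_form L G \<alpha> K H P a e \<Longrightarrow> h \<in> carrier H \<Longrightarrow> antipode H h \<in> carrier H"
    "hopf_form L G \<alpha> K H P a e \<Longrightarrow> h \<in> carrier H \<Longrightarrow> n \<in> carrier P \<Longrightarrow> e (antipode H h) n = e h (inv\<^bsub>P\<^esub> n)"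
  unfolding hopf_form_def by blast+

lemmas hopf_form_mult_closed = mult_law_closed[OF hopf_form_mult_law]
lemmas hopf_form_mult = mult_law_eq[OF hopf_form_mult_law]

section \<open>Structure maps on tensor products, computed on functions\<close>

context galois_action begin

text \<open>The module axioms hold for \<open>L\<close>-valued functions and are pulled back along
  the injective \<open>e\<close>, so only closure and compatibility of the operations have to be
  supplied.\<close>

lemma formI:
  fixes M :: "('l, 'a, 'n) module_scheme"
  assumes gs: "gset G U a"
    and eqv: "\<And>m. m \<in> carrier M \<Longrightarrow> equivariant L G \<alpha> U a (e m)"
    and inj: "\<And>m m'. m \<in> carrier M \<Longrightarrow> m' \<in> carrier M \<Longrightarrow> (\<And>x. x \<in> U \<Longrightarrow> e m x = e m' x) \<Longrightarrow> m = m'"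
    and surj: "\<And>u. equivariant L G \<alpha> U a u \<Longrightarrow> \<exists>m\<in>carrier M. \<forall>x\<in>U. e m x = u x"
    and addc: "\<And>m m'. m \<in> carrier M \<Longrightarrow> m' \<in> carrier M \<Longrightarrow> m \<oplus>\<^bsub>M\<^esub> m' \<in> carrier M"
    and add: "\<And>m m' x. m \<in> carrier M \<Longrightarrow> m' \<in> carrier M \<Longrightarrow> x \<in> U \<Longrightarrow> e (m \<oplus>\<^bsub>M\<^esub> m') x = e m x \<oplus> e m' x"
    and zeroc: "\<zero>\<^bsub>M\<^esub> \<in> carrier M" and zero: "\<And>x. x \<in> U \<Longrightarrow> e \<zero>\<^bsub>M\<^esub> x = \<zero>"
    and smc: "\<And>r m. r \<in> K \<Longrightarrow> m \<in> carrier M \<Longrightarrow> r \<odot>\<^bsub>M\<^esub> m \<in> carrier M"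
    and sm: "\<And>r m x. r \<in> K \<Longrightarrow> m \<in> carrier M \<Longrightarrow> x \<in> U \<Longrightarrow> e (r \<odot>\<^bsub>M\<^esub> m) x = r \<otimes> e m x"
  shows "form L G \<alpha> K M U a e"
proof -
  note cl = equivariant_closed[OF eqv]
  have K: "r \<in> K \<Longrightarrow> r \<in> carrier L" for r using K_subset by auto
  have Kc: "r \<in> K \<Longrightarrow> s \<in> K \<Longrightarrow> r \<oplus> s \<in> K" "r \<in> K \<Longrightarrow> s \<in> K \<Longrightarrow> r \<otimes> s \<in> K" "\<one> \<in> K" for r s
    by (auto simp: K_eq \<alpha>_add \<alpha>_times)
  have ab: "abelian_group M"
  proof (rule abelian_groupI)
    fix m assume m: "m \<in> carrier M"
    \<comment> \<open>The pointwise negative is again equivariant, so surjectivity of the form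
      provides the additive inverse.\<close>
    have "equivariant L G \<alpha> U a (\<lambda>x. \<ominus> e m x)"
      using eqv[OF m] cl[OF m] by (auto simp: equivariant_def \<alpha>_minus)
    from surj[OF this] obtain m' where m': "m' \<in> carrier M" "\<And>x. x \<in> U \<Longrightarrow> e m' x = \<ominus> e m x" by auto
    have "m' \<oplus>\<^bsub>M\<^esub> m = \<zero>\<^bsub>M\<^esub>"
      by (rule inj) (use m m' cl in \<open>auto simp: addc zeroc add zero l_neg\<close>)
    then show "\<exists>y\<in>carrier M. y \<oplus>\<^bsub>M\<^esub> m = \<zero>\<^bsub>M\<^esub>" using m' by auto
  next
    fix x y z assume c: "x \<in> carrier M" "y \<in> carrier M" "z \<in> carrier M"
    show "x \<oplus>\<^bsub>M\<^esub> y \<oplus>\<^bsub>M\<^esub> z = x \<oplus>\<^bsub>M\<^esub> (y \<oplus>\<^bsub>M\<^esub> z)"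
      by (rule inj) (use c cl in \<open>auto simp: addc add a_assoc\<close>)
  next
    fix x y assume c: "x \<in> carrier M" "y \<in> carrier M"
    show "x \<oplus>\<^bsub>M\<^esub> y = y \<oplus>\<^bsub>M\<^esub> x"
      by (rule inj) (use c cl in \<open>auto simp: addc add a_comm\<close>)
  next
    fix x assume c: "x \<in> carrier M"
    show "\<zero>\<^bsub>M\<^esub> \<oplus>\<^bsub>M\<^esub> x = x"
      by (rule inj) (use c cl in \<open>auto simp: addc add zeroc zero\<close>)
  qed (use addc zeroc in auto)
  have "module Kr M"
  proof (rule moduleI)
    fix r s m assume c: "r \<in> carrier Kr" "s \<in> carrier Kr" "m \<in> carrier M"
    then have c': "r \<in> K" "s \<in> K" "m \<in> carrier M" by auto
    have "(r \<oplus> s) \<odot>\<^bsub>M\<^esub> m = r \<odot>\<^bsub>M\<^esub> m \<oplus>\<^bsub>M\<^esub> s \<odot>\<^bsub>M\<^esub> m"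
      by (rule inj) (use c' cl K Kc in \<open>auto simp: addc add smc sm l_distr\<close>)
    then show "(r \<oplus>\<^bsub>Kr\<^esub> s) \<odot>\<^bsub>M\<^esub> m = r \<odot>\<^bsub>M\<^esub> m \<oplus>\<^bsub>M\<^esub> s \<odot>\<^bsub>M\<^esub> m" by simp
    have "(r \<otimes> s) \<odot>\<^bsub>M\<^esub> m = r \<odot>\<^bsub>M\<^esub> (s \<odot>\<^bsub>M\<^esub> m)"
      by (rule inj) (use c' cl K Kc in \<open>auto simp: smc sm m_assoc\<close>)
    then show "(r \<otimes>\<^bsub>Kr\<^esub> s) \<odot>\<^bsub>M\<^esub> m = r \<odot>\<^bsub>M\<^esub> (s \<odot>\<^bsub>M\<^esub> m)" by simp
  next
    fix r m m' assume c: "r \<in> carrier Kr" "m \<in> carrier M" "m' \<in> carrier M"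
    then have c': "r \<in> K" by auto
    show "r \<odot>\<^bsub>M\<^esub> (m \<oplus>\<^bsub>M\<^esub> m') = r \<odot>\<^bsub>M\<^esub> m \<oplus>\<^bsub>M\<^esub> r \<odot>\<^bsub>M\<^esub> m'"
      by (rule inj) (use c c' cl K in \<open>auto simp: addc add smc sm r_distr\<close>)
  next
    fix m assume c: "m \<in> carrier M"
    have "\<one> \<odot>\<^bsub>M\<^esub> m = m"
      by (rule inj) (use c cl K Kc in \<open>auto simp: smc sm\<close>)
    then show "\<one>\<^bsub>Kr\<^esub> \<odot>\<^bsub>M\<^esub> m = m" by simp
  qed (use ab smc Kr_cring in auto)
  then have "kfun L K M U e"
    unfolding kfun_def using add sm cl by blast
  then show ?thesis
    unfolding form_def
  proof (intro conjI gs)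
    show "\<forall>m\<in>carrier M. equivariant L G \<alpha> U a (e m)" using eqv by simp
    show "\<forall>m\<in>carrier M. \<forall>m'\<in>carrier M. (\<forall>x\<in>U. e m x = e m' x) \<longrightarrow> m = m'"
      by (intro ballI impI, rule inj) simp_all
    show "\<forall>u. equivariant L G \<alpha> U a u \<longrightarrow> (\<exists>m\<in>carrier M. \<forall>x\<in>U. e m x = u x)"
      by (intro allI impI, rule surj)
  qed
qed

text \<open>Puts \<open>form_tensor\<close> into the shape in which a tensor product can be the
  target of \<open>lift_into\<close>.\<close>

lemma tensor_emb:
  assumes "form L G \<alpha> K M U a e" "form L G \<alpha> K N V b f"
  shows "emb L (tensor_group Kr M N) (U \<times> V) (ev L Kr M N e f)"
proof -
  interpret module_pair Kr M N by (rule module_pair_kfun[OF form_kfun[OF assms(1)] form_kfun[OF assms(2)]])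
  note T = form_tensor[OF assms]
  show ?thesis unfolding emb_def
  proof (intro conjI)
    show "comm_group TG" by (rule TG.comm_group_axioms)
    show "\<forall>m\<in>carrier TG. \<forall>z\<in>U \<times> V. ev L Kr M N e f m z \<in> carrier L"
      using form_closed[OF T] by simp
    show "\<forall>s\<in>carrier TG. \<forall>t\<in>carrier TG. \<forall>z\<in>U \<times> V.
        ev L Kr M N e f (s \<otimes>\<^bsub>TG\<^esub> t) z = ev L Kr M N e f s z \<oplus> ev L Kr M N e f t z"
      using form_add[OF T] by simp
    show "\<forall>s\<in>carrier TG. \<forall>t\<in>carrier TG. (\<forall>z\<in>U \<times> V. ev L Kr M N e f s z = ev L Kr M N e f t z) \<longrightarrow> s = t"
      using form_inj[OF T] by (metis tensor_carrier)
  qed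
qed

lemma addfun_sum:
  assumes "finite I" "\<And>i. i \<in> I \<Longrightarrow> c i \<in> carrier L" "\<And>i. i \<in> I \<Longrightarrow> k i \<in> U"
  shows "addfun L U (\<lambda>u. \<Oplus>i\<in>I. c i \<otimes> u (k i))" and "addfun L U (\<lambda>u. \<Oplus>i\<in>I. u (k i) \<otimes> c i)"
    and "addfun L U (\<lambda>u. \<Oplus>i\<in>I. u (k i))"
proof -
  show "addfun L U (\<lambda>u. \<Oplus>i\<in>I. c i \<otimes> u (k i))"
  proof (rule addfunI)
    fix u v assume uv: "\<And>x. x \<in> U \<Longrightarrow> u x \<in> carrier L" "\<And>x. x \<in> U \<Longrightarrow> v x \<in> carrier L"
    have "(\<Oplus>i\<in>I. c i \<otimes> (u (k i) \<oplus> v (k i))) = (\<Oplus>i\<in>I. c i \<otimes> u (k i) \<oplus> c i \<otimes> v (k i))"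
      using uv assms by (intro finsum_cong_pointwise) (auto simp: r_distr)
    then show "(\<Oplus>i\<in>I. c i \<otimes> (u (k i) \<oplus> v (k i))) = (\<Oplus>i\<in>I. c i \<otimes> u (k i)) \<oplus> (\<Oplus>i\<in>I. c i \<otimes> v (k i))"
      using uv assms by (simp add: finsum_addf Pi_def)
  qed (auto intro!: finsum_cong_pointwise simp: assms)
  show "addfun L U (\<lambda>u. \<Oplus>i\<in>I. u (k i) \<otimes> c i)"
  proof (rule addfunI)
    fix u v assume uv: "\<And>x. x \<in> U \<Longrightarrow> u x \<in> carrier L" "\<And>x. x \<in> U \<Longrightarrow> v x \<in> carrier L"
    have "(\<Oplus>i\<in>I. (u (k i) \<oplus> v (k i)) \<otimes> c i) = (\<Oplus>i\<in>I. u (k i) \<otimes> c i \<oplus> v (k i) \<otimes> c i)"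
      using uv assms by (intro finsum_cong_pointwise) (auto simp: l_distr)
    then show "(\<Oplus>i\<in>I. (u (k i) \<oplus> v (k i)) \<otimes> c i) = (\<Oplus>i\<in>I. u (k i) \<otimes> c i) \<oplus> (\<Oplus>i\<in>I. v (k i) \<otimes> c i)"
      using uv assms by (simp add: finsum_addf Pi_def)
  qed (auto intro!: finsum_cong_pointwise simp: assms)
  show "addfun L U (\<lambda>u. \<Oplus>i\<in>I. u (k i))"
  proof (rule addfunI)
    fix u v assume uv: "\<And>x. x \<in> U \<Longrightarrow> u x \<in> carrier L" "\<And>x. x \<in> U \<Longrightarrow> v x \<in> carrier L"
    then show "(\<Oplus>i\<in>I. (u (k i) \<oplus> v (k i))) = (\<Oplus>i\<in>I. u (k i)) \<oplus> (\<Oplus>i\<in>I. v (k i))"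
      using uv assms by (simp add: finsum_addf Pi_def)
  qed (auto intro!: finsum_cong_pointwise simp: assms)
qed

lemma addfun_eval:
  "k \<in> U \<Longrightarrow> addfun L U (\<lambda>u. u k)"
  "k \<in> U \<Longrightarrow> c \<in> carrier L \<Longrightarrow> addfun L U (\<lambda>u. u k \<otimes> c)"
  "k \<in> U \<Longrightarrow> c \<in> carrier L \<Longrightarrow> addfun L U (\<lambda>u. c \<otimes> u k)"
  "(b \<Longrightarrow> k \<in> U) \<Longrightarrow> addfun L U (\<lambda>u. if b then u k else \<zero>)"
  by (rule addfunI; auto simp: l_distr r_distr)+

text \<open>The product of two tensors is a lift of lifts: \<open>?in\<close> resolves the right
  factor for a pure left factor, and the second half of the proof resolves the left one. The index
  sets of the two laws combine to their product.\<close>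

lemma tensor_mult_law:
  fixes M :: "('l, 'a, 'n) module_scheme" and N :: "('l, 'b, 'p) module_scheme"
    and U :: "'x set" and V :: "'y set" and I :: "'i set" and J :: "'j set"
  assumes M: "form L G \<alpha> K M U a e" and N: "form L G \<alpha> K N V b f"
    and mM: "mult_law L M U e I l r" and mN: "mult_law L N V f J l' r'"
  shows "mult_law L (tensor Kr M N) (U \<times> V) (ev L Kr M N e f) (I \<times> J)
    (\<lambda>p i. (l (fst p) (fst i), l' (snd p) (snd i))) (\<lambda>p i. (r (fst p) (fst i), r' (snd p) (snd i)))"
proof -
  note Mk = form_kfun[OF M] and Nk = form_kfun[OF N]
  interpret module_pair Kr M N by (rule module_pair_kfun[OF Mk Nk])
  note emb = tensor_emb[OF M N]
  note cl = form_closed[OF M] form_closed[OF N]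
  note ix = mult_law_index[OF mM] mult_law_index[OF mN]
  note fin = mult_law_finite[OF mM] mult_law_finite[OF mN]
  let ?E = "ev L Kr M N e f"
  let ?l = "\<lambda>p i. (l (fst p) (fst i), l' (snd p) (snd i))" and ?r = "\<lambda>p i. (r (fst p) (fst i), r' (snd p) (snd i))"
  let ?in = "\<lambda>m n. tensor_lift Kr M N TG (\<lambda>m' n'. tens Kr M N (m \<otimes>\<^bsub>M\<^esub> m') (n \<otimes>\<^bsub>N\<^esub> n'))"
  have inner: "?in m n t \<in> carrier TG \<and> (\<forall>z\<in>U \<times> V. ?E (?in m n t) z =
      (\<Oplus>i\<in>I \<times> J. (e m (l (fst z) (fst i)) \<otimes> f n (l' (snd z) (snd i))) \<otimes> ?E t (?r z i)))"
    if m: "m \<in> carrier M" and n: "n \<in> carrier N" and t: "t \<in> carrier TG" for m n t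
  proof -
    let ?\<Psi> = "\<lambda>z u. \<Oplus>i\<in>I \<times> J. (e m (l (fst z) (fst i)) \<otimes> f n (l' (snd z) (snd i))) \<otimes> u (?r z i)"
    have c: "tens Kr M N (m \<otimes>\<^bsub>M\<^esub> m') (n \<otimes>\<^bsub>N\<^esub> n') \<in> carrier TG" if "m' \<in> carrier M" "n' \<in> carrier N" for m' n'
      using that m n mult_law_closed[OF mM] mult_law_closed[OF mN] by auto
    have v: "?E (tens Kr M N (m \<otimes>\<^bsub>M\<^esub> m') (n \<otimes>\<^bsub>N\<^esub> n')) z = ?\<Psi> z (\<lambda>p. e m' (fst p) \<otimes> f n' (snd p))"
      if "m' \<in> carrier M" "n' \<in> carrier N" "z \<in> U \<times> V" for m' n' z
    proof -
      obtain p q where z: "z = (p, q)" "p \<in> U" "q \<in> V" using \<open>z \<in> U \<times> V\<close> by auto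
      have "?E (tens Kr M N (m \<otimes>\<^bsub>M\<^esub> m') (n \<otimes>\<^bsub>N\<^esub> n')) z =
          (\<Oplus>i\<in>I. e m (l p i) \<otimes> e m' (r p i)) \<otimes> (\<Oplus>j\<in>J. f n (l' q j) \<otimes> f n' (r' q j))"
        using that m n z mult_law_closed[OF mM] mult_law_closed[OF mN]
        by (simp add: ev_tens[OF Mk Nk] mult_law_eq[OF mM] mult_law_eq[OF mN])
      also have "\<dots> = (\<Oplus>i\<in>I. \<Oplus>j\<in>J. (e m (l p i) \<otimes> e m' (r p i)) \<otimes> (f n (l' q j) \<otimes> f n' (r' q j)))"
        using that m n z fin cl ix by (intro finsum_mult) auto
      also have "\<dots> = (\<Oplus>i\<in>I. \<Oplus>j\<in>J. (e m (l p i) \<otimes> f n (l' q j)) \<otimes> (e m' (r p i) \<otimes> f n' (r' q j)))"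
        using that m n z fin cl ix by (intro finsum_cong_pointwise) (simp add: m_ac)
      also have "\<dots> = ?\<Psi> z (\<lambda>p. e m' (fst p) \<otimes> f n' (snd p))"
        using that m n z fin cl ix by (subst finsum_cartesian) auto
      finally show ?thesis .
    qed
    have a: "addfun L (U \<times> V) (?\<Psi> z)" if "z \<in> U \<times> V" for z
      by (rule addfun_sum(1)) (use that m n fin cl ix in auto)
    show ?thesis
      using lift_into_closed[OF Mk Nk emb c v a t] lift_into_val[OF Mk Nk emb c v a t] by blast
  qed
  have "s \<otimes>\<^bsub>tensor Kr M N\<^esub> t \<in> carrier TG \<and> (\<forall>p\<in>U \<times> V. ?E (s \<otimes>\<^bsub>tensor Kr M N\<^esub> t) p =
      (\<Oplus>i\<in>I \<times> J. ?E s (?l p i) \<otimes> ?E t (?r p i)))"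
    if s: "s \<in> carrier TG" and t: "t \<in> carrier TG" for s t
  proof -
    let ?\<Psi> = "\<lambda>z u. \<Oplus>i\<in>I \<times> J. u (?l z i) \<otimes> ?E t (?r z i)"
    have eq: "s \<otimes>\<^bsub>tensor Kr M N\<^esub> t = tensor_lift Kr M N TG (\<lambda>m n. ?in m n t) s"
      by (simp add: tensor_def)
    have c: "?in m n t \<in> carrier TG" if "m \<in> carrier M" "n \<in> carrier N" for m n
      using inner that t by blast
    have v: "?E (?in m n t) z = ?\<Psi> z (\<lambda>p. e m (fst p) \<otimes> f n (snd p))"
      if "m \<in> carrier M" "n \<in> carrier N" "z \<in> U \<times> V" for m n z
      using bspec[OF conjunct2[OF inner[OF that(1,2) t]] that(3)] by simp
    have a: "addfun L (U \<times> V) (?\<Psi> z)" if "z \<in> U \<times> V" for z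
      by (rule addfun_sum(2)) (use that t fin cl ix ev_closed[OF Mk Nk] in auto)
    show ?thesis unfolding eq
      using lift_into_closed[OF Mk Nk emb c v a s] lift_into_val[OF Mk Nk emb c v a s] by blast
  qed
  then show ?thesis
    unfolding mult_law_def using fin ix by auto
qed

text \<open>Each factor map is a pullback along \<open>\<pi>\<close> or \<open>\<rho>\<close>,
  extended by zero off \<open>B\<close> or \<open>C\<close>. This shape covers antipodes and
  isomorphisms, where nothing is cut off, and also the comultiplication, which is a pullback cut off
  to the diagonal.\<close>

lemma tensor_map_val:
  assumes Mk: "kfun L K M U e" and Nk: "kfun L K N V f"
    and M': "form L G \<alpha> K M' U' a' e'" and N': "form L G \<alpha> K N' V' b' f'"
    and \<phi>: "\<And>m. m \<in> carrier M \<Longrightarrow> \<phi> m \<in> carrier M'"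
      "\<And>m x. m \<in> carrier M \<Longrightarrow> x \<in> U' \<Longrightarrow> e' (\<phi> m) x = (if B x then e m (\<pi> x) else \<zero>)"
      "\<And>x. x \<in> U' \<Longrightarrow> B x \<Longrightarrow> \<pi> x \<in> U"
    and \<psi>: "\<And>n. n \<in> carrier N \<Longrightarrow> \<psi> n \<in> carrier N'"
      "\<And>n y. n \<in> carrier N \<Longrightarrow> y \<in> V' \<Longrightarrow> f' (\<psi> n) y = (if C y then f n (\<rho> y) else \<zero>)"
      "\<And>y. y \<in> V' \<Longrightarrow> C y \<Longrightarrow> \<rho> y \<in> V"
    and t: "t \<in> carrier (tensor_group Kr M N)"
  shows "tensor_map Kr M N M' N' \<phi> \<psi> t \<in> carrier (tensor_group Kr M' N')"
    and "\<And>x y. x \<in> U' \<Longrightarrow> y \<in> V' \<Longrightarrow> ev L Kr M' N' e' f' (tensor_map Kr M N M' N' \<phi> \<psi> t) (x, y) =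
      (if B x \<and> C y then ev L Kr M N e f t (\<pi> x, \<rho> y) else \<zero>)"
proof -
  interpret T': module_pair Kr M' N' by (rule module_pair_kfun[OF form_kfun[OF M'] form_kfun[OF N']])
  note emb = tensor_emb[OF M' N']
  let ?\<Psi> = "\<lambda>z u. if B (fst z) \<and> C (snd z) then u (\<pi> (fst z), \<rho> (snd z)) else \<zero>"
  have c: "tens Kr M' N' (\<phi> m) (\<psi> n) \<in> carrier T'.TG" if "m \<in> carrier M" "n \<in> carrier N" for m n
    using that \<phi> \<psi> by auto
  have v: "ev L Kr M' N' e' f' (tens Kr M' N' (\<phi> m) (\<psi> n)) z = ?\<Psi> z (\<lambda>p. e m (fst p) \<otimes> f n (snd p))"
    if "m \<in> carrier M" "n \<in> carrier N" "z \<in> U' \<times> V'" for m n z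
    using that \<phi> \<psi> kfun_closed[OF Mk] kfun_closed[OF Nk]
    by (auto simp: ev_tens[OF form_kfun[OF M'] form_kfun[OF N']])
  have a: "addfun L (U \<times> V) (?\<Psi> z)" if "z \<in> U' \<times> V'" for z
    by (rule addfun_eval) (use that \<phi> \<psi> in auto)
  show "tensor_map Kr M N M' N' \<phi> \<psi> t \<in> carrier (tensor_group Kr M' N')"
    unfolding tensor_map_def by (rule lift_into_closed[OF Mk Nk emb c v a t])
  show "ev L Kr M' N' e' f' (tensor_map Kr M N M' N' \<phi> \<psi> t) (x, y) =
      (if B x \<and> C y then ev L Kr M N e f t (\<pi> x, \<rho> y) else \<zero>)" if "x \<in> U'" "y \<in> V'" for x y
    unfolding tensor_map_def using lift_into_val[OF Mk Nk emb c v a t, of "(x, y)"] that by simp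
qed

text \<open>On functions the associator only rebrackets the variables. As for products, the inner
  lift is resolved for each \<open>p\<close> before the outer one.\<close>

lemma tensor_assoc_val:
  assumes M: "form L G \<alpha> K M U a e" and N: "form L G \<alpha> K N V b f" and P: "form L G \<alpha> K P W c g"
    and t: "t \<in> carrier (tensor_group Kr (tensor Kr M N) P)"
  shows "tensor_assoc Kr M N P t \<in> carrier (tensor_group Kr M (tensor Kr N P))"
    and "\<And>x y z. x \<in> U \<Longrightarrow> y \<in> V \<Longrightarrow> z \<in> W \<Longrightarrow>
      ev L Kr M (tensor Kr N P) e (ev L Kr N P f g) (tensor_assoc Kr M N P t) (x, (y, z)) =
      ev L Kr (tensor Kr M N) P (ev L Kr M N e f) g t ((x, y), z)"
proof -
  note Mk = form_kfun[OF M] and Nk = form_kfun[OF N] and Pk = form_kfun[OF P]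
  interpret MN: module_pair Kr M N by (rule module_pair_kfun[OF Mk Nk])
  interpret NP: module_pair Kr N P by (rule module_pair_kfun[OF Nk Pk])
  note NPf = form_tensor[OF N P] and MNf = form_tensor[OF M N]
  note NPk = form_kfun[OF NPf] and MNk = form_kfun[OF MNf]
  interpret T: module_pair Kr M "tensor Kr N P" by (rule module_pair_kfun[OF Mk NPk])
  note emb = tensor_emb[OF M NPf]
  let ?E = "ev L Kr M (tensor Kr N P) e (ev L Kr N P f g)"
  let ?in = "\<lambda>t p. tensor_lift Kr M N T.TG (\<lambda>m n. tens Kr M (tensor Kr N P) m (tens Kr N P n p)) t"
  have inner: "?in s p \<in> carrier T.TG \<and> (\<forall>q\<in>U \<times> (V \<times> W). ?E (?in s p) q =
      ev L Kr M N e f s (fst q, fst (snd q)) \<otimes> g p (snd (snd q)))"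
    if s: "s \<in> carrier MN.TG" and p: "p \<in> carrier P" for s p
  proof -
    let ?\<Psi> = "\<lambda>q u. u (fst q, fst (snd q)) \<otimes> g p (snd (snd q))"
    have c: "tens Kr M (tensor Kr N P) m (tens Kr N P n p) \<in> carrier T.TG"
      if "m \<in> carrier M" "n \<in> carrier N" for m n
      using that p by auto
    have v: "?E (tens Kr M (tensor Kr N P) m (tens Kr N P n p)) q = ?\<Psi> q (\<lambda>p. e m (fst p) \<otimes> f n (snd p))"
      if "m \<in> carrier M" "n \<in> carrier N" "q \<in> U \<times> (V \<times> W)" for m n q
      using that p form_closed[OF M] form_closed[OF N] form_closed[OF P]
      by (auto simp: ev_tens[OF Mk NPk] ev_tens[OF Nk Pk] m_assoc)
    have a: "addfun L (U \<times> V) (?\<Psi> q)" if "q \<in> U \<times> (V \<times> W)" for q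
      by (rule addfun_eval) (use that p form_closed[OF P] in auto)
    show ?thesis
      using lift_into_closed[OF Mk Nk emb c v a s] lift_into_val[OF Mk Nk emb c v a s] by blast
  qed
  let ?\<Psi> = "\<lambda>q u. u ((fst q, fst (snd q)), snd (snd q))"
  have c: "?in s p \<in> carrier T.TG" if "s \<in> carrier (tensor Kr M N)" "p \<in> carrier P" for s p
    using that inner by simp
  have v: "?E (?in s p) q = ?\<Psi> q (\<lambda>x. ev L Kr M N e f s (fst x) \<otimes> g p (snd x))"
    if "s \<in> carrier (tensor Kr M N)" "p \<in> carrier P" "q \<in> U \<times> (V \<times> W)" for s p q
    using bspec[OF conjunct2[OF inner[of s p]] that(3)] that(1,2) by simp
  have a: "addfun L ((U \<times> V) \<times> W) (?\<Psi> q)" if "q \<in> U \<times> (V \<times> W)" for q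
    by (rule addfun_eval) (use that in auto)
  show "tensor_assoc Kr M N P t \<in> carrier (tensor_group Kr M (tensor Kr N P))"
    unfolding tensor_assoc_def by (rule lift_into_closed[OF MNk Pk emb, where \<beta> = ?in and \<Psi> = ?\<Psi>, OF c v a t])
  show "?E (tensor_assoc Kr M N P t) (x, (y, z)) = ev L Kr (tensor Kr M N) P (ev L Kr M N e f) g t ((x, y), z)"
    if "x \<in> U" "y \<in> V" "z \<in> W" for x y z
    unfolding tensor_assoc_def using that by (subst lift_into_val[OF MNk Pk emb, where \<beta> = ?in and \<Psi> = ?\<Psi>, OF c v a t]) simp_all
qed

end

lemma (in group) bij_mult_left: "a \<in> carrier G \<Longrightarrow> bij_betw (\<lambda>x. a \<otimes> x) (carrier G) (carrier G)"
  by (rule bij_betw_byWitness[where f' = "\<lambda>x. inv a \<otimes> x"]) (auto simp flip: m_assoc)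

lemma (in group) bij_inv: "bij_betw (m_inv G) (carrier G) (carrier G)"
  by (rule bij_betw_byWitness[where f' = "m_inv G"]) auto

context galois_action begin

lemma finsum_if_eq:
  assumes "finite A" "a \<in> A" "f a \<in> carrier L"
  shows "(\<Oplus>x\<in>A. if x = a then f x else \<zero>) = f a" "(\<Oplus>x\<in>A. if a = x then f x else \<zero>) = f a"
proof -
  show 1: "(\<Oplus>x\<in>A. if x = a then f x else \<zero>) = f a" using finsum_delta[of A f a] assms by simp
  have "(\<Oplus>x\<in>A. if a = x then f x else \<zero>) = (\<Oplus>x\<in>A. if x = a then f x else \<zero>)"
    by (rule finsum_cong_pointwise) auto
  with 1 show "(\<Oplus>x\<in>A. if a = x then f x else \<zero>) = f a" by simp
qed

section \<open>The Hopf algebra axioms for a form of a group\<close>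

context
  fixes H :: "('l, 'a, 'n) hopf_scheme" and P :: "('x, 'p) monoid_scheme" and a e
  assumes HF: "hopf_form L G \<alpha> K H P a e"
begin

interpretation P: group P by (rule hopf_form_group[OF HF])
interpretation H: module Kr H by (rule form_module[OF hopf_form_form[OF HF]])
interpretation HH: module_pair Kr H H ..

lemmas hform = hopf_form_form[OF HF]
lemmas hk = form_kfun[OF hform]
lemmas hcl = form_closed[OF hform]
lemmas hfin = form_finite[OF hform]
lemmas hadd = form_add[OF hform]
lemmas hsm = form_smult[OF hform]
lemmas hinj = form_inj[OF hform]
lemmas hone = hopf_form_one[OF HF]
lemmas hmc = hopf_form_mult_closed[OF HF]
lemmas hmult = hopf_form_mult[OF HF]
lemmas hform2 = form_tensor[OF hform hform]
lemmas hk2 = form_kfun[OF hform2]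

lemma hopf_form_ring: "ring H"
proof (rule ringI)
  show "abelian_group H" ..
  show "monoid H"
  proof (rule monoidI)
    fix x y z assume c: "x \<in> carrier H" "y \<in> carrier H" "z \<in> carrier H"
    show "x \<otimes>\<^bsub>H\<^esub> y \<otimes>\<^bsub>H\<^esub> z = x \<otimes>\<^bsub>H\<^esub> (y \<otimes>\<^bsub>H\<^esub> z)"
    proof (rule hinj)
      fix n assume n: "n \<in> carrier P"
      have "e (x \<otimes>\<^bsub>H\<^esub> y \<otimes>\<^bsub>H\<^esub> z) n =
          (\<Oplus>k\<in>carrier P. (\<Oplus>m\<in>carrier P. e x m \<otimes> e y (inv\<^bsub>P\<^esub> m \<otimes>\<^bsub>P\<^esub> k)) \<otimes> e z (inv\<^bsub>P\<^esub> k \<otimes>\<^bsub>P\<^esub> n))"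
        using c n by (simp add: hmult hmc cong: finsum_cong_pointwise)
      also have "\<dots> = (\<Oplus>k\<in>carrier P. \<Oplus>m\<in>carrier P. e x m \<otimes> (e y (inv\<^bsub>P\<^esub> m \<otimes>\<^bsub>P\<^esub> k) \<otimes> e z (inv\<^bsub>P\<^esub> k \<otimes>\<^bsub>P\<^esub> n)))"
        using c n hcl hfin by (intro finsum_cong_pointwise finsum_mult_assoc) auto
      also have "\<dots> = (\<Oplus>m\<in>carrier P. \<Oplus>k\<in>carrier P. e x m \<otimes> (e y (inv\<^bsub>P\<^esub> m \<otimes>\<^bsub>P\<^esub> k) \<otimes> e z (inv\<^bsub>P\<^esub> k \<otimes>\<^bsub>P\<^esub> n)))"
        using c n hcl hfin by (intro finsum_swap) auto
      \<comment> \<open>Replacing \<open>k\<close> by the product of \<open>m\<close> and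
        \<open>k\<close> turns the inner sum into the convolution of \<open>y\<close> and
        \<open>z\<close> at m^-1 n.\<close>
      also have "\<dots> = (\<Oplus>m\<in>carrier P. \<Oplus>k\<in>carrier P. e x m \<otimes> (e y k \<otimes> e z (inv\<^bsub>P\<^esub> k \<otimes>\<^bsub>P\<^esub> (inv\<^bsub>P\<^esub> m \<otimes>\<^bsub>P\<^esub> n))))"
      proof (rule finsum_cong_pointwise)
        fix m assume m: "m \<in> carrier P"
        have "(\<Oplus>k\<in>carrier P. e x m \<otimes> (e y (inv\<^bsub>P\<^esub> m \<otimes>\<^bsub>P\<^esub> k) \<otimes> e z (inv\<^bsub>P\<^esub> k \<otimes>\<^bsub>P\<^esub> n))) =
           (\<Oplus>k\<in>carrier P. e x m \<otimes> (e y (inv\<^bsub>P\<^esub> m \<otimes>\<^bsub>P\<^esub> (m \<otimes>\<^bsub>P\<^esub> k)) \<otimes> e z (inv\<^bsub>P\<^esub> (m \<otimes>\<^bsub>P\<^esub> k) \<otimes>\<^bsub>P\<^esub> n)))"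
          using c n m hcl by (intro finsum_reindex_bij P.bij_mult_left) auto
        also have "\<dots> = (\<Oplus>k\<in>carrier P. e x m \<otimes> (e y k \<otimes> e z (inv\<^bsub>P\<^esub> k \<otimes>\<^bsub>P\<^esub> (inv\<^bsub>P\<^esub> m \<otimes>\<^bsub>P\<^esub> n))))"
          using n m by (intro finsum_cong_pointwise) (simp add: P.inv_mult_group P.m_assoc[symmetric])
        finally show "(\<Oplus>k\<in>carrier P. e x m \<otimes> (e y (inv\<^bsub>P\<^esub> m \<otimes>\<^bsub>P\<^esub> k) \<otimes> e z (inv\<^bsub>P\<^esub> k \<otimes>\<^bsub>P\<^esub> n))) =
           (\<Oplus>k\<in>carrier P. e x m \<otimes> (e y k \<otimes> e z (inv\<^bsub>P\<^esub> k \<otimes>\<^bsub>P\<^esub> (inv\<^bsub>P\<^esub> m \<otimes>\<^bsub>P\<^esub> n))))" .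
      qed
      also have "\<dots> = (\<Oplus>m\<in>carrier P. e x m \<otimes> (\<Oplus>k\<in>carrier P. e y k \<otimes> e z (inv\<^bsub>P\<^esub> k \<otimes>\<^bsub>P\<^esub> (inv\<^bsub>P\<^esub> m \<otimes>\<^bsub>P\<^esub> n))))"
        using c n hcl hfin by (intro finsum_cong_pointwise finsum_rdistr[symmetric]) auto
      also have "\<dots> = e (x \<otimes>\<^bsub>H\<^esub> (y \<otimes>\<^bsub>H\<^esub> z)) n"
        using c n by (simp add: hmult hmc cong: finsum_cong_pointwise)
      finally show "e (x \<otimes>\<^bsub>H\<^esub> y \<otimes>\<^bsub>H\<^esub> z) n = e (x \<otimes>\<^bsub>H\<^esub> (y \<otimes>\<^bsub>H\<^esub> z)) n" .
    qed (use c hmc in auto)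
  next
    fix x assume c: "x \<in> carrier H"
    show "\<one>\<^bsub>H\<^esub> \<otimes>\<^bsub>H\<^esub> x = x"
    proof (rule hinj)
      fix n assume n: "n \<in> carrier P"
      have "e (\<one>\<^bsub>H\<^esub> \<otimes>\<^bsub>H\<^esub> x) n = (\<Oplus>m\<in>carrier P. if m = \<one>\<^bsub>P\<^esub> then e x (inv\<^bsub>P\<^esub> m \<otimes>\<^bsub>P\<^esub> n) else \<zero>)"
        using c n hcl by (subst hmult) (auto intro!: finsum_cong_pointwise simp: hone)
      also have "\<dots> = e x n" using c n hcl hfin by (subst finsum_if_eq) auto
      finally show "e (\<one>\<^bsub>H\<^esub> \<otimes>\<^bsub>H\<^esub> x) n = e x n" .
    qed (use c hmc hone in auto)
    show "x \<otimes>\<^bsub>H\<^esub> \<one>\<^bsub>H\<^esub> = x"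
    proof (rule hinj)
      fix n assume n: "n \<in> carrier P"
      have i: "inv\<^bsub>P\<^esub> m \<otimes>\<^bsub>P\<^esub> n = \<one>\<^bsub>P\<^esub> \<longleftrightarrow> m = n" if "m \<in> carrier P" for m
        using that n by (metis P.inv_closed P.inv_equality P.inv_inv P.l_inv)
      have "e (x \<otimes>\<^bsub>H\<^esub> \<one>\<^bsub>H\<^esub>) n = (\<Oplus>m\<in>carrier P. if m = n then e x m else \<zero>)"
        using c n hcl by (subst hmult) (auto intro!: finsum_cong_pointwise simp: hone i)
      also have "\<dots> = e x n" using c n hcl hfin by (subst finsum_if_eq) auto
      finally show "e (x \<otimes>\<^bsub>H\<^esub> \<one>\<^bsub>H\<^esub>) n = e x n" .
    qed (use c hmc hone in auto)
  qed (use hmc hone in auto)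
  fix x y z assume c: "x \<in> carrier H" "y \<in> carrier H" "z \<in> carrier H"
  show "(x \<oplus>\<^bsub>H\<^esub> y) \<otimes>\<^bsub>H\<^esub> z = x \<otimes>\<^bsub>H\<^esub> z \<oplus>\<^bsub>H\<^esub> y \<otimes>\<^bsub>H\<^esub> z"
  proof (rule hinj)
    fix n assume n: "n \<in> carrier P"
    have "e ((x \<oplus>\<^bsub>H\<^esub> y) \<otimes>\<^bsub>H\<^esub> z) n =
        (\<Oplus>m\<in>carrier P. e x m \<otimes> e z (inv\<^bsub>P\<^esub> m \<otimes>\<^bsub>P\<^esub> n) \<oplus> e y m \<otimes> e z (inv\<^bsub>P\<^esub> m \<otimes>\<^bsub>P\<^esub> n))"
      unfolding hmult[OF H.M.add.m_closed[OF c(1,2)] c(3) n]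
      by (rule finsum_cong_pointwise) (use c n hcl in \<open>simp add: hadd l_distr\<close>)
    also have "\<dots> = e (x \<otimes>\<^bsub>H\<^esub> z \<oplus>\<^bsub>H\<^esub> y \<otimes>\<^bsub>H\<^esub> z) n"
      using c n hcl by (subst finsum_addf) (auto simp: hadd hmult hmc)
    finally show "e ((x \<oplus>\<^bsub>H\<^esub> y) \<otimes>\<^bsub>H\<^esub> z) n = e (x \<otimes>\<^bsub>H\<^esub> z \<oplus>\<^bsub>H\<^esub> y \<otimes>\<^bsub>H\<^esub> z) n" .
  qed (use c hmc in auto)
  show "z \<otimes>\<^bsub>H\<^esub> (x \<oplus>\<^bsub>H\<^esub> y) = z \<otimes>\<^bsub>H\<^esub> x \<oplus>\<^bsub>H\<^esub> z \<otimes>\<^bsub>H\<^esub> y"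
  proof (rule hinj)
    fix n assume n: "n \<in> carrier P"
    have "e (z \<otimes>\<^bsub>H\<^esub> (x \<oplus>\<^bsub>H\<^esub> y)) n =
        (\<Oplus>m\<in>carrier P. e z m \<otimes> e x (inv\<^bsub>P\<^esub> m \<otimes>\<^bsub>P\<^esub> n) \<oplus> e z m \<otimes> e y (inv\<^bsub>P\<^esub> m \<otimes>\<^bsub>P\<^esub> n))"
      unfolding hmult[OF c(3) H.M.add.m_closed[OF c(1,2)] n]
      by (rule finsum_cong_pointwise) (use c n hcl in \<open>simp add: hadd r_distr\<close>)
    also have "\<dots> = e (z \<otimes>\<^bsub>H\<^esub> x \<oplus>\<^bsub>H\<^esub> z \<otimes>\<^bsub>H\<^esub> y) n"
      using c n hcl by (subst finsum_addf) (auto simp: hadd hmult hmc)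
    finally show "e (z \<otimes>\<^bsub>H\<^esub> (x \<oplus>\<^bsub>H\<^esub> y)) n = e (z \<otimes>\<^bsub>H\<^esub> x \<oplus>\<^bsub>H\<^esub> z \<otimes>\<^bsub>H\<^esub> y) n" .
  qed (use c hmc in auto)
qed

lemma hopf_form_assoc_algebra: "assoc_algebra Kr H"
  unfolding assoc_algebra_def assoc_algebra_axioms_def
proof (intro conjI allI impI hopf_form_ring)
  show "module Kr H" ..
  fix r x y assume c: "r \<in> carrier Kr" "x \<in> carrier H" "y \<in> carrier H"
  then have r: "r \<in> K" "r \<in> carrier L" using K_subset by auto
  note sc = H.smult_closed[OF c(1)]
  show "(r \<odot>\<^bsub>H\<^esub> x) \<otimes>\<^bsub>H\<^esub> y = r \<odot>\<^bsub>H\<^esub> (x \<otimes>\<^bsub>H\<^esub> y)"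
  proof (rule hinj)
    fix n assume n: "n \<in> carrier P"
    have "e ((r \<odot>\<^bsub>H\<^esub> x) \<otimes>\<^bsub>H\<^esub> y) n = (\<Oplus>m\<in>carrier P. r \<otimes> (e x m \<otimes> e y (inv\<^bsub>P\<^esub> m \<otimes>\<^bsub>P\<^esub> n)))"
      using c r n hcl sc by (subst hmult) (auto intro!: finsum_cong_pointwise simp: hsm m_assoc)
    also have "\<dots> = e (r \<odot>\<^bsub>H\<^esub> (x \<otimes>\<^bsub>H\<^esub> y)) n"
      using c r n hcl hfin hmc by (subst finsum_rdistr[symmetric]) (auto simp: hsm hmult)
    finally show "e ((r \<odot>\<^bsub>H\<^esub> x) \<otimes>\<^bsub>H\<^esub> y) n = e (r \<odot>\<^bsub>H\<^esub> (x \<otimes>\<^bsub>H\<^esub> y)) n" .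
  qed (use c hmc sc in auto)
  show "x \<otimes>\<^bsub>H\<^esub> (r \<odot>\<^bsub>H\<^esub> y) = r \<odot>\<^bsub>H\<^esub> (x \<otimes>\<^bsub>H\<^esub> y)"
  proof (rule hinj)
    fix n assume n: "n \<in> carrier P"
    have "e (x \<otimes>\<^bsub>H\<^esub> (r \<odot>\<^bsub>H\<^esub> y)) n = (\<Oplus>m\<in>carrier P. r \<otimes> (e x m \<otimes> e y (inv\<^bsub>P\<^esub> m \<otimes>\<^bsub>P\<^esub> n)))"
      using c r n hcl sc by (subst hmult) (auto intro!: finsum_cong_pointwise simp: hsm m_ac)
    also have "\<dots> = e (r \<odot>\<^bsub>H\<^esub> (x \<otimes>\<^bsub>H\<^esub> y)) n"
      using c r n hcl hfin hmc by (subst finsum_rdistr[symmetric]) (auto simp: hsm hmult)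
    finally show "e (x \<otimes>\<^bsub>H\<^esub> (r \<odot>\<^bsub>H\<^esub> y)) n = e (r \<odot>\<^bsub>H\<^esub> (x \<otimes>\<^bsub>H\<^esub> y)) n" .
  qed (use c hmc sc in auto)
qed

text \<open>The total sum is the pairing with the constant function \<open>\<one>\<close>, which is
  equivariant because automorphisms fix \<open>\<one>\<close>.\<close>

lemma hopf_form_counit_K: "h \<in> carrier H \<Longrightarrow> counit H h \<in> K"
  using equivariant_sum_K[OF form_gset[OF hform] form_equivariant[OF hform], of h "\<lambda>_. \<one>"] hcl
  by (simp add: hopf_form_counit[OF HF] equivariant_def cong: finsum_cong_pointwise)

text \<open>Tensors are determined by their values, so a comultiplication is identified by producing
  any tensor with the right diagonal and zeros elsewhere.\<close>

lemma hopf_form_comult_eqI: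
  assumes "t \<in> carrier (tensor_group Kr H H)" "h \<in> carrier H"
    and "\<And>n m. n \<in> carrier P \<Longrightarrow> m \<in> carrier P \<Longrightarrow> ev L Kr H H e e t (n, m) = (if n = m then e h n else \<zero>)"
  shows "comult H h = t"
  by (rule emb_inj[OF tensor_emb[OF hform hform]])
     (use assms hopf_form_comult[OF HF] in auto)

lemmas hcom = hopf_form_comult[OF HF]

lemma hopf_form_comult_hom: "comult H \<in> alg_hom Kr H (tensor Kr H H)"
proof -
  have cc: "comult H h \<in> carrier HH.TG" if "h \<in> carrier H" for h using hcom(1)[OF that] .
  note T = tensor_mult_law[OF hform hform hopf_form_mult_law[OF HF] hopf_form_mult_law[OF HF]]
  have mult: "comult H (x \<otimes>\<^bsub>H\<^esub> y) = comult H x \<otimes>\<^bsub>tensor Kr H H\<^esub> comult H y"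
    if c: "x \<in> carrier H" "y \<in> carrier H" for x y
  proof (rule hopf_form_comult_eqI)
    fix n m assume nm: "n \<in> carrier P" "m \<in> carrier P"
    let ?iv = "\<lambda>i n. inv\<^bsub>P\<^esub> i \<otimes>\<^bsub>P\<^esub> n"
    have "ev L Kr H H e e (comult H x \<otimes>\<^bsub>tensor Kr H H\<^esub> comult H y) (n, m) =
        (\<Oplus>i\<in>carrier P \<times> carrier P. ev L Kr H H e e (comult H x) (fst i, snd i) \<otimes> ev L Kr H H e e (comult H y) (?iv (fst i) n, ?iv (snd i) m))"
      using mult_law_eq[OF T, of "comult H x" "comult H y" "(n, m)"] cc c nm by simp
    \<comment> \<open>The first factor forces the index onto the diagonal; for such an index the
      points i^-1 n and i^-1 m agree exactly when \<open>n = m\<close>.\<close>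
    also have "\<dots> = (\<Oplus>i\<in>carrier P \<times> carrier P. if fst i = snd i then (if n = m then e x (fst i) \<otimes> e y (?iv (fst i) n) else \<zero>) else \<zero>)"
      using c nm hcl by (intro finsum_cong_pointwise) (auto simp: hcom)
    also have "\<dots> = (\<Oplus>i\<in>carrier P. \<Oplus>j\<in>carrier P. if i = j then (if n = m then e x i \<otimes> e y (?iv i n) else \<zero>) else \<zero>)"
      using c nm hcl hfin by (subst finsum_cartesian, simp_all only: fst_conv snd_conv) auto
    also have "\<dots> = (\<Oplus>i\<in>carrier P. (if n = m then e x i \<otimes> e y (?iv i n) else \<zero>))"
      using c nm hcl hfin by (intro finsum_cong_pointwise finsum_if_eq(2)) auto
    also have "\<dots> = (if n = m then e (x \<otimes>\<^bsub>H\<^esub> y) n else \<zero>)"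
      using c nm by (simp add: hmult)
    finally show "ev L Kr H H e e (comult H x \<otimes>\<^bsub>tensor Kr H H\<^esub> comult H y) (n, m) = (if n = m then e (x \<otimes>\<^bsub>H\<^esub> y) n else \<zero>)" .
  qed (use c cc hmc mult_law_closed[OF T] in auto)
  have add: "comult H (x \<oplus>\<^bsub>H\<^esub> y) = comult H x \<oplus>\<^bsub>tensor Kr H H\<^esub> comult H y"
    if c: "x \<in> carrier H" "y \<in> carrier H" for x y
    by (rule hopf_form_comult_eqI) (use c cc in \<open>auto simp: ev_add[OF hk hk] hcom hadd\<close>)
  have sm: "comult H (r \<odot>\<^bsub>H\<^esub> x) = r \<odot>\<^bsub>tensor Kr H H\<^esub> comult H x"
    if c: "r \<in> carrier Kr" "x \<in> carrier H" for r x
  proof (rule hopf_form_comult_eqI)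
    fix n m assume nm: "n \<in> carrier P" "m \<in> carrier P"
    have r: "r \<in> K" "r \<in> carrier L" using c K_subset by auto
    show "ev L Kr H H e e (r \<odot>\<^bsub>tensor Kr H H\<^esub> comult H x) (n, m) = (if n = m then e (r \<odot>\<^bsub>H\<^esub> x) n else \<zero>)"
      using kfun_smult[OF hk2 r(1), of "comult H x" "(n, m)"] cc c nm r by (simp add: hcom hsm)
  qed (use c cc hom_in_carrier[OF HH.tensor_smult_hom[OF c(1)]] H.smult_closed[OF c] in auto)
  have one: "comult H \<one>\<^bsub>H\<^esub> = \<one>\<^bsub>tensor Kr H H\<^esub>"
    unfolding HH.tensor_one
    by (rule hopf_form_comult_eqI) (auto simp: hone ev_tens[OF hk hk])
  show ?thesis
    unfolding alg_hom_def linear_map_def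
    using cc mult add sm one by (auto intro!: ring_hom_memI)
qed

theorem hopf_form_hopf_algebra: "hopf_algebra Kr H"
  unfolding hopf_algebra_def hopf_algebra_axioms_def
proof (intro conjI allI impI hopf_form_assoc_algebra hopf_form_comult_hom)
  note cnt = hopf_form_counit[OF HF]
  note ant = hopf_form_antipode[OF HF]
  note cntK = hopf_form_counit_K
  have cntL: "counit H h \<in> carrier L" if "h \<in> carrier H" for h using cntK[OF that] K_subset by auto
  have hemb: "emb L (add_monoid H) (carrier P) e" by (rule form_emb[OF hform])
  show "counit H \<in> ring_hom H Kr"
  proof (rule ring_hom_memI)
    fix x y assume c: "x \<in> carrier H" "y \<in> carrier H"
    show "counit H (x \<oplus>\<^bsub>H\<^esub> y) = counit H x \<oplus>\<^bsub>Kr\<^esub> counit H y"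
      using c hcl by (simp add: cnt hadd finsum_addf Pi_def cong: finsum_cong_pointwise)
    have "counit H (x \<otimes>\<^bsub>H\<^esub> y) = (\<Oplus>n\<in>carrier P. \<Oplus>m\<in>carrier P. e x m \<otimes> e y (inv\<^bsub>P\<^esub> m \<otimes>\<^bsub>P\<^esub> n))"
      using c by (simp add: cnt hmc hmult cong: finsum_cong_pointwise)
    also have "\<dots> = (\<Oplus>m\<in>carrier P. \<Oplus>n\<in>carrier P. e x m \<otimes> e y (inv\<^bsub>P\<^esub> m \<otimes>\<^bsub>P\<^esub> n))"
      using c hcl hfin by (intro finsum_swap) auto
    also have "\<dots> = (\<Oplus>m\<in>carrier P. \<Oplus>n\<in>carrier P. e x m \<otimes> e y n)"
      using c hcl by (intro finsum_cong_pointwise finsum_reindex_bij[symmetric] P.bij_mult_left) auto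
    also have "\<dots> = counit H x \<otimes> counit H y"
      using c hcl hfin by (simp add: cnt finsum_mult)
    finally show "counit H (x \<otimes>\<^bsub>H\<^esub> y) = counit H x \<otimes>\<^bsub>Kr\<^esub> counit H y" by simp
  next
    have "counit H \<one>\<^bsub>H\<^esub> = (\<Oplus>n\<in>carrier P. if n = \<one>\<^bsub>P\<^esub> then \<one> else \<zero>)"
      by (simp add: cnt hone cong: finsum_cong_pointwise)
    also have "\<dots> = \<one>" using hfin by (subst finsum_if_eq) auto
    finally show "counit H \<one>\<^bsub>H\<^esub> = \<one>\<^bsub>Kr\<^esub>" by simp
  qed (use cntK in auto)
  show "antipode H \<in> linear_map Kr H H"
    unfolding linear_map_def
  proof (intro CollectI conjI ballI)
    fix x y assume c: "x \<in> carrier H" "y \<in> carrier H"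
    show "antipode H (x \<oplus>\<^bsub>H\<^esub> y) = antipode H x \<oplus>\<^bsub>H\<^esub> antipode H y"
      by (rule hinj) (use c ant in \<open>auto simp: hadd\<close>)
  next
    fix r x assume c: "r \<in> carrier Kr" "x \<in> carrier H"
    then have r: "r \<in> K" by simp
    show "antipode H (r \<odot>\<^bsub>H\<^esub> x) = r \<odot>\<^bsub>H\<^esub> antipode H x"
      by (rule hinj) (use c r ant H.smult_closed[OF c(1)] in \<open>auto simp: hsm\<close>)
  qed (use ant in auto)
  fix h assume h: "h \<in> carrier H"
  note D = hcom(1)[OF h]
  show "counit H (r \<odot>\<^bsub>H\<^esub> h) = r \<otimes>\<^bsub>Kr\<^esub> counit H h" if "r \<in> carrier Kr" for r
  proof -
    have r: "r \<in> K" "r \<in> carrier L" using that K_subset by auto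
    then show ?thesis using H.smult_closed[OF that h] h hcl hfin
      by (simp add: cnt hsm finsum_rdistr Pi_def cong: finsum_cong_pointwise)
  qed
  show "tensor_assoc Kr H H H (tensor_map Kr H H (tensor Kr H H) H (comult H) id (comult H h)) =
      tensor_map Kr H H H (tensor Kr H H) id (comult H) (comult H h)"
  proof (rule emb_inj[OF tensor_emb[OF hform hform2]])
    let ?A = "tensor_map Kr H H (tensor Kr H H) H (comult H) id (comult H h)"
    let ?B = "tensor_map Kr H H H (tensor Kr H H) id (comult H) (comult H h)"
    have d1: "comult H m \<in> carrier (tensor Kr H H)"
      "\<And>x. x \<in> carrier P \<times> carrier P \<Longrightarrow> ev L Kr H H e e (comult H m) x = (if fst x = snd x then e m (fst x) else \<zero>)"
      if "m \<in> carrier H" for m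
      using hcom[OF that] by auto
    \<comment> \<open>Comultiplying one leg duplicates its variable: it is the pullback along
      \<open>fst\<close>, cut off to the diagonal. Both sides of coassociativity thus live on the
      triple diagonal, with value \<open>e h\<close> there.\<close>
    have A: "?A \<in> carrier (tensor_group Kr (tensor Kr H H) H)"
      "\<And>x y. x \<in> carrier P \<times> carrier P \<Longrightarrow> y \<in> carrier P \<Longrightarrow>
        ev L Kr (tensor Kr H H) H (ev L Kr H H e e) e ?A (x, y) =
        (if fst x = snd x \<and> True then ev L Kr H H e e (comult H h) (fst x, y) else \<zero>)"
      by (rule tensor_map_val[OF hk hk hform2 hform, where B = "\<lambda>x. fst x = snd x" and C = "\<lambda>_. True"
            and \<pi> = fst and \<rho> = "\<lambda>y. y"];
          use d1 D in auto)+
    have B: "?B \<in> carrier (tensor_group Kr H (tensor Kr H H))"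
      "\<And>x y. x \<in> carrier P \<Longrightarrow> y \<in> carrier P \<times> carrier P \<Longrightarrow>
        ev L Kr H (tensor Kr H H) e (ev L Kr H H e e) ?B (x, y) =
        (if True \<and> fst y = snd y then ev L Kr H H e e (comult H h) (x, fst y) else \<zero>)"
      by (rule tensor_map_val[OF hk hk hform hform2, where C = "\<lambda>x. fst x = snd x" and B = "\<lambda>_. True"
            and \<rho> = fst and \<pi> = "\<lambda>y. y"];
          use d1 D in auto)+
    show "tensor_assoc Kr H H H ?A \<in> carrier (tensor_group Kr H (tensor Kr H H))"
      by (rule tensor_assoc_val(1)[OF hform hform hform A(1)])
    show "?B \<in> carrier (tensor_group Kr H (tensor Kr H H))" by (rule B)
    fix z assume "z \<in> carrier P \<times> (carrier P \<times> carrier P)"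
    then obtain p q r where z: "z = (p, (q, r))" "p \<in> carrier P" "q \<in> carrier P" "r \<in> carrier P" by auto
    show "ev L Kr H (tensor Kr H H) e (ev L Kr H H e e) (tensor_assoc Kr H H H ?A) z =
        ev L Kr H (tensor Kr H H) e (ev L Kr H H e e) ?B z"
      using z h by (simp add: tensor_assoc_val(2)[OF hform hform hform A(1)] A B hcom)
  qed
  show "tensor_lift Kr H H (add_monoid H) (\<lambda>a b. counit H a \<odot>\<^bsub>H\<^esub> b) (comult H h) = h"
  proof (rule hinj)
    \<comment> \<open>On coefficients the counit of the first leg is summation over the first
      variable; the diagonal support of the comultiplication leaves the term
      \<open>x = n\<close>.\<close>
    let ?\<beta> = "\<lambda>a b. counit H a \<odot>\<^bsub>H\<^esub> b" and ?\<Psi> = "\<lambda>z u. \<Oplus>x\<in>carrier P. u (x, z)"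
    have c: "?\<beta> m n \<in> carrier (add_monoid H)" if "m \<in> carrier H" "n \<in> carrier H" for m n
      using that cntK H.smult_closed by simp
    have v: "e (?\<beta> m n) z = ?\<Psi> z (\<lambda>p. e m (fst p) \<otimes> e n (snd p))"
      if "m \<in> carrier H" "n \<in> carrier H" "z \<in> carrier P" for m n z
      using that cntK hcl hfin by (simp add: hsm cnt finsum_ldistr Pi_def)
    have ad: "addfun L (carrier P \<times> carrier P) (?\<Psi> z)" if "z \<in> carrier P" for z
      by (rule addfun_sum(3)[where c = "\<lambda>_. \<zero>"]) (use that hfin in auto)
    show "tensor_lift Kr H H (add_monoid H) ?\<beta> (comult H h) \<in> carrier H"
      using lift_into_closed[OF hk hk hemb, where \<beta> = ?\<beta> and \<Psi> = ?\<Psi>, OF c v ad D] by simp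
    fix n assume n: "n \<in> carrier P"
    have "e (tensor_lift Kr H H (add_monoid H) ?\<beta> (comult H h)) n = (\<Oplus>x\<in>carrier P. ev L Kr H H e e (comult H h) (x, n))"
      by (rule lift_into_val[OF hk hk hemb, where \<beta> = ?\<beta> and \<Psi> = ?\<Psi>, OF c v ad D n])
    also have "\<dots> = (\<Oplus>x\<in>carrier P. if x = n then e h x else \<zero>)"
      using h n by (intro finsum_cong_pointwise) (simp add: hcom)
    also have "\<dots> = e h n" using h n hcl hfin by (subst finsum_if_eq) auto
    finally show "e (tensor_lift Kr H H (add_monoid H) ?\<beta> (comult H h)) n = e h n" .
  qed (rule h)
  show "tensor_lift Kr H H (add_monoid H) (\<lambda>a b. counit H b \<odot>\<^bsub>H\<^esub> a) (comult H h) = h"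
  proof (rule hinj)
    let ?\<beta> = "\<lambda>a b. counit H b \<odot>\<^bsub>H\<^esub> a" and ?\<Psi> = "\<lambda>z u. \<Oplus>x\<in>carrier P. u (z, x)"
    have c: "?\<beta> m n \<in> carrier (add_monoid H)" if "m \<in> carrier H" "n \<in> carrier H" for m n
      using that cntK H.smult_closed by simp
    have v: "e (?\<beta> m n) z = ?\<Psi> z (\<lambda>p. e m (fst p) \<otimes> e n (snd p))"
      if "m \<in> carrier H" "n \<in> carrier H" "z \<in> carrier P" for m n z
    proof -
      have "e (?\<beta> m n) z = e m z \<otimes> counit H n" using that cntK cntL hcl by (simp add: hsm m_comm)
      then show ?thesis using that hcl hfin by (simp add: cnt finsum_rdistr Pi_def)
    qed
    have ad: "addfun L (carrier P \<times> carrier P) (?\<Psi> z)" if "z \<in> carrier P" for z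
      by (rule addfun_sum(3)[where c = "\<lambda>_. \<zero>"]) (use that hfin in auto)
    show "tensor_lift Kr H H (add_monoid H) ?\<beta> (comult H h) \<in> carrier H"
      using lift_into_closed[OF hk hk hemb, where \<beta> = ?\<beta> and \<Psi> = ?\<Psi>, OF c v ad D] by simp
    fix n assume n: "n \<in> carrier P"
    have "e (tensor_lift Kr H H (add_monoid H) ?\<beta> (comult H h)) n = (\<Oplus>x\<in>carrier P. ev L Kr H H e e (comult H h) (n, x))"
      by (rule lift_into_val[OF hk hk hemb, where \<beta> = ?\<beta> and \<Psi> = ?\<Psi>, OF c v ad D n])
    also have "\<dots> = (\<Oplus>x\<in>carrier P. if x = n then e h x else \<zero>)"
      using h n by (intro finsum_cong_pointwise) (simp add: hcom)
    also have "\<dots> = e h n" using h n hcl hfin by (subst finsum_if_eq) auto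
    finally show "e (tensor_lift Kr H H (add_monoid H) ?\<beta> (comult H h)) n = e h n" .
  qed (rule h)
  have rhs: "e (counit H h \<odot>\<^bsub>H\<^esub> \<one>\<^bsub>H\<^esub>) n = (if n = \<one>\<^bsub>P\<^esub> then counit H h else \<zero>)" if "n \<in> carrier P" for n
    using that h cntK cntL by (simp add: hsm hone)
  have rhsc: "counit H h \<odot>\<^bsub>H\<^esub> \<one>\<^bsub>H\<^esub> \<in> carrier H" using h cntK hone H.smult_closed by simp
  show "tensor_lift Kr H H (add_monoid H) (\<lambda>a b. antipode H a \<otimes>\<^bsub>H\<^esub> b) (comult H h) = counit H h \<odot>\<^bsub>H\<^esub> \<one>\<^bsub>H\<^esub>"
  proof (rule hinj)
    \<comment> \<open>The convolution at \<open>z\<close> collects the pairs (p, q) with p^-1 q = z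
      here, and with p q^-1 = z in the other antipode axiom. Such a pair is diagonal only if
      \<open>z\<close> is the unit, so what remains is the total sum at the unit, that is, counit
      times unit.\<close>
    let ?\<beta> = "\<lambda>a b. antipode H a \<otimes>\<^bsub>H\<^esub> b" and ?\<Psi> = "\<lambda>z u. \<Oplus>x\<in>carrier P. u (inv\<^bsub>P\<^esub> x, inv\<^bsub>P\<^esub> x \<otimes>\<^bsub>P\<^esub> z)"
    have c: "?\<beta> m n \<in> carrier (add_monoid H)" if "m \<in> carrier H" "n \<in> carrier H" for m n
      using that ant hmc by simp
    have v: "e (?\<beta> m n) z = ?\<Psi> z (\<lambda>p. e m (fst p) \<otimes> e n (snd p))"
      if "m \<in> carrier H" "n \<in> carrier H" "z \<in> carrier P" for m n z
      using that ant by (simp add: hmult cong: finsum_cong_pointwise)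
    have ad: "addfun L (carrier P \<times> carrier P) (?\<Psi> z)" if "z \<in> carrier P" for z
      by (rule addfun_sum(3)[where c = "\<lambda>_. \<zero>"]) (use that hfin in auto)
    show "tensor_lift Kr H H (add_monoid H) ?\<beta> (comult H h) \<in> carrier H"
      using lift_into_closed[OF hk hk hemb, where \<beta> = ?\<beta> and \<Psi> = ?\<Psi>, OF c v ad D] by simp
    fix n assume n: "n \<in> carrier P"
    have "e (tensor_lift Kr H H (add_monoid H) ?\<beta> (comult H h)) n =
        (\<Oplus>x\<in>carrier P. ev L Kr H H e e (comult H h) (inv\<^bsub>P\<^esub> x, inv\<^bsub>P\<^esub> x \<otimes>\<^bsub>P\<^esub> n))"
      by (rule lift_into_val[OF hk hk hemb, where \<beta> = ?\<beta> and \<Psi> = ?\<Psi>, OF c v ad D n])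
    also have "\<dots> = (\<Oplus>x\<in>carrier P. if n = \<one>\<^bsub>P\<^esub> then e h (inv\<^bsub>P\<^esub> x) else \<zero>)"
      using h n by (intro finsum_cong_pointwise) (auto simp: hcom P.r_cancel_one)
    also have "\<dots> = (if n = \<one>\<^bsub>P\<^esub> then counit H h else \<zero>)"
      using h hcl finsum_reindex_bij[OF P.bij_inv, of "e h"] by (simp add: cnt)
    finally show "e (tensor_lift Kr H H (add_monoid H) ?\<beta> (comult H h)) n = e (counit H h \<odot>\<^bsub>H\<^esub> \<one>\<^bsub>H\<^esub>) n"
      using rhs n by simp
  qed (rule rhsc)
  show "tensor_lift Kr H H (add_monoid H) (\<lambda>a b. a \<otimes>\<^bsub>H\<^esub> antipode H b) (comult H h) = counit H h \<odot>\<^bsub>H\<^esub> \<one>\<^bsub>H\<^esub>"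
  proof (rule hinj)
    let ?\<beta> = "\<lambda>a b. a \<otimes>\<^bsub>H\<^esub> antipode H b" and ?\<Psi> = "\<lambda>z u. \<Oplus>x\<in>carrier P. u (x, inv\<^bsub>P\<^esub> (inv\<^bsub>P\<^esub> x \<otimes>\<^bsub>P\<^esub> z))"
    have c: "?\<beta> m n \<in> carrier (add_monoid H)" if "m \<in> carrier H" "n \<in> carrier H" for m n
      using that ant hmc by simp
    have v: "e (?\<beta> m n) z = ?\<Psi> z (\<lambda>p. e m (fst p) \<otimes> e n (snd p))"
      if "m \<in> carrier H" "n \<in> carrier H" "z \<in> carrier P" for m n z
      using that ant by (simp add: hmult cong: finsum_cong_pointwise)
    have ad: "addfun L (carrier P \<times> carrier P) (?\<Psi> z)" if "z \<in> carrier P" for z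
      by (rule addfun_sum(3)[where c = "\<lambda>_. \<zero>"]) (use that hfin in auto)
    show "tensor_lift Kr H H (add_monoid H) ?\<beta> (comult H h) \<in> carrier H"
      using lift_into_closed[OF hk hk hemb, where \<beta> = ?\<beta> and \<Psi> = ?\<Psi>, OF c v ad D] by simp
    fix n assume n: "n \<in> carrier P"
    have "e (tensor_lift Kr H H (add_monoid H) ?\<beta> (comult H h)) n =
        (\<Oplus>x\<in>carrier P. ev L Kr H H e e (comult H h) (x, inv\<^bsub>P\<^esub> (inv\<^bsub>P\<^esub> x \<otimes>\<^bsub>P\<^esub> n)))"
      by (rule lift_into_val[OF hk hk hemb, where \<beta> = ?\<beta> and \<Psi> = ?\<Psi>, OF c v ad D n])
    also have "\<dots> = (\<Oplus>x\<in>carrier P. if n = \<one>\<^bsub>P\<^esub> then e h x else \<zero>)"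
    proof (rule finsum_cong_pointwise)
      fix x assume x: "x \<in> carrier P"
      \<comment> \<open>The second point of the pair is n^-1 x, so the pair is diagonal only for
        \<open>n\<close> the unit.\<close>
      have "x = inv\<^bsub>P\<^esub> n \<otimes>\<^bsub>P\<^esub> x \<longleftrightarrow> n = \<one>\<^bsub>P\<^esub>"
        using x n by (metis P.inv_closed P.inv_inv P.inv_one P.l_cancel_one P.l_one P.r_cancel P.one_closed)
      then show "ev L Kr H H e e (comult H h) (x, inv\<^bsub>P\<^esub> (inv\<^bsub>P\<^esub> x \<otimes>\<^bsub>P\<^esub> n)) = (if n = \<one>\<^bsub>P\<^esub> then e h x else \<zero>)"
        using x n h by (simp add: hcom P.inv_mult_group)
    qed
    also have "\<dots> = (if n = \<one>\<^bsub>P\<^esub> then counit H h else \<zero>)"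
      using h by (simp add: cnt)
    finally show "e (tensor_lift Kr H H (add_monoid H) ?\<beta> (comult H h)) n = e (counit H h \<odot>\<^bsub>H\<^esub> \<one>\<^bsub>H\<^esub>) n"
      using rhs n by simp
  qed (rule rhsc)
qed

end

text \<open>The structure maps on both sides are described by the same formulas in the values, so a
  map that preserves values respects all of them; surjectivity uses that every equivariant function
  is attained in \<open>A\<close>.\<close>

theorem hopf_form_iso:
  assumes A: "hopf_form L G \<alpha> K A P a e" and B: "hopf_form L G \<alpha> K B P a f"
    and \<phi>: "\<And>x. x \<in> carrier A \<Longrightarrow> \<phi> x \<in> carrier B"
    and val: "\<And>x n. x \<in> carrier A \<Longrightarrow> n \<in> carrier P \<Longrightarrow> f (\<phi> x) n = e x n"
  shows "hopf_iso Kr A B \<phi>"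
proof -
  note Af = hopf_form_form[OF A] and Bf = hopf_form_form[OF B]
  interpret P: group P by (rule hopf_form_group[OF A])
  interpret A: module Kr A by (rule form_module[OF Af])
  interpret B: module Kr B by (rule form_module[OF Bf])
  interpret BB: module_pair Kr B B ..
  note inj = form_inj[OF Bf]
  have hom: "\<phi> \<in> ring_hom A B"
  proof (rule ring_hom_memI)
    fix x y assume c: "x \<in> carrier A" "y \<in> carrier A"
    show "\<phi> (x \<otimes>\<^bsub>A\<^esub> y) = \<phi> x \<otimes>\<^bsub>B\<^esub> \<phi> y"
      by (rule inj)
         (use c \<phi> in \<open>auto simp: hopf_form_mult_closed[OF A] hopf_form_mult_closed[OF B] val
            hopf_form_mult[OF A] hopf_form_mult[OF B] cong: finsum_cong_pointwise\<close>)
    show "\<phi> (x \<oplus>\<^bsub>A\<^esub> y) = \<phi> x \<oplus>\<^bsub>B\<^esub> \<phi> y"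
      by (rule inj) (use c \<phi> in \<open>auto simp: val form_add[OF Af] form_add[OF Bf]\<close>)
  next
    show "\<phi> \<one>\<^bsub>A\<^esub> = \<one>\<^bsub>B\<^esub>"
      by (rule inj) (use \<phi> in \<open>auto simp: val hopf_form_one[OF A] hopf_form_one[OF B]\<close>)
  qed (rule \<phi>)
  have sm: "\<phi> (r \<odot>\<^bsub>A\<^esub> x) = r \<odot>\<^bsub>B\<^esub> \<phi> x" if "r \<in> carrier Kr" "x \<in> carrier A" for r x
    by (rule inj)
       (use that \<phi> A.smult_closed B.smult_closed in \<open>auto simp: val form_smult[OF Af] form_smult[OF Bf]\<close>)
  have "\<phi> \<in> linear_map Kr A B"
    unfolding linear_map_def using \<phi> sm ring_hom_add[OF hom] by auto
  moreover have "bij_betw \<phi> (carrier A) (carrier B)"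
  proof (rule bij_betwI')
    fix x y assume c: "x \<in> carrier A" "y \<in> carrier A"
    show "(\<phi> x = \<phi> y) = (x = y)"
    proof
      assume "\<phi> x = \<phi> y"
      then show "x = y" by (intro form_inj[OF Af c]) (use c val in metis)
    qed simp
  next
    fix y assume c: "y \<in> carrier B"
    obtain x where x: "x \<in> carrier A" "\<forall>n\<in>carrier P. e x n = f y n"
      using form_surj[OF Af form_equivariant[OF Bf c]] by auto
    have "y = \<phi> x" by (rule inj) (use c x \<phi> val in auto)
    with x show "\<exists>x\<in>carrier A. y = \<phi> x" by auto
  qed (rule \<phi>)
  moreover have "comult B (\<phi> x) = tensor_map Kr A A B B \<phi> \<phi> (comult A x)" if x: "x \<in> carrier A" for x
  proof (rule hopf_form_comult_eqI[OF B])
    note tm = tensor_map_val[OF form_kfun[OF Af] form_kfun[OF Af] Bf Bf, where \<phi> = \<phi> and \<psi> = \<phi> and B = "\<lambda>_. True"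
        and C = "\<lambda>_. True" and \<pi> = "\<lambda>x. x" and \<rho> = "\<lambda>x. x", OF \<phi> _ _ \<phi> _ _ hopf_form_comult(1)[OF A x]]
    show "tensor_map Kr A A B B \<phi> \<phi> (comult A x) \<in> carrier BB.TG"
      by (rule tm) (auto simp: val)
    fix n m assume nm: "n \<in> carrier P" "m \<in> carrier P"
    have "ev L Kr B B f f (tensor_map Kr A A B B \<phi> \<phi> (comult A x)) (n, m) =
       (if True \<and> True then ev L Kr A A e e (comult A x) (n, m) else \<zero>)"
      by (rule tm) (use nm in \<open>auto simp: val\<close>)
    then show "ev L Kr B B f f (tensor_map Kr A A B B \<phi> \<phi> (comult A x)) (n, m) = (if n = m then f (\<phi> x) n else \<zero>)"
      using nm x by (simp add: hopf_form_comult[OF A] val)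
  qed (use x \<phi> in auto)
  moreover have "counit B (\<phi> x) = counit A x" if x: "x \<in> carrier A" for x
    using x \<phi> by (simp add: hopf_form_counit[OF A] hopf_form_counit[OF B] val cong: finsum_cong_pointwise)
  moreover have "antipode B (\<phi> x) = \<phi> (antipode A x)" if x: "x \<in> carrier A" for x
    by (rule inj) (use x \<phi> in \<open>auto simp: hopf_form_antipode[OF A] hopf_form_antipode[OF B] val\<close>)
  ultimately show ?thesis
    unfolding hopf_iso_def alg_hom_def using hom by auto
qed

end

section \<open>Actions of forms and bijectivity of the map \<open>j\<close>\<close>

lemma linear_map_closed: "f \<in> linear_map R M N \<Longrightarrow> x \<in> carrier M \<Longrightarrow> f x \<in> carrier N"
  and linear_map_add: "f \<in> linear_map R M N \<Longrightarrow> x \<in> carrier M \<Longrightarrow> y \<in> carrier M \<Longrightarrow> f (x \<oplus>\<^bsub>M\<^esub> y) = f x \<oplus>\<^bsub>N\<^esub> f y"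
  and linear_map_smult: "f \<in> linear_map R M N \<Longrightarrow> r \<in> carrier R \<Longrightarrow> x \<in> carrier M \<Longrightarrow> f (r \<odot>\<^bsub>M\<^esub> x) = r \<odot>\<^bsub>N\<^esub> f x"
  unfolding linear_map_def by auto

lemma (in module) linear_map_combination:
  assumes f: "f \<in> linear_map R M M" and I: "finite I" "\<And>i. i \<in> I \<Longrightarrow> c i \<in> carrier R" "\<And>i. i \<in> I \<Longrightarrow> h i \<in> carrier M"
  shows "f (\<Oplus>\<^bsub>M\<^esub>i\<in>I. c i \<odot>\<^bsub>M\<^esub> h i) = (\<Oplus>\<^bsub>M\<^esub>i\<in>I. c i \<odot>\<^bsub>M\<^esub> f (h i))"
  using I
proof (induction I rule: finite_induct)
  case empty
  have "f (\<zero> \<odot>\<^bsub>M\<^esub> \<zero>\<^bsub>M\<^esub>) = \<zero> \<odot>\<^bsub>M\<^esub> f \<zero>\<^bsub>M\<^esub>" by (rule linear_map_smult[OF f]) auto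
  then show ?case using linear_map_closed[OF f, of "\<zero>\<^bsub>M\<^esub>"] by simp
next
  case (insert i I)
  have 1: "(\<lambda>i. c i \<odot>\<^bsub>M\<^esub> h i) \<in> I \<rightarrow> carrier M" "c i \<odot>\<^bsub>M\<^esub> h i \<in> carrier M"
    "(\<lambda>i. c i \<odot>\<^bsub>M\<^esub> f (h i)) \<in> I \<rightarrow> carrier M" "c i \<odot>\<^bsub>M\<^esub> f (h i) \<in> carrier M"
    using insert linear_map_closed[OF f] by auto
  have "f (\<Oplus>\<^bsub>M\<^esub>i\<in>insert i I. c i \<odot>\<^bsub>M\<^esub> h i) = f (c i \<odot>\<^bsub>M\<^esub> h i) \<oplus>\<^bsub>M\<^esub> f (\<Oplus>\<^bsub>M\<^esub>i\<in>I. c i \<odot>\<^bsub>M\<^esub> h i)"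
    using insert 1 by (simp add: linear_map_add[OF f] M.finsum_insert M.finsum_closed)
  also have "\<dots> = c i \<odot>\<^bsub>M\<^esub> f (h i) \<oplus>\<^bsub>M\<^esub> (\<Oplus>\<^bsub>M\<^esub>i\<in>I. c i \<odot>\<^bsub>M\<^esub> f (h i))"
    using insert by (simp add: linear_map_smult[OF f])
  also have "\<dots> = (\<Oplus>\<^bsub>M\<^esub>i\<in>insert i I. c i \<odot>\<^bsub>M\<^esub> f (h i))"
    using insert 1 by (simp add: M.finsum_insert)
  finally show ?case .
qed

text \<open>Members of \<open>End_group\<close> are extensional, so equality is pointwise on the
  carrier and the group laws reduce to those of \<open>M\<close>.\<close>

lemma (in module) comm_group_End_group: "comm_group (End_group R M)"
proof (rule comm_groupI)
  have ext: "f = g" if "f \<in> extensional (carrier M)" "g \<in> extensional (carrier M)" "\<And>x. x \<in> carrier M \<Longrightarrow> f x = g x" for f g :: "'c \<Rightarrow> 'c"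
    using that by (rule extensionalityI)
  have lc: "f x \<in> carrier M" if "f \<in> carrier (End_group R M)" "x \<in> carrier M" for f x
    using that linear_map_closed by (fastforce simp: End_group_def)
  show "f \<otimes>\<^bsub>End_group R M\<^esub> g \<in> carrier (End_group R M)" if "f \<in> carrier (End_group R M)" "g \<in> carrier (End_group R M)" for f g
    using that by (auto simp: End_group_def linear_map_def Pi_def M.a_ac smult_r_distr)
  show "\<one>\<^bsub>End_group R M\<^esub> \<in> carrier (End_group R M)"
    by (auto simp: End_group_def linear_map_def)
  fix f assume f: "f \<in> carrier (End_group R M)"
  show "\<one>\<^bsub>End_group R M\<^esub> \<otimes>\<^bsub>End_group R M\<^esub> f = f"
    by (rule ext) (use f lc in \<open>auto simp: End_group_def\<close>)
  have "(\<lambda>x\<in>carrier M. \<ominus>\<^bsub>M\<^esub> f x) \<in> carrier (End_group R M)"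
    using f by (auto simp: End_group_def linear_map_def Pi_def smult_r_minus M.minus_add)
  moreover have "(\<lambda>x\<in>carrier M. \<ominus>\<^bsub>M\<^esub> f x) \<otimes>\<^bsub>End_group R M\<^esub> f = \<one>\<^bsub>End_group R M\<^esub>"
    by (rule ext) (use f lc in \<open>auto simp: End_group_def M.l_neg\<close>)
  ultimately show "\<exists>g\<in>carrier (End_group R M). g \<otimes>\<^bsub>End_group R M\<^esub> f = \<one>\<^bsub>End_group R M\<^esub>" by blast
  fix g assume g: "g \<in> carrier (End_group R M)"
  show "f \<otimes>\<^bsub>End_group R M\<^esub> g = g \<otimes>\<^bsub>End_group R M\<^esub> f"
    by (rule ext) (use f g lc in \<open>auto simp: End_group_def M.a_comm\<close>)
  fix h assume h: "h \<in> carrier (End_group R M)"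
  show "f \<otimes>\<^bsub>End_group R M\<^esub> g \<otimes>\<^bsub>End_group R M\<^esub> h = f \<otimes>\<^bsub>End_group R M\<^esub> (g \<otimes>\<^bsub>End_group R M\<^esub> h)"
    by (rule ext) (use f g h lc in \<open>auto simp: End_group_def M.a_assoc\<close>)
qed

context galois_action begin

text \<open>In the applications \<open>\<nu> n y\<close> is n^-1 applied to \<open>y\<close>, as in
  the action formula; this is why \<open>\<nu>_mult\<close> reverses the factors. Premise
  \<open>act_val\<close> describes \<open>act h x\<close> at all points of \<open>U\<close>, whereas
  the Greither-Pareigis formula gives it at the base point only.\<close>

context
  fixes H :: "('l, 'h, 'n) hopf_scheme" and P :: "('p, 's) monoid_scheme" and b and e
    and A :: "('l, 'a, 'o) module_scheme" and U :: "'y set" and a f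
    and \<nu> :: "'p \<Rightarrow> 'y \<Rightarrow> 'y" and act
  assumes HF: "hopf_form L G \<alpha> K H P b e"
    and AF: "form L G \<alpha> K A U a f"
    and A_alg: "assoc_algebra Kr A"
    and A_mult: "\<And>x y p. x \<in> carrier A \<Longrightarrow> y \<in> carrier A \<Longrightarrow> p \<in> U \<Longrightarrow> f (x \<otimes>\<^bsub>A\<^esub> y) p = f x p \<otimes> f y p"
    and A_one: "\<And>p. p \<in> U \<Longrightarrow> f \<one>\<^bsub>A\<^esub> p = \<one>"
    and \<nu>_closed: "\<And>n y. n \<in> carrier P \<Longrightarrow> y \<in> U \<Longrightarrow> \<nu> n y \<in> U"
    and \<nu>_one: "\<And>y. y \<in> U \<Longrightarrow> \<nu> \<one>\<^bsub>P\<^esub> y = y"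
    and \<nu>_mult: "\<And>n m y. n \<in> carrier P \<Longrightarrow> m \<in> carrier P \<Longrightarrow> y \<in> U \<Longrightarrow> \<nu> (n \<otimes>\<^bsub>P\<^esub> m) y = \<nu> m (\<nu> n y)"
    and \<nu>_equivariant: "\<And>g n y. g \<in> carrier G \<Longrightarrow> n \<in> carrier P \<Longrightarrow> y \<in> U \<Longrightarrow> a g (\<nu> n y) = \<nu> (b g n) (a g y)"
    and \<nu>_regular: "\<And>y y'. y \<in> U \<Longrightarrow> y' \<in> U \<Longrightarrow> \<exists>!n. n \<in> carrier P \<and> \<nu> n y = y'"
    and act_closed: "\<And>h x. h \<in> carrier H \<Longrightarrow> x \<in> carrier A \<Longrightarrow> act h x \<in> carrier A"
    and act_val: "\<And>h x y. h \<in> carrier H \<Longrightarrow> x \<in> carrier A \<Longrightarrow> y \<in> U \<Longrightarrow>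
      f (act h x) y = (\<Oplus>n\<in>carrier P. e h n \<otimes> f x (\<nu> n y))"
begin

interpretation P: group P by (rule hopf_form_group[OF HF])
interpretation A: assoc_algebra Kr A by (rule A_alg)

lemmas Hf = hopf_form_form[OF HF]
lemmas Hk = form_kfun[OF Hf]
lemmas Hcl = form_closed[OF Hf]
lemmas Ak = form_kfun[OF AF]
lemmas Acl = form_closed[OF AF]
lemmas Ainj = form_inj[OF AF]
lemmas Pfin = form_finite[OF Hf]

interpretation H: module Kr H by (rule form_module[OF Hf])

lemma \<nu>_bij: "y \<in> U \<Longrightarrow> bij_betw (\<lambda>n. \<nu> n y) (carrier P) U"
  unfolding bij_betw_def inj_on_def using \<nu>_regular \<nu>_closed by (blast intro!: equalityI)

lemma form_module_algebra: "hopf_module_algebra Kr H A act"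
  unfolding hopf_module_algebra_def hopf_module_algebra_axioms_def
proof (intro conjI allI impI A_alg hopf_form_hopf_algebra[OF HF])
  fix h assume h: "h \<in> carrier H"
  show "act h \<in> linear_map Kr A A"
    unfolding linear_map_def
  proof (intro CollectI conjI ballI)
    fix x y assume c: "x \<in> carrier A" "y \<in> carrier A"
    show "act h (x \<oplus>\<^bsub>A\<^esub> y) = act h x \<oplus>\<^bsub>A\<^esub> act h y"
    proof (rule Ainj)
      fix q assume q: "q \<in> U"
      have "f (act h (x \<oplus>\<^bsub>A\<^esub> y)) q = (\<Oplus>n\<in>carrier P. e h n \<otimes> f x (\<nu> n q) \<oplus> e h n \<otimes> f y (\<nu> n q))"
        unfolding act_val[OF h A.M.add.m_closed[OF c] q]
        by (rule finsum_cong_pointwise) (use c h q Hcl Acl \<nu>_closed in \<open>simp add: form_add[OF AF] r_distr\<close>)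
      then show "f (act h (x \<oplus>\<^bsub>A\<^esub> y)) q = f (act h x \<oplus>\<^bsub>A\<^esub> act h y) q"
        using c h q Hcl Acl \<nu>_closed act_closed by (simp add: form_add[OF AF] act_val finsum_addf Pi_def)
    qed (use c h act_closed in auto)
  next
    fix r x assume c: "r \<in> carrier Kr" "x \<in> carrier A"
    then have r: "r \<in> K" "r \<in> carrier L" using K_subset by auto
    note sc = A.smult_closed[OF c(1)]
    show "act h (r \<odot>\<^bsub>A\<^esub> x) = r \<odot>\<^bsub>A\<^esub> act h x"
    proof (rule Ainj)
      fix q assume q: "q \<in> U"
      have "f (act h (r \<odot>\<^bsub>A\<^esub> x)) q = (\<Oplus>n\<in>carrier P. r \<otimes> (e h n \<otimes> f x (\<nu> n q)))"
        unfolding act_val[OF h sc[OF c(2)] q]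
        by (rule finsum_cong_pointwise) (use c r h q Hcl Acl \<nu>_closed in \<open>simp add: form_smult[OF AF] m_ac\<close>)
      then show "f (act h (r \<odot>\<^bsub>A\<^esub> x)) q = f (r \<odot>\<^bsub>A\<^esub> act h x) q"
        using c r h q Hcl Acl \<nu>_closed act_closed Pfin by (simp add: form_smult[OF AF] act_val finsum_rdistr Pi_def)
    qed (use c h act_closed sc in auto)
  qed (use h act_closed in auto)
  show "act h \<one>\<^bsub>A\<^esub> = counit H h \<odot>\<^bsub>A\<^esub> \<one>\<^bsub>A\<^esub>"
  proof (rule Ainj)
    note cK = hopf_form_counit_K[OF HF h]
    have cL: "counit H h \<in> carrier L" using cK K_subset by auto
    show "counit H h \<odot>\<^bsub>A\<^esub> \<one>\<^bsub>A\<^esub> \<in> carrier A" using cK by (intro A.smult_closed) auto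
    fix q assume q: "q \<in> U"
    have "f (act h \<one>\<^bsub>A\<^esub>) q = (\<Oplus>n\<in>carrier P. e h n)"
      unfolding act_val[OF h A.one_closed q]
      by (rule finsum_cong_pointwise) (use h q Hcl \<nu>_closed in \<open>simp add: A_one\<close>)
    then show "f (act h \<one>\<^bsub>A\<^esub>) q = f (counit H h \<odot>\<^bsub>A\<^esub> \<one>\<^bsub>A\<^esub>) q"
      using h q cK cL by (simp add: hopf_form_counit[OF HF h, symmetric] form_smult[OF AF] A_one)
  qed (use h act_closed in auto)
  fix x assume x: "x \<in> carrier A"
  show "act (r \<odot>\<^bsub>H\<^esub> h) x = r \<odot>\<^bsub>A\<^esub> act h x" if rr: "r \<in> carrier Kr" for r
  proof (rule Ainj)
    have r: "r \<in> K" "r \<in> carrier L" using rr K_subset by auto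
    note sc = H.smult_closed[OF rr h]
    fix q assume q: "q \<in> U"
    have "f (act (r \<odot>\<^bsub>H\<^esub> h) x) q = (\<Oplus>n\<in>carrier P. r \<otimes> (e h n \<otimes> f x (\<nu> n q)))"
      unfolding act_val[OF sc x q]
      by (rule finsum_cong_pointwise) (use x r h q Hcl Acl \<nu>_closed in \<open>simp add: form_smult[OF Hf] m_ac\<close>)
    then show "f (act (r \<odot>\<^bsub>H\<^esub> h) x) q = f (r \<odot>\<^bsub>A\<^esub> act h x) q"
      using x r h q Hcl Acl \<nu>_closed act_closed Pfin by (simp add: form_smult[OF AF] act_val finsum_rdistr Pi_def)
  qed (use x h act_closed H.smult_closed[OF that h] A.smult_closed[OF that] in auto)
  show "act h (x \<otimes>\<^bsub>A\<^esub> y) = tensor_lift Kr H H (add_monoid A) (\<lambda>a b. act a x \<otimes>\<^bsub>A\<^esub> act b y) (comult H h)"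
    if y: "y \<in> carrier A" for y
  proof (rule Ainj)
    note D = hopf_form_comult[OF HF h]
    let ?\<beta> = "\<lambda>a b. act a x \<otimes>\<^bsub>A\<^esub> act b y"
      and ?\<Psi> = "\<lambda>z u. \<Oplus>p\<in>carrier P \<times> carrier P. u p \<otimes> (f x (\<nu> (fst p) z) \<otimes> f y (\<nu> (snd p) z))"
    have c: "?\<beta> m n \<in> carrier (add_monoid A)" if "m \<in> carrier H" "n \<in> carrier H" for m n
      using that x y act_closed by simp
    have v: "f (?\<beta> m n) z = ?\<Psi> z (\<lambda>p. e m (fst p) \<otimes> e n (snd p))"
      if "m \<in> carrier H" "n \<in> carrier H" "z \<in> U" for m n z
    proof -
      have "f (?\<beta> m n) z = (\<Oplus>i\<in>carrier P. e m i \<otimes> f x (\<nu> i z)) \<otimes> (\<Oplus>j\<in>carrier P. e n j \<otimes> f y (\<nu> j z))"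
        using that x y act_closed by (simp add: A_mult act_val)
      also have "\<dots> = (\<Oplus>i\<in>carrier P. \<Oplus>j\<in>carrier P. (e m i \<otimes> f x (\<nu> i z)) \<otimes> (e n j \<otimes> f y (\<nu> j z)))"
        using that x y Hcl Acl \<nu>_closed Pfin by (intro finsum_mult) auto
      also have "\<dots> = (\<Oplus>i\<in>carrier P. \<Oplus>j\<in>carrier P. (e m i \<otimes> e n j) \<otimes> (f x (\<nu> i z) \<otimes> f y (\<nu> j z)))"
        using that x y Hcl Acl \<nu>_closed by (intro finsum_cong_pointwise) (simp add: m_ac)
      also have "\<dots> = ?\<Psi> z (\<lambda>p. e m (fst p) \<otimes> e n (snd p))"
        using that x y Hcl Acl \<nu>_closed Pfin by (subst finsum_cartesian) auto
      finally show ?thesis .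
    qed
    have ad: "addfun L (carrier P \<times> carrier P) (?\<Psi> z)" if "z \<in> U" for z
      by (rule addfun_sum(2)) (use that x y Acl \<nu>_closed Pfin in auto)
    show "tensor_lift Kr H H (add_monoid A) ?\<beta> (comult H h) \<in> carrier A"
      using lift_into_closed[OF Hk Hk form_emb[OF AF], where \<beta> = ?\<beta> and \<Psi> = ?\<Psi>, OF c v ad D(1)] by simp
    fix q assume q: "q \<in> U"
    have "f (tensor_lift Kr H H (add_monoid A) ?\<beta> (comult H h)) q = ?\<Psi> q (ev L Kr H H e e (comult H h))"
      by (rule lift_into_val[OF Hk Hk form_emb[OF AF], where \<beta> = ?\<beta> and \<Psi> = ?\<Psi>, OF c v ad D(1) q])
    also have "\<dots> = (\<Oplus>i\<in>carrier P. \<Oplus>j\<in>carrier P. ev L Kr H H e e (comult H h) (i, j) \<otimes> (f x (\<nu> i q) \<otimes> f y (\<nu> j q)))"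
      using h q x y Hcl Acl \<nu>_closed Pfin
      by (subst finsum_cartesian, simp_all only: fst_conv snd_conv) (auto simp: D)
    also have "\<dots> = (\<Oplus>i\<in>carrier P. \<Oplus>j\<in>carrier P. if i = j then e h i \<otimes> (f x (\<nu> i q) \<otimes> f y (\<nu> i q)) else \<zero>)"
      using h q x y Hcl Acl \<nu>_closed by (intro finsum_cong_pointwise) (simp add: D)
    also have "\<dots> = (\<Oplus>i\<in>carrier P. e h i \<otimes> (f x (\<nu> i q) \<otimes> f y (\<nu> i q)))"
      using h q x y Hcl Acl \<nu>_closed Pfin by (intro finsum_cong_pointwise finsum_if_eq(2)) auto
    also have "\<dots> = f (act h (x \<otimes>\<^bsub>A\<^esub> y)) q"
      unfolding act_val[OF h A.m_closed[OF x y] q]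
      by (rule finsum_cong_pointwise) (use q x y \<nu>_closed in \<open>simp add: A_mult\<close>)
    finally show "f (act h (x \<otimes>\<^bsub>A\<^esub> y)) q = f (tensor_lift Kr H H (add_monoid A) ?\<beta> (comult H h)) q" by simp
  qed (use h x y act_closed in auto)
  fix h' assume h': "h' \<in> carrier H"
  show "act (h \<oplus>\<^bsub>H\<^esub> h') x = act h x \<oplus>\<^bsub>A\<^esub> act h' x"
  proof (rule Ainj)
    fix q assume q: "q \<in> U"
    have "f (act (h \<oplus>\<^bsub>H\<^esub> h') x) q = (\<Oplus>n\<in>carrier P. e h n \<otimes> f x (\<nu> n q) \<oplus> e h' n \<otimes> f x (\<nu> n q))"
      unfolding act_val[OF H.M.add.m_closed[OF h h'] x q]
      by (rule finsum_cong_pointwise) (use x h h' q Hcl Acl \<nu>_closed in \<open>simp add: form_add[OF Hf] l_distr\<close>)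
    then show "f (act (h \<oplus>\<^bsub>H\<^esub> h') x) q = f (act h x \<oplus>\<^bsub>A\<^esub> act h' x) q"
      using x h h' q Hcl Acl \<nu>_closed act_closed by (simp add: form_add[OF AF] act_val finsum_addf Pi_def)
  qed (use x h h' act_closed in auto)
  show "act (h \<otimes>\<^bsub>H\<^esub> h') x = act h (act h' x)"
  proof (rule Ainj)
    fix q assume q: "q \<in> U"
    have "f (act (h \<otimes>\<^bsub>H\<^esub> h') x) q =
        (\<Oplus>n\<in>carrier P. (\<Oplus>m\<in>carrier P. e h m \<otimes> e h' (inv\<^bsub>P\<^esub> m \<otimes>\<^bsub>P\<^esub> n)) \<otimes> f x (\<nu> n q))"
      unfolding act_val[OF hopf_form_mult_closed[OF HF h h'] x q]
      by (rule finsum_cong_pointwise) (simp add: hopf_form_mult[OF HF h h'])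
    also have "\<dots> = (\<Oplus>n\<in>carrier P. \<Oplus>m\<in>carrier P. e h m \<otimes> (e h' (inv\<^bsub>P\<^esub> m \<otimes>\<^bsub>P\<^esub> n) \<otimes> f x (\<nu> n q)))"
      using x h h' q Hcl Acl \<nu>_closed Pfin by (intro finsum_cong_pointwise finsum_mult_assoc) auto
    also have "\<dots> = (\<Oplus>m\<in>carrier P. \<Oplus>n\<in>carrier P. e h m \<otimes> (e h' (inv\<^bsub>P\<^esub> m \<otimes>\<^bsub>P\<^esub> n) \<otimes> f x (\<nu> n q)))"
      using x h h' q Hcl Acl \<nu>_closed Pfin by (intro finsum_swap) auto
    \<comment> \<open>Replacing \<open>n\<close> by the product of \<open>m\<close> and
      \<open>n\<close> and using the reversed rule for \<open>\<nu>\<close>: the right action on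
      points becomes a left action on functions.\<close>
    also have "\<dots> = (\<Oplus>m\<in>carrier P. e h m \<otimes> (\<Oplus>k\<in>carrier P. e h' k \<otimes> f x (\<nu> k (\<nu> m q))))"
    proof (rule finsum_cong_pointwise)
      fix m assume m: "m \<in> carrier P"
      have "(\<Oplus>n\<in>carrier P. e h m \<otimes> (e h' (inv\<^bsub>P\<^esub> m \<otimes>\<^bsub>P\<^esub> n) \<otimes> f x (\<nu> n q))) =
          (\<Oplus>n\<in>carrier P. e h m \<otimes> (e h' (inv\<^bsub>P\<^esub> m \<otimes>\<^bsub>P\<^esub> (m \<otimes>\<^bsub>P\<^esub> n)) \<otimes> f x (\<nu> (m \<otimes>\<^bsub>P\<^esub> n) q)))"
        using m x h h' q Hcl Acl \<nu>_closed by (intro finsum_reindex_bij P.bij_mult_left) auto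
      also have "\<dots> = (\<Oplus>n\<in>carrier P. e h m \<otimes> (e h' n \<otimes> f x (\<nu> n (\<nu> m q))))"
        using m q by (intro finsum_cong_pointwise) (simp add: \<nu>_mult P.m_assoc[symmetric])
      also have "\<dots> = e h m \<otimes> (\<Oplus>k\<in>carrier P. e h' k \<otimes> f x (\<nu> k (\<nu> m q)))"
        using m x h h' q Hcl Acl \<nu>_closed Pfin by (intro finsum_rdistr[symmetric]) auto
      finally show "(\<Oplus>n\<in>carrier P. e h m \<otimes> (e h' (inv\<^bsub>P\<^esub> m \<otimes>\<^bsub>P\<^esub> n) \<otimes> f x (\<nu> n q))) = \<dots>" .
    qed
    also have "\<dots> = f (act h (act h' x)) q"
      unfolding act_val[OF h act_closed[OF h' x] q]
      by (rule finsum_cong_pointwise) (use q \<nu>_closed in \<open>simp add: act_val[OF h' x]\<close>)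
    finally show "f (act (h \<otimes>\<^bsub>H\<^esub> h') x) q = f (act h (act h' x)) q" .
  qed (use x h h' act_closed hopf_form_mult_closed[OF HF] in auto)
next
  fix x assume x: "x \<in> carrier A"
  show "act \<one>\<^bsub>H\<^esub> x = x"
  proof (rule Ainj)
    fix q assume q: "q \<in> U"
    have "f (act \<one>\<^bsub>H\<^esub> x) q = (\<Oplus>n\<in>carrier P. if n = \<one>\<^bsub>P\<^esub> then f x (\<nu> n q) else \<zero>)"
      unfolding act_val[OF hopf_form_one(1)[OF HF] x q]
      by (rule finsum_cong_pointwise) (use q x Acl \<nu>_closed in \<open>simp add: hopf_form_one[OF HF]\<close>)
    also have "\<dots> = f x q" using q x Acl \<nu>_closed Pfin by (subst finsum_if_eq) (auto simp: \<nu>_one)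
    finally show "f (act \<one>\<^bsub>H\<^esub> x) q = f x q" .
  qed (use x act_closed hopf_form_one[OF HF] in auto)
qed

text \<open>Evaluated at \<open>q\<close>, \<open>?j t\<close> is summation against a kernel:
  \<open>y\<close> goes to the sum over \<open>n\<close> of \<open>t\<close> at (q, n) times the
  value of \<open>y\<close> at \<open>\<nu> n q\<close>. By regularity \<open>\<nu> n q\<close> runs
  once through \<open>U\<close>, so a dual basis of \<open>A\<close> recovers the kernel from
  \<open>?j t\<close>; the recovery formula applied to an arbitrary endomorphism then gives its
  preimage.\<close>

lemma form_galois_bij:
  "bij_betw (tensor_lift Kr A H (End_group Kr A) (\<lambda>x h. \<lambda>y\<in>carrier A. x \<otimes>\<^bsub>A\<^esub> act h y))
     (carrier (tensor Kr A H)) (carrier (End_group Kr A))"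
proof -
  interpret MA: hopf_module_algebra Kr H A act by (rule form_module_algebra)
  interpret T: module_pair Kr A H ..
  note TF = form_tensor[OF AF Hf]
  let ?End = "End_group Kr A"
  have Ec: "g \<in> linear_map Kr A A" "g \<in> extensional (carrier A)" if "g \<in> carrier ?End" for g
    using that by (auto simp: End_group_def)
  note Elc = linear_map_closed[OF Ec(1)]
  \<comment> \<open>Endomorphisms are compared through the values of their images: a point of the
    index set is an element of \<open>A\<close> together with a point of \<open>U\<close>. This set
    may be infinite, which \<open>emb\<close> allows.\<close>
  have E: "emb L ?End (carrier A \<times> U) (\<lambda>g p. f (g (fst p)) (snd p))"
    unfolding emb_def
  proof (intro conjI ballI impI A.comm_group_End_group)
    fix g assume g: "g \<in> carrier ?End"
    show "f (g (fst z)) (snd z) \<in> carrier L" if "z \<in> carrier A \<times> U" for z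
      using that Acl Elc[OF g] by auto
    fix g' assume g': "g' \<in> carrier ?End"
    show "f ((g \<otimes>\<^bsub>?End\<^esub> g') (fst z)) (snd z) = f (g (fst z)) (snd z) \<oplus> f (g' (fst z)) (snd z)"
      if "z \<in> carrier A \<times> U" for z
    proof -
      from that obtain y q where z: "z = (y, q)" "y \<in> carrier A" "q \<in> U" by auto
      show ?thesis
        using form_add[OF AF Elc[OF g z(2)] Elc[OF g' z(2)] z(3)] z by (simp add: End_group_def)
    qed
    show "g = g'" if "\<forall>z\<in>carrier A \<times> U. f (g (fst z)) (snd z) = f (g' (fst z)) (snd z)"
      by (rule extensionalityI[OF Ec(2)[OF g] Ec(2)[OF g']], rule Ainj) (use that Elc[OF g] Elc[OF g'] in auto)
  qed
  let ?\<beta> = "\<lambda>x h. \<lambda>y\<in>carrier A. x \<otimes>\<^bsub>A\<^esub> act h y"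
  let ?\<Psi> = "\<lambda>z u. \<Oplus>n\<in>carrier P. u (snd z, n) \<otimes> f (fst z) (\<nu> n (snd z))"
  have c: "?\<beta> x h \<in> carrier ?End" if "x \<in> carrier A" "h \<in> carrier H" for x h
    using that linear_map_add[OF MA.act_linear] linear_map_smult[OF MA.act_linear] act_closed
    by (auto simp: End_group_def linear_map_def A.r_distr A.smult_mult_right)
  have v: "f (?\<beta> x h (fst z)) (snd z) = ?\<Psi> z (\<lambda>p. f x (fst p) \<otimes> e h (snd p))"
    if "x \<in> carrier A" "h \<in> carrier H" and z: "z \<in> carrier A \<times> U" for x h z
  proof -
    have "f (?\<beta> x h (fst z)) (snd z) = f x (snd z) \<otimes> (\<Oplus>n\<in>carrier P. e h n \<otimes> f (fst z) (\<nu> n (snd z)))"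
      using that act_closed by (auto simp: A_mult act_val)
    also have "\<dots> = (\<Oplus>n\<in>carrier P. f x (snd z) \<otimes> (e h n \<otimes> f (fst z) (\<nu> n (snd z))))"
      using that Acl Hcl \<nu>_closed Pfin by (intro finsum_rdistr) auto
    also have "\<dots> = ?\<Psi> z (\<lambda>p. f x (fst p) \<otimes> e h (snd p))"
      using that Acl Hcl \<nu>_closed by (intro finsum_cong_pointwise) (auto simp: m_assoc)
    finally show ?thesis .
  qed
  have ad: "addfun L (U \<times> carrier P) (?\<Psi> z)" if "z \<in> carrier A \<times> U" for z
    by (rule addfun_sum(2)) (use that Acl \<nu>_closed Pfin in auto)
  let ?j = "tensor_lift Kr A H ?End ?\<beta>"
  have jc: "?j t \<in> carrier ?End" if "t \<in> carrier T.TG" for t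
    by (rule lift_into_closed[OF Ak Hk E, where \<beta> = ?\<beta> and \<Psi> = ?\<Psi>, OF c v ad that])
  have jv: "f (?j t y) q = (\<Oplus>n\<in>carrier P. ev L Kr A H f e t (q, n) \<otimes> f y (\<nu> n q))"
    if "t \<in> carrier T.TG" "y \<in> carrier A" "q \<in> U" for t y q
    using lift_into_val[OF Ak Hk E, where \<beta> = ?\<beta> and \<Psi> = ?\<Psi>, OF c v ad that(1), of "(y, q)"] that by simp
  obtain I :: "('y \<times> nat) set" and w h where I: "finite I"
    "\<And>k. k \<in> I \<Longrightarrow> equivariant L G \<alpha> U a (w k)" "\<And>k. k \<in> I \<Longrightarrow> h k \<in> carrier A"
    "\<And>x y. x \<in> U \<Longrightarrow> y \<in> U \<Longrightarrow> (\<Oplus>k\<in>I. w k x \<otimes> f (h k) y) = (if x = y then \<one> else \<zero>)"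
    "\<And>m. m \<in> carrier A \<Longrightarrow> m = (\<Oplus>\<^bsub>A\<^esub>k\<in>I. (\<Oplus>x\<in>U. f m x \<otimes> w k x) \<odot>\<^bsub>A\<^esub> h k)"
    "\<And>m k. m \<in> carrier A \<Longrightarrow> k \<in> I \<Longrightarrow> (\<Oplus>x\<in>U. f m x \<otimes> w k x) \<in> K"
    by (rule form_frame[OF AF]) (rule that)
  note wc = equivariant_closed[OF I(2)]
  note evc = ev_closed[OF Ak Hk]
  have recover: "ev L Kr A H f e t (q, n) = (\<Oplus>k\<in>I. w k (\<nu> n q) \<otimes> f (?j t (h k)) q)"
    if t: "t \<in> carrier T.TG" and q: "q \<in> U" and n: "n \<in> carrier P" for t q n
  proof -
    have "(\<Oplus>k\<in>I. w k (\<nu> n q) \<otimes> f (?j t (h k)) q) =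
        (\<Oplus>k\<in>I. \<Oplus>m\<in>carrier P. w k (\<nu> n q) \<otimes> (ev L Kr A H f e t (q, m) \<otimes> f (h k) (\<nu> m q)))"
    proof (rule finsum_cong_pointwise)
      fix k assume k: "k \<in> I"
      have "w k (\<nu> n q) \<otimes> f (?j t (h k)) q = w k (\<nu> n q) \<otimes> (\<Oplus>m\<in>carrier P. ev L Kr A H f e t (q, m) \<otimes> f (h k) (\<nu> m q))"
        using t q I(3)[OF k] by (simp add: jv)
      also have "\<dots> = (\<Oplus>m\<in>carrier P. w k (\<nu> n q) \<otimes> (ev L Kr A H f e t (q, m) \<otimes> f (h k) (\<nu> m q)))"
        using t q n k I(3) wc evc Acl \<nu>_closed Pfin by (intro finsum_rdistr) auto
      finally show "w k (\<nu> n q) \<otimes> f (?j t (h k)) q = \<dots>" .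
    qed
    also have "\<dots> = (\<Oplus>m\<in>carrier P. \<Oplus>k\<in>I. w k (\<nu> n q) \<otimes> (ev L Kr A H f e t (q, m) \<otimes> f (h k) (\<nu> m q)))"
      using t q n I(1,3) wc evc Acl \<nu>_closed Pfin by (intro finsum_swap) auto
    also have "\<dots> = (\<Oplus>m\<in>carrier P. if m = n then ev L Kr A H f e t (q, m) else \<zero>)"
    proof (rule finsum_cong_pointwise)
      fix m assume m: "m \<in> carrier P"
      have "(\<Oplus>k\<in>I. w k (\<nu> n q) \<otimes> (ev L Kr A H f e t (q, m) \<otimes> f (h k) (\<nu> m q))) =
          (\<Oplus>k\<in>I. ev L Kr A H f e t (q, m) \<otimes> (w k (\<nu> n q) \<otimes> f (h k) (\<nu> m q)))"
        using t q n m I(3) wc evc Acl \<nu>_closed by (intro finsum_cong_pointwise) (simp add: m_ac)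
      also have "\<dots> = ev L Kr A H f e t (q, m) \<otimes> (\<Oplus>k\<in>I. w k (\<nu> n q) \<otimes> f (h k) (\<nu> m q))"
        using t q n m I(1,3) wc evc Acl \<nu>_closed by (intro finsum_rdistr[symmetric]) auto
      \<comment> \<open>By regularity \<open>\<nu> m q\<close> equals \<open>\<nu> n q\<close> only
        for \<open>m = n\<close>, so the frame relation singles out one term.\<close>
      also have "\<dots> = (if m = n then ev L Kr A H f e t (q, m) else \<zero>)"
        using \<nu>_regular[OF q \<nu>_closed[OF n q]] m n t q evc \<nu>_closed by (auto simp: I(4))
      finally show "(\<Oplus>k\<in>I. w k (\<nu> n q) \<otimes> (ev L Kr A H f e t (q, m) \<otimes> f (h k) (\<nu> m q))) = \<dots>" .
    qed
    also have "\<dots> = ev L Kr A H f e t (q, n)"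
      using t q n evc Pfin by (subst finsum_if_eq) auto
    finally show ?thesis by simp
  qed
  show ?thesis
  proof (rule bij_betwI')
    fix s t assume st: "s \<in> carrier (tensor Kr A H)" "t \<in> carrier (tensor Kr A H)"
    show "(?j s = ?j t) = (s = t)"
    proof
      assume eq: "?j s = ?j t"
      show "s = t"
        by (rule emb_inj[OF tensor_emb[OF AF Hf]]) (use st eq recover in auto)
    qed simp
  next
    fix t assume "t \<in> carrier (tensor Kr A H)"
    then show "?j t \<in> carrier ?End" using jc by simp
  next
    fix g assume g: "g \<in> carrier ?End"
    note gc = Elc[OF g]
    \<comment> \<open>The formula of \<open>recover\<close> with \<open>g\<close> in place of
      \<open>?j t\<close>, hence the only possible kernel for \<open>g\<close>.\<close>
    define u where "u = (\<lambda>p. \<Oplus>k\<in>I. w k (\<nu> (snd p) (fst p)) \<otimes> f (g (h k)) (fst p))"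
    have "equivariant L G \<alpha> (U \<times> carrier P) (\<lambda>s p. (a s (fst p), b s (snd p))) u"
      unfolding equivariant_def
    proof (intro conjI ballI)
      fix p assume "p \<in> U \<times> carrier P"
      then obtain q n where p: "p = (q, n)" "q \<in> U" "n \<in> carrier P" by auto
      show "u p \<in> carrier L"
        unfolding u_def using p wc Acl gc I(3) \<nu>_closed by (intro finsum_closed) auto
      fix s assume s: "s \<in> carrier G"
      have "u (a s (fst p), b s (snd p)) = (\<Oplus>k\<in>I. \<alpha> s (w k (\<nu> n q) \<otimes> f (g (h k)) q))"
        unfolding u_def
        by (rule finsum_cong_pointwise)
           (use s p wc Acl gc I(3) \<nu>_closed in \<open>simp add: \<nu>_equivariant[symmetric] equivariant_eq[OF I(2)]
             equivariant_eq[OF form_equivariant[OF AF]] \<alpha>_times\<close>)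
      also have "\<dots> = \<alpha> s (u p)"
        unfolding u_def using s p wc Acl gc I(3) \<nu>_closed by (subst \<alpha>_finsum) auto
      finally show "u (a s (fst p), b s (snd p)) = \<alpha> s (u p)" .
    qed
    then obtain t where t: "t \<in> carrier T.TG" "\<And>p. p \<in> U \<times> carrier P \<Longrightarrow> ev L Kr A H f e t p = u p"
      using form_surj[OF TF, of u] unfolding T.tensor_carrier by blast
    have "?j t = g"
    proof (rule extensionalityI[OF Ec(2)[OF jc[OF t(1)]] Ec(2)[OF g]])
      fix y assume y: "y \<in> carrier A"
      let ?\<phi> = "\<lambda>k. \<Oplus>x\<in>U. f y x \<otimes> w k x"
      have \<phi>K: "?\<phi> k \<in> carrier Kr" if "k \<in> I" for k using I(6)[OF y that] by simp
      show "?j t y = g y"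
      proof (rule Ainj)
        show "?j t y \<in> carrier A" using Elc[OF jc[OF t(1)] y] .
        show "g y \<in> carrier A" using gc[OF y] .
        fix q assume q: "q \<in> U"
        have "f (?j t y) q = (\<Oplus>n\<in>carrier P. (\<Oplus>k\<in>I. w k (\<nu> n q) \<otimes> f (g (h k)) q) \<otimes> f y (\<nu> n q))"
          unfolding jv[OF t(1) y q] by (rule finsum_cong_pointwise) (use q in \<open>simp add: t u_def\<close>)
        also have "\<dots> = (\<Oplus>n\<in>carrier P. \<Oplus>k\<in>I. w k (\<nu> n q) \<otimes> (f (g (h k)) q \<otimes> f y (\<nu> n q)))"
          using q y wc Acl gc I(1,3) \<nu>_closed by (intro finsum_cong_pointwise finsum_mult_assoc) auto
        also have "\<dots> = (\<Oplus>k\<in>I. \<Oplus>n\<in>carrier P. w k (\<nu> n q) \<otimes> (f (g (h k)) q \<otimes> f y (\<nu> n q)))"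
          using q y wc Acl gc I(1,3) \<nu>_closed Pfin by (intro finsum_swap) auto
        also have "\<dots> = (\<Oplus>k\<in>I. ?\<phi> k \<otimes> f (g (h k)) q)"
        proof (rule finsum_cong_pointwise)
          fix k assume k: "k \<in> I"
          have "(\<Oplus>n\<in>carrier P. w k (\<nu> n q) \<otimes> (f (g (h k)) q \<otimes> f y (\<nu> n q))) =
              (\<Oplus>n\<in>carrier P. f y (\<nu> n q) \<otimes> w k (\<nu> n q) \<otimes> f (g (h k)) q)"
            using q y k wc Acl gc I(3) \<nu>_closed by (intro finsum_cong_pointwise) (simp add: m_ac)
          also have "\<dots> = (\<Oplus>n\<in>carrier P. f y (\<nu> n q) \<otimes> w k (\<nu> n q)) \<otimes> f (g (h k)) q"
            using q y k wc Acl gc I(3) \<nu>_closed Pfin by (intro finsum_ldistr[symmetric]) auto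
          also have "(\<Oplus>n\<in>carrier P. f y (\<nu> n q) \<otimes> w k (\<nu> n q)) = ?\<phi> k"
            using q y k wc Acl by (intro finsum_reindex_bij[symmetric] \<nu>_bij) auto
          finally show "(\<Oplus>n\<in>carrier P. w k (\<nu> n q) \<otimes> (f (g (h k)) q \<otimes> f y (\<nu> n q))) = ?\<phi> k \<otimes> f (g (h k)) q" .
        qed
        also have "\<dots> = f (\<Oplus>\<^bsub>A\<^esub>k\<in>I. ?\<phi> k \<odot>\<^bsub>A\<^esub> g (h k)) q"
          using q y gc I(1,3,6) A.smult_closed[OF \<phi>K]
          by (subst form_finsum[OF AF]) (auto intro!: finsum_cong_pointwise simp: form_smult[OF AF])
        \<comment> \<open>Linearity over \<open>K\<close> enters here: the coordinates
          \<open>?\<phi> k\<close> lie in \<open>K\<close> and pass through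
          \<open>g\<close>.\<close>
        also have "(\<Oplus>\<^bsub>A\<^esub>k\<in>I. ?\<phi> k \<odot>\<^bsub>A\<^esub> g (h k)) = g (\<Oplus>\<^bsub>A\<^esub>k\<in>I. ?\<phi> k \<odot>\<^bsub>A\<^esub> h k)"
          by (rule A.linear_map_combination[OF Ec(1)[OF g] I(1) \<phi>K I(3), symmetric])
        also have "(\<Oplus>\<^bsub>A\<^esub>k\<in>I. ?\<phi> k \<odot>\<^bsub>A\<^esub> h k) = y" using I(5)[OF y] by simp
        finally show "f (?j t y) q = f (g y) q" .
      qed
    qed
    with t show "\<exists>t\<in>carrier (tensor Kr A H). g = ?j t" by auto
  qed
qed

lemmas form_galois = conjI[OF form_module_algebra form_galois_bij]

end

end

section \<open>Fixed points of group algebras as forms\<close>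

lemma
  assumes "carrier R = carrier R'"
    and "carrier M = carrier M'" "ring.add M = ring.add M'" "smult M = smult M'"
    and "carrier N = carrier N'" "ring.add N = ring.add N'" "smult N = smult N'"
  shows tensor_group_cong: "tensor_group R M N = tensor_group R' M' N'"
    and tens_cong: "tens R M N = tens R' M' N'"
    and tensor_lift_cong: "tensor_lift R M N = tensor_lift R' M' N'"
proof -
  have "tensor_relators R M N = tensor_relators R' M' N'"
    unfolding tensor_relators_def assms ..
  then have k: "tensor_kernel R M N = tensor_kernel R' M' N'"
    by (simp add: tensor_kernel_def assms)
  then show g: "tensor_group R M N = tensor_group R' M' N'"
    by (simp add: tensor_group_def assms)
  show t: "tens R M N = tens R' M' N'"
    by (intro ext) (simp add: tens_def k assms)
  show "tensor_lift R M N = tensor_lift R' M' N'"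
    by (intro ext) (simp add: tensor_lift_def g t assms)
qed

lemma ev_cong:
  assumes "carrier R = carrier R'"
    and "carrier M = carrier M'" "ring.add M = ring.add M'" "smult M = smult M'"
    and "carrier N = carrier N'" "ring.add N = ring.add N'" "smult N = smult N'"
  shows "ev L R M N = ev L R' M' N'"
  by (intro ext) (simp add: ev_def tensor_lift_cong[OF assms])

text \<open>Used for \<open>Hbar\<close>, whose sums are taken in \<open>F\<close> while forms
  compute in \<open>L\<close>. On an infinite index set both sums have the default value
  zero.\<close>

lemma (in ring) finsum_subring:
  assumes F: "subring F R" and "\<And>x. x \<in> A \<Longrightarrow> f x \<in> F"
  shows "finsum (R\<lparr>carrier := F\<rparr>) f A = finsum R f A"
  using assms(2)
proof (induction A rule: infinite_finite_induct)
  interpret F: ring "R\<lparr>carrier := F\<rparr>" by (rule subring_is_ring[OF F])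
  {
    case (infinite A) then show ?case by simp
  next
    case empty then show ?case by simp
  next
    case (insert x A)
    then have "finsum (R\<lparr>carrier := F\<rparr>) f (insert x A) = f x \<oplus> finsum (R\<lparr>carrier := F\<rparr>) f A"
      by (subst F.finsum_insert) auto
    also have "\<dots> = finsum R f (insert x A)"
      using insert subringE(1)[OF F] by (subst finsum_insert) (auto simp: Pi_def)
    finally show ?case .
  }
qed

lemma emb_superfield:
  "emb (L\<lparr>carrier := F\<rparr>) P Z g \<Longrightarrow> F \<subseteq> carrier L \<Longrightarrow> emb L P Z g"
  unfolding emb_def by auto

text \<open>
  The full group algebra \<open>F[P]\<close> is a form over \<open>F\<close> for the trivial group, acting on the field \<open>F\<close>.
\<close>

definition trivial_monoid :: "unit monoid"
  where "trivial_monoid = \<lparr>carrier = {()}, monoid.mult = (\<lambda>_ _. ()), monoid.one = ()\<rparr>"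

lemma group_trivial_monoid: "group trivial_monoid"
  by (rule groupI) (auto simp: trivial_monoid_def)

context galois_action begin

lemma trivial_galois_action:
  assumes F: "subfield F L"
  shows "galois_action (L\<lparr>carrier := F\<rparr>) trivial_monoid (\<lambda>_ x. x) F"
proof -
  interpret F: field "L\<lparr>carrier := F\<rparr>" by (rule subfield_iff(2)[OF F])
  interpret T: group trivial_monoid by (rule group_trivial_monoid)
  show ?thesis
    by unfold_locales (auto simp: trivial_monoid_def ring_hom_def)
qed

lemma group_alg_form:
  fixes P :: "('p, 's) monoid_scheme"
  assumes F: "subfield F L" and P: "group P" "finite (carrier P)"
  shows "form (L\<lparr>carrier := F\<rparr>) trivial_monoid (\<lambda>_ x. x) F (group_hopf (L\<lparr>carrier := F\<rparr>) P)
    (carrier P) (\<lambda>_ x. x) (\<lambda>c. c)"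
proof -
  interpret F: galois_action "L\<lparr>carrier := F\<rparr>" trivial_monoid "\<lambda>_ x. x" F
    by (rule trivial_galois_action[OF F])
  have Fs: "subring F L" using F by (simp add: subfieldE)
  show ?thesis
  proof (rule F.formI)
    show "gset trivial_monoid (carrier P) (\<lambda>_ x. x)" using P by (simp add: gset_def)
    fix u assume "equivariant (L\<lparr>carrier := F\<rparr>) trivial_monoid (\<lambda>_ x. x) (carrier P) (\<lambda>_ x. x) u"
    then have "restrict u (carrier P) \<in> carrier (group_hopf (L\<lparr>carrier := F\<rparr>) P)"
      by (auto simp: group_hopf_def hopf_of_def group_alg_def Let_def equivariant_def)
    then show "\<exists>m\<in>carrier (group_hopf (L\<lparr>carrier := F\<rparr>) P). \<forall>x\<in>carrier P. m x = u x"
      by (rule bexI[rotated]) simp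
  qed (use subringE[OF Fs] in \<open>auto simp: group_hopf_def hopf_of_def group_alg_def Let_def equivariant_def
        Pi_def PiE_iff intro: extensionalityI\<close>)
qed

text \<open>The comultiplication is an inverse image under the map \<open>?can\<close> into the
  tensor square of the full group algebra. Both tensor squares consist of functions on pairs of
  elements of \<open>P\<close>, and \<open>?can\<close> preserves values, so it is injective. The
  function equal to \<open>h\<close> on the diagonal is equivariant, hence comes from a tensor over
  \<open>K\<close>, which is the required preimage. As field of coefficients, \<open>F\<close> is
  \<open>L\<close> itself or, for \<open>Hbar\<close>, the fixed field of \<open>J\<close>.\<close>

theorem group_hopf_form:
  fixes P :: "('p, 's) monoid_scheme"
  assumes P: "group P" and gs: "gset G (carrier P) b"
    and aut: "\<And>g n m. g \<in> carrier G \<Longrightarrow> n \<in> carrier P \<Longrightarrow> m \<in> carrier P \<Longrightarrow> b g (n \<otimes>\<^bsub>P\<^esub> m) = b g n \<otimes>\<^bsub>P\<^esub> b g m"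
    and F: "subfield F L"
    and C: "C = {c \<in> carrier P \<rightarrow>\<^sub>E carrier L. equivariant L G \<alpha> (carrier P) b c}"
    and CF: "\<And>c n. c \<in> C \<Longrightarrow> n \<in> carrier P \<Longrightarrow> c n \<in> F"
    and LN: "LN = group_hopf (L\<lparr>carrier := F\<rparr>) P"
    and H0: "H0 = LN\<lparr>carrier := C\<rparr>"
    and H: "H = H0\<lparr>comult := (\<lambda>h. inv_into (carrier (tensor Kr H0 H0))
      (tensor_lift Kr H0 H0 (tensor_group (L\<lparr>carrier := F\<rparr>) LN LN) (tens (L\<lparr>carrier := F\<rparr>) LN LN)) (comult LN h))\<rparr>"
  shows "hopf_form L G \<alpha> K H P b (\<lambda>c. c)"
proof -
  let ?F = "L\<lparr>carrier := F\<rparr>"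
  interpret P: group P by (rule P)
  interpret F: galois_action ?F trivial_monoid "\<lambda>_ x. x" F
    by (rule trivial_galois_action[OF F])
  have Fs: "subring F L" using F by (simp add: subfieldE)
  have FL: "F \<subseteq> carrier L" using subringE(1)[OF Fs] .
  note Pfin = gset_finite[OF gs]
  have cC: "c n \<in> carrier L" if "c \<in> C" "n \<in> carrier P" for c n using that C by auto
  have eC: "c (b g n) = \<alpha> g (c n)" if "c \<in> C" "n \<in> carrier P" "g \<in> carrier G" for c n g
    using that C by (auto dest: equivariant_eq)
  have inC: "(\<lambda>n\<in>carrier P. u n) \<in> C"
    if "equivariant L G \<alpha> (carrier P) b u" for u
    using that gset_closed[OF gs] by (auto simp: C equivariant_def)
  note bc = gset_closed[OF gs]
  have binv: "b g (inv\<^bsub>P\<^esub> n) = inv\<^bsub>P\<^esub> (b g n)" "b g \<one>\<^bsub>P\<^esub> = \<one>\<^bsub>P\<^esub>" if "g \<in> carrier G" "n \<in> carrier P" for g n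
  proof -
    have "b g \<one>\<^bsub>P\<^esub> \<otimes>\<^bsub>P\<^esub> b g \<one>\<^bsub>P\<^esub> = b g \<one>\<^bsub>P\<^esub>" using aut[of g "\<one>\<^bsub>P\<^esub>" "\<one>\<^bsub>P\<^esub>"] that by simp
    then show 1: "b g \<one>\<^bsub>P\<^esub> = \<one>\<^bsub>P\<^esub>" using bc[of g "\<one>\<^bsub>P\<^esub>"] that P.l_cancel_one' by (metis P.one_closed)
    have "b g (inv\<^bsub>P\<^esub> n) \<otimes>\<^bsub>P\<^esub> b g n = \<one>\<^bsub>P\<^esub>" using aut[of g "inv\<^bsub>P\<^esub> n" n] that 1 by simp
    then show "b g (inv\<^bsub>P\<^esub> n) = inv\<^bsub>P\<^esub> (b g n)" using that bc by (intro P.inv_equality[symmetric]) auto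
  qed
  have carrier_H: "carrier H = C" by (simp add: H H0)
  have add_H: "c \<oplus>\<^bsub>H\<^esub> d = (\<lambda>n\<in>carrier P. c n \<oplus> d n)" for c d
    by (simp add: H H0 LN group_hopf_def hopf_of_def group_alg_def Let_def)
  have zero_H: "\<zero>\<^bsub>H\<^esub> = (\<lambda>n\<in>carrier P. \<zero>)"
    by (simp add: H H0 LN group_hopf_def hopf_of_def group_alg_def Let_def)
  have smult_H: "r \<odot>\<^bsub>H\<^esub> c = (\<lambda>n\<in>carrier P. r \<otimes> c n)" for r c
    by (simp add: H H0 LN group_hopf_def hopf_of_def group_alg_def Let_def)
  have one_H: "\<one>\<^bsub>H\<^esub> = (\<lambda>n\<in>carrier P. if n = \<one>\<^bsub>P\<^esub> then \<one> else \<zero>)"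
    by (auto simp: H H0 LN group_hopf_def hopf_of_def group_alg_def Let_def single_def intro!: restrict_ext)
  have mult_H: "c \<otimes>\<^bsub>H\<^esub> d = (\<lambda>n\<in>carrier P. \<Oplus>m\<in>carrier P. c m \<otimes> d (inv\<^bsub>P\<^esub> m \<otimes>\<^bsub>P\<^esub> n))" if "c \<in> C" "d \<in> C" for c d
  proof -
    have "c \<otimes>\<^bsub>H\<^esub> d = (\<lambda>n\<in>carrier P. finsum ?F (\<lambda>m. c m \<otimes> d (inv\<^bsub>P\<^esub> m \<otimes>\<^bsub>P\<^esub> n)) (carrier P))"
      by (simp add: H H0 LN group_hopf_def hopf_of_def group_alg_def Let_def)
    also have "\<dots> = (\<lambda>n\<in>carrier P. \<Oplus>m\<in>carrier P. c m \<otimes> d (inv\<^bsub>P\<^esub> m \<otimes>\<^bsub>P\<^esub> n))"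
      by (intro restrict_ext finsum_subring[OF Fs] subringE(6)[OF Fs] CF that) auto
    finally show ?thesis .
  qed
  have counit_H: "counit H c = (\<Oplus>n\<in>carrier P. c n)" if "c \<in> C" for c
  proof -
    have "counit H c = finsum ?F c (carrier P)"
      by (simp add: H H0 LN group_hopf_def hopf_of_def Let_def)
    also have "\<dots> = (\<Oplus>n\<in>carrier P. c n)" by (rule finsum_subring[OF Fs]) (use CF that in auto)
    finally show ?thesis .
  qed
  have antipode_H: "antipode H c = (\<lambda>n\<in>carrier P. c (inv\<^bsub>P\<^esub> n))" for c
    by (simp add: H H0 LN group_hopf_def hopf_of_def Let_def)
  have fH: "form L G \<alpha> K H (carrier P) b (\<lambda>c. c)"
  proof (rule formI[OF gs]; (unfold carrier_H)?)
    show "equivariant L G \<alpha> (carrier P) b c" if "c \<in> C" for c using that C by auto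
    show "c = d" if "c \<in> C" "d \<in> C" "\<And>n. n \<in> carrier P \<Longrightarrow> c n = d n" for c d
      using that C by (auto intro: extensionalityI simp: PiE_iff)
    show "\<exists>m\<in>C. \<forall>x\<in>carrier P. m x = u x" if "equivariant L G \<alpha> (carrier P) b u" for u
      using inC[OF that] by (intro bexI) auto
    show "c \<oplus>\<^bsub>H\<^esub> d \<in> C" if "c \<in> C" "d \<in> C" for c d
      unfolding add_H using that by (intro inC) (auto simp: equivariant_def cC eC \<alpha>_add)
    show "\<zero>\<^bsub>H\<^esub> \<in> C" unfolding zero_H by (intro inC) (auto simp: equivariant_def)
    show "r \<odot>\<^bsub>H\<^esub> c \<in> C" if "r \<in> K" "c \<in> C" for r c
      unfolding smult_H using that by (intro inC) (auto simp: equivariant_def cC eC \<alpha>_times K_eq)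
  qed (auto simp: add_H zero_H smult_H)
  have mult_C: "c \<otimes>\<^bsub>H\<^esub> d \<in> C" if cd: "c \<in> C" "d \<in> C" for c d
    unfolding mult_H[OF that]
  proof (rule inC, unfold equivariant_def, intro conjI ballI)
    fix n assume n: "n \<in> carrier P"
    show "(\<Oplus>m\<in>carrier P. c m \<otimes> d (inv\<^bsub>P\<^esub> m \<otimes>\<^bsub>P\<^esub> n)) \<in> carrier L"
      using cd n cC by (intro finsum_closed) auto
    fix g assume g: "g \<in> carrier G"
    have "(\<Oplus>m\<in>carrier P. c m \<otimes> d (inv\<^bsub>P\<^esub> m \<otimes>\<^bsub>P\<^esub> b g n)) =
        (\<Oplus>m\<in>carrier P. c (b g m) \<otimes> d (inv\<^bsub>P\<^esub> (b g m) \<otimes>\<^bsub>P\<^esub> b g n))"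
      using cd n g cC bc by (intro finsum_reindex_bij gset_bij[OF G.is_group gs]) auto
    also have "\<dots> = (\<Oplus>m\<in>carrier P. \<alpha> g (c m \<otimes> d (inv\<^bsub>P\<^esub> m \<otimes>\<^bsub>P\<^esub> n)))"
      using cd n g cC bc by (intro finsum_cong_pointwise) (simp add: eC \<alpha>_times flip: aut binv)
    also have "\<dots> = \<alpha> g (\<Oplus>m\<in>carrier P. c m \<otimes> d (inv\<^bsub>P\<^esub> m \<otimes>\<^bsub>P\<^esub> n))"
      using cd n g cC by (subst \<alpha>_finsum) auto
    finally show "(\<Oplus>m\<in>carrier P. c m \<otimes> d (inv\<^bsub>P\<^esub> m \<otimes>\<^bsub>P\<^esub> b g n)) = \<alpha> g (\<Oplus>m\<in>carrier P. c m \<otimes> d (inv\<^bsub>P\<^esub> m \<otimes>\<^bsub>P\<^esub> n))" .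
  qed
  have fLN: "form ?F trivial_monoid (\<lambda>_ x. x) F LN (carrier P) (\<lambda>_ x. x) (\<lambda>c. c)"
    unfolding LN by (rule group_alg_form[OF F P Pfin])
  have Feq: "F.Kr = ?F" by simp
  note fLN2 = F.form_tensor[OF fLN fLN, unfolded Feq]
  interpret LN: module_pair ?F LN LN
    using F.module_pair_kfun[OF form_kfun[OF fLN] form_kfun[OF fLN]] by simp
  let ?EF = "ev ?F ?F LN LN (\<lambda>c. c) (\<lambda>c. c)"
  have embF: "emb L LN.TG (carrier P \<times> carrier P) ?EF"
    using emb_superfield[OF F.tensor_emb[OF fLN fLN, unfolded Feq] FL] .
  note Hk = form_kfun[OF fH]
  interpret H: module_pair Kr H H by (rule module_pair_kfun[OF Hk Hk])
  have C_LN: "c \<in> carrier LN" if "c \<in> C" for c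
    using that C CF by (auto simp: LN group_hopf_def hopf_of_def group_alg_def Let_def PiE_iff)
  let ?can = "tensor_lift Kr H H LN.TG (tens ?F LN LN)"
  have tLN: "?EF (tens ?F LN LN c d) p = c (fst p) \<otimes> d (snd p)"
    if "c \<in> carrier LN" "d \<in> carrier LN" "p \<in> carrier P \<times> carrier P" for c d p
    using F.ev_tens[OF form_kfun[OF fLN] form_kfun[OF fLN], unfolded Feq, of c d "fst p" "snd p"] that by auto
  have can: "?can t \<in> carrier LN.TG"
    "\<And>p. p \<in> carrier P \<times> carrier P \<Longrightarrow> ?EF (?can t) p = ev L Kr H H (\<lambda>c. c) (\<lambda>c. c) t p"
    if "t \<in> carrier H.TG" for t
    by (rule lift_into_closed[OF Hk Hk embF, where \<beta> = "tens ?F LN LN" and \<Psi> = "\<lambda>z u. u z"]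
             lift_into_val[OF Hk Hk embF, where \<beta> = "tens ?F LN LN" and \<Psi> = "\<lambda>z u. u z"];
        use that carrier_H C_LN tLN in \<open>auto intro: addfun_eval\<close>)+
  have dLN: "comult LN h \<in> carrier LN.TG"
    "\<And>n m. n \<in> carrier P \<Longrightarrow> m \<in> carrier P \<Longrightarrow> ?EF (comult LN h) (n, m) = (if n = m then h n else \<zero>)"
    if h: "h \<in> C" for h
  proof -
    have s: "single ?F P r g \<in> carrier LN" if "r \<in> F" for r g
      using that subringE(2)[OF Fs] by (auto simp: LN group_hopf_def hopf_of_def group_alg_def Let_def single_def)
    \<comment> \<open>\<open>group_hopf\<close> takes its tensor square over the bare group algebra,
      whereas \<open>LN\<close> also carries the Hopf structure; the two squares coincide.\<close>
    have eq: "comult LN h = finsum (tensor ?F LN LN) (\<lambda>g. tens ?F LN LN (single ?F P (h g) g) (single ?F P \<one> g)) (carrier P)"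
    proof -
      have c: "carrier LN = carrier (group_alg ?F P)" "ring.add LN = ring.add (group_alg ?F P)"
        "smult LN = smult (group_alg ?F P)" "monoid.mult LN = monoid.mult (group_alg ?F P)" "monoid.one LN = monoid.one (group_alg ?F P)"
        by (simp_all add: LN group_hopf_def hopf_of_def Let_def)
      note e = tensor_group_cong[of ?F ?F LN "group_alg ?F P" LN "group_alg ?F P", OF refl c(1-3) c(1-3)]
        tens_cong[of ?F ?F LN "group_alg ?F P" LN "group_alg ?F P", OF refl c(1-3) c(1-3)]
        tensor_lift_cong[of ?F ?F LN "group_alg ?F P" LN "group_alg ?F P", OF refl c(1-3) c(1-3)]
      have "tensor ?F LN LN = tensor ?F (group_alg ?F P) (group_alg ?F P)"
        unfolding tensor_def e c ..
      then show ?thesis unfolding e by (simp add: LN group_hopf_def hopf_of_def Let_def)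
    qed
    have oneF: "\<one> \<in> F" "\<zero> \<in> F" using subringE(2,3)[OF Fs] by auto
    have tc: "tens ?F LN LN (single ?F P (h g) g) (single ?F P \<one> g) \<in> carrier (tensor ?F LN LN)" if "g \<in> carrier P" for g
      using s CF[OF h that] oneF by auto
    interpret T: abelian_group "tensor ?F LN LN" by (rule LN.abelian_group_tensor)
    show "comult LN h \<in> carrier LN.TG"
      using T.finsum_closed[of "\<lambda>g. tens ?F LN LN (single ?F P (h g) g) (single ?F P \<one> g)" "carrier P"] tc
      unfolding eq by auto
    fix n m assume nm: "n \<in> carrier P" "m \<in> carrier P"
    have "?EF (comult LN h) (n, m) = finsum ?F (\<lambda>g. ?EF (tens ?F LN LN (single ?F P (h g) g) (single ?F P \<one> g)) (n, m)) (carrier P)"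
      unfolding eq by (rule F.form_finsum[OF fLN2]) (use Pfin tc nm in auto)
    also have "\<dots> = finsum ?F (\<lambda>g. if g = n then (if n = m then h g else \<zero>) else \<zero>\<^bsub>?F\<^esub>) (carrier P)"
      using nm s CF[OF h] oneF FL
      by (intro finsum_cong_pointwise) (auto simp: tLN single_def subset_iff)
    also have "\<dots> = (if n = m then h n else \<zero>)"
      by (rule F.finsum_if_eq(1)[OF Pfin nm(1)]) (use CF[OF h nm(1)] oneF in auto)
    finally show "?EF (comult LN h) (n, m) = (if n = m then h n else \<zero>)" .
  qed
  note fH2 = form_tensor[OF fH fH]
  \<comment> \<open>\<open>gp_hopf\<close> forms the tensor square before the comultiplication is
    replaced, that is, of \<open>H0\<close>; it equals the square of \<open>H\<close>.\<close>
  have comult_H: "comult H h = inv_into (carrier H.TG) ?can (comult LN h)" for h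
  proof -
    have c: "carrier H0 = carrier H" "ring.add H0 = ring.add H" "smult H0 = smult H"
      by (simp_all add: H)
    have e: "tensor_group Kr H0 H0 = H.TG" "tensor_lift Kr H0 H0 = tensor_lift Kr H H"
      by (rule tensor_group_cong tensor_lift_cong; simp add: c)+
    have "carrier (tensor Kr H0 H0) = carrier H.TG" by (simp add: tensor_def e)
    then show ?thesis unfolding e(2)[symmetric] by (simp add: H)
  qed
  have inj: "inj_on ?can (carrier H.TG)"
  proof (rule inj_onI)
    fix s t assume st: "s \<in> carrier H.TG" "t \<in> carrier H.TG" "?can s = ?can t"
    show "s = t"
      by (rule emb_inj[OF tensor_emb[OF fH fH] st(1,2)]) (metis can(2)[OF st(1)] can(2)[OF st(2)] st(3))
  qed
  have comult: "comult H h \<in> carrier H.TG \<and>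
      (\<forall>n\<in>carrier P. \<forall>m\<in>carrier P. ev L Kr H H (\<lambda>c. c) (\<lambda>c. c) (comult H h) (n, m) = (if n = m then h n else \<zero>))"
    if h: "h \<in> C" for h
  proof -
    \<comment> \<open>Extension by zero off the diagonal is equivariant because \<open>b g\<close>
      is injective, so the diagonal is preserved in both directions.\<close>
    have "equivariant L G \<alpha> (carrier P \<times> carrier P) (\<lambda>g p. (b g (fst p), b g (snd p)))
        (\<lambda>p. if fst p = snd p then h (fst p) else \<zero>)"
      using h gset_cancel[OF G.is_group gs] by (auto simp: equivariant_def cC eC)
    then obtain t where t: "t \<in> carrier H.TG"
      "\<forall>p\<in>carrier P \<times> carrier P. ev L Kr H H (\<lambda>c. c) (\<lambda>c. c) t p = (if fst p = snd p then h (fst p) else \<zero>)"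
      using form_surj[OF fH2] unfolding H.tensor_carrier by blast
    have "?can t = comult LN h"
      by (rule emb_inj[OF embF can(1)[OF t(1)] dLN(1)[OF h]]) (use can(2)[OF t(1)] dLN(2)[OF h] t(2) in auto)
    then have "comult H h = t"
      unfolding comult_H using inv_into_f_f[OF inj t(1)] by simp
    with t show ?thesis by simp
  qed
  show ?thesis
    unfolding hopf_form_def carrier_H
  proof (intro conjI fH P ballI)
    show "mult_law L H (carrier P) (\<lambda>c. c) (carrier P) (\<lambda>p i. i) (\<lambda>p i. inv\<^bsub>P\<^esub> i \<otimes>\<^bsub>P\<^esub> p)"
      unfolding mult_law_def carrier_H using Pfin mult_C mult_H by auto
    show "\<one>\<^bsub>H\<^esub> \<in> C"
      unfolding one_H
    proof (rule inC, unfold equivariant_def, intro conjI ballI)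
      fix g n assume "g \<in> carrier G" "n \<in> carrier P"
      then show "(if b g n = \<one>\<^bsub>P\<^esub> then \<one> else \<zero>) = \<alpha> g (if n = \<one>\<^bsub>P\<^esub> then \<one> else \<zero>)"
        using gset_cancel[OF G.is_group gs, of g n "\<one>\<^bsub>P\<^esub>"] binv(2)[of g n] by auto
    qed auto
    show "antipode H h \<in> C" if "h \<in> C" for h
      unfolding antipode_H using that binv(1) bc by (intro inC) (auto simp: equivariant_def cC eC simp flip: binv)
  qed (auto simp: one_H counit_H antipode_H comult)
qed

text \<open>Composition with \<open>\<pi>\<close> matches the equivariant functions on the two sets.
  It replaces \<open>J \<times> G'\<close> by \<open>G\<close>, and \<open>N1 \<times> N2\<close> by
  the group of all \<open>iota\<close> of its pairs.\<close>

lemma form_transport: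
  assumes M: "form L G \<alpha> K M U a e" and gs: "gset G U' a'" and bij: "bij_betw \<pi> U' U"
    and eq: "\<And>g x. g \<in> carrier G \<Longrightarrow> x \<in> U' \<Longrightarrow> \<pi> (a' g x) = a g (\<pi> x)"
  shows "form L G \<alpha> K M U' a' (\<lambda>m x. e m (\<pi> x))"
proof -
  have \<pi>: "\<pi> x \<in> U" if "x \<in> U'" for x using bij that by (auto simp: bij_betw_def)
  have surj: "\<exists>x'\<in>U'. x = \<pi> x'" if "x \<in> U" for x using bij that by (auto simp: bij_betw_def)
  show ?thesis
    unfolding form_def
  proof (intro conjI ballI impI allI gs)
    show "kfun L K M U' (\<lambda>m x. e m (\<pi> x))"
      using form_kfun[OF M] \<pi> unfolding kfun_def by auto
    show "equivariant L G \<alpha> U' a' (\<lambda>x. e m (\<pi> x))" if "m \<in> carrier M" for m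
      using form_equivariant[OF M that] \<pi> eq unfolding equivariant_def by auto
    show "m = m'" if "m \<in> carrier M" "m' \<in> carrier M" "\<forall>x\<in>U'. e m (\<pi> x) = e m' (\<pi> x)" for m m'
      by (rule form_inj[OF M that(1,2)]) (use surj that(3) in blast)
    fix u assume u: "equivariant L G \<alpha> U' a' u"
    let ?i = "inv_into U' \<pi>"
    have i: "?i x \<in> U'" "\<pi> (?i x) = x" if "x \<in> U" for x
      using bij_betw_imp_surj_on[OF bij] that by (auto intro: inv_into_into f_inv_into_f)
    have i2: "?i (\<pi> x) = x" if "x \<in> U'" for x using bij that by (simp add: bij_betw_inv_into_left)
    have "equivariant L G \<alpha> U a (\<lambda>x. u (?i x))"
      unfolding equivariant_def
    proof (intro conjI ballI)
      fix x assume x: "x \<in> U"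
      show "u (?i x) \<in> carrier L" using equivariant_closed[OF u] i x by auto
      fix g assume g: "g \<in> carrier G"
      have "?i (a g x) = a' g (?i x)" using eq[OF g i(1)[OF x]] i[OF x] i2 gset_closed[OF gs g] by metis
      then show "u (?i (a g x)) = \<alpha> g (u (?i x))" using equivariant_eq[OF u g i(1)[OF x]] by simp
    qed
    from form_surj[OF M this] obtain m where "m \<in> carrier M" "\<forall>x\<in>U. e m x = u (?i x)" by auto
    then show "\<exists>m\<in>carrier M. \<forall>x\<in>U'. e m (\<pi> x) = u x" using i2 \<pi> by (intro bexI[of _ m]) auto
  qed
qed

end

section \<open>Tensor products and scalar extensions of Hopf forms\<close>

context galois_action begin

text \<open>The tensor product is at first a form of \<open>P \<times> Q\<close>; an isomorphic
  group \<open>S\<close> is allowed so that the result can be compared directly with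
  \<open>induced_subgroup\<close>. The comultiplication is a threefold nested lift, resolved from
  the inside: \<open>inner\<close> for the legs of \<open>b\<close>, \<open>middle\<close> for the
  legs of \<open>a\<close>, and finally the tensor itself.\<close>

theorem tensor_hopf_form:
  fixes A :: "('l, 'a, 'n) hopf_scheme" and B :: "('l, 'b, 'o) hopf_scheme"
    and P :: "('p, 's) monoid_scheme" and Q :: "('q, 't) monoid_scheme" and S :: "('u, 'v) monoid_scheme"
  assumes A: "hopf_form L G \<alpha> K A P a e" and B: "hopf_form L G \<alpha> K B Q b f"
    and S: "group S" "gset G (carrier S) c"
    and \<pi>: "bij_betw \<pi> (carrier S) (carrier P \<times> carrier Q)"
    and \<pi>_mult: "\<And>s t. s \<in> carrier S \<Longrightarrow> t \<in> carrier S \<Longrightarrow>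
        \<pi> (s \<otimes>\<^bsub>S\<^esub> t) = (fst (\<pi> s) \<otimes>\<^bsub>P\<^esub> fst (\<pi> t), snd (\<pi> s) \<otimes>\<^bsub>Q\<^esub> snd (\<pi> t))"
    and \<pi>_eq: "\<And>g s. g \<in> carrier G \<Longrightarrow> s \<in> carrier S \<Longrightarrow> \<pi> (c g s) = (a g (fst (\<pi> s)), b g (snd (\<pi> s)))"
  shows "hopf_form L G \<alpha> K (tensor_hopf Kr A B) S c (\<lambda>t s. ev L Kr A B e f t (\<pi> s))"
proof -
  interpret P: group P by (rule hopf_form_group[OF A])
  interpret Q: group Q by (rule hopf_form_group[OF B])
  interpret S: group S by (rule S(1))
  note Af = hopf_form_form[OF A] and Bf = hopf_form_form[OF B]
  note Ak = form_kfun[OF Af] and Bk = form_kfun[OF Bf]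
  note Acl = form_closed[OF Af] and Bcl = form_closed[OF Bf]
  note Pfin = form_finite[OF Af] and Qfin = form_finite[OF Bf]
  interpret AB: module_pair Kr A B by (rule module_pair_kfun[OF Ak Bk])
  define T where "T = tensor Kr A B"
  let ?E = "ev L Kr A B e f"
  let ?e = "\<lambda>t s. ?E t (\<pi> s)"
  let ?H = "tensor_hopf Kr A B"
  have \<pi>c: "fst (\<pi> s) \<in> carrier P" "snd (\<pi> s) \<in> carrier Q" "\<pi> s \<in> carrier P \<times> carrier Q" if "s \<in> carrier S" for s
    using bij_betw_apply[OF \<pi> that] by auto
  have \<pi>inj: "\<pi> s = \<pi> t \<longleftrightarrow> s = t" if "s \<in> carrier S" "t \<in> carrier S" for s t
    using \<pi> that by (auto simp: bij_betw_def inj_on_def)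
  have \<pi>one: "\<pi> \<one>\<^bsub>S\<^esub> = (\<one>\<^bsub>P\<^esub>, \<one>\<^bsub>Q\<^esub>)"
  proof -
    have "\<pi> \<one>\<^bsub>S\<^esub> = (fst (\<pi> \<one>\<^bsub>S\<^esub>) \<otimes>\<^bsub>P\<^esub> fst (\<pi> \<one>\<^bsub>S\<^esub>), snd (\<pi> \<one>\<^bsub>S\<^esub>) \<otimes>\<^bsub>Q\<^esub> snd (\<pi> \<one>\<^bsub>S\<^esub>))"
      using \<pi>_mult[of "\<one>\<^bsub>S\<^esub>" "\<one>\<^bsub>S\<^esub>"] by simp
    then have "fst (\<pi> \<one>\<^bsub>S\<^esub>) = fst (\<pi> \<one>\<^bsub>S\<^esub>) \<otimes>\<^bsub>P\<^esub> fst (\<pi> \<one>\<^bsub>S\<^esub>)" "snd (\<pi> \<one>\<^bsub>S\<^esub>) = snd (\<pi> \<one>\<^bsub>S\<^esub>) \<otimes>\<^bsub>Q\<^esub> snd (\<pi> \<one>\<^bsub>S\<^esub>)"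
      by (metis fst_conv, metis snd_conv)
    then show ?thesis using \<pi>c[OF S.one_closed] P.l_cancel_one Q.l_cancel_one by (metis prod.collapse)
  qed
  have \<pi>inv: "\<pi> (inv\<^bsub>S\<^esub> s) = (inv\<^bsub>P\<^esub> fst (\<pi> s), inv\<^bsub>Q\<^esub> snd (\<pi> s))" if s: "s \<in> carrier S" for s
  proof -
    have "fst (\<pi> (inv\<^bsub>S\<^esub> s)) \<otimes>\<^bsub>P\<^esub> fst (\<pi> s) = \<one>\<^bsub>P\<^esub>" "snd (\<pi> (inv\<^bsub>S\<^esub> s)) \<otimes>\<^bsub>Q\<^esub> snd (\<pi> s) = \<one>\<^bsub>Q\<^esub>"
      using \<pi>_mult[of "inv\<^bsub>S\<^esub> s" s] s \<pi>one by auto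
    then show ?thesis
      using \<pi>c[OF s] \<pi>c[OF S.inv_closed[OF s]] P.inv_equality Q.inv_equality by (metis prod.collapse)
  qed
  note Tf = form_tensor[OF Af Bf]
  have fS: "form L G \<alpha> K T (carrier S) c ?e"
    using form_transport[OF Tf S(2) \<pi>] \<pi>_eq unfolding T_def by auto
  have Hf: "carrier ?H = carrier T" "ring.add ?H = ring.add T" "smult ?H = smult T"
    "monoid.mult ?H = monoid.mult T" "monoid.one ?H = monoid.one T" "ring.zero ?H = ring.zero T"
    by (simp_all add: tensor_hopf_def hopf_of_def Let_def T_def)
  have fH: "form L G \<alpha> K ?H (carrier S) c ?e"
  proof (rule formI[OF S(2)])
    interpret T: module Kr T by (rule form_module[OF fS])
    show "\<zero>\<^bsub>?H\<^esub> \<in> carrier ?H" unfolding Hf by simp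
    show "?e \<zero>\<^bsub>?H\<^esub> x = \<zero>" if "x \<in> carrier S" for x
      unfolding Hf using ev_one[OF Ak Bk, of "fst (\<pi> x)" "snd (\<pi> x)"] \<pi>c[OF that] by (simp add: T_def)
  qed (use form_equivariant[OF fS] form_inj[OF fS] form_surj[OF fS] form_add[OF fS] form_smult[OF fS]
        module.smult_closed[OF form_module[OF fS]] abelian_group.axioms(1)[OF module.axioms(2)[OF form_module[OF fS]]] abelian_monoid.a_closed in \<open>auto simp: Hf\<close>)
  \<comment> \<open>The Hopf record and its underlying tensor product share their module structure,
    so tensor squares and evaluations over either agree.\<close>
  have TT: "tensor_group Kr ?H ?H = tensor_group Kr T T" "ev L Kr ?H ?H = ev L Kr T T" "tens Kr ?H ?H = tens Kr T T"
    by (rule tensor_group_cong ev_cong tens_cong; simp add: Hf)+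
  note Tk = form_kfun[OF fS]
  interpret T2: module_pair Kr T T by (rule module_pair_kfun[OF Tk Tk])
  have carT: "carrier T = carrier AB.TG" by (simp add: T_def)
  have embTT: "emb L T2.TG (carrier S \<times> carrier S) (ev L Kr T T ?e ?e)" by (rule tensor_emb[OF fS fS])
  show ?thesis
    unfolding hopf_form_def
  proof (intro conjI fH S(1))
    note ml = tensor_mult_law[OF Af Bf hopf_form_mult_law[OF A] hopf_form_mult_law[OF B]]
    show "mult_law L ?H (carrier S) ?e (carrier S) (\<lambda>p i. i) (\<lambda>p i. inv\<^bsub>S\<^esub> i \<otimes>\<^bsub>S\<^esub> p)"
      unfolding mult_law_def Hf
    proof (intro conjI ballI)
      show "finite (carrier S)" by (rule form_finite[OF fS])
      fix s t assume st: "s \<in> carrier T" "t \<in> carrier T"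
      show "s \<otimes>\<^bsub>T\<^esub> t \<in> carrier T" using mult_law_closed[OF ml] st unfolding T_def by blast
      fix p assume p: "p \<in> carrier S"
      have "?E (s \<otimes>\<^bsub>T\<^esub> t) (\<pi> p) = (\<Oplus>i\<in>carrier P \<times> carrier Q. ?E s (fst i, snd i) \<otimes>
          ?E t (inv\<^bsub>P\<^esub> fst i \<otimes>\<^bsub>P\<^esub> fst (\<pi> p), inv\<^bsub>Q\<^esub> snd i \<otimes>\<^bsub>Q\<^esub> snd (\<pi> p)))"
        using mult_law_eq[OF ml, of s t "\<pi> p"] st \<pi>c[OF p] unfolding T_def by blast
      also have "\<dots> = (\<Oplus>i\<in>carrier S. ?E s (fst (\<pi> i), snd (\<pi> i)) \<otimes>
          ?E t (inv\<^bsub>P\<^esub> fst (\<pi> i) \<otimes>\<^bsub>P\<^esub> fst (\<pi> p), inv\<^bsub>Q\<^esub> snd (\<pi> i) \<otimes>\<^bsub>Q\<^esub> snd (\<pi> p)))"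
        using st \<pi>c[OF p] ev_closed[OF Ak Bk] carT by (intro finsum_reindex_bij[OF \<pi>]) auto
      also have "\<dots> = (\<Oplus>i\<in>carrier S. ?E s (\<pi> i) \<otimes> ?E t (\<pi> (inv\<^bsub>S\<^esub> i \<otimes>\<^bsub>S\<^esub> p)))"
        using p by (intro finsum_cong_pointwise) (simp add: \<pi>_mult \<pi>inv)
      finally show "?E (s \<otimes>\<^bsub>T\<^esub> t) (\<pi> p) = (\<Oplus>i\<in>carrier S. ?E s (\<pi> i) \<otimes> ?E t (\<pi> (inv\<^bsub>S\<^esub> i \<otimes>\<^bsub>S\<^esub> p)))" .
    qed auto
    show "\<one>\<^bsub>?H\<^esub> \<in> carrier ?H"
      unfolding Hf T_def AB.tensor_one using hopf_form_one(1)[OF A] hopf_form_one(1)[OF B] by simp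
    show "\<forall>n\<in>carrier S. ?e \<one>\<^bsub>?H\<^esub> n = (if n = \<one>\<^bsub>S\<^esub> then \<one> else \<zero>)"
    proof
      fix n assume n: "n \<in> carrier S"
      have "?e \<one>\<^bsub>?H\<^esub> n = ?E (tens Kr A B \<one>\<^bsub>A\<^esub> \<one>\<^bsub>B\<^esub>) (fst (\<pi> n), snd (\<pi> n))"
        unfolding Hf T_def AB.tensor_one by simp
      also have "\<dots> = (if \<pi> n = \<pi> \<one>\<^bsub>S\<^esub> then \<one> else \<zero>)"
        using \<pi>c[OF n] hopf_form_one[OF A] hopf_form_one[OF B]
        by (subst ev_tens[OF Ak Bk]) (auto simp: \<pi>one prod_eq_iff)
      finally show "?e \<one>\<^bsub>?H\<^esub> n = (if n = \<one>\<^bsub>S\<^esub> then \<one> else \<zero>)" using n by (simp add: \<pi>inj)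
    qed
    have "antipode ?H = tensor_map Kr A B A B (antipode A) (antipode B)"
      by (simp add: tensor_hopf_def hopf_of_def Let_def)
    moreover have "tensor_map Kr A B A B (antipode A) (antipode B) h \<in> carrier AB.TG"
      "\<And>x y. x \<in> carrier P \<Longrightarrow> y \<in> carrier Q \<Longrightarrow> ?E (tensor_map Kr A B A B (antipode A) (antipode B) h) (x, y) =
        (if True \<and> True then ?E h (inv\<^bsub>P\<^esub> x, inv\<^bsub>Q\<^esub> y) else \<zero>)" if "h \<in> carrier AB.TG" for h
      by (rule tensor_map_val[OF Ak Bk Af Bf, where B = "\<lambda>_. True" and C = "\<lambda>_. True"
            and \<pi> = "m_inv P" and \<rho> = "m_inv Q"];
          use that hopf_form_antipode[OF A] hopf_form_antipode[OF B] in auto)+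
    ultimately show "\<forall>h\<in>carrier ?H. antipode ?H h \<in> carrier ?H \<and> (\<forall>n\<in>carrier S. ?e (antipode ?H h) n = ?e h (inv\<^bsub>S\<^esub> n))"
      using \<pi>c unfolding Hf carT by (metis \<pi>inv prod.collapse)
    show "\<forall>h\<in>carrier ?H. counit ?H h = (\<Oplus>n\<in>carrier S. ?e h n)"
    proof
      fix h assume "h \<in> carrier ?H"
      then have h: "h \<in> carrier AB.TG" unfolding Hf carT .
      let ?\<beta> = "\<lambda>a b. counit A a \<otimes>\<^bsub>Kr\<^esub> counit B b" and ?\<Psi> = "\<lambda>z u. \<Oplus>p\<in>carrier P \<times> carrier Q. u p"
      have KR: "comm_group (add_monoid Kr)"
        using Kr_field by (intro comm_group_add_monoid) (simp add: field_def domain_def cring_def ring_def)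
      \<comment> \<open>Scalars are treated as functions on a one-point set, which makes the counit
        another instance of \<open>lift_into\<close>.\<close>
      have Ke: "emb L (add_monoid Kr) {()} (\<lambda>r _. r)"
        unfolding emb_def using KR K_subset by auto
      have kk: "counit A m \<in> K" "counit A m \<in> carrier L" if "m \<in> carrier A" for m
        using hopf_form_counit_K[OF A that] K_subset by auto
      have kk': "counit B m \<in> K" "counit B m \<in> carrier L" if "m \<in> carrier B" for m
        using hopf_form_counit_K[OF B that] K_subset by auto
      have c: "?\<beta> m n \<in> carrier (add_monoid Kr)" if "m \<in> carrier A" "n \<in> carrier B" for m n
        using kk[OF that(1)] kk'[OF that(2)] by (simp add: K_eq \<alpha>_times)
      have v: "?\<beta> m n = ?\<Psi> () (\<lambda>p. e m (fst p) \<otimes> f n (snd p))"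
        if "m \<in> carrier A" "n \<in> carrier B" for m n and z :: unit
      proof -
        have "?\<beta> m n = (\<Oplus>x\<in>carrier P. \<Oplus>y\<in>carrier Q. e m x \<otimes> f n y)"
          using that Acl Bcl Pfin Qfin
          by (simp add: hopf_form_counit[OF A] hopf_form_counit[OF B] finsum_mult)
        also have "\<dots> = ?\<Psi> () (\<lambda>p. e m (fst p) \<otimes> f n (snd p))"
          using that Acl Bcl Pfin Qfin by (subst finsum_cartesian) auto
        finally show ?thesis .
      qed
      have ad: "addfun L (carrier P \<times> carrier Q) (?\<Psi> z)" for z :: unit
        by (rule addfun_sum(3)[where c = "\<lambda>_. \<zero>"]) (use Pfin Qfin in auto)
      have "counit ?H h = tensor_lift Kr A B (add_monoid Kr) ?\<beta> h"
        by (simp add: tensor_hopf_def hopf_of_def Let_def)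
      also have "\<dots> = ?\<Psi> () (?E h)"
        by (rule lift_into_val[OF Ak Bk Ke, where \<beta> = ?\<beta> and \<Psi> = ?\<Psi>, OF c v ad h]) auto
      also have "\<dots> = (\<Oplus>n\<in>carrier S. ?e h n)"
        using ev_closed[OF Ak Bk h] by (intro finsum_reindex_bij[OF \<pi>]) auto
      finally show "counit ?H h = (\<Oplus>n\<in>carrier S. ?e h n)" .
    qed
    show "\<forall>h\<in>carrier ?H. comult ?H h \<in> carrier (tensor_group Kr ?H ?H) \<and>
      (\<forall>n\<in>carrier S. \<forall>m\<in>carrier S. ev L Kr ?H ?H ?e ?e (comult ?H h) (n, m) = (if n = m then ?e h n else \<zero>))"
    proof
      fix h assume "h \<in> carrier ?H"
      then have h: "h \<in> carrier AB.TG" unfolding Hf carT .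
      let ?EE = "ev L Kr T T ?e ?e"
      let ?b0 = "\<lambda>a1 a2 b1 b2. tens Kr T T (tens Kr A B a1 b1) (tens Kr A B a2 b2)"
      let ?b1 = "\<lambda>s a1 a2. tensor_lift Kr B B T2.TG (?b0 a1 a2) s"
      let ?b2 = "\<lambda>a b. tensor_lift Kr A A T2.TG (?b1 (comult B b)) (comult A a)"
      have inner: "?b1 s a1 a2 \<in> carrier T2.TG"
        "\<And>z. z \<in> carrier S \<times> carrier S \<Longrightarrow> ?EE (?b1 s a1 a2) z =
          (e a1 (fst (\<pi> (fst z))) \<otimes> e a2 (fst (\<pi> (snd z)))) \<otimes> ev L Kr B B f f s (snd (\<pi> (fst z)), snd (\<pi> (snd z)))"
        if as: "a1 \<in> carrier A" "a2 \<in> carrier A" and s: "s \<in> carrier (tensor_group Kr B B)" for s a1 a2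
      proof -
        let ?\<Psi> = "\<lambda>z u. (e a1 (fst (\<pi> (fst z))) \<otimes> e a2 (fst (\<pi> (snd z)))) \<otimes> u (snd (\<pi> (fst z)), snd (\<pi> (snd z)))"
        have c: "?b0 a1 a2 m n \<in> carrier T2.TG" if "m \<in> carrier B" "n \<in> carrier B" for m n
          using that as by (intro T2.tens_closed) (auto simp: carT)
        have v: "?EE (?b0 a1 a2 m n) z = ?\<Psi> z (\<lambda>p. f m (fst p) \<otimes> f n (snd p))"
          if "m \<in> carrier B" "n \<in> carrier B" and z: "z \<in> carrier S \<times> carrier S" for m n z
        proof -
          obtain p q where z': "z = (p, q)" "p \<in> carrier S" "q \<in> carrier S" using z by auto
          have "?E (tens Kr A B a1 m) (fst (\<pi> p), snd (\<pi> p)) = e a1 (fst (\<pi> p)) \<otimes> f m (snd (\<pi> p))"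
            "?E (tens Kr A B a2 n) (fst (\<pi> q), snd (\<pi> q)) = e a2 (fst (\<pi> q)) \<otimes> f n (snd (\<pi> q))"
            by (rule ev_tens[OF Ak Bk]; use that as z' \<pi>c in simp)+
          then show ?thesis
            using z' that as Acl Bcl \<pi>c by (simp add: ev_tens[OF Tk Tk] carT m_ac)
        qed
        have ad: "addfun L (carrier Q \<times> carrier Q) (?\<Psi> z)" if "z \<in> carrier S \<times> carrier S" for z
          by (rule addfun_eval) (use that as Acl \<pi>c in auto)
        show "?b1 s a1 a2 \<in> carrier T2.TG"
          by (rule lift_into_closed[OF Bk Bk embTT, where \<beta> = "?b0 a1 a2" and \<Psi> = ?\<Psi>, OF c v ad s])
        show "?EE (?b1 s a1 a2) z = ?\<Psi> z (ev L Kr B B f f s)" if "z \<in> carrier S \<times> carrier S" for z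
          by (rule lift_into_val[OF Bk Bk embTT, where \<beta> = "?b0 a1 a2" and \<Psi> = ?\<Psi>, OF c v ad s that])
      qed
      have middle: "?b2 m n \<in> carrier T2.TG"
        "\<And>z. z \<in> carrier S \<times> carrier S \<Longrightarrow> ?EE (?b2 m n) z =
          (if fst z = snd z then e m (fst (\<pi> (fst z))) \<otimes> f n (snd (\<pi> (fst z))) else \<zero>)"
        if m: "m \<in> carrier A" and n: "n \<in> carrier B" for m n
      proof -
        note DA = hopf_form_comult[OF A m] and DB = hopf_form_comult[OF B n]
        let ?\<Psi> = "\<lambda>z u. u (fst (\<pi> (fst z)), fst (\<pi> (snd z))) \<otimes> ev L Kr B B f f (comult B n) (snd (\<pi> (fst z)), snd (\<pi> (snd z)))"
        have c: "?b1 (comult B n) a1 a2 \<in> carrier T2.TG" if "a1 \<in> carrier A" "a2 \<in> carrier A" for a1 a2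
          by (rule inner(1)[OF that DB(1)])
        have v: "?EE (?b1 (comult B n) a1 a2) z = ?\<Psi> z (\<lambda>p. e a1 (fst p) \<otimes> e a2 (snd p))"
          if "a1 \<in> carrier A" "a2 \<in> carrier A" "z \<in> carrier S \<times> carrier S" for a1 a2 z
          using inner(2)[OF that(1,2) DB(1) that(3)] by simp
        have ad: "addfun L (carrier P \<times> carrier P) (?\<Psi> z)" if "z \<in> carrier S \<times> carrier S" for z
          by (rule addfun_eval) (use that \<pi>c ev_closed[OF Bk Bk DB(1)] in auto)
        show "?b2 m n \<in> carrier T2.TG"
          by (rule lift_into_closed[OF Ak Ak embTT, where \<beta> = "?b1 (comult B n)" and \<Psi> = ?\<Psi>, OF c v ad DA(1)])
        fix z assume z: "z \<in> carrier S \<times> carrier S"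
        then obtain p q where pq: "z = (p, q)" "p \<in> carrier S" "q \<in> carrier S" by auto
        have "?EE (?b2 m n) z = ?\<Psi> z (ev L Kr A A e e (comult A m))"
          by (rule lift_into_val[OF Ak Ak embTT, where \<beta> = "?b1 (comult B n)" and \<Psi> = ?\<Psi>, OF c v ad DA(1) z])
        \<comment> \<open>The diagonal conditions in \<open>P\<close> and in \<open>Q\<close>
          together say that the two images under \<open>\<pi>\<close> are equal.\<close>
        also have "\<dots> = (if \<pi> p = \<pi> q then e m (fst (\<pi> p)) \<otimes> f n (snd (\<pi> p)) else \<zero>)"
          using pq \<pi>c Acl[OF m] Bcl[OF n] by (auto simp: DA DB prod_eq_iff)
        finally show "?EE (?b2 m n) z = (if fst z = snd z then e m (fst (\<pi> (fst z))) \<otimes> f n (snd (\<pi> (fst z))) else \<zero>)"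
          using pq by (simp add: \<pi>inj)
      qed
      let ?\<Psi> = "\<lambda>z u. if fst z = snd z then u (\<pi> (fst z)) else \<zero>"
      have v: "?EE (?b2 m n) z = ?\<Psi> z (\<lambda>p. e m (fst p) \<otimes> f n (snd p))"
        if "m \<in> carrier A" "n \<in> carrier B" "z \<in> carrier S \<times> carrier S" for m n z
        using middle(2)[OF that] by simp
      have ad: "addfun L (carrier P \<times> carrier Q) (?\<Psi> z)" if "z \<in> carrier S \<times> carrier S" for z
        by (rule addfun_eval) (use that \<pi>c in auto)
      have eq: "comult ?H h = tensor_lift Kr A B T2.TG ?b2 h"
        by (simp add: tensor_hopf_def hopf_of_def Let_def T_def)
      have "comult ?H h \<in> carrier T2.TG"
        unfolding eq by (rule lift_into_closed[OF Ak Bk embTT, where \<beta> = ?b2 and \<Psi> = ?\<Psi>, OF middle(1) v ad h])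
      moreover have "?EE (comult ?H h) (n, m) = (if n = m then ?e h n else \<zero>)" if "n \<in> carrier S" "m \<in> carrier S" for n m
        using lift_into_val[OF Ak Bk embTT, where \<beta> = ?b2 and \<Psi> = ?\<Psi>, OF middle(1) v ad h, of "(n, m)"] that
        unfolding eq by simp
      ultimately show "comult ?H h \<in> carrier (tensor_group Kr ?H ?H) \<and>
        (\<forall>n\<in>carrier S. \<forall>m\<in>carrier S. ev L Kr ?H ?H ?e ?e (comult ?H h) (n, m) = (if n = m then ?e h n else \<zero>))"
        unfolding TT by blast
    qed
  qed
qed

end

lemma sub_alg_simps [simp]:
  "carrier (sub_alg L E) = E" "monoid.mult (sub_alg L E) = monoid.mult L" "\<one>\<^bsub>sub_alg L E\<^esub> = \<one>\<^bsub>L\<^esub>"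
  "\<zero>\<^bsub>sub_alg L E\<^esub> = \<zero>\<^bsub>L\<^esub>" "ring.add (sub_alg L E) = ring.add L" "smult (sub_alg L E) = monoid.mult L"
  by (simp_all add: sub_alg_def)

context galois_action begin

text \<open>Elements that fix \<open>V\<close> pointwise carry \<open>u0\<close> to every point of
  \<open>U\<close>, so equivariance spreads the values at \<open>u0\<close> over all of
  \<open>V \<times> U\<close>.\<close>

lemma restriction_injective:
  assumes u: "equivariant L G \<alpha> (V \<times> U) (\<lambda>g p. (b g (fst p), a g (snd p))) u"
    and v: "equivariant L G \<alpha> (V \<times> U) (\<lambda>g p. (b g (fst p), a g (snd p))) v"
    and u0: "u0 \<in> U" and s: "\<And>x. x \<in> U \<Longrightarrow> \<exists>s\<in>carrier G. a s u0 = x \<and> (\<forall>n\<in>V. b s n = n)"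
    and eq: "\<And>n. n \<in> V \<Longrightarrow> u (n, u0) = v (n, u0)" and p: "p \<in> V \<times> U"
  shows "u p = v p"
proof -
  obtain n x where nx: "p = (n, x)" "n \<in> V" "x \<in> U" using p by auto
  obtain t where t: "t \<in> carrier G" "a t u0 = x" "\<forall>n\<in>V. b t n = n" using s[OF nx(3)] by blast
  have "u (n, x) = \<alpha> t (u (n, u0))" "v (n, x) = \<alpha> t (v (n, u0))"
    using equivariant_eq[OF u t(1), of "(n, u0)"] equivariant_eq[OF v t(1), of "(n, u0)"] t nx u0 by auto
  then show ?thesis using nx eq by simp
qed

text \<open>Choose \<open>t x\<close> fixing \<open>V\<close> pointwise and moving \<open>u0\<close>
  to \<open>x\<close>, and give the extension the value \<open>\<alpha> (t x) (v n)\<close> at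
  \<open>(n, x)\<close>. The choice is free up to the stabilizer \<open>G'\<close> of
  \<open>u0\<close>, and there \<open>v\<close> is equivariant.\<close>

lemma restriction_surjective:
  assumes gs: "gset G V b" "gset G U a" and G': "subgroup G' G"
    and v: "equivariant L (G\<lparr>carrier := G'\<rparr>) \<alpha> V b v" and u0: "u0 \<in> U"
    and s: "\<And>x. x \<in> U \<Longrightarrow> \<exists>s\<in>carrier G. a s u0 = x \<and> (\<forall>n\<in>V. b s n = n)"
    and stab: "\<And>g. g \<in> carrier G \<Longrightarrow> a g u0 = u0 \<Longrightarrow> g \<in> G'" "\<And>g. g \<in> G' \<Longrightarrow> a g u0 = u0"
  shows "\<exists>u. equivariant L G \<alpha> (V \<times> U) (\<lambda>g p. (b g (fst p), a g (snd p))) u \<and> (\<forall>n\<in>V. u (n, u0) = v n)"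
proof -
  have vc: "v n \<in> carrier L" if "n \<in> V" for n using equivariant_closed[OF v that] .
  have ve: "v (b g n) = \<alpha> g (v n)" if "g \<in> G'" "n \<in> V" for g n
    using equivariant_eq[OF v, of g n] that by simp
  obtain t where t: "\<And>x. x \<in> U \<Longrightarrow> t x \<in> carrier G" "\<And>x. x \<in> U \<Longrightarrow> a (t x) u0 = x" "\<And>x n. x \<in> U \<Longrightarrow> n \<in> V \<Longrightarrow> b (t x) n = n"
    using s by metis
  define u where "u = (\<lambda>p. \<alpha> (t (snd p)) (v (fst p)))"
  have "equivariant L G \<alpha> (V \<times> U) (\<lambda>g p. (b g (fst p), a g (snd p))) u"
    unfolding equivariant_def
  proof (intro conjI ballI)
    fix p assume p: "p \<in> V \<times> U"
    then obtain n x where nx: "p = (n, x)" "n \<in> V" "x \<in> U" by auto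
    show "u p \<in> carrier L" using nx t vc by (simp add: u_def)
    fix g assume g: "g \<in> carrier G"
    define y where "y = a g x"
    have y: "y \<in> U" using gset_closed[OF gs(2) g] nx by (simp add: y_def)
    note gi = gset_inv[OF G.is_group]
    \<comment> \<open>Compares two ways from \<open>u0\<close> to \<open>y\<close>: through
      \<open>x\<close> and then by \<open>g\<close>, or directly by \<open>t y\<close>. Their
      quotient fixes \<open>u0\<close>, so it lies in \<open>G'\<close>, and it acts on
      \<open>n\<close> as \<open>g\<close> does.\<close>
    let ?k = "inv\<^bsub>G\<^esub> t y \<otimes>\<^bsub>G\<^esub> (g \<otimes>\<^bsub>G\<^esub> t x)"
    have k: "?k \<in> carrier G" using t y nx g by auto
    have "a ?k u0 = a (inv\<^bsub>G\<^esub> t y) y"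
      using t y nx g u0 by (simp add: gset_mult[OF gs(2)] y_def)
    also have "\<dots> = a (inv\<^bsub>G\<^esub> t y) (a (t y) u0)" using t(2)[OF y] by simp
    also have "\<dots> = u0" using gi(1)[OF gs(2) t(1)[OF y] u0] .
    finally have kG: "?k \<in> G'" using stab(1)[OF k] by simp
    have gn: "b g n \<in> V" using gset_closed[OF gs(1) g nx(2)] .
    have "b ?k n = b (inv\<^bsub>G\<^esub> t y) (b g n)"
      using t y nx g by (simp add: gset_mult[OF gs(1)])
    also have "\<dots> = b (inv\<^bsub>G\<^esub> t y) (b (t y) (b g n))" using t(3)[OF y gn] by simp
    also have "\<dots> = b g n" using gi(1)[OF gs(1) t(1)[OF y] gn] .
    finally have "v (b g n) = \<alpha> ?k (v n)" using ve[OF kG nx(2)] by simp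
    then have "\<alpha> (t y) (v (b g n)) = \<alpha> (t y \<otimes>\<^bsub>G\<^esub> ?k) (v n)"
      using t y k vc nx by (simp add: \<alpha>_mult)
    also have "t y \<otimes>\<^bsub>G\<^esub> ?k = g \<otimes>\<^bsub>G\<^esub> t x"
      using t y nx g by (simp add: G.m_assoc[symmetric])
    finally show "u (b g (fst p), a g (snd p)) = \<alpha> g (u p)"
      using nx t g vc by (simp add: u_def y_def[symmetric] \<alpha>_mult)
  qed
  moreover have "u (n, u0) = v n" if n: "n \<in> V" for n
  proof -
    have "t u0 \<in> G'" using stab(1) t u0 by auto
    then show ?thesis using ve[of "t u0" n] t(3)[OF u0 n] n by (simp add: u_def)
  qed
  ultimately show ?thesis by blast
qed

text \<open>Values are taken at the second coordinate \<open>u0\<close>, where an element of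
  \<open>E\<close> evaluates to itself; there the extended scalars act by plain multiplication, and
  what is left of equivariance is that for the stabilizer \<open>G'\<close>. The restriction lemmas
  show that a tensor is determined by these values and that every \<open>G'\<close>-equivariant
  function occurs.\<close>

theorem base_change_form:
  fixes A :: "('l, 'a, 'n) hopf_scheme" and P :: "('p, 's) monoid_scheme"
  assumes G': "subgroup G' G" and E: "galois_action L (G\<lparr>carrier := G'\<rparr>) \<alpha> E"
    and A: "hopf_form L G \<alpha> K A P b e"
    and B: "form L G \<alpha> K (sub_alg L E) U a f"
    and fmult: "\<And>x y p. x \<in> E \<Longrightarrow> y \<in> E \<Longrightarrow> p \<in> U \<Longrightarrow> f (x \<otimes> y) p = f x p \<otimes> f y p"
    and fone: "\<And>p. p \<in> U \<Longrightarrow> f \<one> p = \<one>"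
    and u0: "u0 \<in> U" "\<And>x. x \<in> E \<Longrightarrow> f x u0 = x"
    and s: "\<And>x. x \<in> U \<Longrightarrow> \<exists>s\<in>carrier G. a s u0 = x \<and> (\<forall>n\<in>carrier P. b s n = n)"
    and stab: "\<And>g. g \<in> carrier G \<Longrightarrow> a g u0 = u0 \<Longrightarrow> g \<in> G'" "\<And>g. g \<in> G' \<Longrightarrow> a g u0 = u0"
  shows "hopf_form L (G\<lparr>carrier := G'\<rparr>) \<alpha> E (base_change Kr A (sub_alg L E)) P b
    (\<lambda>t n. ev L Kr A (sub_alg L E) e f t (n, u0))"
proof -
  let ?G' = "G\<lparr>carrier := G'\<rparr>" and ?B = "sub_alg L E"
  interpret E: galois_action L ?G' \<alpha> E by (rule E)
  let ?Er = "L\<lparr>carrier := E\<rparr>"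
  interpret P: group P by (rule hopf_form_group[OF A])
  note Af = hopf_form_form[OF A]
  note Ak = form_kfun[OF Af] and Bk = form_kfun[OF B]
  note Acl = form_closed[OF Af] and Bcl = form_closed[OF B]
  note Pfin = form_finite[OF Af]
  interpret AB: module_pair Kr A ?B by (rule module_pair_kfun[OF Ak Bk])
  define T where "T = tensor Kr A ?B"
  let ?E = "ev L Kr A ?B e f" and ?H = "base_change Kr A ?B"
  let ?e = "\<lambda>t n. ?E t (n, u0)"
  note Tf = form_tensor[OF Af B]
  have EL: "E \<subseteq> carrier L" by (rule E.K_subset)
  have EE: "\<one> \<in> E" "x \<in> E \<Longrightarrow> y \<in> E \<Longrightarrow> x \<otimes> y \<in> E" for x y
    by (auto simp: E.K_eq \<alpha>_times E.\<alpha>_times)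
  have carT: "carrier T = carrier AB.TG" by (simp add: T_def)
  have Hf: "carrier ?H = carrier T" "ring.add ?H = ring.add T" "monoid.mult ?H = monoid.mult T"
    "monoid.one ?H = monoid.one T" "ring.zero ?H = ring.zero T"
    "smult ?H = (\<lambda>s. tensor_lift Kr A ?B AB.TG (\<lambda>h x. tens Kr A ?B h (s \<otimes> x)))"
    by (simp_all add: base_change_def hopf_of_def Let_def T_def)
  have gs': "gset ?G' (carrier P) b"
    using form_gset[OF Af] subgroup.subset[OF G'] unfolding gset_def by (simp add: subset_iff)
  note embT = tensor_emb[OF Af B]
  \<comment> \<open>The new scalars act on the second factor, on functions by multiplication with
    \<open>f s\<close>, whose value at \<open>u0\<close> is \<open>s\<close>.\<close>
  have sm: "s \<odot>\<^bsub>?H\<^esub> t \<in> carrier AB.TG" "\<And>z. z \<in> carrier P \<times> U \<Longrightarrow> ?E (s \<odot>\<^bsub>?H\<^esub> t) z = f s (snd z) \<otimes> ?E t (fst z, snd z)"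
    if s: "s \<in> E" and t: "t \<in> carrier AB.TG" for s t
  proof -
    let ?\<beta> = "\<lambda>h x. tens Kr A ?B h (s \<otimes> x)" and ?\<Psi> = "\<lambda>z w. f s (snd z) \<otimes> w (fst z, snd z)"
    have c: "?\<beta> m n \<in> carrier AB.TG" if "m \<in> carrier A" "n \<in> carrier ?B" for m n
      using that s EE by (intro AB.tens_closed) auto
    have v: "?E (?\<beta> m n) z = ?\<Psi> z (\<lambda>p. e m (fst p) \<otimes> f n (snd p))"
      if "m \<in> carrier A" "n \<in> carrier ?B" "z \<in> carrier P \<times> U" for m n z
    proof -
      obtain p q where z: "z = (p, q)" "p \<in> carrier P" "q \<in> U" using \<open>z \<in> carrier P \<times> U\<close> by auto
      have "?E (?\<beta> m n) (p, q) = e m p \<otimes> f (s \<otimes> n) q"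
        by (rule ev_tens[OF Ak Bk]) (use that z s EE in auto)
      then show ?thesis using that z s fmult Acl Bcl by (simp add: m_lcomm)
    qed
    have ad: "addfun L (carrier P \<times> U) (?\<Psi> z)" if "z \<in> carrier P \<times> U" for z
      by (rule addfun_eval) (use that s Bcl in auto)
    show "s \<odot>\<^bsub>?H\<^esub> t \<in> carrier AB.TG"
      unfolding Hf by (rule lift_into_closed[OF Ak Bk embT, where \<beta> = ?\<beta> and \<Psi> = ?\<Psi>, OF c v ad t])
    show "?E (s \<odot>\<^bsub>?H\<^esub> t) z = ?\<Psi> z (?E t)" if "z \<in> carrier P \<times> U" for z
      unfolding Hf by (rule lift_into_val[OF Ak Bk embT, where \<beta> = ?\<beta> and \<Psi> = ?\<Psi>, OF c v ad t that])
  qed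
  have fH: "form L ?G' \<alpha> E ?H (carrier P) b ?e"
  proof (rule E.formI[OF gs']; (unfold Hf(1) carT)?)
    fix t assume t: "t \<in> carrier AB.TG"
    note te = form_equivariant[OF Tf, unfolded AB.tensor_carrier, OF t]
    show "equivariant L ?G' \<alpha> (carrier P) b (?e t)"
      unfolding equivariant_def
    proof (intro conjI ballI)
      fix n assume n: "n \<in> carrier P"
      show "?e t n \<in> carrier L" using ev_closed[OF Ak Bk t n u0(1)] .
      fix g assume "g \<in> carrier ?G'"
      then have "g \<in> carrier G" "a g u0 = u0" using subgroup.subset[OF G'] stab(2) by auto
      then show "?e t (b g n) = \<alpha> g (?e t n)" using equivariant_eq[OF te, of g "(n, u0)"] n u0(1) by simp
    qed
    fix t' assume t': "t' \<in> carrier AB.TG"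
    note te' = form_equivariant[OF Tf, unfolded AB.tensor_carrier, OF t']
    show "t = t'" if "\<And>n. n \<in> carrier P \<Longrightarrow> ?e t n = ?e t' n"
      by (rule emb_inj[OF embT t t']) (rule restriction_injective[OF te te' u0(1) s that])
  next
    fix v assume "equivariant L ?G' \<alpha> (carrier P) b v"
    then obtain u where u: "equivariant L G \<alpha> (carrier P \<times> U) (\<lambda>g p. (b g (fst p), a g (snd p))) u"
      "\<forall>n\<in>carrier P. u (n, u0) = v n"
      using restriction_surjective[OF form_gset[OF Af] form_gset[OF B] G' _ u0(1) s stab] by blast
    obtain t where "t \<in> carrier AB.TG" "\<forall>p\<in>carrier P \<times> U. ?E t p = u p"
      using form_surj[OF Tf u(1)] unfolding AB.tensor_carrier by blast
    then show "\<exists>m\<in>carrier AB.TG. \<forall>n\<in>carrier P. ?e m n = v n"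
      using u(2) u0(1) by (intro bexI[of _ t]) auto
  next
    fix s t assume st: "s \<in> carrier AB.TG" "t \<in> carrier AB.TG"
    show "s \<oplus>\<^bsub>?H\<^esub> t \<in> carrier AB.TG" unfolding Hf T_def using st by simp
    show "?e (s \<oplus>\<^bsub>?H\<^esub> t) n = ?e s n \<oplus> ?e t n" if "n \<in> carrier P" for n
      unfolding Hf T_def using ev_add[OF Ak Bk st that u0(1)] by simp
  next
    show "\<zero>\<^bsub>?H\<^esub> \<in> carrier AB.TG" unfolding Hf T_def by simp
    show "?e \<zero>\<^bsub>?H\<^esub> n = \<zero>" if "n \<in> carrier P" for n
      unfolding Hf T_def using ev_one[OF Ak Bk that u0(1)] by simp
  next
    fix r t assume r: "r \<in> E" and t: "t \<in> carrier AB.TG"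
    show "r \<odot>\<^bsub>?H\<^esub> t \<in> carrier AB.TG" by (rule sm(1)[OF r t])
    show "?e (r \<odot>\<^bsub>?H\<^esub> t) n = r \<otimes> ?e t n" if "n \<in> carrier P" for n
      using sm(2)[OF r t, of "(n, u0)"] that u0 r by simp
  qed
  note Hk = form_kfun[OF fH]
  interpret H2: module_pair ?Er ?H ?H by (rule E.module_pair_kfun[OF Hk Hk])
  have embHH: "emb L H2.TG (carrier P \<times> carrier P) (ev L ?Er ?H ?H ?e ?e)" by (rule E.tensor_emb[OF fH fH])
  show ?thesis
    unfolding hopf_form_def
  proof (intro conjI fH P.is_group)
    \<comment> \<open>The product of \<open>E\<close> is pointwise, which is a law with a single
      index.\<close>
    have mB: "mult_law L ?B U f {()} (\<lambda>p i. p) (\<lambda>p i. p)"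
      unfolding mult_law_def using fmult EE Bcl by auto
    note ml = tensor_mult_law[OF Af B hopf_form_mult_law[OF A] mB]
    show "mult_law L ?H (carrier P) ?e (carrier P) (\<lambda>p i. i) (\<lambda>p i. inv\<^bsub>P\<^esub> i \<otimes>\<^bsub>P\<^esub> p)"
      unfolding mult_law_def Hf
    proof (intro conjI ballI Pfin)
      fix s t assume st: "s \<in> carrier T" "t \<in> carrier T"
      show "s \<otimes>\<^bsub>T\<^esub> t \<in> carrier T" using mult_law_closed[OF ml] st unfolding T_def by blast
      fix p assume p: "p \<in> carrier P"
      have "?E (s \<otimes>\<^bsub>T\<^esub> t) (p, u0) = (\<Oplus>i\<in>carrier P \<times> {()}. ?E s (fst i, u0) \<otimes> ?E t (inv\<^bsub>P\<^esub> fst i \<otimes>\<^bsub>P\<^esub> p, u0))"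
        using mult_law_eq[OF ml, of s t "(p, u0)"] st p u0(1) unfolding T_def by simp
      also have "\<dots> = (\<Oplus>i\<in>carrier P. ?E s (i, u0) \<otimes> ?E t (inv\<^bsub>P\<^esub> i \<otimes>\<^bsub>P\<^esub> p, u0))"
        by (rule trans[OF finsum_reindex_bij[of "\<lambda>i. (i, ())" "carrier P"]])
           (use st p u0(1) ev_closed[OF Ak Bk] carT in \<open>auto simp: bij_betw_def inj_on_def\<close>)
      finally show "?E (s \<otimes>\<^bsub>T\<^esub> t) (p, u0) = (\<Oplus>i\<in>carrier P. ?E s (i, u0) \<otimes> ?E t (inv\<^bsub>P\<^esub> i \<otimes>\<^bsub>P\<^esub> p, u0))" .
    qed auto
    show "\<one>\<^bsub>?H\<^esub> \<in> carrier ?H"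
      unfolding Hf T_def AB.tensor_one using hopf_form_one(1)[OF A] EE by simp
    show "\<forall>n\<in>carrier P. ?e \<one>\<^bsub>?H\<^esub> n = (if n = \<one>\<^bsub>P\<^esub> then \<one> else \<zero>)"
    proof
      fix n assume n: "n \<in> carrier P"
      show "?e \<one>\<^bsub>?H\<^esub> n = (if n = \<one>\<^bsub>P\<^esub> then \<one> else \<zero>)"
        unfolding Hf T_def AB.tensor_one
        by (subst ev_tens[OF Ak Bk]) (use n u0 EE hopf_form_one[OF A] in auto)
    qed
    have "antipode ?H = tensor_map Kr A ?B A ?B (antipode A) id"
      by (simp add: base_change_def hopf_of_def Let_def)
    moreover have "tensor_map Kr A ?B A ?B (antipode A) id h \<in> carrier AB.TG"
      "\<And>x y. x \<in> carrier P \<Longrightarrow> y \<in> U \<Longrightarrow> ?E (tensor_map Kr A ?B A ?B (antipode A) id h) (x, y) =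
        (if True \<and> True then ?E h (inv\<^bsub>P\<^esub> x, y) else \<zero>)" if "h \<in> carrier AB.TG" for h
      by (rule tensor_map_val[OF Ak Bk Af B, where B = "\<lambda>_. True" and C = "\<lambda>_. True"
            and \<pi> = "m_inv P" and \<rho> = "\<lambda>y. y"];
          use that hopf_form_antipode[OF A] in auto)+
    ultimately show "\<forall>h\<in>carrier ?H. antipode ?H h \<in> carrier ?H \<and> (\<forall>n\<in>carrier P. ?e (antipode ?H h) n = ?e h (inv\<^bsub>P\<^esub> n))"
      using u0(1) unfolding Hf carT by simp
    show "\<forall>h\<in>carrier ?H. counit ?H h = (\<Oplus>n\<in>carrier P. ?e h n)"
    proof
      fix h assume "h \<in> carrier ?H"
      then have h: "h \<in> carrier AB.TG" unfolding Hf carT .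
      let ?\<beta> = "\<lambda>h x. counit A h \<otimes> x" and ?\<Psi> = "\<lambda>z w. \<Oplus>n\<in>carrier P. w (n, u0)"
      have Ke: "emb L (add_monoid ?B) {()} (\<lambda>r _. r)"
        unfolding emb_def using comm_group_add_monoid[OF AB.N.M.abelian_group_axioms] EL by auto
      have kk: "counit A m \<in> K" "counit A m \<in> carrier L" if "m \<in> carrier A" for m
        using hopf_form_counit_K[OF A that] K_subset by auto
      have c: "?\<beta> m n \<in> carrier (add_monoid ?B)" if "m \<in> carrier A" "n \<in> carrier ?B" for m n
        using AB.N.smult_closed[of "counit A m" n] kk[OF that(1)] that by simp
      have v: "?\<beta> m n = ?\<Psi> () (\<lambda>p. e m (fst p) \<otimes> f n (snd p))"
        if "m \<in> carrier A" "n \<in> carrier ?B" for m n and z :: unit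
        using that Acl u0 EL Pfin
        by (simp add: hopf_form_counit[OF A] finsum_ldistr Pi_def subset_iff)
      have ad: "addfun L (carrier P \<times> U) (?\<Psi> z)" for z :: unit
        by (rule addfun_sum(3)[where c = "\<lambda>_. \<zero>"]) (use Pfin u0 in auto)
      have "counit ?H h = tensor_lift Kr A ?B (add_monoid ?B) ?\<beta> h"
        by (simp add: base_change_def hopf_of_def Let_def)
      also have "\<dots> = ?\<Psi> () (?E h)"
        by (rule lift_into_val[OF Ak Bk Ke, where \<beta> = ?\<beta> and \<Psi> = ?\<Psi>, OF c v ad h]) auto
      finally show "counit ?H h = (\<Oplus>n\<in>carrier P. ?e h n)" .
    qed
    show "\<forall>h\<in>carrier ?H. comult ?H h \<in> carrier H2.TG \<and>
      (\<forall>n\<in>carrier P. \<forall>m\<in>carrier P. ev L ?Er ?H ?H ?e ?e (comult ?H h) (n, m) = (if n = m then ?e h n else \<zero>))"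
    proof
      fix h assume "h \<in> carrier ?H"
      then have h: "h \<in> carrier AB.TG" unfolding Hf carT .
      let ?EE = "ev L ?Er ?H ?H ?e ?e"
      \<comment> \<open>The comultiplication of a scalar extension puts \<open>x\<close> on the
        second leg; on values at \<open>u0\<close> it contributes just the factor
        \<open>x\<close>.\<close>
      let ?b0 = "\<lambda>x h1 h2. tens ?Er ?H ?H (tens Kr A ?B h1 \<one>) (tens Kr A ?B h2 x)"
      let ?b1 = "\<lambda>h x. tensor_lift Kr A A H2.TG (?b0 x) (comult A h)"
      have inner: "?b1 m x \<in> carrier H2.TG"
        "\<And>z. z \<in> carrier P \<times> carrier P \<Longrightarrow> ?EE (?b1 m x) z = (if fst z = snd z then e m (fst z) \<otimes> x else \<zero>)"
        if m: "m \<in> carrier A" and x: "x \<in> E" for m x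
      proof -
        note DA = hopf_form_comult[OF A m]
        have xL: "x \<in> carrier L" using x EL by auto
        let ?\<Psi> = "\<lambda>z w. w (fst z, snd z) \<otimes> x"
        have c: "?b0 x h1 h2 \<in> carrier H2.TG" if "h1 \<in> carrier A" "h2 \<in> carrier A" for h1 h2
          using that x EE by (intro H2.tens_closed) (auto simp: Hf carT)
        have v: "?EE (?b0 x h1 h2) z = ?\<Psi> z (\<lambda>p. e h1 (fst p) \<otimes> e h2 (snd p))"
          if "h1 \<in> carrier A" "h2 \<in> carrier A" and z: "z \<in> carrier P \<times> carrier P" for h1 h2 z
        proof -
          obtain p q where z': "z = (p, q)" "p \<in> carrier P" "q \<in> carrier P" using z by auto
          have 1: "?E (tens Kr A ?B h1 \<one>) (p, u0) = e h1 p \<otimes> f \<one> u0" "?E (tens Kr A ?B h2 x) (q, u0) = e h2 q \<otimes> f x u0"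
            by (rule ev_tens[OF Ak Bk]; use that x EE u0 z' in simp)+
          have "?EE (?b0 x h1 h2) (p, q) = ?E (tens Kr A ?B h1 \<one>) (p, u0) \<otimes> ?E (tens Kr A ?B h2 x) (q, u0)"
            by (rule E.ev_tens[OF Hk Hk]) (use that x EE z' in \<open>auto simp: Hf carT\<close>)
          then show ?thesis
            using that x xL z' u0 EE Acl by (simp add: 1 m_assoc)
        qed
        have ad: "addfun L (carrier P \<times> carrier P) (?\<Psi> z)" if "z \<in> carrier P \<times> carrier P" for z
          by (rule addfun_eval) (use that xL in auto)
        show "?b1 m x \<in> carrier H2.TG"
          by (rule lift_into_closed[OF Ak Ak embHH, where \<beta> = "?b0 x" and \<Psi> = ?\<Psi>, OF c v ad DA(1)])
        fix z assume z: "z \<in> carrier P \<times> carrier P"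
        have "?EE (?b1 m x) z = ?\<Psi> z (ev L Kr A A e e (comult A m))"
          by (rule lift_into_val[OF Ak Ak embHH, where \<beta> = "?b0 x" and \<Psi> = ?\<Psi>, OF c v ad DA(1) z])
        then show "?EE (?b1 m x) z = (if fst z = snd z then e m (fst z) \<otimes> x else \<zero>)"
          using z xL by (auto simp: DA)
      qed
      let ?\<Psi> = "\<lambda>z w. if fst z = snd z then w (fst z, u0) else \<zero>"
      have c: "?b1 m x \<in> carrier H2.TG" if "m \<in> carrier A" "x \<in> carrier ?B" for m x
        using inner(1) that by simp
      have v: "?EE (?b1 m x) z = ?\<Psi> z (\<lambda>p. e m (fst p) \<otimes> f x (snd p))"
        if "m \<in> carrier A" "x \<in> carrier ?B" "z \<in> carrier P \<times> carrier P" for m x z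
        using inner(2)[of m x z] that u0 by simp
      have ad: "addfun L (carrier P \<times> U) (?\<Psi> z)" if "z \<in> carrier P \<times> carrier P" for z
        by (rule addfun_eval) (use that u0 in auto)
      have eq: "comult ?H h = tensor_lift Kr A ?B H2.TG ?b1 h"
      proof -
        let ?T = "\<lparr>carrier = carrier (tensor Kr A ?B), monoid.mult = monoid.mult (tensor Kr A ?B),
          monoid.one = monoid.one (tensor Kr A ?B), ring.zero = ring.zero (tensor Kr A ?B),
          ring.add = ring.add (tensor Kr A ?B),
          smult = (\<lambda>s. tensor_lift Kr A ?B AB.TG (\<lambda>h x. tens Kr A ?B h (s \<otimes> x)))\<rparr>"
        \<comment> \<open>\<open>base_change\<close> builds its tensor square over
          \<open>sub_alg L E\<close> with an auxiliary record; carriers, addition and scalars are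
          those of \<open>?Er\<close> and \<open>?H\<close>.\<close>
        have e: "tensor_group ?B ?T ?T = H2.TG" "tens ?B ?T ?T = tens ?Er ?H ?H"
          by (rule tensor_group_cong tens_cong; simp add: Hf T_def)+
        show ?thesis
          unfolding e[symmetric] by (simp add: base_change_def hopf_of_def Let_def)
      qed
      have "comult ?H h \<in> carrier H2.TG"
        unfolding eq by (rule lift_into_closed[OF Ak Bk embHH, where \<beta> = ?b1 and \<Psi> = ?\<Psi>, OF c v ad h])
      moreover have "?EE (comult ?H h) (n, m) = (if n = m then ?e h n else \<zero>)" if "n \<in> carrier P" "m \<in> carrier P" for n m
        using lift_into_val[OF Ak Bk embHH, where \<beta> = ?b1 and \<Psi> = ?\<Psi>, OF c v ad h, of "(n, m)"] that
        unfolding eq by simp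
      ultimately show "comult ?H h \<in> carrier H2.TG \<and>
        (\<forall>n\<in>carrier P. \<forall>m\<in>carrier P. ?EE (comult ?H h) (n, m) = (if n = m then ?e h n else \<zero>))"
        by blast
    qed
  qed
qed

end

section \<open>Permutation groups and semidirect products\<close>

lemma carrier_BijGroup [simp]: "carrier (BijGroup S) = Bij S"
  by (simp add: BijGroup_def)

lemma one_BijGroup: "\<one>\<^bsub>BijGroup S\<^esub> = (\<lambda>x\<in>S. x)"
  by (simp add: BijGroup_def)

lemma BijGroup_apply: "f \<in> Bij S \<Longrightarrow> g \<in> Bij S \<Longrightarrow> x \<in> S \<Longrightarrow> (f \<otimes>\<^bsub>BijGroup S\<^esub> g) x = f (g x)"
  by (simp add: BijGroup_def compose_def)

lemma Bij_closed: "f \<in> Bij S \<Longrightarrow> x \<in> S \<Longrightarrow> f x \<in> S"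
  using Bij_imp_funcset by blast

lemma Bij_eqI: "f \<in> Bij S \<Longrightarrow> g \<in> Bij S \<Longrightarrow> (\<And>x. x \<in> S \<Longrightarrow> f x = g x) \<Longrightarrow> f = g"
  by (rule extensionalityI[OF Bij_imp_extensional Bij_imp_extensional])

lemma BijI: "f \<in> extensional S \<Longrightarrow> bij_betw f S S \<Longrightarrow> f \<in> Bij S"
  by (simp add: Bij_def)

lemma
  assumes f: "f \<in> Bij S"
  shows inv_BijGroup_closed: "inv\<^bsub>BijGroup S\<^esub> f \<in> Bij S"
    and inv_BijGroup_apply: "\<And>x. x \<in> S \<Longrightarrow> (inv\<^bsub>BijGroup S\<^esub> f) (f x) = x"
    and apply_inv_BijGroup: "\<And>x. x \<in> S \<Longrightarrow> f ((inv\<^bsub>BijGroup S\<^esub> f) x) = x"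
proof -
  interpret group "BijGroup S" by (rule group_BijGroup)
  show c: "inv\<^bsub>BijGroup S\<^esub> f \<in> Bij S" using inv_closed[of f] f by simp
  show "(inv\<^bsub>BijGroup S\<^esub> f) (f x) = x" if "x \<in> S" for x
    using BijGroup_apply[OF c f that] l_inv[of f] f that by (simp add: one_BijGroup)
  show "f ((inv\<^bsub>BijGroup S\<^esub> f) x) = x" if "x \<in> S" for x
    using BijGroup_apply[OF f c that] r_inv[of f] f that by (simp add: one_BijGroup)
qed

lemma finite_Bij: "finite S \<Longrightarrow> finite (Bij S)"
  by (rule finite_subset[OF _ finite_PiE[of S "\<lambda>_. S"]])
     (auto simp: PiE_def dest: Bij_imp_funcset Bij_imp_extensional)

lemma (in group) mult_inv_cancel:
  assumes "x \<in> carrier G" "y \<in> carrier G"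
  shows "x \<otimes> (inv x \<otimes> y) = y" "inv x \<otimes> (x \<otimes> y) = y"
  using assms by (simp_all add: m_assoc[symmetric])

lemma (in group) subgroup_conj_image:
  assumes N: "subgroup N G" and p: "p \<in> N"
  shows "(\<lambda>n. p \<otimes> n \<otimes> inv p) ` N = N"
proof (rule equalityI; rule subsetI)
  note c = subgroup.mem_carrier[OF N] subgroup.m_closed[OF N] subgroup.m_inv_closed[OF N]
  show "n \<in> N" if "n \<in> (\<lambda>n. p \<otimes> n \<otimes> inv p) ` N" for n
    using that p c by auto
  fix n assume n: "n \<in> N"
  have "n = p \<otimes> (inv p \<otimes> n \<otimes> p) \<otimes> inv p"
    using c(1)[OF p] c(1)[OF n] by (simp add: m_assoc mult_inv_cancel)
  moreover have "inv p \<otimes> n \<otimes> p \<in> N" using n p c by auto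
  ultimately show "n \<in> (\<lambda>n. p \<otimes> n \<otimes> inv p) ` N" by blast
qed

definition conj_act :: "'y set \<Rightarrow> ('g \<Rightarrow> 'y \<Rightarrow> 'y) \<Rightarrow> 'g \<Rightarrow> ('y \<Rightarrow> 'y) \<Rightarrow> ('y \<Rightarrow> 'y)"
  where "conj_act Y \<rho> g n = \<rho> g \<otimes>\<^bsub>BijGroup Y\<^esub> n \<otimes>\<^bsub>BijGroup Y\<^esub> inv\<^bsub>BijGroup Y\<^esub> (\<rho> g)"

locale normalized_perms = G: group G for G :: "('g, 'm) monoid_scheme" and Y :: "'y set" and \<rho> N +
  assumes \<rho>: "\<rho> \<in> hom G (BijGroup Y)"
    and N: "subgroup N (BijGroup Y)"
    and normalized: "\<And>g n. g \<in> carrier G \<Longrightarrow> n \<in> N \<Longrightarrow> conj_act Y \<rho> g n \<in> N"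
    and finite_Y: "finite Y"
begin

abbreviation "P \<equiv> (BijGroup Y)\<lparr>carrier := N\<rparr>"

sublocale B: group "BijGroup Y" by (rule group_BijGroup)
sublocale P: group P by (rule B.subgroup_imp_group[OF N])

lemma N_Bij: "n \<in> N \<Longrightarrow> n \<in> Bij Y" using subgroup.subset[OF N] by auto
lemma N_mult: "n \<in> N \<Longrightarrow> m \<in> N \<Longrightarrow> n \<otimes>\<^bsub>BijGroup Y\<^esub> m \<in> N" by (rule subgroup.m_closed[OF N])
lemma N_inv: "n \<in> N \<Longrightarrow> inv\<^bsub>BijGroup Y\<^esub> n \<in> N" by (rule subgroup.m_inv_closed[OF N])
lemma N_one: "(\<lambda>x\<in>Y. x) \<in> N" using subgroup.one_closed[OF N] by (simp add: one_BijGroup)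
lemma finite_N: "finite N"
  by (rule finite_subset[OF _ finite_Bij[OF finite_Y]]) (use N_Bij in auto)
lemma \<rho>_closed: "g \<in> carrier G \<Longrightarrow> \<rho> g \<in> Bij Y"
  using hom_in_carrier[OF \<rho>] by simp

lemma \<rho>_mult: "g \<in> carrier G \<Longrightarrow> h \<in> carrier G \<Longrightarrow> \<rho> (g \<otimes>\<^bsub>G\<^esub> h) = \<rho> g \<otimes>\<^bsub>BijGroup Y\<^esub> \<rho> h"
  using hom_mult[OF \<rho>] by simp

lemma \<rho>_one: "\<rho> \<one>\<^bsub>G\<^esub> = \<one>\<^bsub>BijGroup Y\<^esub>"
  using hom_one[OF \<rho> G.is_group B.is_group] .

lemma conj_act_apply:
  assumes "g \<in> carrier G" "n \<in> N" "y \<in> Y"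
  shows "conj_act Y \<rho> g n (\<rho> g y) = \<rho> g (n y)"
proof -
  have r: "\<rho> g \<in> Bij Y" by (rule \<rho>_closed[OF assms(1)])
  have n: "n \<in> Bij Y" by (rule N_Bij[OF assms(2)])
  have "\<rho> g \<otimes>\<^bsub>BijGroup Y\<^esub> n \<in> Bij Y" using B.m_closed[of "\<rho> g" n] r n by simp
  then show ?thesis
    using r n assms(3) inv_BijGroup_closed[OF r] by (simp add: conj_act_def BijGroup_apply Bij_closed inv_BijGroup_apply)
qed

lemma conj_act_gset: "gset G N (conj_act Y \<rho>)"
  unfolding gset_def
proof (intro conjI ballI)
  show "conj_act Y \<rho> \<one>\<^bsub>G\<^esub> n = n" if "n \<in> N" for n
    using N_Bij[OF that] by (simp add: conj_act_def \<rho>_one)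
  fix g h n assume "g \<in> carrier G" "h \<in> carrier G" "n \<in> N"
  then have "\<rho> g \<in> carrier (BijGroup Y)" "\<rho> h \<in> carrier (BijGroup Y)" "n \<in> carrier (BijGroup Y)"
    using \<rho>_closed N_Bij by auto
  then show "conj_act Y \<rho> (g \<otimes>\<^bsub>G\<^esub> h) n = conj_act Y \<rho> g (conj_act Y \<rho> h n)"
    using \<rho>_mult[OF \<open>g \<in> carrier G\<close> \<open>h \<in> carrier G\<close>]
    by (simp add: conj_act_def B.inv_mult_group B.m_assoc del: carrier_BijGroup)
qed (use normalized finite_N in auto)

lemma conj_act_mult:
  assumes "g \<in> carrier G" "n \<in> N" "m \<in> N"
  shows "conj_act Y \<rho> g (n \<otimes>\<^bsub>BijGroup Y\<^esub> m) = conj_act Y \<rho> g n \<otimes>\<^bsub>BijGroup Y\<^esub> conj_act Y \<rho> g m"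
proof -
  have c: "\<rho> g \<in> carrier (BijGroup Y)" "n \<in> carrier (BijGroup Y)" "m \<in> carrier (BijGroup Y)"
    using \<rho>_closed N_Bij assms by auto
  have "inv\<^bsub>BijGroup Y\<^esub> (\<rho> g) \<otimes>\<^bsub>BijGroup Y\<^esub> (\<rho> g \<otimes>\<^bsub>BijGroup Y\<^esub> x) = x" if "x \<in> carrier (BijGroup Y)" for x
    using c that by (simp add: B.m_assoc[symmetric] del: carrier_BijGroup)
  then show ?thesis
    using c by (simp add: conj_act_def B.m_assoc del: carrier_BijGroup)
qed

end

lemma normalized_by_conj_act:
  "normalized_by Y N (\<rho> ` S) \<Longrightarrow> g \<in> S \<Longrightarrow> n \<in> N \<Longrightarrow> conj_act Y \<rho> g n \<in> N"
  unfolding normalized_by_def conj_act_def by blast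

lemma (in group) gset_hom:
  assumes "gset G S a" and "\<And>g. g \<in> carrier G \<Longrightarrow> a g \<in> extensional S"
  shows "a \<in> hom G (BijGroup S)"
proof (rule homI)
  show B: "a g \<in> carrier (BijGroup S)" if "g \<in> carrier G" for g
    using assms(2)[OF that] gset_bij[OF is_group assms(1) that] by (simp add: BijI)
  show "a (g \<otimes> h) = a g \<otimes>\<^bsub>BijGroup S\<^esub> a h" if gh: "g \<in> carrier G" "h \<in> carrier G" for g h
  proof (rule Bij_eqI[of _ S])
    show "a (g \<otimes> h) \<in> Bij S" using B[of "g \<otimes> h"] gh by simp
    show "a g \<otimes>\<^bsub>BijGroup S\<^esub> a h \<in> Bij S"
      using group.axioms(1)[OF group_BijGroup] monoid.m_closed[of "BijGroup S" "a g" "a h"] B gh by auto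
    show "a (g \<otimes> h) x = (a g \<otimes>\<^bsub>BijGroup S\<^esub> a h) x" if "x \<in> S" for x
      using BijGroup_apply[of "a g" S "a h" x] B gh that gset_mult[OF assms(1)] by auto
  qed
qed

lemma (in group) left_reg_gset:
  assumes H: "subgroup H G" "finite H"
  shows "gset (G\<lparr>carrier := H\<rparr>) H (left_reg G H)"
  using subgroup.subset[OF H(1)] subgroup.m_closed[OF H(1)] subgroup.one_closed[OF H(1)] H(2)
  unfolding gset_def left_reg_def by (auto simp: subset_iff m_assoc)

lemma (in group) left_reg_hom:
  assumes H: "subgroup H G" "finite H"
  shows "left_reg G H \<in> hom (G\<lparr>carrier := H\<rparr>) (BijGroup H)"
  using group.gset_hom[OF subgroup_imp_group[OF H(1)] left_reg_gset[OF H]] by (simp add: left_reg_def)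

text \<open>Together with \<open>left_reg_J_normalized\<close> and
  \<open>left_reg_G'_normalized\<close> this supplies a concrete pair \<open>N1\<close>,
  \<open>N2\<close>, from which the existence of Hopf Galois structures follows.\<close>

lemma (in group) left_reg_regular_subgroup:
  assumes H: "subgroup H G" "finite H"
  shows "regular_subgroup H (left_reg G H ` H)"
  unfolding regular_subgroup_def
proof (intro conjI ballI)
  interpret h: group_hom "G\<lparr>carrier := H\<rparr>" "BijGroup H" "left_reg G H"
    using left_reg_hom[OF H] subgroup_imp_group[OF H(1)] group_BijGroup
    by (simp add: group_hom_def group_hom_axioms_def)
  show "subgroup (left_reg G H ` H) (BijGroup H)" using h.img_is_subgroup by simp
  fix x y assume xy: "x \<in> H" "y \<in> H"
  note Hc = subgroup.subset[OF H(1)] subgroup.m_closed[OF H(1)] subgroup.m_inv_closed[OF H(1)]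
  have x: "x \<in> carrier G" "y \<in> carrier G" using xy Hc by auto
  show "\<exists>!n. n \<in> left_reg G H ` H \<and> n x = y"
  proof (rule ex1I[of _ "left_reg G H (y \<otimes> inv x)"])
    show "left_reg G H (y \<otimes> inv x) \<in> left_reg G H ` H \<and> left_reg G H (y \<otimes> inv x) x = y"
      using xy x Hc by (auto simp: left_reg_def m_assoc)
    fix n assume "n \<in> left_reg G H ` H \<and> n x = y"
    then obtain h where h: "h \<in> H" "n = left_reg G H h" "n x = y" by auto
    then have "h \<otimes> x = y" using xy by (simp add: left_reg_def)
    then have "h = y \<otimes> inv x" using h(1) x Hc by (auto simp: m_assoc)
    with h show "n = left_reg G H (y \<otimes> inv x)" by simp
  qed
qed

section \<open>Components in a semidirect product and the map \<open>iota\<close>\<close>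

locale semidirect_product = group G for G (structure) +
  fixes J G'
  assumes sd: "semidirect G J G'"
    and finite_G: "finite (carrier G)"
begin

abbreviation "np \<equiv> normal_part G J G'"
abbreviation "cp \<equiv> compl_part G J G'"

lemma J_normal: "J \<lhd> G" and G'_subgroup: "subgroup G' G"
  using sd by (auto simp: semidirect_def)

lemma J_subgroup: "subgroup J G" by (rule normal_imp_subgroup[OF J_normal])

lemmas J_closed = subgroup.mem_carrier[OF J_subgroup]
lemmas G'_closed = subgroup.mem_carrier[OF G'_subgroup]
lemmas J_mult = subgroup.m_closed[OF J_subgroup]
lemmas G'_mult = subgroup.m_closed[OF G'_subgroup]
lemmas J_inv = subgroup.m_inv_closed[OF J_subgroup]
lemmas G'_inv = subgroup.m_inv_closed[OF G'_subgroup]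
lemmas J_one = subgroup.one_closed[OF J_subgroup]
lemmas G'_one = subgroup.one_closed[OF G'_subgroup]

lemma finite_J: "finite J" and finite_G': "finite G'"
  using finite_G subgroup.subset[OF J_subgroup] subgroup.subset[OF G'_subgroup] by (auto intro: finite_subset)

lemma decompose: "g \<in> carrier G \<Longrightarrow> \<exists>\<sigma>\<in>J. \<exists>\<tau>\<in>G'. g = \<sigma> \<otimes> \<tau>"
  using sd unfolding semidirect_def set_mult_def by blast

lemma unique:
  assumes "\<sigma> \<in> J" "\<tau> \<in> G'" "\<sigma>' \<in> J" "\<tau>' \<in> G'" "\<sigma> \<otimes> \<tau> = \<sigma>' \<otimes> \<tau>'"
  shows "\<sigma> = \<sigma>'" "\<tau> = \<tau>'"
proof -
  note c = J_closed[OF assms(1)] G'_closed[OF assms(2)] J_closed[OF assms(3)] G'_closed[OF assms(4)]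
  have "inv \<sigma>' \<otimes> \<sigma> = \<tau>' \<otimes> inv \<tau>"
  proof -
    have "inv \<sigma>' \<otimes> \<sigma> = inv \<sigma>' \<otimes> (\<sigma> \<otimes> \<tau>) \<otimes> inv \<tau>" using c by (simp add: m_assoc)
    also have "\<dots> = \<tau>' \<otimes> inv \<tau>" unfolding assms(5) using c by (simp add: m_assoc[symmetric])
    finally show ?thesis .
  qed
  moreover have "inv \<sigma>' \<otimes> \<sigma> \<in> J" "\<tau>' \<otimes> inv \<tau> \<in> G'" using assms J_mult J_inv G'_mult G'_inv by auto
  ultimately have 1: "inv \<sigma>' \<otimes> \<sigma> = \<one>" "\<tau>' \<otimes> inv \<tau> = \<one>" using sd by (auto simp: semidirect_def)
  have "\<sigma>' \<otimes> (inv \<sigma>' \<otimes> \<sigma>) = \<sigma>" "(\<tau>' \<otimes> inv \<tau>) \<otimes> \<tau> = \<tau>'"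
    using c by (simp_all add: m_assoc) (simp add: m_assoc[symmetric])
  then show "\<sigma> = \<sigma>'" "\<tau> = \<tau>'" using c by (simp_all add: 1)
qed

lemma np_eq: "\<sigma> \<in> J \<Longrightarrow> \<tau> \<in> G' \<Longrightarrow> np (\<sigma> \<otimes> \<tau>) = \<sigma>"
  and cp_eq: "\<sigma> \<in> J \<Longrightarrow> \<tau> \<in> G' \<Longrightarrow> cp (\<sigma> \<otimes> \<tau>) = \<tau>"
  unfolding normal_part_def compl_part_def by (rule the_equality; use unique in blast)+

lemma np_closed: "g \<in> carrier G \<Longrightarrow> np g \<in> J"
  and cp_closed: "g \<in> carrier G \<Longrightarrow> cp g \<in> G'"
  and np_cp: "g \<in> carrier G \<Longrightarrow> np g \<otimes> cp g = g"
  using decompose[of g] by (auto simp: np_eq cp_eq)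

lemma np_J: "\<sigma> \<in> J \<Longrightarrow> np \<sigma> = \<sigma>" "\<sigma> \<in> J \<Longrightarrow> cp \<sigma> = \<one>"
  using np_eq[of \<sigma> \<one>] cp_eq[of \<sigma> \<one>] G'_one J_closed by auto

lemma cp_G': "\<tau> \<in> G' \<Longrightarrow> np \<tau> = \<one>" "\<tau> \<in> G' \<Longrightarrow> cp \<tau> = \<tau>"
  using np_eq[of \<one> \<tau>] cp_eq[of \<one> \<tau>] J_one G'_closed by auto

lemma conj_J: "g \<in> carrier G \<Longrightarrow> \<sigma> \<in> J \<Longrightarrow> g \<otimes> \<sigma> \<otimes> inv g \<in> J"
  using normal.inv_op_closed2[OF J_normal] by simp

text \<open>Pushing \<open>cp g\<close> past the normal component of \<open>h\<close> gives g h = (g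
  np(h) cp(g)^-1)(cp(g) cp(h)), and the first bracket lies in \<open>J\<close> by normality. The
  first component is the formula of \<open>lambda_c\<close>; the second makes \<open>cp\<close>
  multiplicative.\<close>

lemma mult_parts:
  assumes "g \<in> carrier G" "h \<in> carrier G"
  shows "np (g \<otimes> h) = g \<otimes> np h \<otimes> inv cp g" "cp (g \<otimes> h) = cp g \<otimes> cp h" "g \<otimes> np h \<otimes> inv cp g \<in> J"
proof -
  note c = J_closed[OF np_closed] G'_closed[OF cp_closed]
  have "np g \<otimes> (cp g \<otimes> np h \<otimes> inv cp g) \<in> J"
    by (rule J_mult[OF np_closed conj_J[OF G'_closed[OF cp_closed] np_closed]]) (rule assms)+
  moreover have eq: "np g \<otimes> (cp g \<otimes> np h \<otimes> inv cp g) = g \<otimes> np h \<otimes> inv cp g"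
  proof -
    have "np g \<otimes> (cp g \<otimes> np h \<otimes> inv cp g) = (np g \<otimes> cp g) \<otimes> np h \<otimes> inv cp g"
      using assms c by (simp add: m_assoc)
    then show ?thesis using assms by (simp add: np_cp)
  qed
  ultimately show J: "g \<otimes> np h \<otimes> inv cp g \<in> J" by simp
  have "(g \<otimes> np h \<otimes> inv cp g) \<otimes> (cp g \<otimes> cp h) = g \<otimes> (np h \<otimes> cp h)"
  proof -
    have "inv cp g \<otimes> (cp g \<otimes> cp h) = cp h" using assms c by (simp add: m_assoc[symmetric])
    then show ?thesis using assms c by (simp add: m_assoc)
  qed
  then have e: "g \<otimes> h = (g \<otimes> np h \<otimes> inv cp g) \<otimes> (cp g \<otimes> cp h)" using assms by (simp add: np_cp)
  show "np (g \<otimes> h) = g \<otimes> np h \<otimes> inv cp g" "cp (g \<otimes> h) = cp g \<otimes> cp h"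
    unfolding e using assms J cp_closed G'_mult by (auto intro!: np_eq cp_eq)
qed

lemma lambda_c_eq: "g \<in> carrier G \<Longrightarrow> s \<in> J \<Longrightarrow> lambda_c G J G' g s = g \<otimes> s \<otimes> inv cp g"
  by (simp add: lambda_c_def np_cp)

text \<open>\<open>J\<close> represents the cosets of \<open>G'\<close> by normal parts, and in
  these terms \<open>lambda_c\<close> is left translation of cosets; the action law is easiest in
  this form.\<close>

lemma lambda_c_np: "g \<in> carrier G \<Longrightarrow> s \<in> J \<Longrightarrow> lambda_c G J G' g s = np (g \<otimes> s)"
  using mult_parts(1)[of g s] by (simp add: lambda_c_eq J_closed np_J)

lemma lambda_c_gset: "gset G J (lambda_c G J G')"
  unfolding gset_def
proof (intro conjI ballI finite_J)
  fix g s assume g: "g \<in> carrier G" and s: "s \<in> J"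
  show "lambda_c G J G' g s \<in> J" using g s by (simp add: lambda_c_np np_closed J_closed)
  fix h assume h: "h \<in> carrier G"
  have "lambda_c G J G' (h \<otimes> g) s = np (h \<otimes> (g \<otimes> s))"
    using g h s by (simp add: lambda_c_np J_closed m_assoc)
  also have "\<dots> = lambda_c G J G' h (np (g \<otimes> s))"
    using g h s mult_parts(3)[of g s] by (simp add: mult_parts(1) lambda_c_eq J_closed np_J)
  finally show "lambda_c G J G' (h \<otimes> g) s = lambda_c G J G' h (lambda_c G J G' g s)"
    using g s by (simp add: lambda_c_np)
qed (simp add: lambda_c_np J_closed np_J)

lemma lambda_c_hom: "lambda_c G J G' \<in> hom G (BijGroup J)"
  by (rule gset_hom[OF lambda_c_gset]) (simp add: lambda_c_def)

lemma lambda_c_one: "g \<in> carrier G \<Longrightarrow> lambda_c G J G' g \<one> = np g"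
  by (simp add: lambda_c_np J_one)

text \<open>Since \<open>cp\<close> is multiplicative with kernel \<open>J\<close>, this is the
  action of the quotient of \<open>G\<close> by \<open>J\<close>, written as an action of
  \<open>G\<close> so that \<open>F\<close> is handled with the same group as \<open>E\<close> and
  \<open>L\<close>.\<close>

lemma left_cp_gset: "gset G G' (\<lambda>g. left_reg G G' (cp g))"
  using gset_closed[OF left_reg_gset[OF G'_subgroup finite_G']] gset_mult[OF left_reg_gset[OF G'_subgroup finite_G']] cp_closed
  unfolding gset_def by (auto simp: mult_parts(2) finite_G' cp_G'[OF G'_one] left_reg_def G'_closed)

lemma left_cp_hom: "(\<lambda>g. left_reg G G' (cp g)) \<in> hom G (BijGroup G')"
  by (rule gset_hom[OF left_cp_gset]) (simp add: left_reg_def)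

lemma iota_apply: "g \<in> carrier G \<Longrightarrow> iota G J G' \<phi> \<psi> g = \<phi> (np g) \<otimes> \<psi> (cp g)"
  by (simp add: iota_def)

lemma iota_parts:
  assumes "\<phi> \<in> Bij J" "\<psi> \<in> Bij G'" "g \<in> carrier G"
  shows "iota G J G' \<phi> \<psi> g \<in> carrier G" "np (iota G J G' \<phi> \<psi> g) = \<phi> (np g)" "cp (iota G J G' \<phi> \<psi> g) = \<psi> (cp g)"
  using Bij_closed[OF assms(1) np_closed[OF assms(3)]] Bij_closed[OF assms(2) cp_closed[OF assms(3)]] assms(3)
  by (simp_all add: iota_apply J_closed G'_closed np_eq cp_eq)

lemma iota_Bij:
  assumes "\<phi> \<in> Bij J" "\<psi> \<in> Bij G'"
  shows "iota G J G' \<phi> \<psi> \<in> Bij (carrier G)"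
proof (rule BijI)
  show "iota G J G' \<phi> \<psi> \<in> extensional (carrier G)" by (simp add: iota_def)
  note i1 = inv_BijGroup_closed[OF assms(1)] and i2 = inv_BijGroup_closed[OF assms(2)]
  show "bij_betw (iota G J G' \<phi> \<psi>) (carrier G) (carrier G)"
  proof (rule bij_betw_byWitness[where f' = "iota G J G' (inv\<^bsub>BijGroup J\<^esub> \<phi>) (inv\<^bsub>BijGroup G'\<^esub> \<psi>)"]; safe)
    fix g assume g: "g \<in> carrier G"
    note p = iota_parts[OF assms g] and q = iota_parts[OF i1 i2 g]
    show "iota G J G' (inv\<^bsub>BijGroup J\<^esub> \<phi>) (inv\<^bsub>BijGroup G'\<^esub> \<psi>) (iota G J G' \<phi> \<psi> g) = g"
      using p g by (simp add: iota_apply inv_BijGroup_apply[OF assms(1)] inv_BijGroup_apply[OF assms(2)] np_closed cp_closed np_cp)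
    show "iota G J G' \<phi> \<psi> (iota G J G' (inv\<^bsub>BijGroup J\<^esub> \<phi>) (inv\<^bsub>BijGroup G'\<^esub> \<psi>) g) = g"
      using q g by (simp add: iota_apply[OF q(1)] apply_inv_BijGroup[OF assms(1)] apply_inv_BijGroup[OF assms(2)] np_closed cp_closed np_cp)
    show "iota G J G' \<phi> \<psi> g \<in> carrier G" "iota G J G' (inv\<^bsub>BijGroup J\<^esub> \<phi>) (inv\<^bsub>BijGroup G'\<^esub> \<psi>) g \<in> carrier G"
      using p q by auto
  qed
qed

lemma iota_mult:
  assumes "\<phi> \<in> Bij J" "\<psi> \<in> Bij G'" "\<phi>' \<in> Bij J" "\<psi>' \<in> Bij G'"
  shows "iota G J G' (\<phi> \<otimes>\<^bsub>BijGroup J\<^esub> \<phi>') (\<psi> \<otimes>\<^bsub>BijGroup G'\<^esub> \<psi>') =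
    iota G J G' \<phi> \<psi> \<otimes>\<^bsub>BijGroup (carrier G)\<^esub> iota G J G' \<phi>' \<psi>'"
proof (rule Bij_eqI[of _ "carrier G"])
  interpret BJ: group "BijGroup J" by (rule group_BijGroup)
  interpret BG': group "BijGroup G'" by (rule group_BijGroup)
  interpret BG: group "BijGroup (carrier G)" by (rule group_BijGroup)
  show "iota G J G' (\<phi> \<otimes>\<^bsub>BijGroup J\<^esub> \<phi>') (\<psi> \<otimes>\<^bsub>BijGroup G'\<^esub> \<psi>') \<in> Bij (carrier G)"
    using BJ.m_closed[of \<phi> \<phi>'] BG'.m_closed[of \<psi> \<psi>'] assms by (intro iota_Bij) auto
  show "iota G J G' \<phi> \<psi> \<otimes>\<^bsub>BijGroup (carrier G)\<^esub> iota G J G' \<phi>' \<psi>' \<in> Bij (carrier G)"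
    using BG.m_closed[of "iota G J G' \<phi> \<psi>" "iota G J G' \<phi>' \<psi>'"] iota_Bij assms by simp
  fix g assume g: "g \<in> carrier G"
  then show "iota G J G' (\<phi> \<otimes>\<^bsub>BijGroup J\<^esub> \<phi>') (\<psi> \<otimes>\<^bsub>BijGroup G'\<^esub> \<psi>') g =
      (iota G J G' \<phi> \<psi> \<otimes>\<^bsub>BijGroup (carrier G)\<^esub> iota G J G' \<phi>' \<psi>') g"
    using assms iota_parts[OF assms(3,4) g]
    by (simp add: BijGroup_apply iota_Bij iota_apply np_closed cp_closed)
qed

text \<open>At elements of \<open>J\<close> the normal part of the value is given by
  \<open>\<phi>\<close>, and at elements of \<open>G'\<close> the complement part by
  \<open>\<psi>\<close>, so both maps can be read off.\<close>

lemma iota_inj: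
  assumes "\<phi> \<in> Bij J" "\<psi> \<in> Bij G'" "\<phi>' \<in> Bij J" "\<psi>' \<in> Bij G'"
    and eq: "iota G J G' \<phi> \<psi> = iota G J G' \<phi>' \<psi>'"
  shows "\<phi> = \<phi>'" "\<psi> = \<psi>'"
proof -
  show "\<phi> = \<phi>'"
    by (rule Bij_eqI[OF assms(1,3)])
       (metis J_closed np_J(1) assms iota_parts(2))
  show "\<psi> = \<psi>'"
    by (rule Bij_eqI[OF assms(2,4)])
       (metis G'_closed cp_G'(2) assms iota_parts(3))
qed

text \<open>By \<open>mult_parts\<close>, left translation respects components. As
  \<open>iota\<close> is multiplicative, conjugation by translations of \<open>G\<close> can then be
  computed in each component.\<close>

lemma left_reg_iota:
  assumes g: "g \<in> carrier G"
  shows "left_reg G (carrier G) g = iota G J G' (lambda_c G J G' g) (left_reg G G' (cp g))"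
proof (rule extensionalityI[of _ "carrier G"])
  fix h assume h: "h \<in> carrier G"
  have "g \<otimes> h = np (g \<otimes> h) \<otimes> cp (g \<otimes> h)" using g h by (simp add: np_cp)
  then show "left_reg G (carrier G) g h = iota G J G' (lambda_c G J G' g) (left_reg G G' (cp g)) h"
    using g h by (simp add: left_reg_def iota_apply mult_parts lambda_c_eq np_closed cp_closed)
qed (simp_all add: left_reg_def iota_def)

text \<open>At \<open>x\<close> this is g (s x) cp(g)^-1 = (g s g^-1)(g x cp(g)^-1), checked as a
  commutation rule before the inverse is brought in. Normality of \<open>J\<close> keeps g s g^-1 in
  \<open>J\<close>, so the translations of \<open>J\<close> are stable under conjugation.\<close>

lemma left_reg_lambda_c:
  assumes g: "g \<in> carrier G" and s: "s \<in> J"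
  shows "conj_act J (lambda_c G J G') g (left_reg G J s) = left_reg G J (g \<otimes> s \<otimes> inv g)"
proof -
  interpret BJ: group "BijGroup J" by (rule group_BijGroup)
  have l: "lambda_c G J G' g \<in> Bij J" using hom_in_carrier[OF lambda_c_hom g] by simp
  have r: "left_reg G J t \<in> Bij J" if "t \<in> J" for t
    using hom_in_carrier[OF left_reg_hom[OF J_subgroup finite_J]] that by simp
  have c: "g \<otimes> s \<otimes> inv g \<in> J" by (rule conj_J[OF g s])
  have "lambda_c G J G' g \<otimes>\<^bsub>BijGroup J\<^esub> left_reg G J s = left_reg G J (g \<otimes> s \<otimes> inv g) \<otimes>\<^bsub>BijGroup J\<^esub> lambda_c G J G' g"
  proof (rule Bij_eqI[of _ J])
    fix x assume x: "x \<in> J"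
    have "g \<otimes> (s \<otimes> x) \<otimes> inv cp g = g \<otimes> s \<otimes> inv g \<otimes> (g \<otimes> x \<otimes> inv cp g)"
    proof -
      have "inv g \<otimes> (g \<otimes> (x \<otimes> inv cp g)) = x \<otimes> inv cp g"
        using g x by (simp add: m_assoc[symmetric] J_closed G'_closed cp_closed)
      then show ?thesis using g s x by (simp add: m_assoc J_closed G'_closed cp_closed)
    qed
    then show "(lambda_c G J G' g \<otimes>\<^bsub>BijGroup J\<^esub> left_reg G J s) x = (left_reg G J (g \<otimes> s \<otimes> inv g) \<otimes>\<^bsub>BijGroup J\<^esub> lambda_c G J G' g) x"
      using l r[OF s] r[OF c] g s x gset_closed[OF lambda_c_gset g x] J_mult[OF s x]
      by (simp add: BijGroup_apply) (simp add: left_reg_def lambda_c_eq)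
  qed (use l r[OF s] r[OF c] BJ.m_closed in auto)
  then have "conj_act J (lambda_c G J G') g (left_reg G J s) =
      left_reg G J (g \<otimes> s \<otimes> inv g) \<otimes>\<^bsub>BijGroup J\<^esub> lambda_c G J G' g \<otimes>\<^bsub>BijGroup J\<^esub> inv\<^bsub>BijGroup J\<^esub> lambda_c G J G' g"
    by (simp add: conj_act_def)
  also have "\<dots> = left_reg G J (g \<otimes> s \<otimes> inv g)"
    using l r[OF c] BJ.m_assoc[of "left_reg G J (g \<otimes> s \<otimes> inv g)" "lambda_c G J G' g" "inv\<^bsub>BijGroup J\<^esub> lambda_c G J G' g"]
      BJ.r_inv[of "lambda_c G J G' g"] BJ.inv_closed[of "lambda_c G J G' g"] BJ.r_one by simp
  finally show ?thesis .
qed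

lemma left_reg_J_normalized: "normalized_by J (left_reg G J ` J) (lambda_c G J G' ` carrier G)"
  unfolding normalized_by_def
proof
  fix p assume "p \<in> lambda_c G J G' ` carrier G"
  then obtain g where g: "g \<in> carrier G" "p = lambda_c G J G' g" by auto
  have "(\<lambda>n. conj_act J (lambda_c G J G') g n) ` (left_reg G J ` J) = left_reg G J ` J"
  proof (rule equalityI; rule subsetI)
    fix n assume "n \<in> conj_act J (lambda_c G J G') g ` left_reg G J ` J"
    then show "n \<in> left_reg G J ` J" using g(1) left_reg_lambda_c conj_J by auto
  next
    fix n assume "n \<in> left_reg G J ` J"
    then obtain s where s: "s \<in> J" "n = left_reg G J s" by auto
    have t: "inv g \<otimes> s \<otimes> g \<in> J" using normal.inv_op_closed1[OF J_normal g(1) s(1)] .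
    have "g \<otimes> (inv g \<otimes> s \<otimes> g) \<otimes> inv g = s"
      using g(1) J_closed[OF s(1)] by (simp add: m_assoc mult_inv_cancel)
    then have "conj_act J (lambda_c G J G') g (left_reg G J (inv g \<otimes> s \<otimes> g)) = n"
      using left_reg_lambda_c[OF g(1) t] s by simp
    with t show "n \<in> conj_act J (lambda_c G J G') g ` left_reg G J ` J" by blast
  qed
  then show "(\<lambda>n. p \<otimes>\<^bsub>BijGroup J\<^esub> n \<otimes>\<^bsub>BijGroup J\<^esub> inv\<^bsub>BijGroup J\<^esub> p) ` left_reg G J ` J = left_reg G J ` J"
    by (simp add: conj_act_def g(2))
qed

lemma left_reg_G'_normalized: "normalized_by G' (left_reg G G' ` G') (left_reg G G' ` G')"
  using group.subgroup_conj_image[OF group_BijGroup] left_reg_regular_subgroup[OF G'_subgroup finite_G']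
  unfolding normalized_by_def regular_subgroup_def by blast

end

section \<open>Galois groups and Greither--Pareigis structures\<close>

lemma carrier_gal: "carrier (gal L K) = {\<sigma> \<in> Bij (carrier L). \<sigma> \<in> ring_hom L L \<and> (\<forall>k\<in>K. \<sigma> k = k)}"
  by (simp add: gal_def)

lemma mult_gal: "monoid.mult (gal L K) = monoid.mult (BijGroup (carrier L))"
  by (simp add: gal_def)

lemma one_gal: "\<one>\<^bsub>gal L K\<^esub> = (\<lambda>x\<in>carrier L. x)"
  by (simp add: gal_def one_BijGroup)

lemma gal_apply:
  "\<sigma> \<in> carrier (gal L K) \<Longrightarrow> \<tau> \<in> carrier (gal L K) \<Longrightarrow> x \<in> carrier L \<Longrightarrow> (\<sigma> \<otimes>\<^bsub>gal L K\<^esub> \<tau>) x = \<sigma> (\<tau> x)"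
  by (simp add: mult_gal carrier_gal BijGroup_apply)

lemma gal_eqI:
  "\<sigma> \<in> carrier (gal L K) \<Longrightarrow> \<tau> \<in> carrier (gal L K) \<Longrightarrow> (\<And>x. x \<in> carrier L \<Longrightarrow> \<sigma> x = \<tau> x) \<Longrightarrow> \<sigma> = \<tau>"
  by (rule Bij_eqI[of _ "carrier L"]) (auto simp: carrier_gal)

lemma (in field) group_gal:
  assumes K: "K \<subseteq> carrier R"
  shows "group (gal R K)"
proof -
  interpret B: group "BijGroup (carrier R)" by (rule group_BijGroup)
  have "subgroup (carrier (gal R K)) (BijGroup (carrier R))"
  proof (rule B.subgroupI)
    show "carrier (gal R K) \<subseteq> carrier (BijGroup (carrier R))" by (auto simp: carrier_gal)
    have "\<one>\<^bsub>BijGroup (carrier R)\<^esub> \<in> carrier (gal R K)"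
      using K id_Bij by (auto simp: carrier_gal one_BijGroup ring_hom_def subset_iff)
    then show "carrier (gal R K) \<noteq> {}" by auto
    fix \<sigma> assume \<sigma>: "\<sigma> \<in> carrier (gal R K)"
    then have s: "\<sigma> \<in> Bij (carrier R)" "\<sigma> \<in> ring_hom R R" "\<forall>k\<in>K. \<sigma> k = k" by (auto simp: carrier_gal)
    let ?i = "inv\<^bsub>BijGroup (carrier R)\<^esub> \<sigma>"
    note i = inv_BijGroup_closed[OF s(1)] inv_BijGroup_apply[OF s(1)] apply_inv_BijGroup[OF s(1)]
    have ic: "?i x \<in> carrier R" if "x \<in> carrier R" for x using Bij_closed[OF i(1) that] .
    have "?i \<in> ring_hom R R"
    proof (rule ring_hom_memI)
      fix x y assume c: "x \<in> carrier R" "y \<in> carrier R"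
      have "?i (x \<otimes> y) = ?i (\<sigma> (?i x \<otimes> ?i y))" using c ic by (simp add: ring_hom_mult[OF s(2)] i(3))
      then show "?i (x \<otimes> y) = ?i x \<otimes> ?i y" using c ic by (simp add: i(2))
      have "?i (x \<oplus> y) = ?i (\<sigma> (?i x \<oplus> ?i y))" using c ic by (simp add: ring_hom_add[OF s(2)] i(3))
      then show "?i (x \<oplus> y) = ?i x \<oplus> ?i y" using c ic by (simp add: i(2))
    next
      show "?i \<one> = \<one>" using i(2)[of \<one>] ring_hom_one[OF s(2)] by simp
    qed (rule ic)
    moreover have "?i k = k" if "k \<in> K" for k using i(2)[of k] s(3) that K by auto
    ultimately show "?i \<in> carrier (gal R K)" using i(1) by (simp add: carrier_gal)
    fix \<tau> assume \<tau>: "\<tau> \<in> carrier (gal R K)"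
    then have t: "\<tau> \<in> Bij (carrier R)" "\<tau> \<in> ring_hom R R" "\<forall>k\<in>K. \<tau> k = k" by (auto simp: carrier_gal)
    have m: "\<sigma> \<otimes>\<^bsub>BijGroup (carrier R)\<^esub> \<tau> \<in> Bij (carrier R)" using B.m_closed[of \<sigma> \<tau>] s t by simp
    moreover have "\<sigma> \<otimes>\<^bsub>BijGroup (carrier R)\<^esub> \<tau> \<in> ring_hom R R"
      by (rule ring_hom_memI)
         (use s t Bij_closed[OF s(1)] Bij_closed[OF t(1)] in
           \<open>auto simp: BijGroup_apply ring_hom_mult[OF s(2)] ring_hom_mult[OF t(2)]
             ring_hom_add[OF s(2)] ring_hom_add[OF t(2)] ring_hom_one[OF s(2)] ring_hom_one[OF t(2)]\<close>)
    moreover have "(\<sigma> \<otimes>\<^bsub>BijGroup (carrier R)\<^esub> \<tau>) k = k" if "k \<in> K" for k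
      using that s t K by (simp add: BijGroup_apply subset_iff)
    ultimately show "\<sigma> \<otimes>\<^bsub>BijGroup (carrier R)\<^esub> \<tau> \<in> carrier (gal R K)" by (simp add: carrier_gal)
  qed
  then have "group ((BijGroup (carrier R))\<lparr>carrier := carrier (gal R K)\<rparr>)"
    by (rule B.subgroup_imp_group)
  then show ?thesis by (simp add: gal_def)
qed

text \<open>An automorphism is determined by its values on a finite spanning list, and each of these
  values is a root of a fixed polynomial over \<open>K\<close>.\<close>

lemma (in field) finite_gal:
  assumes K: "subfield K R" and fd: "finite_dimension K (carrier R)"
  shows "finite (carrier (gal R K))"
proof -
  obtain n where "dimension n K (carrier R)" using fd by auto
  then obtain Vs where Vs: "set Vs \<subseteq> carrier R" "Span K Vs = carrier R" using exists_base[OF K] by blast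
  have KR: "K \<subseteq> carrier R" using subfieldE(3)[OF K] .
  have "\<exists>S. finite S \<and> (\<forall>\<sigma>\<in>carrier (gal R K). \<sigma> v \<in> S)" if v: "v \<in> carrier R" for v
  proof -
    have "(algebraic over K) v"
      using finite_dimension_imp_algebraic[OF K carrier_is_subring fd v] .
    then obtain p where p: "p \<in> carrier (K[X])" "p \<noteq> []" "eval p v = \<zero>"
      by (rule algebraicE[OF subfieldE(1)[OF K] v])
    have pK: "set p \<subseteq> K" using p(1) by (auto simp: univ_poly_carrier[symmetric] polynomial_def)
    have "p \<in> carrier (poly_ring R)"
      using p(1) pK KR by (auto simp: univ_poly_carrier[symmetric] polynomial_def)
    then have "finite {x. is_root p x}" by (rule finite_number_of_roots)
    moreover have "is_root p (\<sigma> v)" if \<sigma>: "\<sigma> \<in> carrier (gal R K)" for \<sigma>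
    proof -
      have s: "\<sigma> \<in> Bij (carrier R)" "\<sigma> \<in> ring_hom R R" "\<forall>k\<in>K. \<sigma> k = k" using \<sigma> by (auto simp: carrier_gal)
      interpret h: ring_hom_ring R R \<sigma>
        using s(2) by (intro ring_hom_ringI2) (auto intro: is_ring)
      have "map \<sigma> p = p" using s(3) pK by (intro map_idI) auto
      moreover have "\<sigma> (eval p v) = eval (map \<sigma> p) (\<sigma> v)"
        by (rule h.eval_hom') (use v pK KR in auto)
      ultimately have "eval p (\<sigma> v) = \<zero>" using p(3) by simp
      then show ?thesis using p(2) Bij_closed[OF s(1) v] by (simp add: is_root_def)
    qed
    ultimately show ?thesis by (intro exI[of _ "{x. is_root p x}"]) auto
  qed
  then obtain S where S: "\<And>v. v \<in> carrier R \<Longrightarrow> finite (S v)"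
    "\<And>v \<sigma>. v \<in> carrier R \<Longrightarrow> \<sigma> \<in> carrier (gal R K) \<Longrightarrow> \<sigma> v \<in> S v"
    by metis
  have "inj_on (\<lambda>\<sigma>. restrict \<sigma> (set Vs)) (carrier (gal R K))"
  proof (rule inj_onI)
    fix \<sigma> \<tau> assume c: "\<sigma> \<in> carrier (gal R K)" "\<tau> \<in> carrier (gal R K)"
      and eq: "restrict \<sigma> (set Vs) = restrict \<tau> (set Vs)"
    have s: "\<sigma> \<in> ring_hom R R" "\<forall>k\<in>K. \<sigma> k = k" and t: "\<tau> \<in> ring_hom R R" "\<forall>k\<in>K. \<tau> k = k"
      using c by (auto simp: carrier_gal)
    interpret s: ring_hom_cring R R \<sigma>
      using s(1) by (simp add: ring_hom_cring_def ring_hom_cring_axioms_def is_cring)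
    interpret t: ring_hom_cring R R \<tau>
      using t(1) by (simp add: ring_hom_cring_def ring_hom_cring_axioms_def is_cring)
    \<comment> \<open>The locus where two automorphisms agree is a \<open>K\<close>-subspace; as it
      contains the spanning list, it is everything.\<close>
    let ?V = "{x \<in> carrier R. \<sigma> x = \<tau> x}"
    have "subalgebra K ?V R"
    proof (intro subalgebra.intro subalgebra_axioms.intro)
      have "\<ominus> x \<in> ?V" if "x \<in> ?V" for x using that by simp
      then show "subgroup ?V (add_monoid R)"
        by (intro add.subgroupI) (auto simp: a_inv_def[symmetric])
      show "k \<otimes> v \<in> ?V" if "k \<in> K" "v \<in> ?V" for k v
        using that s(2) t(2) KR by (auto simp: subset_iff)
    qed
    moreover have "set Vs \<subseteq> ?V"
    proof
      fix v assume v: "v \<in> set Vs"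
      then have "restrict \<sigma> (set Vs) v = restrict \<tau> (set Vs) v" using eq by simp
      then show "v \<in> ?V" using v Vs(1) by auto
    qed
    ultimately have "carrier R \<subseteq> ?V"
      using subalgebra_Span_incl[OF K] Vs(2) by metis
    then show "\<sigma> = \<tau>" by (intro gal_eqI[OF c]) auto
  qed
  moreover have "(\<lambda>\<sigma>. restrict \<sigma> (set Vs)) ` carrier (gal R K) \<subseteq> PiE (set Vs) S"
    using S(2) Vs(1) by auto
  moreover have "finite (PiE (set Vs) S)"
    using S(1) Vs(1) by (intro finite_PiE) auto
  ultimately show ?thesis by (meson finite_imageD finite_subset)
qed

text \<open>A list spanning over \<open>K\<close> spans over \<open>E\<close>, because its
  \<open>E\<close>-span is in particular a \<open>K\<close>-subspace.\<close>

lemma (in field) finite_dimension_superfield: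
  assumes K: "subfield K R" and E: "subfield E R" and KE: "K \<subseteq> E" and fd: "finite_dimension K (carrier R)"
  shows "finite_dimension E (carrier R)"
proof -
  obtain n where "dimension n K (carrier R)" using fd by auto
  then obtain Vs where Vs: "set Vs \<subseteq> carrier R" "Span K Vs = carrier R" using exists_base[OF K] by blast
  have a: "subalgebra E (Span E Vs) R" by (rule Span_is_subalgebra[OF E Vs(1)])
  then have "subalgebra K (Span E Vs) R"
    using KE unfolding subalgebra_def subalgebra_axioms_def by auto
  then have "carrier R \<subseteq> Span E Vs"
    using subalgebra_Span_incl[OF K _ Span_base_incl[OF E Vs(1)]] Vs(2) by metis
  then have "Span E Vs = carrier R" using subalgebra_in_carrier[OF a] by auto
  then show ?thesis using Span_finite_dimension[OF E Vs(1)] by simp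
qed

lemma (in field) finite_dimension_subfield:
  assumes K: "subfield K R" and E: "subfield E R" and KE: "K \<subseteq> E" and fd: "finite_dimension K (carrier R)"
  shows "finite_dimension K E"
proof (rule subalbegra_incl_imp_finite_dimension[OF K fd])
  have s: "subring E R" using subfieldE(1)[OF E] .
  show "subalgebra K E R"
    using subring.axioms(1)[OF s] subringE(6)[OF s] KE
    by (intro subalgebra.intro subalgebra_axioms.intro) auto
  show "E \<subseteq> carrier R" using subfieldE(3)[OF E] .
qed

text \<open>Applied to the whole Galois group, to \<open>G'\<close> and to \<open>J\<close>.
  Faithfulness holds because members of \<open>gal\<close> are extensional, hence determined by
  their values on \<open>L\<close>.\<close>

lemma galois_action_gal:
  assumes L: "field L" and K: "K \<subseteq> carrier L" and fin: "finite (carrier (gal L K))" and H: "subgroup H (gal L K)"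
  shows "galois_action L ((gal L K)\<lparr>carrier := H\<rparr>) (\<lambda>g. g) (fixed_field L H)"
proof -
  interpret field L by (rule L)
  interpret G: group "gal L K" by (rule group_gal[OF K])
  interpret H: group "(gal L K)\<lparr>carrier := H\<rparr>" by (rule G.subgroup_imp_group[OF H])
  note Hc = subgroup.mem_carrier[OF H]
  show ?thesis
  proof
    show "finite (carrier ((gal L K)\<lparr>carrier := H\<rparr>))"
      using fin subgroup.subset[OF H] by (auto intro: finite_subset)
    fix g assume g: "g \<in> carrier ((gal L K)\<lparr>carrier := H\<rparr>)"
    then show "g \<in> ring_hom L L" using Hc by (auto simp: carrier_gal)
    show "g = \<one>\<^bsub>(gal L K)\<lparr>carrier := H\<rparr>\<^esub>" if "\<forall>x\<in>carrier L. g x = x"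
      using gal_eqI[of g L K "\<one>\<^bsub>gal L K\<^esub>"] g Hc that G.one_closed by (simp add: one_gal)
    fix h x assume "h \<in> carrier ((gal L K)\<lparr>carrier := H\<rparr>)" "x \<in> carrier L"
    then show "(g \<otimes>\<^bsub>(gal L K)\<lparr>carrier := H\<rparr>\<^esub> h) x = g (h x)" using g Hc gal_apply[of g L K h x] by simp
  qed (auto simp: one_gal fixed_field_def)
qed

lemma (in field) assoc_algebra_sub_alg:
  assumes K: "subfield K R" and E: "subfield E R" and KE: "K \<subseteq> E"
  shows "assoc_algebra (R\<lparr>carrier := K\<rparr>) (sub_alg R E)"
proof -
  have Es: "subring E R" using subfieldE(1)[OF E] .
  note Ec = subringE[OF Es]
  have EL: "x \<in> E \<Longrightarrow> x \<in> carrier R" for x using Ec(1) by auto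
  have KL: "x \<in> K \<Longrightarrow> x \<in> carrier R" for x using KE EL by auto
  have ab: "abelian_group (sub_alg R E)"
  proof (rule abelian_groupI)
    show "\<exists>y\<in>carrier (sub_alg R E). y \<oplus>\<^bsub>sub_alg R E\<^esub> x = \<zero>\<^bsub>sub_alg R E\<^esub>" if "x \<in> carrier (sub_alg R E)" for x
      using that Ec(5)[of x] EL[of x] by (intro bexI[of _ "\<ominus> x"]) (auto simp: l_neg)
  qed (use Ec in \<open>auto simp: a_ac EL\<close>)
  have cr: "cring (R\<lparr>carrier := K\<rparr>)"
    using subfield_iff(2)[OF K] by (simp add: field_def domain_def)
  show ?thesis
    unfolding assoc_algebra_def assoc_algebra_axioms_def
  proof (intro conjI allI impI)
    show "module (R\<lparr>carrier := K\<rparr>) (sub_alg R E)"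
      by (rule moduleI[OF cr ab]) (use Ec KE in \<open>auto simp: EL KL l_distr r_distr m_assoc subset_iff\<close>)
    show "ring (sub_alg R E)"
      by (rule ringI[OF ab]) (auto intro!: monoidI simp: Ec EL l_distr r_distr m_assoc)
  qed (auto simp: EL KL m_ac)
qed

text \<open>An equivariant \<open>v\<close> is determined by \<open>v u0\<close>. This value is
  fixed by the stabilizer of \<open>u0\<close>, so it lies in \<open>E\<close>, and transitivity
  forces \<open>v u = u (v u0)\<close>: every equivariant function is evaluation of an element of
  \<open>E\<close>.\<close>

lemma (in galois_action) embedding_form:
  fixes a :: "'g \<Rightarrow> ('l \<Rightarrow> 'l) \<Rightarrow> ('l \<Rightarrow> 'l)"
  assumes gs: "gset G U a" and E: "subfield E L" and KE: "K \<subseteq> E"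
    and U: "\<And>u. u \<in> U \<Longrightarrow> u \<in> ring_hom L L" "\<And>u k. u \<in> U \<Longrightarrow> k \<in> K \<Longrightarrow> u k = k"
    and u0: "u0 \<in> U" "\<And>x. x \<in> E \<Longrightarrow> u0 x = x"
    and compat: "\<And>g u x. g \<in> carrier G \<Longrightarrow> u \<in> U \<Longrightarrow> x \<in> E \<Longrightarrow> a g u x = \<alpha> g (u x)"
    and trans: "\<And>u. u \<in> U \<Longrightarrow> \<exists>g\<in>carrier G. a g u0 = u"
    and E_eq: "\<And>x. x \<in> carrier L \<Longrightarrow> (\<And>g. g \<in> carrier G \<Longrightarrow> a g u0 = u0 \<Longrightarrow> \<alpha> g x = x) \<Longrightarrow> x \<in> E"
  shows "form L G \<alpha> K (sub_alg L E) U a (\<lambda>x u. u x)"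
proof -
  have Es: "subring E L" using subfieldE(1)[OF E] .
  note Ec = subringE[OF Es]
  have EL: "x \<in> E \<Longrightarrow> x \<in> carrier L" for x using Ec(1) by auto
  have KL: "x \<in> K \<Longrightarrow> x \<in> carrier L" for x using KE EL by auto
  note Uh = ring_hom_closed[OF U(1)] ring_hom_mult[OF U(1)] ring_hom_add[OF U(1)]
  have Uz: "u \<zero> = \<zero>" if "u \<in> U" for u using ring_hom_zero[OF U(1)[OF that]] ring_axioms by simp
  show ?thesis
  proof (rule formI[OF gs]; unfold sub_alg_simps)
    show "equivariant L G \<alpha> U a (\<lambda>u. u m)" if "m \<in> E" for m
      unfolding equivariant_def using that compat Uh(1) EL by auto
    show "m = m'" if "m \<in> E" "m' \<in> E" "\<And>u. u \<in> U \<Longrightarrow> u m = u m'" for m m'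
      using that(3)[OF u0(1)] u0(2) that by simp
    fix v assume v: "equivariant L G \<alpha> U a v"
    have vE: "v u0 \<in> E"
    proof (rule E_eq)
      show "v u0 \<in> carrier L" by (rule equivariant_closed[OF v u0(1)])
      fix g assume g: "g \<in> carrier G" "a g u0 = u0"
      show "\<alpha> g (v u0) = v u0" using equivariant_eq[OF v g(1) u0(1)] g(2) by simp
    qed
    have "u (v u0) = v u" if u: "u \<in> U" for u
    proof -
      obtain g where g: "g \<in> carrier G" "a g u0 = u" using trans[OF u] by auto
      have "u (v u0) = \<alpha> g (u0 (v u0))" using compat[OF g(1) u0(1) vE] g(2) by simp
      also have "\<dots> = v u" using equivariant_eq[OF v g(1) u0(1)] g(2) u0(2)[OF vE] by simp
      finally show ?thesis .
    qed
    with vE show "\<exists>m\<in>E. \<forall>u\<in>U. u m = v u" by (intro bexI[of _ "v u0"]) auto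
  next
    fix m m' assume m: "m \<in> E" "m' \<in> E"
    show "m \<oplus> m' \<in> E" using m Ec(7) by simp
    show "u (m \<oplus> m') = u m \<oplus> u m'" if "u \<in> U" for u
      using Uh(3)[OF that EL[OF m(1)] EL[OF m(2)]] .
  next
    fix r m assume m: "r \<in> K" "m \<in> E"
    show "r \<otimes> m \<in> E" using m Ec(6) KE by auto
    show "u (r \<otimes> m) = r \<otimes> u m" if "u \<in> U" for u
      using Uh(2)[OF that KL[OF m(1)] EL[OF m(2)]] U(2)[OF that m(1)] by simp
  next
    show "\<zero> \<in> E" by (rule Ec(2))
    show "u \<zero> = \<zero>" if "u \<in> U" for u by (rule Uz[OF that])
  qed
qed

lemma (in normalized_perms) conj_act_inv:
  assumes g: "g \<in> carrier G"
  shows "conj_act Y \<rho> (inv\<^bsub>G\<^esub> g) n = inv\<^bsub>BijGroup Y\<^esub> (\<rho> g) \<otimes>\<^bsub>BijGroup Y\<^esub> n \<otimes>\<^bsub>BijGroup Y\<^esub> \<rho> g"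
proof -
  interpret h: group_hom G "BijGroup Y" \<rho>
    using \<rho> by (simp add: group_hom_def group_hom_axioms_def G.is_group B.is_group)
  have "\<rho> (inv\<^bsub>G\<^esub> g) = inv\<^bsub>BijGroup Y\<^esub> (\<rho> g)" using h.hom_inv[OF g] .
  then show ?thesis using \<rho>_closed[OF g] by (simp add: conj_act_def B.inv_inv)
qed

text \<open>The action conjugates the argument by the inverse; substituting the conjugate for
  \<open>n\<close> turns invariance into equivariance. Two maps \<open>\<rho>'\<close> and
  \<open>\<rho>\<close> occur because \<open>Hbar\<close> and \<open>H2\<close> are defined with
  \<open>left_reg\<close> but analysed with its composite with the projection to
  \<open>G'\<close>.\<close>

lemma (in normalized_perms) gp_galois_action_fixed_iff:
  fixes \<rho>' :: "('l \<Rightarrow> 'l) \<Rightarrow> 'y \<Rightarrow> 'y"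
  assumes g: "g \<in> carrier G" and c: "c \<in> extensional N" and t: "\<rho>' \<tau> = \<rho> g"
  shows "gp_galois_action Y \<rho>' N \<tau> c = c \<longleftrightarrow> (\<forall>n\<in>N. c (conj_act Y \<rho> g n) = \<tau> (c n))"
proof
  have i: "inv\<^bsub>G\<^esub> g \<in> carrier G" using g by simp
  have eq: "gp_galois_action Y \<rho>' N \<tau> c n = \<tau> (c (conj_act Y \<rho> (inv\<^bsub>G\<^esub> g) n))" if "n \<in> N" for n
    using that by (simp add: gp_galois_action_def conj_act_inv[OF g] t)
  note gi = gset_inv[OF G.is_group conj_act_gset g]
  {
    assume fx: "gp_galois_action Y \<rho>' N \<tau> c = c"
    show "\<forall>n\<in>N. c (conj_act Y \<rho> g n) = \<tau> (c n)"
    proof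
      fix n assume n: "n \<in> N"
      have m: "conj_act Y \<rho> g n \<in> N" by (rule normalized[OF g n])
      show "c (conj_act Y \<rho> g n) = \<tau> (c n)" using eq[OF m] fx gi(1)[OF n] by simp
    qed
  next
    assume h: "\<forall>n\<in>N. c (conj_act Y \<rho> g n) = \<tau> (c n)"
    show "gp_galois_action Y \<rho>' N \<tau> c = c"
    proof (rule extensionalityI[OF _ c])
      show "gp_galois_action Y \<rho>' N \<tau> c \<in> extensional N" by (simp add: gp_galois_action_def)
      fix n assume n: "n \<in> N"
      show "gp_galois_action Y \<rho>' N \<tau> c n = c n"
        using eq[OF n] h normalized[OF i n] gi(2)[OF n] by metis
    qed
  }
qed

text \<open>Here \<open>Y\<close> is a set of embeddings into \<open>L\<close> of an intermediate field, on which \<open>G\<close> acts by \<open>\<rho>\<close>.\<close>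

locale gp_data = galois_action L G "\<lambda>g. g" K + normalized_perms G Y \<rho> N
  for L :: "('l, 'r) ring_scheme" and G :: "('l \<Rightarrow> 'l, 'm) monoid_scheme" and K
    and Y :: "('l \<Rightarrow> 'l) set" and \<rho> N +
  assumes regular: "regular_subgroup Y N"
begin

text \<open>Premise \<open>C\<close> says that the fixed elements, defined by \<open>S\<close> and
  coefficients in \<open>F\<close>, are exactly the \<open>G\<close>-equivariant
  \<open>L\<close>-valued functions. For \<open>F = L\<close> and \<open>S = carrier G\<close> this
  is a reformulation; for \<open>Hbar\<close> it is the step from \<open>G'\<close> and
  \<open>F\<close> to \<open>G\<close> and \<open>L\<close>.\<close>

lemma hopf_form_of_group_hopf:
  assumes F: "subfield F L"
    and C: "{c \<in> carrier (group_hopf (L\<lparr>carrier := F\<rparr>) P). \<forall>\<tau>\<in>S. gp_galois_action Y \<rho>' N \<tau> c = c} =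
      {c \<in> N \<rightarrow>\<^sub>E carrier L. equivariant L G (\<lambda>g. g) N (conj_act Y \<rho>) c}"
  shows "hopf_form L G (\<lambda>g. g) K (gp_hopf Kr (L\<lparr>carrier := F\<rparr>) S Y \<rho>' N) P (conj_act Y \<rho>) (\<lambda>c. c)"
proof -
  let ?C = "{c \<in> N \<rightarrow>\<^sub>E carrier L. equivariant L G (\<lambda>g. g) N (conj_act Y \<rho>) c}"
  have gs: "gset G (carrier P) (conj_act Y \<rho>)" using conj_act_gset by simp
  have aut: "conj_act Y \<rho> g (n \<otimes>\<^bsub>P\<^esub> m) = conj_act Y \<rho> g n \<otimes>\<^bsub>P\<^esub> conj_act Y \<rho> g m"
    if "g \<in> carrier G" "n \<in> carrier P" "m \<in> carrier P" for g n m
    using that conj_act_mult by simp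
  have C': "?C = {c \<in> carrier P \<rightarrow>\<^sub>E carrier L. equivariant L G (\<lambda>g. g) (carrier P) (conj_act Y \<rho>) c}" by simp
  have CF: "c n \<in> F" if "c \<in> ?C" "n \<in> carrier P" for c n
  proof -
    have "c \<in> carrier (group_hopf (L\<lparr>carrier := F\<rparr>) P)" using that(1) unfolding C[symmetric] by simp
    then show ?thesis using that(2) by (auto simp: group_hopf_def hopf_of_def group_alg_def Let_def)
  qed
  show ?thesis
    unfolding gp_hopf_def Let_def C
    by (rule group_hopf_form[where P = P and b = "conj_act Y \<rho>" and F = F and C = ?C, OF P.is_group gs _ F C' _ refl refl refl])
       (erule (2) aut, erule (1) CF)
qed

lemma gp_hopf_form:
  "hopf_form L G (\<lambda>g. g) K (gp_hopf Kr L (carrier G) Y \<rho> N) P (conj_act Y \<rho>) (\<lambda>c. c)"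
proof -
  have fx: "gp_galois_action Y \<rho> N \<tau> c = c \<longleftrightarrow> (\<forall>n\<in>N. c (conj_act Y \<rho> \<tau> n) = \<tau> (c n))"
    if "\<tau> \<in> carrier G" "c \<in> extensional N" for \<tau> c
    by (rule gp_galois_action_fixed_iff[OF that]) simp
  have "{c \<in> carrier (group_hopf (L\<lparr>carrier := carrier L\<rparr>) P). \<forall>\<tau>\<in>carrier G. gp_galois_action Y \<rho> N \<tau> c = c} =
      {c \<in> N \<rightarrow>\<^sub>E carrier L. equivariant L G (\<lambda>g. g) N (conj_act Y \<rho>) c}"
    using fx by (auto simp: group_hopf_def hopf_of_def group_alg_def Let_def equivariant_def PiE_iff)
  from hopf_form_of_group_hopf[OF carrier_is_subfield this] show ?thesis by simp
qed

text \<open>The action formula gives only the value at the base point \<open>u0\<close>. The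
  function \<open>v\<close>, the same formula at an arbitrary point, is equivariant and therefore
  comes from an element of \<open>E\<close>; comparison at \<open>u0\<close> shows that this element
  is \<open>act h x\<close>, whose values are then known everywhere, as \<open>form_galois\<close>
  demands.\<close>

theorem gp_hopf_galois:
  assumes H: "hopf_form L G (\<lambda>g. g) K H P (conj_act Y \<rho>) (\<lambda>c. c)"
    and E: "subfield E L" "K \<subseteq> E" "finite_dimension K E"
    and EF: "form L G (\<lambda>g. g) K (sub_alg L E) Y a (\<lambda>x u. u x)"
    and a: "\<And>g y. g \<in> carrier G \<Longrightarrow> y \<in> Y \<Longrightarrow> a g y = \<rho> g y"
    and Y: "\<And>u. u \<in> Y \<Longrightarrow> u \<in> ring_hom L L"
    and u0: "u0 \<in> Y" "\<And>x. x \<in> E \<Longrightarrow> u0 x = x"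
    and act: "\<And>h x. h \<in> carrier H \<Longrightarrow> x \<in> E \<Longrightarrow> act h x = (\<Oplus>\<^bsub>L\<^esub>n\<in>N. h n \<otimes>\<^bsub>L\<^esub> (inv\<^bsub>BijGroup Y\<^esub> n) u0 x)"
  shows "hopf_galois L K E H act"
proof -
  note Hf = hopf_form_form[OF H]
  \<comment> \<open>The inverse makes \<open>?\<nu>\<close> a right action of \<open>N\<close>,
    which is the order required of \<open>\<nu>\<close>.\<close>
  let ?A = "sub_alg L E" and ?\<nu> = "\<lambda>n y. (inv\<^bsub>BijGroup Y\<^esub> n) y"
  have EL: "E \<subseteq> carrier L" using subfieldE(3)[OF E(1)] .
  have inv: "inv\<^bsub>BijGroup Y\<^esub> n \<in> Bij Y" if "n \<in> N" for n using inv_BijGroup_closed[OF N_Bij[OF that]] .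
  have \<nu>c: "?\<nu> n y \<in> Y" if "n \<in> N" "y \<in> Y" for n y using Bij_closed[OF inv[OF that(1)] that(2)] .
  have \<nu>e: "a g (?\<nu> n y) = ?\<nu> (conj_act Y \<rho> g n) (a g y)" if "g \<in> carrier G" "n \<in> N" "y \<in> Y" for g n y
  proof -
    note c = \<rho>_closed[OF that(1)] N_Bij[OF that(2)] N_Bij[OF normalized[OF that(1,2)]]
    have ry: "\<rho> g (?\<nu> n y) \<in> Y" using Bij_closed[OF c(1) \<nu>c[OF that(2,3)]] .
    have "conj_act Y \<rho> g n (\<rho> g (?\<nu> n y)) = \<rho> g y"
      using conj_act_apply[OF that(1,2) \<nu>c[OF that(2,3)]] apply_inv_BijGroup[OF c(2) that(3)] by simp
    then show ?thesis
      using inv_BijGroup_apply[OF c(3) ry] a[OF that(1)] \<nu>c[OF that(2,3)] that(3) by simp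
  qed
  have val: "act h x \<in> E \<and> (\<forall>y\<in>Y. y (act h x) = (\<Oplus>\<^bsub>L\<^esub>n\<in>N. h n \<otimes>\<^bsub>L\<^esub> ?\<nu> n y x))"
    if h: "h \<in> carrier H" and x: "x \<in> E" for h x
  proof -
    define v where "v = (\<lambda>y. \<Oplus>\<^bsub>L\<^esub>n\<in>N. h n \<otimes>\<^bsub>L\<^esub> ?\<nu> n y x)"
    have hc: "h n \<in> carrier L" if "n \<in> N" for n using form_closed[OF Hf h] that by simp
    have he: "h (conj_act Y \<rho> g n) = g (h n)" if "g \<in> carrier G" "n \<in> N" for g n
      using equivariant_eq[OF form_equivariant[OF Hf h] that(1)] that(2) by simp
    have xc: "u x \<in> carrier L" if "u \<in> Y" for u using ring_hom_closed[OF Y[OF that]] x EL by auto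
    have xe: "a g u x = g (u x)" if "g \<in> carrier G" "u \<in> Y" for g u
      using equivariant_eq[OF form_equivariant[OF EF, of x] that] x by simp
    have "equivariant L G (\<lambda>g. g) Y a v"
      unfolding equivariant_def
    proof (intro conjI ballI)
      fix y assume y: "y \<in> Y"
      show "v y \<in> carrier L" unfolding v_def using hc xc \<nu>c y by (intro finsum_closed) auto
      fix g assume g: "g \<in> carrier G"
      have ay: "a g y \<in> Y" using gset_closed[OF form_gset[OF EF] g y] .
      have "v (a g y) = (\<Oplus>\<^bsub>L\<^esub>n\<in>N. h (conj_act Y \<rho> g n) \<otimes>\<^bsub>L\<^esub> ?\<nu> (conj_act Y \<rho> g n) (a g y) x)"
        unfolding v_def
        by (rule finsum_reindex_bij[OF gset_bij[OF G.is_group conj_act_gset g]]) (use hc xc \<nu>c ay in auto)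
      also have "\<dots> = (\<Oplus>\<^bsub>L\<^esub>n\<in>N. g (h n \<otimes>\<^bsub>L\<^esub> ?\<nu> n y x))"
        using g y \<nu>c hc xc by (intro finsum_cong_pointwise) (simp add: he \<nu>e[symmetric] xe \<alpha>_times)
      also have "\<dots> = g (v y)" unfolding v_def using g y \<nu>c hc xc by (subst \<alpha>_finsum) auto
      finally show "v (a g y) = g (v y)" .
    qed
    from form_surj[OF EF this] obtain m where m: "m \<in> E" "\<forall>y\<in>Y. y m = v y" by auto
    have "act h x = v u0" unfolding act[OF h x] v_def ..
    also have "\<dots> = m" using m u0 by force
    finally show ?thesis using m by (simp add: v_def)
  qed
  have A: "assoc_algebra Kr ?A" by (rule assoc_algebra_sub_alg[OF K_subfield E(1,2)])
  have c1: "act h x \<in> carrier ?A" if "h \<in> carrier H" "x \<in> carrier ?A" for h x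
    using val that by simp
  have c2: "y (act h x) = (\<Oplus>\<^bsub>L\<^esub>n\<in>carrier P. h n \<otimes>\<^bsub>L\<^esub> ?\<nu> n y x)"
    if "h \<in> carrier H" "x \<in> carrier ?A" "y \<in> Y" for h x y
    using val that by simp
  \<comment> \<open>That n^-1 sends \<open>y\<close> to \<open>y'\<close> means that
    \<open>n\<close> sends \<open>y'\<close> to \<open>y\<close>, so simple transitivity is used
    with the points exchanged.\<close>
  have r: "\<exists>!n. n \<in> carrier P \<and> ?\<nu> n y = y'" if "y \<in> Y" "y' \<in> Y" for y y'
  proof -
    have "(?\<nu> n y = y') = (n y' = y)" if "n \<in> N" for n
      using inv_BijGroup_apply[OF N_Bij[OF that] \<open>y' \<in> Y\<close>] apply_inv_BijGroup[OF N_Bij[OF that] \<open>y \<in> Y\<close>] by auto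
    then have "(n \<in> carrier P \<and> ?\<nu> n y = y') = (n \<in> N \<and> n y' = y)" for n by auto
    then show ?thesis using regular that by (simp add: regular_subgroup_def)
  qed
  have one: "?\<nu> \<one>\<^bsub>P\<^esub> y = y" if "y \<in> Y" for y
    using that B.inv_one by (simp add: one_BijGroup)
  have mult: "?\<nu> (n \<otimes>\<^bsub>P\<^esub> m) y = ?\<nu> m (?\<nu> n y)" if "n \<in> carrier P" "m \<in> carrier P" "y \<in> Y" for n m y
    using that N_Bij inv by (simp add: B.inv_mult_group BijGroup_apply)
  have fm: "p (x \<otimes>\<^bsub>?A\<^esub> y) = p x \<otimes>\<^bsub>L\<^esub> p y" if "x \<in> carrier ?A" "y \<in> carrier ?A" "p \<in> Y" for x y p
    using that ring_hom_mult[OF Y[OF that(3)]] EL by auto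
  have fo: "p \<one>\<^bsub>?A\<^esub> = \<one>\<^bsub>L\<^esub>" if "p \<in> Y" for p using ring_hom_one[OF Y[OF that]] by simp
  have \<nu>c': "?\<nu> n y \<in> Y" if "n \<in> carrier P" "y \<in> Y" for n y using \<nu>c that by simp
  have \<nu>e': "a g (?\<nu> n y) = ?\<nu> (conj_act Y \<rho> g n) (a g y)" if "g \<in> carrier G" "n \<in> carrier P" "y \<in> Y" for g n y
    using \<nu>e that by simp
  have "hopf_module_algebra Kr H ?A act \<and>
    bij_betw (tensor_lift Kr ?A H (End_group Kr ?A) (\<lambda>x h. \<lambda>y\<in>carrier ?A. x \<otimes>\<^bsub>?A\<^esub> act h y))
      (carrier (tensor Kr ?A H)) (carrier (End_group Kr ?A))"
  proof (rule form_galois[where \<nu> = ?\<nu> and f = "\<lambda>x u. u x" and e = "\<lambda>c. c", OF H EF A])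
    show "p (x \<otimes>\<^bsub>?A\<^esub> y) = p x \<otimes>\<^bsub>L\<^esub> p y" if "x \<in> carrier ?A" "y \<in> carrier ?A" "p \<in> Y" for x y p
      using that by (rule fm)
    show "p \<one>\<^bsub>?A\<^esub> = \<one>\<^bsub>L\<^esub>" if "p \<in> Y" for p using that by (rule fo)
    show "?\<nu> n y \<in> Y" if "n \<in> carrier P" "y \<in> Y" for n y using that by (rule \<nu>c')
    show "?\<nu> \<one>\<^bsub>P\<^esub> y = y" if "y \<in> Y" for y using that by (rule one)
    show "?\<nu> (n \<otimes>\<^bsub>P\<^esub> m) y = ?\<nu> m (?\<nu> n y)" if "n \<in> carrier P" "m \<in> carrier P" "y \<in> Y" for n m y
      using that by (rule mult)
    show "a g (?\<nu> n y) = ?\<nu> (conj_act Y \<rho> g n) (a g y)" if "g \<in> carrier G" "n \<in> carrier P" "y \<in> Y" for g n y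
      using that by (rule \<nu>e')
    show "\<exists>!n. n \<in> carrier P \<and> ?\<nu> n y = y'" if "y \<in> Y" "y' \<in> Y" for y y' using that by (rule r)
    show "act h x \<in> carrier ?A" if "h \<in> carrier H" "x \<in> carrier ?A" for h x using that by (rule c1)
    show "y (act h x) = (\<Oplus>\<^bsub>L\<^esub>n\<in>carrier P. h n \<otimes>\<^bsub>L\<^esub> ?\<nu> n y x)"
      if "h \<in> carrier H" "x \<in> carrier ?A" "y \<in> Y" for h x y using that by (rule c2)
  qed
  then show ?thesis
    unfolding hopf_galois_def using E K_subfield field_axioms by simp
qed

end

lemma (in galois_action) form_bij:
  assumes M: "form L G \<alpha> K M U a e" and M': "form L G \<alpha> K M' U a e'"
    and \<phi>: "\<And>m. m \<in> carrier M \<Longrightarrow> \<phi> m \<in> carrier M'" "\<And>m x. m \<in> carrier M \<Longrightarrow> x \<in> U \<Longrightarrow> e' (\<phi> m) x = e m x"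
  shows "bij_betw \<phi> (carrier M) (carrier M')"
proof (rule bij_betwI')
  fix x y assume c: "x \<in> carrier M" "y \<in> carrier M"
  show "(\<phi> x = \<phi> y) = (x = y)"
  proof
    assume "\<phi> x = \<phi> y"
    then show "x = y" by (intro form_inj[OF M c]) (use c \<phi>(2) in metis)
  qed simp
next
  fix y assume c: "y \<in> carrier M'"
  obtain x where x: "x \<in> carrier M" "\<forall>n\<in>U. e x n = e' y n"
    using form_surj[OF M form_equivariant[OF M' c]] by auto
  have "y = \<phi> x" by (rule form_inj[OF M' c]) (use x \<phi> in auto)
  with x show "\<exists>x\<in>carrier M. y = \<phi> x" by auto
qed (rule \<phi>(1))

section \<open>Semidirect products of Galois groups\<close>

locale galois_semidirect =
  fixes L :: "('l, 'm) ring_scheme" and K :: "'l set" and J G' :: "('l \<Rightarrow> 'l) set"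
  assumes galois: "finite_galois L K" and sd: "semidirect (gal L K) J G'"
begin

abbreviation "G \<equiv> gal L K"
abbreviation "E \<equiv> fixed_field L G'"
abbreviation "F \<equiv> fixed_field L J"

lemma fieldL: "field L" and subfieldK: "subfield K L" and fdL: "ring.finite_dimension L K (carrier L)"
  and fixedK: "fixed_field L (carrier G) = K"
  using galois by (auto simp: finite_galois_def)

sublocale L: field L by (rule fieldL)

lemma KL: "K \<subseteq> carrier L" using subfieldE(3)[OF subfieldK] .
lemma finG: "finite (carrier G)" by (rule L.finite_gal[OF subfieldK fdL])
lemma groupG: "group G" by (rule L.group_gal[OF KL])

sublocale S: semidirect_product G J G'
  by (rule semidirect_product.intro[OF groupG semidirect_product_axioms.intro[OF sd finG]])

sublocale A: galois_action L G "\<lambda>g. g" K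
  using galois_action_gal[OF fieldL KL finG group.subgroup_self[OF groupG]] by (simp add: fixedK)

abbreviation "GG' \<equiv> G\<lparr>carrier := G'\<rparr>"

sublocale AE: galois_action L GG' "\<lambda>g. g" E
  by (rule galois_action_gal[OF fieldL KL finG S.G'_subgroup])

sublocale AF: galois_action L "G\<lparr>carrier := J\<rparr>" "\<lambda>g. g" F
  by (rule galois_action_gal[OF fieldL KL finG S.J_subgroup])

lemma G_hom: "g \<in> carrier G \<Longrightarrow> g \<in> ring_hom L L" by (rule A.\<alpha>_hom)
lemma G_K: "g \<in> carrier G \<Longrightarrow> k \<in> K \<Longrightarrow> g k = k" by (simp add: carrier_gal)
lemma G_mult: "g \<in> carrier G \<Longrightarrow> h \<in> carrier G \<Longrightarrow> x \<in> carrier L \<Longrightarrow> (g \<otimes>\<^bsub>G\<^esub> h) x = g (h x)"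
  by (rule gal_apply)
lemma G_one: "x \<in> carrier L \<Longrightarrow> \<one>\<^bsub>G\<^esub> x = x" by (simp add: one_gal)

lemma K_E: "K \<subseteq> E" and K_F: "K \<subseteq> F"
  using KL G_K S.G'_closed S.J_closed by (auto simp: fixed_field_def)

lemma E_carrier: "x \<in> E \<Longrightarrow> x \<in> carrier L" and F_carrier: "x \<in> F \<Longrightarrow> x \<in> carrier L"
  by (auto simp: fixed_field_def)

text \<open>Normality of \<open>J\<close>: \<open>\<sigma>\<close> after \<open>g\<close> is
  \<open>g\<close> after the conjugate g^-1 \<sigma> g, which lies in \<open>J\<close> and fixes
  \<open>x\<close>.\<close>

lemma F_stable:
  assumes "g \<in> carrier G" "x \<in> F" shows "g x \<in> F"
proof -
  have x: "x \<in> carrier L" by (rule F_carrier[OF assms(2)])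
  have "\<sigma> (g x) = g x" if s: "\<sigma> \<in> J" for \<sigma>
  proof -
    have t: "inv\<^bsub>G\<^esub> g \<otimes>\<^bsub>G\<^esub> \<sigma> \<otimes>\<^bsub>G\<^esub> g \<in> J" by (rule normal.inv_op_closed1[OF S.J_normal assms(1) s])
    have "g \<otimes>\<^bsub>G\<^esub> (inv\<^bsub>G\<^esub> g \<otimes>\<^bsub>G\<^esub> \<sigma> \<otimes>\<^bsub>G\<^esub> g) = \<sigma> \<otimes>\<^bsub>G\<^esub> g"
      using assms(1) S.J_closed[OF s] by (simp add: S.m_assoc S.mult_inv_cancel)
    then have "\<sigma> (g x) = g ((inv\<^bsub>G\<^esub> g \<otimes>\<^bsub>G\<^esub> \<sigma> \<otimes>\<^bsub>G\<^esub> g) x)"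
      using assms(1) S.J_closed[OF s] S.J_closed[OF t] x by (metis G_mult)
    also have "(inv\<^bsub>G\<^esub> g \<otimes>\<^bsub>G\<^esub> \<sigma> \<otimes>\<^bsub>G\<^esub> g) x = x"
      using t assms(2) unfolding fixed_field_def by blast
    finally show ?thesis .
  qed
  then show ?thesis using assms(1) x A.\<alpha>_closed by (simp add: fixed_field_def)
qed

text \<open>The component in \<open>G'\<close> is applied first and fixes \<open>E\<close>. For
  \<open>apply_F\<close> the component in \<open>J\<close> comes last and meets an element of
  \<open>F\<close>, by \<open>F_stable\<close>.\<close>

lemma apply_E: "g \<in> carrier G \<Longrightarrow> x \<in> E \<Longrightarrow> g x = S.np g x"
proof -
  assume g: "g \<in> carrier G" and x: "x \<in> E"
  have "g x = (S.np g \<otimes>\<^bsub>G\<^esub> S.cp g) x" using g by (simp add: S.np_cp)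
  also have "\<dots> = S.np g (S.cp g x)"
    by (rule G_mult[OF S.J_closed[OF S.np_closed[OF g]] S.G'_closed[OF S.cp_closed[OF g]] E_carrier[OF x]])
  also have "S.cp g x = x" using x S.cp_closed[OF g] by (simp add: fixed_field_def)
  finally show ?thesis .
qed

lemma apply_F: "g \<in> carrier G \<Longrightarrow> x \<in> F \<Longrightarrow> g x = S.cp g x"
proof -
  assume g: "g \<in> carrier G" and x: "x \<in> F"
  have "g x = (S.np g \<otimes>\<^bsub>G\<^esub> S.cp g) x" using g by (simp add: S.np_cp)
  also have "\<dots> = S.np g (S.cp g x)"
    by (rule G_mult[OF S.J_closed[OF S.np_closed[OF g]] S.G'_closed[OF S.cp_closed[OF g]] F_carrier[OF x]])
  also have "\<dots> = S.cp g x"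
    using F_stable[OF S.G'_closed[OF S.cp_closed[OF g]] x] S.np_closed[OF g] by (simp add: fixed_field_def)
  finally show ?thesis .
qed

lemma E_Int_F: "E \<inter> F = K"
proof -
  have "x \<in> K" if x: "x \<in> E" "x \<in> F" for x
  proof -
    have "g x = x" if g: "g \<in> carrier G" for g
      using apply_E[OF g x(1)] x(2) S.np_closed[OF g] by (simp add: fixed_field_def)
    then have "x \<in> fixed_field L (carrier G)" using E_carrier[OF x(1)] by (simp add: fixed_field_def)
    then show ?thesis unfolding fixedK .
  qed
  then show ?thesis using K_E K_F by auto
qed

section \<open>The fields \<open>E\<close>, \<open>F\<close> and \<open>L\<close> as forms\<close>

abbreviation "lamc \<equiv> lambda_c G J G'"
abbreviation "lamb \<equiv> \<lambda>g. left_reg G G' (S.cp g)"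
abbreviation "lam \<equiv> left_reg G (carrier G)"
abbreviation "EA \<equiv> sub_alg L E"
abbreviation "FA \<equiv> sub_alg L F"
abbreviation "LA \<equiv> sub_alg L (carrier L)"
abbreviation "app \<equiv> \<lambda>(x :: 'l) (u :: 'l \<Rightarrow> 'l). u x"

text \<open>Elements of \<open>J\<close> are regarded as embeddings of \<open>E\<close>. The
  restriction of a group element to \<open>E\<close> depends only on its normal part, which is why
  composition with \<open>g\<close> becomes \<open>lambda_c\<close> on \<open>J\<close>.\<close>

lemma form_E: "form L G (\<lambda>g. g) K EA J lamc app"
proof (rule A.embedding_form[OF S.lambda_c_gset AE.K_subfield K_E _ _ S.J_one])
  fix u assume u: "u \<in> J"
  show "u \<in> ring_hom L L" by (rule G_hom[OF S.J_closed[OF u]])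
  show "u k = k" if "k \<in> K" for k by (rule G_K[OF S.J_closed[OF u] that])
  show "\<exists>g\<in>carrier G. lamc g \<one>\<^bsub>G\<^esub> = u"
    using S.lambda_c_one[OF S.J_closed[OF u]] S.np_J(1)[OF u] S.J_closed[OF u] by auto
  fix g x assume g: "g \<in> carrier G" and x: "x \<in> E"
  have c: "g \<otimes>\<^bsub>G\<^esub> u \<in> carrier G" using g S.J_closed[OF u] by simp
  show "lamc g u x = g (u x)"
    using apply_E[OF c x] G_mult[OF g S.J_closed[OF u] E_carrier[OF x]] S.lambda_c_np[OF g u] by simp
next
  fix x assume x: "x \<in> carrier L" and h: "\<And>g. g \<in> carrier G \<Longrightarrow> lamc g \<one>\<^bsub>G\<^esub> = \<one>\<^bsub>G\<^esub> \<Longrightarrow> g x = x"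
  show "x \<in> E"
    using x h[OF S.G'_closed] S.lambda_c_one[OF S.G'_closed] S.cp_G'(1) by (simp add: fixed_field_def)
qed (simp add: G_one E_carrier)

lemma form_F: "form L G (\<lambda>g. g) K FA G' lamb app"
proof (rule A.embedding_form[OF S.left_cp_gset AF.K_subfield K_F _ _ S.G'_one])
  fix u assume u: "u \<in> G'"
  show "u \<in> ring_hom L L" by (rule G_hom[OF S.G'_closed[OF u]])
  show "u k = k" if "k \<in> K" for k by (rule G_K[OF S.G'_closed[OF u] that])
  show "\<exists>g\<in>carrier G. lamb g \<one>\<^bsub>G\<^esub> = u"
    using u S.G'_closed[OF u] S.G'_one by (intro bexI[of _ u]) (simp_all add: left_reg_def S.cp_G')
  fix g x assume g: "g \<in> carrier G" and x: "x \<in> F"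
  have "lamb g u x = (S.cp g \<otimes>\<^bsub>G\<^esub> u) x" using u by (simp add: left_reg_def)
  also have "\<dots> = S.cp g (u x)"
    by (rule G_mult[OF S.G'_closed[OF S.cp_closed[OF g]] S.G'_closed[OF u] F_carrier[OF x]])
  also have "\<dots> = g (u x)" using apply_F[OF g F_stable[OF S.G'_closed[OF u] x]] by simp
  finally show "lamb g u x = g (u x)" .
next
  fix x assume x: "x \<in> carrier L" and h: "\<And>g. g \<in> carrier G \<Longrightarrow> lamb g \<one>\<^bsub>G\<^esub> = \<one>\<^bsub>G\<^esub> \<Longrightarrow> g x = x"
  have "g x = x" if g: "g \<in> J" for g
    by (rule h[OF S.J_closed[OF g]]) (use S.G'_one in \<open>simp add: left_reg_def S.np_J(2)[OF g]\<close>)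
  then show "x \<in> F" using x by (simp add: fixed_field_def)
qed (simp add: G_one F_carrier)

lemma lam_gset: "gset G (carrier G) lam"
  using S.left_reg_gset[OF S.subgroup_self finG] by simp

lemma lam_hom: "lam \<in> hom G (BijGroup (carrier G))"
  using S.left_reg_hom[OF S.subgroup_self finG] by simp

lemma form_L: "form L G (\<lambda>g. g) K LA (carrier G) lam app"
proof (rule A.embedding_form[OF lam_gset L.carrier_is_subfield KL _ _ S.one_closed])
  fix u assume u: "u \<in> carrier G"
  show "u \<in> ring_hom L L" by (rule G_hom[OF u])
  show "u k = k" if "k \<in> K" for k by (rule G_K[OF u that])
  show "\<exists>g\<in>carrier G. lam g \<one>\<^bsub>G\<^esub> = u" using u by (intro bexI[of _ u]) (simp_all add: left_reg_def)
  show "lam g u x = g (u x)" if "g \<in> carrier G" "x \<in> carrier L" for g x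
    using that u by (simp add: left_reg_def G_mult)
qed (simp_all add: G_one)

lemma left_cp_gset': "gset GG' G' lamb"
  using S.left_cp_gset S.G'_closed unfolding gset_def by simp

lemma left_cp_hom': "lamb \<in> hom GG' (BijGroup G')"
  using S.left_cp_hom S.G'_closed by (auto simp: hom_def)

text \<open>Here \<open>L\<close> itself is a form of \<open>G'\<close>, for the smaller group
  \<open>G'\<close> and over \<open>E\<close>; this is the version needed for
  \<open>H2\<close>.\<close>

lemma form_LE: "form L GG' (\<lambda>g. g) E LA G' lamb app"
proof (rule AE.embedding_form[OF left_cp_gset' L.carrier_is_subfield _ _ _ S.G'_one])
  show "E \<subseteq> carrier L" using E_carrier by auto
  fix u assume u: "u \<in> G'"
  show "u \<in> ring_hom L L" by (rule G_hom[OF S.G'_closed[OF u]])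
  show "u k = k" if "k \<in> E" for k using that u by (simp add: fixed_field_def)
  show "\<exists>g\<in>carrier GG'. lamb g \<one>\<^bsub>G\<^esub> = u"
    using u S.G'_closed[OF u] S.G'_one by (intro bexI[of _ u]) (simp_all add: left_reg_def S.cp_G')
  show "lamb g u x = g (u x)" if "g \<in> carrier GG'" "x \<in> carrier L" for g x
    using that u by (simp add: left_reg_def G_mult S.cp_G' S.G'_closed)
next
  fix x assume x: "x \<in> carrier L" and h: "\<And>g. g \<in> carrier GG' \<Longrightarrow> lamb g \<one>\<^bsub>G\<^esub> = \<one>\<^bsub>G\<^esub> \<Longrightarrow> g x = x"
  show "x \<in> carrier L" by (rule x)
qed (simp_all add: G_one)

section \<open>Linear disjointness of \<open>E\<close> and \<open>F\<close>\<close>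

lemmas kfun_E = form_kfun[OF form_E]
lemmas kfun_F = form_kfun[OF form_F]

sublocale EF: module_pair A.Kr EA FA by (rule A.module_pair_kfun[OF kfun_E kfun_F])

abbreviation "ev_EF \<equiv> ev L A.Kr EA FA app app"

text \<open>Sending \<open>g\<close> to its two components is equivariant by
  \<open>mult_parts\<close>, so the tensor product becomes a form of the same \<open>G\<close>-set
  as \<open>L\<close> and can be compared with it.\<close>

lemma form_EF: "form L G (\<lambda>g. g) K (tensor A.Kr EA FA) (carrier G) lam (\<lambda>t g. ev_EF t (S.np g, S.cp g))"
proof (rule A.form_transport[OF A.form_tensor[OF form_E form_F] lam_gset])
  show "bij_betw (\<lambda>g. (S.np g, S.cp g)) (carrier G) (J \<times> G')"
    by (rule bij_betw_byWitness[where f' = "\<lambda>p. fst p \<otimes>\<^bsub>G\<^esub> snd p"])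
       (auto simp: S.np_cp S.np_eq S.cp_eq S.np_closed S.cp_closed S.J_closed S.G'_closed)
  fix g x assume g: "g \<in> carrier G" and x: "x \<in> carrier G"
  then show "(S.np (lam g x), S.cp (lam g x)) = (lamc g (fst (S.np x, S.cp x)), lamb g (snd (S.np x, S.cp x)))"
    by (simp add: left_reg_def S.mult_parts S.lambda_c_eq S.np_closed S.cp_closed)
qed

definition "\<mu> = tensor_lift A.Kr EA FA (add_monoid LA) (\<lambda>x y. x \<otimes>\<^bsub>L\<^esub> y)"

lemma apply_EF:
  assumes g: "g \<in> carrier G" and x: "x \<in> E" and y: "y \<in> F"
  shows "g (x \<otimes>\<^bsub>L\<^esub> y) = S.np g x \<otimes>\<^bsub>L\<^esub> S.cp g y"
  using A.\<alpha>_times[OF g E_carrier[OF x] F_carrier[OF y]] apply_E[OF g x] apply_F[OF g y] by simp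

lemma
  shows \<mu>_tens: "x \<in> E \<Longrightarrow> y \<in> F \<Longrightarrow> \<mu> (tens A.Kr EA FA x y) = x \<otimes>\<^bsub>L\<^esub> y"
    and \<mu>_closed: "t \<in> carrier EF.TG \<Longrightarrow> \<mu> t \<in> carrier L"
    and \<mu>_val: "t \<in> carrier EF.TG \<Longrightarrow> g \<in> carrier G \<Longrightarrow> g (\<mu> t) = ev_EF t (S.np g, S.cp g)"
    and \<mu>_hom: "\<mu> \<in> hom EF.TG (add_monoid LA)"
proof -
  \<comment> \<open>An element \<open>g\<close> acts on a product from \<open>E\<close> and
    \<open>F\<close> through one component on each factor, so the value of \<open>\<mu> t\<close> at
    \<open>g\<close> is the value of \<open>t\<close> at the pair of components of
    \<open>g\<close>.\<close>
  let ?\<Psi> = "\<lambda>g w. w (S.np g, S.cp g)"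
  have c: "x \<otimes>\<^bsub>L\<^esub> y \<in> carrier (add_monoid LA)" if "x \<in> carrier EA" "y \<in> carrier FA" for x y
    using that E_carrier F_carrier by simp
  have v: "g (x \<otimes>\<^bsub>L\<^esub> y) = ?\<Psi> g (\<lambda>p. fst p x \<otimes>\<^bsub>L\<^esub> snd p y)"
    if "x \<in> carrier EA" "y \<in> carrier FA" "g \<in> carrier G" for x y g
    using that apply_EF by simp
  have ad: "addfun L (J \<times> G') (?\<Psi> g)" if "g \<in> carrier G" for g
    by (rule A.addfun_eval) (use that S.np_closed S.cp_closed in auto)
  let ?\<beta> = "\<lambda>x y. x \<otimes>\<^bsub>L\<^esub> y"
  note emb = form_emb[OF form_L]
  show "\<mu> (tens A.Kr EA FA x y) = x \<otimes>\<^bsub>L\<^esub> y" if "x \<in> E" "y \<in> F"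
    unfolding \<mu>_def
    by (rule A.lift_into_tens[OF kfun_E kfun_F emb, where \<beta> = ?\<beta> and \<Psi> = ?\<Psi>, OF c v ad]) (use that in simp_all)
  show "\<mu> t \<in> carrier L" if "t \<in> carrier EF.TG"
    using A.lift_into_closed[OF kfun_E kfun_F emb, where \<beta> = ?\<beta> and \<Psi> = ?\<Psi>, OF c v ad that]
    unfolding \<mu>_def by simp
  show "g (\<mu> t) = ev_EF t (S.np g, S.cp g)" if "t \<in> carrier EF.TG" "g \<in> carrier G"
    unfolding \<mu>_def
    by (rule A.lift_into_val[OF kfun_E kfun_F emb, where \<beta> = ?\<beta> and \<Psi> = ?\<Psi>, OF c v ad that])
  show "\<mu> \<in> hom EF.TG (add_monoid LA)"
    unfolding \<mu>_def
    by (rule A.lift_into_hom[OF kfun_E kfun_F emb, where \<beta> = ?\<beta> and \<Psi> = ?\<Psi>, OF c v ad])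
qed

lemma \<mu>_bij: "bij_betw \<mu> (carrier (tensor A.Kr EA FA)) (carrier LA)"
  by (rule A.form_bij[OF form_EF form_L]) (use \<mu>_closed \<mu>_val in auto)

lemma mult_law_EF: "mult_law L EA J app {()} (\<lambda>p i. p) (\<lambda>p i. p)" "mult_law L FA G' app {()} (\<lambda>p i. p) (\<lambda>p i. p)"
proof -
  show "mult_law L EA J app {()} (\<lambda>p i. p) (\<lambda>p i. p)"
    using subringE(6)[OF subfieldE(1)[OF AE.K_subfield]] A.\<alpha>_times[OF S.J_closed] A.\<alpha>_closed[OF S.J_closed] E_carrier
    by (simp add: mult_law_def)
  show "mult_law L FA G' app {()} (\<lambda>p i. p) (\<lambda>p i. p)"
    using subringE(6)[OF subfieldE(1)[OF AF.K_subfield]] A.\<alpha>_times[OF S.G'_closed] A.\<alpha>_closed[OF S.G'_closed] F_carrier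
    by (simp add: mult_law_def)
qed

lemma \<mu>_alg_hom: "\<mu> \<in> alg_hom A.Kr (tensor A.Kr EA FA) LA"
proof -
  note ml = A.tensor_mult_law[OF form_E form_F mult_law_EF]
  have inj: "x = y" if "x \<in> carrier L" "y \<in> carrier L" "\<And>g. g \<in> carrier G \<Longrightarrow> g x = g y" for x y
    using form_inj[OF form_L, of x y] that by simp
  have mult: "\<mu> (s \<otimes>\<^bsub>tensor A.Kr EA FA\<^esub> t) = \<mu> s \<otimes>\<^bsub>L\<^esub> \<mu> t" if st: "s \<in> carrier EF.TG" "t \<in> carrier EF.TG" for s t
  proof (rule inj)
    have c: "s \<otimes>\<^bsub>tensor A.Kr EA FA\<^esub> t \<in> carrier EF.TG" using mult_law_closed[OF ml] st by simp
    show "\<mu> (s \<otimes>\<^bsub>tensor A.Kr EA FA\<^esub> t) \<in> carrier L" by (rule \<mu>_closed[OF c])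
    show "\<mu> s \<otimes>\<^bsub>L\<^esub> \<mu> t \<in> carrier L" using \<mu>_closed st by simp
    fix g assume g: "g \<in> carrier G"
    note p = S.np_closed[OF g] S.cp_closed[OF g]
    have "ev_EF (s \<otimes>\<^bsub>tensor A.Kr EA FA\<^esub> t) (S.np g, S.cp g) = ev_EF s (S.np g, S.cp g) \<otimes>\<^bsub>L\<^esub> ev_EF t (S.np g, S.cp g)"
      using mult_law_eq[OF ml, of s t "(S.np g, S.cp g)"] st p A.ev_closed[OF kfun_E kfun_F _ p] by simp
    then show "g (\<mu> (s \<otimes>\<^bsub>tensor A.Kr EA FA\<^esub> t)) = g (\<mu> s \<otimes>\<^bsub>L\<^esub> \<mu> t)"
      using g c st \<mu>_closed by (simp add: \<mu>_val A.\<alpha>_times)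
  qed
  have sm: "\<mu> (r \<odot>\<^bsub>tensor A.Kr EA FA\<^esub> t) = r \<otimes>\<^bsub>L\<^esub> \<mu> t" if r: "r \<in> K" and t: "t \<in> carrier EF.TG" for r t
  proof (rule inj)
    have c: "r \<odot>\<^bsub>tensor A.Kr EA FA\<^esub> t \<in> carrier EF.TG"
      using hom_in_carrier[OF EF.tensor_smult_hom t] r by simp
    show "\<mu> (r \<odot>\<^bsub>tensor A.Kr EA FA\<^esub> t) \<in> carrier L" by (rule \<mu>_closed[OF c])
    show "r \<otimes>\<^bsub>L\<^esub> \<mu> t \<in> carrier L" using \<mu>_closed t r KL by auto
    fix g assume g: "g \<in> carrier G"
    have "ev_EF (r \<odot>\<^bsub>tensor A.Kr EA FA\<^esub> t) (S.np g, S.cp g) = r \<otimes>\<^bsub>L\<^esub> ev_EF t (S.np g, S.cp g)"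
      using kfun_smult[OF A.kfun_tensor[OF kfun_E kfun_F] r, of t "(S.np g, S.cp g)"] t S.np_closed[OF g] S.cp_closed[OF g] by simp
    then show "g (\<mu> (r \<odot>\<^bsub>tensor A.Kr EA FA\<^esub> t)) = g (r \<otimes>\<^bsub>L\<^esub> \<mu> t)"
      using g c t r KL \<mu>_closed by (simp add: \<mu>_val A.\<alpha>_times G_K subset_iff)
  qed
  have "\<mu> \<one>\<^bsub>tensor A.Kr EA FA\<^esub> = \<one>\<^bsub>L\<^esub>"
    using \<mu>_tens[of "\<one>\<^bsub>L\<^esub>" "\<one>\<^bsub>L\<^esub>"] subringE(3)[OF subfieldE(1)[OF AE.K_subfield]] subringE(3)[OF subfieldE(1)[OF AF.K_subfield]]
    by (simp add: EF.tensor_one)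
  then show ?thesis
    unfolding alg_hom_def linear_map_def
    using \<mu>_closed mult sm hom_mult[OF \<mu>_hom] by (auto intro!: ring_hom_memI)
qed

text \<open>Surjectivity of \<open>\<mu>\<close> writes each element of \<open>L\<close> as a sum of
  products of elements of \<open>E\<close> and \<open>F\<close>; no quotients are used.\<close>

lemma generate_EF: "generate_field L (E \<union> F) = carrier L"
proof
  have EFL: "E \<union> F \<subseteq> carrier L" using E_carrier F_carrier by auto
  show "generate_field L (E \<union> F) \<subseteq> carrier L" by (rule L.generate_field_incl[OF EFL])
  show "carrier L \<subseteq> generate_field L (E \<union> F)"
  proof
    fix x assume "x \<in> carrier L"
    then obtain t where t: "t \<in> carrier EF.TG" "x = \<mu> t" using \<mu>_bij by (auto simp: bij_betw_def)
    from t(1) have "\<mu> t \<in> generate_field L (E \<union> F)"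
    proof (induction t rule: EF.tensor_induct)
      case (tens x y)
      then show ?case by (simp add: \<mu>_tens) (blast intro: generate_field.intros)
    next
      case (add s t)
      then show ?case using hom_mult[OF \<mu>_hom] by (simp add: generate_field.eng_add)
    qed
    with t show "x \<in> generate_field L (E \<union> F)" by simp
  qed
qed

lemma fd_E: "ring.finite_dimension L K E" and fd_F: "ring.finite_dimension L K F"
  and fd_LE: "ring.finite_dimension L E (carrier L)"
  using L.finite_dimension_subfield[OF subfieldK AE.K_subfield K_E fdL]
    L.finite_dimension_subfield[OF subfieldK AF.K_subfield K_F fdL]
    L.finite_dimension_superfield[OF subfieldK AE.K_subfield K_E fdL] by auto

end

section \<open>The structure induced by \<open>N1\<close> and \<open>N2\<close>\<close>

context semidirect_product begin

lemma iota_inv: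
  assumes "\<phi> \<in> Bij J" "\<psi> \<in> Bij G'"
  shows "inv\<^bsub>BijGroup (carrier G)\<^esub> (iota G J G' \<phi> \<psi>) =
    iota G J G' (inv\<^bsub>BijGroup J\<^esub> \<phi>) (inv\<^bsub>BijGroup G'\<^esub> \<psi>)"
proof (rule group.inv_equality[OF group_BijGroup])
  interpret BJ: group "BijGroup J" by (rule group_BijGroup)
  interpret BG': group "BijGroup G'" by (rule group_BijGroup)
  have "iota G J G' (\<lambda>x\<in>J. x) (\<lambda>x\<in>G'. x) = \<one>\<^bsub>BijGroup (carrier G)\<^esub>"
    by (rule Bij_eqI[of _ "carrier G"])
       (simp_all add: iota_Bij id_Bij one_BijGroup iota_apply np_closed cp_closed np_cp)
  then show "iota G J G' (inv\<^bsub>BijGroup J\<^esub> \<phi>) (inv\<^bsub>BijGroup G'\<^esub> \<psi>) \<otimes>\<^bsub>BijGroup (carrier G)\<^esub> iota G J G' \<phi> \<psi> =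
      \<one>\<^bsub>BijGroup (carrier G)\<^esub>"
    using assms BJ.l_inv[of \<phi>] BG'.l_inv[of \<psi>]
    by (simp add: iota_mult[symmetric] inv_BijGroup_closed) (simp add: one_BijGroup)
qed (use assms in \<open>auto intro: iota_Bij inv_BijGroup_closed\<close>)

text \<open>\<open>left_reg_iota\<close> splits the conjugating translation into components, and
  \<open>iota\<close> respects products and inverses.\<close>

lemma conj_act_iota:
  assumes g: "g \<in> carrier G" and "\<phi> \<in> Bij J" "\<psi> \<in> Bij G'"
  shows "conj_act (carrier G) (left_reg G (carrier G)) g (iota G J G' \<phi> \<psi>) =
    iota G J G' (conj_act J (lambda_c G J G') g \<phi>) (conj_act G' (\<lambda>g. left_reg G G' (cp g)) g \<psi>)"
proof -
  interpret BJ: group "BijGroup J" by (rule group_BijGroup)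
  interpret BG': group "BijGroup G'" by (rule group_BijGroup)
  have a: "lambda_c G J G' g \<in> Bij J" "left_reg G G' (cp g) \<in> Bij G'"
    using hom_in_carrier[OF lambda_c_hom g] hom_in_carrier[OF left_cp_hom g] by auto
  show ?thesis
    using assms a BJ.m_closed[of "lambda_c G J G' g" \<phi>] BG'.m_closed[of "left_reg G G' (cp g)" \<psi>]
    by (simp add: conj_act_def left_reg_iota[OF g] iota_inv iota_mult inv_BijGroup_closed)
qed

end

lemma (in gp_data) gp_hopf_extensional:
  "h \<in> carrier (gp_hopf R (L\<lparr>carrier := F\<rparr>) S Y \<rho>' N) \<Longrightarrow> h \<in> extensional N"
  by (simp add: gp_hopf_def Let_def group_hopf_def hopf_of_def group_alg_def PiE_iff)

locale induced_structure = galois_semidirect +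
  fixes N1 N2
  assumes N1: "regular_subgroup J N1" "normalized_by J N1 (lambda_c (gal L K) J G' ` carrier (gal L K))"
    and N2: "regular_subgroup G' N2" "normalized_by G' N2 (left_reg (gal L K) G' ` G')"
begin

abbreviation "N \<equiv> induced_subgroup G J G' N1 N2"
abbreviation "io \<equiv> iota G J G'"

lemma N1_Bij: "n \<in> N1 \<Longrightarrow> n \<in> Bij J"
  using N1(1) subgroup.mem_carrier by (fastforce simp: regular_subgroup_def)
lemma N2_Bij: "n \<in> N2 \<Longrightarrow> n \<in> Bij G'"
  using N2(1) subgroup.mem_carrier by (fastforce simp: regular_subgroup_def)

lemma gp1: "gp_data L G K J lamc N1"
proof -
  have "normalized_perms G J lamc N1"
    by (rule normalized_perms.intro[OF groupG normalized_perms_axioms.intro])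
       (use N1 normalized_by_conj_act[OF N1(2)] S.lambda_c_hom S.finite_J in \<open>auto simp: regular_subgroup_def\<close>)
  then show ?thesis
    using N1(1) A.galois_action_axioms by (simp add: gp_data_def gp_data_axioms_def)
qed

lemma lamb_normalized: "g \<in> carrier G \<Longrightarrow> n \<in> N2 \<Longrightarrow> conj_act G' lamb g n \<in> N2"
  using normalized_by_conj_act[OF N2(2) S.cp_closed, of g n] by (simp add: conj_act_def)

text \<open>The same \<open>N2\<close> is used twice: here for \<open>G\<close> over
  \<open>K\<close>, acting through the projection to \<open>G'\<close>, which leads to
  \<open>Hbar\<close>; in \<open>gp2\<close> for \<open>G'\<close> over \<open>E\<close>, which
  leads to \<open>H2\<close>.\<close>

lemma gpb: "gp_data L G K G' lamb N2"
proof -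
  have "normalized_perms G G' lamb N2"
    by (rule normalized_perms.intro[OF groupG normalized_perms_axioms.intro])
       (use N2 lamb_normalized S.left_cp_hom S.finite_G' in \<open>auto simp: regular_subgroup_def\<close>)
  then show ?thesis
    using N2(1) A.galois_action_axioms by (simp add: gp_data_def gp_data_axioms_def)
qed

lemma gp2: "gp_data L GG' E G' lamb N2"
proof -
  have "normalized_perms GG' G' lamb N2"
    by (rule normalized_perms.intro[OF AE.G.is_group normalized_perms_axioms.intro])
       (use N2 lamb_normalized left_cp_hom' S.finite_G' S.G'_closed in \<open>auto simp: regular_subgroup_def\<close>)
  then show ?thesis
    using N2(1) AE.galois_action_axioms by (simp add: gp_data_def gp_data_axioms_def)
qed

interpretation D1: gp_data L G K J lamc N1 by (rule gp1)
interpretation Db: gp_data L G K G' lamb N2 by (rule gpb)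
interpretation D2: gp_data L GG' E G' lamb N2 by (rule gp2)

lemma iota_N: "n \<in> N1 \<Longrightarrow> m \<in> N2 \<Longrightarrow> io n m \<in> N"
  unfolding induced_subgroup_def by auto

lemma N_iota: "k \<in> N \<Longrightarrow> \<exists>n\<in>N1. \<exists>m\<in>N2. k = io n m"
  unfolding induced_subgroup_def by auto

lemma N_subgroup: "subgroup N (BijGroup (carrier G))"
proof (rule group.subgroupI[OF group_BijGroup])
  show "N \<subseteq> carrier (BijGroup (carrier G))"
    using N_iota S.iota_Bij N1_Bij N2_Bij by fastforce
  show "N \<noteq> {}" using iota_N[OF D1.N_one Db.N_one] by auto
  fix k assume "k \<in> N"
  then obtain n m where k: "n \<in> N1" "m \<in> N2" "k = io n m" using N_iota by blast
  show "inv\<^bsub>BijGroup (carrier G)\<^esub> k \<in> N"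
    unfolding k(3) S.iota_inv[OF N1_Bij[OF k(1)] N2_Bij[OF k(2)]]
    by (rule iota_N[OF D1.N_inv[OF k(1)] Db.N_inv[OF k(2)]])
  fix l assume "l \<in> N"
  then obtain n' m' where l: "n' \<in> N1" "m' \<in> N2" "l = io n' m'" using N_iota by blast
  show "k \<otimes>\<^bsub>BijGroup (carrier G)\<^esub> l \<in> N"
    unfolding k(3) l(3) S.iota_mult[OF N1_Bij[OF k(1)] N2_Bij[OF k(2)] N1_Bij[OF l(1)] N2_Bij[OF l(2)], symmetric]
    by (rule iota_N[OF D1.N_mult[OF k(1) l(1)] Db.N_mult[OF k(2) l(2)]])
qed

lemma N_regular: "regular_subgroup (carrier G) N"
  unfolding regular_subgroup_def
proof (intro conjI N_subgroup ballI)
  fix x y assume xy: "x \<in> carrier G" "y \<in> carrier G"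
  obtain n where n: "n \<in> N1" "n (S.np x) = S.np y" "\<And>n'. n' \<in> N1 \<Longrightarrow> n' (S.np x) = S.np y \<Longrightarrow> n' = n"
    using N1(1) S.np_closed[OF xy(1)] S.np_closed[OF xy(2)] unfolding regular_subgroup_def by blast
  obtain m where m: "m \<in> N2" "m (S.cp x) = S.cp y" "\<And>m'. m' \<in> N2 \<Longrightarrow> m' (S.cp x) = S.cp y \<Longrightarrow> m' = m"
    using N2(1) S.cp_closed[OF xy(1)] S.cp_closed[OF xy(2)] unfolding regular_subgroup_def by blast
  show "\<exists>!k. k \<in> N \<and> k x = y"
  proof (rule ex1I[of _ "io n m"])
    show "io n m \<in> N \<and> io n m x = y"
      using iota_N[OF n(1) m(1)] S.np_cp[OF xy(2)] by (simp add: S.iota_apply[OF xy(1)] n(2) m(2))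
    fix k assume k: "k \<in> N \<and> k x = y"
    then obtain n' m' where k': "n' \<in> N1" "m' \<in> N2" "k = io n' m'" using N_iota by blast
    have "n' (S.np x) = S.np y" "m' (S.cp x) = S.cp y"
      using S.iota_parts[OF N1_Bij[OF k'(1)] N2_Bij[OF k'(2)] xy(1)] k k'(3) by auto
    then show "k = io n m" using n(3)[OF k'(1)] m(3)[OF k'(2)] k'(3) by simp
  qed
qed

lemma conj_io:
  "g \<in> carrier G \<Longrightarrow> n \<in> N1 \<Longrightarrow> m \<in> N2 \<Longrightarrow>
    conj_act (carrier G) lam g (io n m) = io (conj_act J lamc g n) (conj_act G' lamb g m)"
  by (rule S.conj_act_iota[OF _ N1_Bij N2_Bij])

lemma gpN: "gp_data L G K (carrier G) lam N"
proof -
  have "conj_act (carrier G) lam g k \<in> N" if "g \<in> carrier G" "k \<in> N" for g k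
  proof -
    from N_iota[OF that(2)] obtain n m where k: "n \<in> N1" "m \<in> N2" "k = io n m" by blast
    show ?thesis unfolding k(3) conj_io[OF that(1) k(1,2)]
      by (rule iota_N[OF D1.normalized[OF that(1) k(1)] Db.normalized[OF that(1) k(2)]])
  qed
  then have "normalized_perms G (carrier G) lam N"
    by (intro normalized_perms.intro[OF groupG] normalized_perms_axioms.intro N_subgroup lam_hom finG)
  then show ?thesis
    using N_regular A.galois_action_axioms by (simp add: gp_data_def gp_data_axioms_def)
qed

interpretation D: gp_data L G K "carrier G" lam N by (rule gpN)

abbreviation "H1 \<equiv> gp_hopf A.Kr L (carrier G) J lamc N1"
abbreviation "Hbar \<equiv> gp_hopf A.Kr (L\<lparr>carrier := F\<rparr>) G' G' (left_reg G G') N2"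
abbreviation "H2 \<equiv> gp_hopf AE.Kr L G' G' (left_reg G G') N2"
abbreviation "H \<equiv> gp_hopf A.Kr L (carrier G) (carrier G) lam N"
abbreviation "act1 \<equiv> gp_act L J \<one>\<^bsub>G\<^esub> N1"
abbreviation "actbar \<equiv> gp_act (L\<lparr>carrier := F\<rparr>) G' \<one>\<^bsub>G\<^esub> N2"
abbreviation "act2 \<equiv> gp_act L G' \<one>\<^bsub>G\<^esub> N2"
abbreviation "act \<equiv> gp_act L (carrier G) \<one>\<^bsub>G\<^esub> N"
abbreviation "ide \<equiv> \<lambda>c. c"

lemma hopf_form_H1: "hopf_form L G (\<lambda>g. g) K H1 D1.P (conj_act J lamc) ide"
  by (rule D1.gp_hopf_form)

lemma hopf_form_H: "hopf_form L G (\<lambda>g. g) K H D.P (conj_act (carrier G) lam) ide"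
  by (rule D.gp_hopf_form)

lemma fixed_iff_G':
  assumes "\<tau> \<in> G'" "c \<in> extensional N2"
  shows "gp_galois_action G' (left_reg G G') N2 \<tau> c = c \<longleftrightarrow> (\<forall>n\<in>N2. c (conj_act G' lamb \<tau> n) = \<tau> (c n))"
  by (rule Db.gp_galois_action_fixed_iff) (use assms S.G'_closed S.cp_G' in auto)

lemma hopf_form_H2: "hopf_form L GG' (\<lambda>g. g) E H2 D2.P (conj_act G' lamb) ide"
proof -
  have "{c \<in> carrier (group_hopf (L\<lparr>carrier := carrier L\<rparr>) D2.P). \<forall>\<tau>\<in>G'. gp_galois_action G' (left_reg G G') N2 \<tau> c = c} =
      {c \<in> N2 \<rightarrow>\<^sub>E carrier L. equivariant L GG' (\<lambda>g. g) N2 (conj_act G' lamb) c}"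
    using fixed_iff_G' by (auto simp: group_hopf_def hopf_of_def group_alg_def Let_def equivariant_def PiE_iff)
  from D2.hopf_form_of_group_hopf[OF L.carrier_is_subfield this] show ?thesis by simp
qed

lemma conj_lamb_J:
  assumes "g \<in> J" "n \<in> N2" shows "conj_act G' lamb g n = n"
proof -
  have "lamb g = lamb \<one>\<^bsub>G\<^esub>" using assms(1) S.np_J(2) S.J_one by simp
  then have "conj_act G' lamb g n = conj_act G' lamb \<one>\<^bsub>G\<^esub> n" by (simp add: conj_act_def)
  then show ?thesis using gset_one[OF Db.conj_act_gset assms(2)] by simp
qed

lemma conj_lamb_cp: "g \<in> carrier G \<Longrightarrow> conj_act G' lamb g n = conj_act G' lamb (S.cp g) n"
  by (simp add: conj_act_def S.cp_G' S.cp_closed)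

text \<open>\<open>J\<close> acts trivially on \<open>N2\<close>, so the values of a
  \<open>G\<close>-equivariant function are \<open>J\<close>-invariant and automatically lie in
  \<open>F\<close>. Conversely, on values in \<open>F\<close> an element \<open>g\<close> acts as
  its component in \<open>G'\<close>, so invariance under \<open>G'\<close> amounts to equivariance
  under \<open>G\<close>.\<close>

lemma hopf_form_Hbar: "hopf_form L G (\<lambda>g. g) K Hbar Db.P (conj_act G' lamb) ide"
proof (rule Db.hopf_form_of_group_hopf[OF AF.K_subfield])
  show "{c \<in> carrier (group_hopf (L\<lparr>carrier := F\<rparr>) Db.P). \<forall>\<tau>\<in>G'. gp_galois_action G' (left_reg G G') N2 \<tau> c = c} =
      {c \<in> N2 \<rightarrow>\<^sub>E carrier L. equivariant L G (\<lambda>g. g) N2 (conj_act G' lamb) c}" (is "?A = ?B")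
  proof (rule equalityI; rule subsetI)
    fix c assume "c \<in> ?A"
    then have c: "c \<in> N2 \<rightarrow>\<^sub>E F" "\<And>\<tau>. \<tau> \<in> G' \<Longrightarrow> gp_galois_action G' (left_reg G G') N2 \<tau> c = c"
      by (auto simp: group_hopf_def hopf_of_def group_alg_def Let_def)
    have "c (conj_act G' lamb g n) = g (c n)" if "g \<in> carrier G" "n \<in> N2" for g n
    proof -
      have "c (conj_act G' lamb g n) = S.cp g (c n)"
        using fixed_iff_G'[OF S.cp_closed[OF that(1)], of c] c that conj_lamb_cp[OF that(1)] S.cp_closed[OF that(1)]
        by (auto simp: PiE_iff)
      moreover have "c n \<in> F" using c(1) that(2) by (rule PiE_mem)
      ultimately show ?thesis using apply_F[OF that(1), of "c n"] by simp
    qed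
    then show "c \<in> ?B" using c(1) F_carrier by (auto simp: equivariant_def PiE_iff)
  next
    fix c assume "c \<in> ?B"
    then have c: "c \<in> N2 \<rightarrow>\<^sub>E carrier L" "\<And>g n. g \<in> carrier G \<Longrightarrow> n \<in> N2 \<Longrightarrow> c (conj_act G' lamb g n) = g (c n)"
      by (auto simp: equivariant_def)
    have "\<sigma> (c n) = c n" if "\<sigma> \<in> J" "n \<in> N2" for \<sigma> n
      using c(2)[OF S.J_closed[OF that(1)] that(2)] conj_lamb_J[OF that] by simp
    then have "c \<in> N2 \<rightarrow>\<^sub>E F" using c(1) by (auto simp: PiE_iff fixed_field_def)
    moreover have "gp_galois_action G' (left_reg G G') N2 \<tau> c = c" if "\<tau> \<in> G'" for \<tau>
      using fixed_iff_G'[OF that, of c] c S.G'_closed[OF that] by (auto simp: PiE_iff)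
    ultimately show "c \<in> ?A" by (auto simp: group_hopf_def hopf_of_def group_alg_def Let_def)
  qed
qed

lemma Hbar_F: "h \<in> carrier Hbar \<Longrightarrow> n \<in> N2 \<Longrightarrow> h n \<in> F"
  by (auto simp: gp_hopf_def Let_def group_hopf_def hopf_of_def group_alg_def)

text \<open>The action of \<open>Hbar\<close> is a sum in the field \<open>F\<close>; its terms stay
  in \<open>F\<close> by \<open>F_stable\<close>, so the sum may be taken in
  \<open>L\<close>.\<close>

lemma actbar_eq:
  assumes "h \<in> carrier Hbar" "x \<in> F"
  shows "actbar h x = (\<Oplus>\<^bsub>L\<^esub>n\<in>N2. h n \<otimes>\<^bsub>L\<^esub> (inv\<^bsub>BijGroup G'\<^esub> n) \<one>\<^bsub>G\<^esub> x)"
proof -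
  have Fs: "subring F L" using subfieldE(1)[OF AF.K_subfield] .
  have "h n \<otimes>\<^bsub>L\<^esub> (inv\<^bsub>BijGroup G'\<^esub> n) \<one>\<^bsub>G\<^esub> x \<in> F" if n: "n \<in> N2" for n
    using Hbar_F[OF assms(1) n] Bij_closed[OF N2_Bij[OF Db.N_inv[OF n]] S.G'_one]
      F_stable[OF S.G'_closed assms(2)] subringE(6)[OF Fs] by auto
  then show ?thesis
    unfolding gp_act_def by (simp add: L.finsum_subring[OF Fs])
qed

lemma G'_hom: "u \<in> G' \<Longrightarrow> u \<in> ring_hom L L" and J_hom: "u \<in> J \<Longrightarrow> u \<in> ring_hom L L"
  using G_hom S.G'_closed S.J_closed by auto

lemma galois_H1: "hopf_galois L K E H1 act1"
  by (rule D1.gp_hopf_galois[OF hopf_form_H1 AE.K_subfield K_E fd_E form_E])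
     (auto simp: gp_act_def J_hom S.J_one G_one E_carrier)

lemma galois_Hbar: "hopf_galois L K F Hbar actbar"
  by (rule Db.gp_hopf_galois[OF hopf_form_Hbar AF.K_subfield K_F fd_F form_F])
     (auto simp: actbar_eq G'_hom S.G'_one G_one F_carrier)

lemma galois_H: "hopf_galois L K (carrier L) H act"
  by (rule D.gp_hopf_galois[OF hopf_form_H L.carrier_is_subfield KL fdL form_L])
     (auto simp: gp_act_def G_hom G_one)

lemma galois_H2: "hopf_galois L E (carrier L) H2 act2"
  by (rule D2.gp_hopf_galois[OF hopf_form_H2 L.carrier_is_subfield _ fd_LE form_LE])
     (auto simp: gp_act_def G'_hom S.G'_one G_one E_carrier)

text \<open>An element of \<open>Hbar\<close> already belongs to \<open>H2\<close>: both are fixed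
  by \<open>G'\<close>, and only the coefficient field grows. The coefficient at \<open>n\<close> of
  the multiple by \<open>x\<close> is the value of the tensor at \<open>n\<close> and the identity
  of \<open>J\<close>, so \<open>?\<theta>\<close> preserves values between two forms of
  \<open>N2\<close> over \<open>E\<close>.\<close>

lemma \<theta>_iso:
  "hopf_iso AE.Kr (base_change A.Kr Hbar EA) H2 (tensor_lift A.Kr Hbar EA (add_monoid H2) (\<lambda>\<eta> x. x \<odot>\<^bsub>H2\<^esub> \<eta>))"
  (is "hopf_iso _ ?T _ ?\<theta>")
proof -
  note Bf = hopf_form_form[OF hopf_form_Hbar]
  note Hk = form_kfun[OF Bf]
  note H2f = hopf_form_form[OF hopf_form_H2]
  interpret H2: module AE.Kr H2 by (rule form_module[OF H2f])
  have bc: "hopf_form L GG' (\<lambda>g. g) E ?T Db.P (conj_act G' lamb) (\<lambda>t n. ev L A.Kr Hbar EA ide app t (n, \<one>\<^bsub>G\<^esub>))"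
  proof (rule A.base_change_form[OF S.G'_subgroup AE.galois_action_axioms hopf_form_Hbar form_E])
    show "p (x \<otimes>\<^bsub>L\<^esub> y) = p x \<otimes>\<^bsub>L\<^esub> p y" if "x \<in> E" "y \<in> E" "p \<in> J" for x y p
      by (rule ring_hom_mult[OF J_hom[OF that(3)]]) (use that E_carrier in auto)
    show "p \<one>\<^bsub>L\<^esub> = \<one>\<^bsub>L\<^esub>" if "p \<in> J" for p by (rule ring_hom_one[OF J_hom[OF that]])
    \<comment> \<open>The translating element is \<open>x\<close> itself: as a member of
      \<open>J\<close> it sends the identity to \<open>x\<close> and acts trivially on
      \<open>N2\<close>.\<close>
    show "\<exists>s\<in>carrier G. lamc s \<one>\<^bsub>G\<^esub> = x \<and> (\<forall>n\<in>carrier Db.P. conj_act G' lamb s n = n)" if "x \<in> J" for x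
      using S.J_closed[OF that] S.lambda_c_one[OF S.J_closed[OF that]] S.np_J(1)[OF that] conj_lamb_J[OF that]
      by (intro bexI[of _ x]) auto
    show "g \<in> G'" if "g \<in> carrier G" "lamc g \<one>\<^bsub>G\<^esub> = \<one>\<^bsub>G\<^esub>" for g
      using that S.lambda_c_one[OF that(1)] S.np_cp[OF that(1)] S.cp_closed[OF that(1)] S.G'_closed by (metis S.l_one)
    show "lamc g \<one>\<^bsub>G\<^esub> = \<one>\<^bsub>G\<^esub>" if "g \<in> G'" for g
      using S.lambda_c_one[OF S.G'_closed[OF that]] S.cp_G'(1)[OF that] by simp
  qed (simp_all add: S.J_one G_one E_carrier)
  let ?\<beta> = "\<lambda>\<eta> x. x \<odot>\<^bsub>H2\<^esub> \<eta>" and ?\<Psi> = "\<lambda>n w. w (n, \<one>\<^bsub>G\<^esub>)"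
  have sub: "\<eta> \<in> carrier H2" if \<eta>: "\<eta> \<in> carrier Hbar" for \<eta>
    using \<eta> F_carrier
    by (auto simp: gp_hopf_def Let_def group_hopf_def hopf_of_def group_alg_def PiE_iff)
  have c: "?\<beta> \<eta> x \<in> carrier (add_monoid H2)" if "\<eta> \<in> carrier Hbar" "x \<in> carrier EA" for \<eta> x
    using sub[OF that(1)] that(2) H2.smult_closed[of x \<eta>] by simp
  have v: "?\<beta> \<eta> x n = ?\<Psi> n (\<lambda>p. \<eta> (fst p) \<otimes>\<^bsub>L\<^esub> snd p x)"
    if "\<eta> \<in> carrier Hbar" "x \<in> carrier EA" "n \<in> carrier Db.P" for \<eta> x n
    using form_smult[OF H2f, of x \<eta> n] sub[OF that(1)] that form_closed[OF Bf that(1,3)] E_carrier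
    by (simp add: G_one L.m_comm)
  have ad: "addfun L (carrier Db.P \<times> J) (?\<Psi> n)" if "n \<in> carrier Db.P" for n
    by (rule A.addfun_eval) (use that S.J_one in auto)
  note emb = form_emb[OF H2f]
  have car: "carrier ?T = carrier (tensor_group A.Kr Hbar EA)"
    by (simp add: base_change_def hopf_of_def Let_def tensor_def)
  show ?thesis
  proof (rule AE.hopf_form_iso[OF bc hopf_form_H2])
    fix t assume "t \<in> carrier ?T"
    then have t: "t \<in> carrier (tensor_group A.Kr Hbar EA)" unfolding car .
    show "?\<theta> t \<in> carrier H2"
      using A.lift_into_closed[OF Hk kfun_E emb, where \<beta> = ?\<beta> and \<Psi> = ?\<Psi>, OF c v ad t] by simp
    show "?\<theta> t n = ev L A.Kr Hbar EA ide app t (n, \<one>\<^bsub>G\<^esub>)" if "n \<in> carrier Db.P" for n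
      by (rule A.lift_into_val[OF Hk kfun_E emb, where \<beta> = ?\<beta> and \<Psi> = ?\<Psi>, OF c v ad t that])
  qed
qed

definition "\<pi> k = (THE p. p \<in> N1 \<times> N2 \<and> k = io (fst p) (snd p))"

lemma \<pi>_iota: "n \<in> N1 \<Longrightarrow> m \<in> N2 \<Longrightarrow> \<pi> (io n m) = (n, m)"
  unfolding \<pi>_def
  by (rule the_equality)
     (auto simp: prod_eq_iff intro: S.iota_inj[OF N1_Bij N2_Bij N1_Bij N2_Bij] dest: sym)

lemma \<pi>_closed: "k \<in> N \<Longrightarrow> fst (\<pi> k) \<in> N1" "k \<in> N \<Longrightarrow> snd (\<pi> k) \<in> N2"
  and iota_\<pi>: "k \<in> N \<Longrightarrow> io (fst (\<pi> k)) (snd (\<pi> k)) = k"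
  using N_iota[of k] \<pi>_iota by auto

lemma iota_bij: "bij_betw (\<lambda>p. io (fst p) (snd p)) (N1 \<times> N2) N"
  by (rule bij_betw_byWitness[where f' = \<pi>]) (simp_all add: \<pi>_iota iota_\<pi> iota_N \<pi>_closed mem_Times_iff image_subset_iff)

text \<open>The defining sum runs over a fibre of \<open>iota\<close>, which has exactly one
  element.\<close>

lemma iota_prod_val:
  assumes "k \<in> N" "c (fst (\<pi> k)) \<in> carrier L" "d (snd (\<pi> k)) \<in> carrier L"
  shows "iota_prod L G J G' N1 N2 c d k = c (fst (\<pi> k)) \<otimes>\<^bsub>L\<^esub> d (snd (\<pi> k))"
proof -
  have "{p \<in> N1 \<times> N2. io (fst p) (snd p) = k} = {\<pi> k}"
    using \<pi>_iota \<pi>_closed[OF assms(1)] iota_\<pi>[OF assms(1)] by (auto simp: mem_Times_iff)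
  then show ?thesis using assms by (simp add: iota_prod_def)
qed

text \<open>The inverse \<open>\<pi>\<close> of \<open>iota\<close> is a group isomorphism because
  \<open>iota\<close> is multiplicative, and equivariant by \<open>conj_io\<close>.\<close>

lemma hopf_form_tensor:
  "hopf_form L G (\<lambda>g. g) K (tensor_hopf A.Kr H1 Hbar) D.P (conj_act (carrier G) lam)
    (\<lambda>t k. ev L A.Kr H1 Hbar ide ide t (\<pi> k))"
proof (rule A.tensor_hopf_form[OF hopf_form_H1 hopf_form_Hbar])
  show "group D.P" by (rule D.P.is_group)
  show "gset G (carrier D.P) (conj_act (carrier G) lam)" using D.conj_act_gset by simp
  show "bij_betw \<pi> (carrier D.P) (carrier D1.P \<times> carrier Db.P)"
    by (rule bij_betw_byWitness[where f' = "\<lambda>p. io (fst p) (snd p)"])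
       (simp_all add: \<pi>_iota iota_\<pi> iota_N \<pi>_closed mem_Times_iff image_subset_iff)
  show "\<pi> (s \<otimes>\<^bsub>D.P\<^esub> t) = (fst (\<pi> s) \<otimes>\<^bsub>D1.P\<^esub> fst (\<pi> t), snd (\<pi> s) \<otimes>\<^bsub>Db.P\<^esub> snd (\<pi> t))"
    if "s \<in> carrier D.P" "t \<in> carrier D.P" for s t
  proof -
    have "s \<in> N" "t \<in> N" using that by simp_all
    from N_iota[OF this(1)] N_iota[OF this(2)] obtain n m n' m'
      where "n \<in> N1" "m \<in> N2" "s = io n m" "n' \<in> N1" "m' \<in> N2" "t = io n' m'" by blast
    then show ?thesis
      using N1_Bij N2_Bij D1.N_mult Db.N_mult by (simp add: S.iota_mult[symmetric] \<pi>_iota)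
  qed
  show "\<pi> (conj_act (carrier G) lam g s) = (conj_act J lamc g (fst (\<pi> s)), conj_act G' lamb g (snd (\<pi> s)))"
    if "g \<in> carrier G" "s \<in> carrier D.P" for g s
  proof -
    have "s \<in> N" using that(2) by simp
    from N_iota[OF this] obtain n m where "n \<in> N1" "m \<in> N2" "s = io n m" by blast
    then show ?thesis using that(1) D1.normalized Db.normalized by (simp add: conj_io \<pi>_iota)
  qed
qed

abbreviation "\<Phi> \<equiv> tensor_lift A.Kr H1 Hbar (add_monoid H) (iota_prod L G J G' N1 N2)"

lemma \<Phi>_iso: "hopf_iso A.Kr (tensor_hopf A.Kr H1 Hbar) H \<Phi>"
  and \<Phi>_tens: "w \<in> carrier H1 \<Longrightarrow> \<eta> \<in> carrier Hbar \<Longrightarrow> \<Phi> (tens A.Kr H1 Hbar w \<eta>) = iota_prod L G J G' N1 N2 w \<eta>"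
proof -
  note f1 = hopf_form_form[OF hopf_form_H1] and fb = hopf_form_form[OF hopf_form_Hbar]
  note fH = hopf_form_form[OF hopf_form_H]
  note k1 = form_kfun[OF f1] and kb = form_kfun[OF fb]
  interpret T: module_pair A.Kr H1 Hbar by (rule A.module_pair_kfun[OF k1 kb])
  note ft = hopf_form_form[OF hopf_form_tensor]
  have car: "carrier (tensor_hopf A.Kr H1 Hbar) = carrier T.TG"
    by (simp add: tensor_hopf_def hopf_of_def Let_def)
  let ?\<beta> = "iota_prod L G J G' N1 N2" and ?\<Psi> = "\<lambda>k w. w (\<pi> k)"
  have v: "?\<beta> w \<eta> k = ?\<Psi> k (\<lambda>p. w (fst p) \<otimes>\<^bsub>L\<^esub> \<eta> (snd p))"
    if "w \<in> carrier H1" "\<eta> \<in> carrier Hbar" "k \<in> carrier D.P" for w \<eta> k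
    using iota_prod_val[of k w \<eta>] that \<pi>_closed[of k] form_closed[OF f1 that(1)] form_closed[OF fb that(2)] by simp
  \<comment> \<open>Membership in \<open>H\<close> is obtained without computing the Galois action
    on \<open>iota_prod\<close>: the function with the values of the tensor is equivariant, so it is
    realized by some \<open>m\<close> in \<open>H\<close>, and extensional functions with equal
    values on \<open>N\<close> coincide.\<close>
  have c: "?\<beta> w \<eta> \<in> carrier (add_monoid H)" if w: "w \<in> carrier H1" and \<eta>: "\<eta> \<in> carrier Hbar" for w \<eta>
  proof -
    have t: "tens A.Kr H1 Hbar w \<eta> \<in> carrier (tensor_hopf A.Kr H1 Hbar)" using w \<eta> by (simp add: car)
    obtain m where m: "m \<in> carrier H" "\<forall>k\<in>N. m k = ev L A.Kr H1 Hbar ide ide (tens A.Kr H1 Hbar w \<eta>) (\<pi> k)"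
      using form_surj[OF fH form_equivariant[OF ft t]] by auto
    have "m = ?\<beta> w \<eta>"
    proof (rule extensionalityI[of _ N])
      show "m \<in> extensional N" using D.gp_hopf_extensional[of m _ "carrier L"] m(1) by simp
      show "?\<beta> w \<eta> \<in> extensional N" by (simp add: iota_prod_def)
      fix k assume k: "k \<in> N"
      have "ev L A.Kr H1 Hbar ide ide (tens A.Kr H1 Hbar w \<eta>) (fst (\<pi> k), snd (\<pi> k)) = w (fst (\<pi> k)) \<otimes>\<^bsub>L\<^esub> \<eta> (snd (\<pi> k))"
        by (rule A.ev_tens[OF k1 kb]) (use w \<eta> k \<pi>_closed in auto)
      then show "m k = ?\<beta> w \<eta> k" using m(2) k v[OF w \<eta>, of k] by simp
    qed
    then show ?thesis using m(1) by simp
  qed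
  have ad: "addfun L (carrier D1.P \<times> carrier Db.P) (?\<Psi> k)" if "k \<in> carrier D.P" for k
    by (rule A.addfun_eval) (use that \<pi>_closed[of k] in \<open>auto simp: mem_Times_iff\<close>)
  note emb = form_emb[OF fH]
  show "\<Phi> (tens A.Kr H1 Hbar w \<eta>) = iota_prod L G J G' N1 N2 w \<eta>" if "w \<in> carrier H1" "\<eta> \<in> carrier Hbar"
    by (rule A.lift_into_tens[OF k1 kb emb, where \<beta> = ?\<beta> and \<Psi> = ?\<Psi>, OF c v ad that])
  show "hopf_iso A.Kr (tensor_hopf A.Kr H1 Hbar) H \<Phi>"
  proof (rule A.hopf_form_iso[OF hopf_form_tensor hopf_form_H])
    fix t assume "t \<in> carrier (tensor_hopf A.Kr H1 Hbar)"
    then have t: "t \<in> carrier T.TG" unfolding car .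
    show "\<Phi> t \<in> carrier H"
      using A.lift_into_closed[OF k1 kb emb, where \<beta> = ?\<beta> and \<Psi> = ?\<Psi>, OF c v ad t] by simp
    show "\<Phi> t k = ev L A.Kr H1 Hbar ide ide t (\<pi> k)" if "k \<in> carrier D.P" for k
      by (rule A.lift_into_val[OF k1 kb emb, where \<beta> = ?\<beta> and \<Psi> = ?\<Psi>, OF c v ad t that])
  qed
qed

text \<open>On pure tensors \<open>\<Phi>\<close> and \<open>\<mu>\<close> are explicit; the sum
  over \<open>N\<close> becomes a double sum over \<open>N1\<close> and \<open>N2\<close> whose
  terms separate, so it factors into the two actions.\<close>

lemma act_Kronecker:
  assumes w: "w \<in> carrier H1" and \<eta>: "\<eta> \<in> carrier Hbar" and x: "x \<in> E" and z: "z \<in> F"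
  shows "act (\<Phi> (tens A.Kr H1 Hbar w \<eta>)) (\<mu> (tens A.Kr EA FA x z)) = \<mu> (tens A.Kr EA FA (act1 w x) (actbar \<eta> z))"
proof -
  have mod: "hopf_module_algebra A.Kr H1 EA act1" "hopf_module_algebra A.Kr Hbar FA actbar"
    using galois_H1 galois_Hbar unfolding hopf_galois_def by blast+
  have cl: "act1 w x \<in> E" "actbar \<eta> z \<in> F"
    using linear_map_closed[OF hopf_module_algebra.act_linear[OF mod(1) w], of x]
      linear_map_closed[OF hopf_module_algebra.act_linear[OF mod(2) \<eta>], of z] x z by simp_all
  let ?s = "\<lambda>n. (inv\<^bsub>BijGroup J\<^esub> n) \<one>\<^bsub>G\<^esub>" and ?t = "\<lambda>m. (inv\<^bsub>BijGroup G'\<^esub> m) \<one>\<^bsub>G\<^esub>"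
  have sJ: "?s n \<in> J" if "n \<in> N1" for n using Bij_closed[OF N1_Bij[OF D1.N_inv[OF that]] S.J_one] .
  have tG: "?t m \<in> G'" if "m \<in> N2" for m using Bij_closed[OF N2_Bij[OF Db.N_inv[OF that]] S.G'_one] .
  have wc: "w n \<in> carrier L" if "n \<in> N1" for n using form_closed[OF hopf_form_form[OF hopf_form_H1] w] that by simp
  have ec: "\<eta> m \<in> carrier L" if "m \<in> N2" for m using form_closed[OF hopf_form_form[OF hopf_form_Hbar] \<eta>] that by simp
  have sx: "?s n x \<in> carrier L" if "n \<in> N1" for n using A.\<alpha>_closed[OF S.J_closed[OF sJ[OF that]] E_carrier[OF x]] .
  have tz: "?t m z \<in> carrier L" if "m \<in> N2" for m using A.\<alpha>_closed[OF S.G'_closed[OF tG[OF that]] F_carrier[OF z]] .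
  \<comment> \<open>The inverse of \<open>io n m\<close> takes the identity to a product of an
    element of \<open>J\<close> and one of \<open>G'\<close>. By \<open>apply_EF\<close> this
    product acts on \<open>x\<close> through the first and on \<open>z\<close> through the
    second.\<close>
  have term_eq: "iota_prod L G J G' N1 N2 w \<eta> (io n m) \<otimes>\<^bsub>L\<^esub> (inv\<^bsub>BijGroup (carrier G)\<^esub> (io n m)) \<one>\<^bsub>G\<^esub> (x \<otimes>\<^bsub>L\<^esub> z) =
      (w n \<otimes>\<^bsub>L\<^esub> ?s n x) \<otimes>\<^bsub>L\<^esub> (\<eta> m \<otimes>\<^bsub>L\<^esub> ?t m z)" if nm: "n \<in> N1" "m \<in> N2" for n m
  proof -
    have "(inv\<^bsub>BijGroup (carrier G)\<^esub> (io n m)) \<one>\<^bsub>G\<^esub> = ?s n \<otimes>\<^bsub>G\<^esub> ?t m"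
      using nm N1_Bij N2_Bij S.np_J[OF S.J_one] by (simp add: S.iota_inv S.iota_apply)
    moreover have "(?s n \<otimes>\<^bsub>G\<^esub> ?t m) (x \<otimes>\<^bsub>L\<^esub> z) = ?s n x \<otimes>\<^bsub>L\<^esub> ?t m z"
      using apply_EF[of "?s n \<otimes>\<^bsub>G\<^esub> ?t m" x z] sJ[OF nm(1)] tG[OF nm(2)] x z
      by (simp add: S.np_eq S.cp_eq S.J_closed S.G'_closed)
    moreover have "iota_prod L G J G' N1 N2 w \<eta> (io n m) = w n \<otimes>\<^bsub>L\<^esub> \<eta> m"
      using iota_prod_val[OF iota_N[OF nm], of w \<eta>] nm wc ec by (simp add: \<pi>_iota)
    ultimately show ?thesis using nm wc ec sx tz by (simp add: L.m_ac)
  qed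
  have "act (\<Phi> (tens A.Kr H1 Hbar w \<eta>)) (\<mu> (tens A.Kr EA FA x z)) =
      (\<Oplus>\<^bsub>L\<^esub>k\<in>N. iota_prod L G J G' N1 N2 w \<eta> k \<otimes>\<^bsub>L\<^esub> (inv\<^bsub>BijGroup (carrier G)\<^esub> k) \<one>\<^bsub>G\<^esub> (x \<otimes>\<^bsub>L\<^esub> z))"
    by (simp add: gp_act_def \<Phi>_tens[OF w \<eta>] \<mu>_tens[OF x z])
  also have "\<dots> = (\<Oplus>\<^bsub>L\<^esub>p\<in>N1 \<times> N2. iota_prod L G J G' N1 N2 w \<eta> (io (fst p) (snd p)) \<otimes>\<^bsub>L\<^esub>
      (inv\<^bsub>BijGroup (carrier G)\<^esub> (io (fst p) (snd p))) \<one>\<^bsub>G\<^esub> (x \<otimes>\<^bsub>L\<^esub> z))"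
  proof (rule L.finsum_reindex_bij[OF iota_bij])
    fix k assume "k \<in> N"
    then obtain n m where "n \<in> N1" "m \<in> N2" "k = io n m" using N_iota by blast
    then show "iota_prod L G J G' N1 N2 w \<eta> k \<otimes>\<^bsub>L\<^esub> (inv\<^bsub>BijGroup (carrier G)\<^esub> k) \<one>\<^bsub>G\<^esub> (x \<otimes>\<^bsub>L\<^esub> z) \<in> carrier L"
      using term_eq wc ec sx tz by simp
  qed
  also have "\<dots> = (\<Oplus>\<^bsub>L\<^esub>p\<in>N1 \<times> N2. (w (fst p) \<otimes>\<^bsub>L\<^esub> ?s (fst p) x) \<otimes>\<^bsub>L\<^esub> (\<eta> (snd p) \<otimes>\<^bsub>L\<^esub> ?t (snd p) z))"
    by (rule finsum_cong_pointwise) (auto simp: term_eq)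
  also have "\<dots> = (\<Oplus>\<^bsub>L\<^esub>n\<in>N1. \<Oplus>\<^bsub>L\<^esub>m\<in>N2. (w n \<otimes>\<^bsub>L\<^esub> ?s n x) \<otimes>\<^bsub>L\<^esub> (\<eta> m \<otimes>\<^bsub>L\<^esub> ?t m z))"
    using wc ec sx tz D1.finite_N Db.finite_N by (subst L.finsum_cartesian) auto
  also have "\<dots> = (\<Oplus>\<^bsub>L\<^esub>n\<in>N1. w n \<otimes>\<^bsub>L\<^esub> ?s n x) \<otimes>\<^bsub>L\<^esub> (\<Oplus>\<^bsub>L\<^esub>m\<in>N2. \<eta> m \<otimes>\<^bsub>L\<^esub> ?t m z)"
    using wc ec sx tz D1.finite_N Db.finite_N by (intro L.finsum_mult[symmetric]) auto
  also have "\<dots> = act1 w x \<otimes>\<^bsub>L\<^esub> actbar \<eta> z"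
    unfolding actbar_eq[OF \<eta> z] by (simp add: gp_act_def)
  also have "\<dots> = \<mu> (tens A.Kr EA FA (act1 w x) (actbar \<eta> z))"
    by (rule \<mu>_tens[OF cl, symmetric])
  finally show ?thesis .
qed

end

theorem theorem1p3:
  fixes L :: "('l, 'm) ring_scheme"
    and K E F :: "'l set"
    and J G' :: "('l \<Rightarrow> 'l) set"
  assumes "finite_galois L K"
    and "semidirect (gal L K) J G'"
    and "E = fixed_field L G'"
    and "F = fixed_field L J"
  shows
    "hopf_galois_extension L K E \<and> hopf_galois_extension L K F \<and>
     generate_field L (E \<union> F) = carrier L \<and> E \<inter> F = K \<and>
     (let Kr = L\<lparr>carrier := K\<rparr>; EA = sub_alg L E; FA = sub_alg L F;
          EF = sub_alg L (generate_field L (E \<union> F));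
          \<mu> = tensor_lift Kr EA FA (add_monoid EF) (\<lambda>x y. x \<otimes>\<^bsub>L\<^esub> y)
      in
      \<mu> \<in> alg_hom Kr (tensor Kr EA FA) EF \<and>
      bij_betw \<mu> (carrier (tensor Kr EA FA)) (carrier EF) \<and>
      (\<forall>N1 N2.
         regular_subgroup J N1 \<and>
         normalized_by J N1 (lambda_c (gal L K) J G' ` carrier (gal L K)) \<and>
         regular_subgroup G' N2 \<and>
         normalized_by G' N2 (left_reg (gal L K) G' ` G') \<longrightarrow>
         (let G = gal L K;
              Er = L\<lparr>carrier := E\<rparr>; Fr = L\<lparr>carrier := F\<rparr>;
              N = induced_subgroup G J G' N1 N2;
              H1 = gp_hopf Kr L (carrier G) J (lambda_c G J G') N1;
              act1 = gp_act L J \<one>\<^bsub>G\<^esub> N1;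
              H2 = gp_hopf Er L G' G' (left_reg G G') N2;
              act2 = gp_act L G' \<one>\<^bsub>G\<^esub> N2;
              Hbar = gp_hopf Kr Fr G' G' (left_reg G G') N2;
              actbar = gp_act Fr G' \<one>\<^bsub>G\<^esub> N2;
              H = gp_hopf Kr L (carrier G) (carrier G) (left_reg G (carrier G)) N;
              act = gp_act L (carrier G) \<one>\<^bsub>G\<^esub> N;
              \<theta> = tensor_lift Kr Hbar EA (add_monoid H2) (\<lambda>\<eta> x. x \<odot>\<^bsub>H2\<^esub> \<eta>);
              \<Phi> = tensor_lift Kr H1 Hbar (add_monoid H) (iota_prod L G J G' N1 N2)
          in
          hopf_galois L K E H1 act1 \<and>
          hopf_galois L E (carrier L) H2 act2 \<and>
          hopf_galois L K F Hbar actbar \<and>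
          hopf_galois L K (carrier L) H act \<and>
          hopf_iso Er (base_change Kr Hbar EA) H2 \<theta> \<and>
          hopf_iso Kr (tensor_hopf Kr H1 Hbar) H \<Phi> \<and>
          (\<forall>w\<in>carrier H1. \<forall>\<eta>\<in>carrier Hbar. \<forall>\<alpha>\<in>E. \<forall>z\<in>F.
             act (\<Phi> (tens Kr H1 Hbar w \<eta>)) (\<mu> (tens Kr EA FA \<alpha> z)) =
             \<mu> (tens Kr EA FA (act1 w \<alpha>) (actbar \<eta> z))))))"
proof -
  interpret galois_semidirect L K J G' by (rule galois_semidirect.intro[OF assms(1,2)])
  have I: "induced_structure L K J G' N1 N2"
    if "regular_subgroup J N1" "normalized_by J N1 (lambda_c (gal L K) J G' ` carrier (gal L K))"
      "regular_subgroup G' N2" "normalized_by G' N2 (left_reg (gal L K) G' ` G')" for N1 N2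
    by (rule induced_structure.intro[OF galois_semidirect_axioms induced_structure_axioms.intro[OF that]])
  \<comment> \<open>For the existence claims one admissible pair is enough: the left translations of
    \<open>J\<close> and of \<open>G'\<close>.\<close>
  have I0: "induced_structure L K J G' (left_reg (gal L K) J ` J) (left_reg (gal L K) G' ` G')"
    by (rule I[OF S.left_reg_regular_subgroup[OF S.J_subgroup S.finite_J] S.left_reg_J_normalized
          S.left_reg_regular_subgroup[OF S.G'_subgroup S.finite_G'] S.left_reg_G'_normalized])
  have ext: "hopf_galois_extension L K E" "hopf_galois_extension L K F"
    unfolding hopf_galois_extension_def assms(3,4)
    using induced_structure.galois_H1[OF I0] induced_structure.galois_Hbar[OF I0] by blast+
  \<comment> \<open>Rewriting the generated field to \<open>carrier L\<close> turns the map of the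
    statement into the constant \<open>\<mu>\<close>, so the collected facts apply as they
    stand.\<close>
  show ?thesis
    unfolding assms(3,4) Let_def generate_EF \<mu>_def[symmetric]
    using ext[unfolded assms(3,4)] E_Int_F \<mu>_alg_hom \<mu>_bij
      induced_structure.galois_H1[OF I] induced_structure.galois_H2[OF I]
      induced_structure.galois_Hbar[OF I] induced_structure.galois_H[OF I]
      induced_structure.\<theta>_iso[OF I] induced_structure.\<Phi>_iso[OF I] induced_structure.act_Kronecker[OF I]
    by (intro conjI allI impI ballI; (elim conjE)?) simp_all
qed

end
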